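(* Let $G$ be a Vilenkin group, let $T$ be a bilinear Calderón–Zygmund operator on $G$, i.e. a bilinear operator associated with a bilinear Calderón–Zygmund kernel, and let $u_1,u_2:\mathcal I\to(0,\infty)$. Suppose that $1<p,p_1,p_2<\infty$ satisfy $\frac1p=\frac1{p_1}+\frac1{p_2}$, that the measure $dx$ satisfies $$2m_n\le m_{n+1}\le B\,m_n\qquad\text{for all } n\in\mathbb Z,$$ and that, for $i=1,2$ and some constant $C>0$, $$u_i(I_{j-1})\le C\,u_i(I_j),\qquad j\in\mathbb Z.$$ If there exists a constant $C>0$ such that for all $I\in\mathcal I$, $$\sum_{j=-\infty}^{-1}\frac{|I|^{1/p_i}}{|I_{j-1}|^{1/p_i}}\,u_i(I_{j-1})\le C\,u_i(I),\qquad i=1,2,$$ and $u=u_1u_2$, then there is a constant $C>0$ such that $$\|T(f_1,f_2)\|_{\mathcal M_{p,u}(G)}\le C\,\|f_1\|_{\mathcal M_{p_1,u_1}(G)}\,\|f_2\|_{\mathcal M_{p_2,u_2}(G)}$$ for all $f_i\in\mathcal M_{p_i,u_i}(G)$, $i=1,2$.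
   Context: **Vilenkin group.** $G$ is a locally compact abelian group with a strictly decreasing sequence of compact open subgroups $\{G_n\}_{n\in\mathbb Z}$ such that $\bigcup_{n\in\mathbb Z}G_n=G$, $\bigcap_{n\in\mathbb Z}G_n=\{0\}$, and $\sup_{n\in\mathbb Z}\operatorname{order}(G_n/G_{n+1})=B<\infty$. $dx$ is Haar measure on $G$ normalized so that $|G_0|=1$, where $|A|$ denotes the Haar measure of $A$, and $m_n=|G_n|^{-1}$. The metric $d$ on $G$ is $d(x,y)=m_n^{-1}$ if $x-y\in G_n\setminus G_{n+1}$, and $d(x,x)=0$. **Cosets.** $\mathcal I=\{x+G_k:x\in G,\ k\in\mathbb Z\}$. For $I=x+G_l$ (with $x\in G$, $l\in\mathbb Z$) and $j\in\mathbb Z$, write $I_j=x+G_{l+j}$; conditions involving $I_j$ are required for every such $I$. $\chi_I$ is the characteristic function of $I$. **Function spaces.** $\mathcal S(G)$ is the space of functions $\varphi:G\to\mathbb C$ for which there are $k,l\in\mathbb Z$ with $\operatorname{supp}\varphi\subset G_k$ and $\varphi$ constant on the cosets of $G_l$. $L^p(G)$ is the usual Lebesgue space with respect to Haar measure. For $0<p<\infty$ and $u:\mathcal I\to(0,\infty)$, the Morrey space $\mathcal M_{p,u}(G)$ consists of all measurable functions $f$ on $G$ with $$\|f\|_{\mathcal M_{p,u}(G)}=\sup_{I\in\mathcal I}\frac1{u(I)}\|\chi_I f\|_{L^p(G)}<\infty.$$ **Bilinear Calderón–Zygmund kernel.** A locally integrable function $K(x,y_1,y_2)$ defined away from the diagonal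 $x=y_1=y_2$ in $G\times G\times G$ such that, for some $C>0$ and $\varepsilon>0$ and all points with $x\ne y_j$ for some $j$: - $|K(x,y_1,y_2)|\le \dfrac{C}{(d(x,y_1)+d(x,y_2))^2}$; - $|K(x,y_1,y_2)-K(x',y_1,y_2)|\le \dfrac{C\,d(x,x')^\varepsilon}{(d(x,y_1)+d(x,y_2))^{2+\varepsilon}}$ whenever $d(x,x')\le\frac12\max\{d(x,y_1),d(x,y_2)\}$; - $|K(x,y_1,y_2)-K(x,y_1',y_2)|\le \dfrac{C\,d(y_1,y_1')^\varepsilon}{(d(x,y_1)+d(x,y_2))^{2+\varepsilon}}$ whenever $d(y_1,y_1')\le\frac12\max\{d(x,y_1),d(x,y_2)\}$; - $|K(x,y_1,y_2)-K(x,y_1,y_2')|\le \dfrac{C\,d(y_2,y_2')^\varepsilon}{(d(x,y_1)+d(x,y_2))^{2+\varepsilon}}$ whenever $d(y_2,y_2')\le\frac12\max\{d(x,y_1),d(x,y_2)\}$. **Associated operator.** A bilinear operator $T$ is associated with $K$ if $$T(f_1,f_2)(x)=\int_G\int_G K(x,y_1,y_2)f_1(y_1)f_2(y_2)\,dy_1\,dy_2$$ for all $f_1,f_2\in\mathcal S(G)$ and all $x\notin\operatorname{supp}(f_1)\cap\operatorname{supp}(f_2)$. The estimate in the claim is understood as saying that $T$ extends to a bounded bilinear mapping from $\mathcal M_{p_1,u_1}(G)\times\mathcal M_{p_2,u_2}(G)$ into $\mathcal M_{p,u}(G)$, the extension being again denoted by $T$.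
   Formalization: T is also assumed bounded from L^{q1}×L^{q2} to L^q on test functions for some 1≤q1,q2<∞ with 1/q=1/q1+1/q2; without this the claim fails, e.g. K=0 and T(f1,f2)=g·f1·f2 with g unbounded and u1=u2=1. *)

theory Defs
  imports "HOL-Analysis.Analysis"
begin

section \<open>Vilenkin groups\<close>

definition coset :: "(int \<Rightarrow> 'a::ab_group_add set) \<Rightarrow> 'a \<Rightarrow> int \<Rightarrow> 'a set" where
  "coset G x k = (+) x ` G k"

definition cosets :: "(int \<Rightarrow> 'a::ab_group_add set) \<Rightarrow> 'a set set" where
  "cosets G = {coset G x k | x k. True}"

definition quotient_order :: "(int \<Rightarrow> 'a::ab_group_add set) \<Rightarrow> int \<Rightarrow> nat" where
  "quotient_order G n = card ((\<lambda>x. coset G x (n + 1)) ` G n)"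

locale vilenkin_group =
  fixes G :: "int \<Rightarrow> 'a::{topological_ab_group_add, t2_space} set"
  assumes locally_compact: "locally_compact_space (euclidean :: 'a topology)"
    and zero_mem: "0 \<in> G n"
    and add_mem: "x \<in> G n \<Longrightarrow> y \<in> G n \<Longrightarrow> x + y \<in> G n"
    and uminus_mem: "x \<in> G n \<Longrightarrow> - x \<in> G n"
    and compact: "compact (G n)"
    and "open": "open (G n)"
    and strictly_decreasing: "G (n + 1) \<subset> G n"
    and Union_eq: "(\<Union>n. G n) = UNIV"
    and Inter_eq: "(\<Inter>n. G n) = {0}"
    and finite_quotient: "finite ((\<lambda>x. coset G x (n + 1)) ` G n)"
    and bounded_order: "bdd_above (range (quotient_order G))"

text \<open>The supremum of the orders of the quotients; it is a genuine supremum by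
  the assumption \<open>bounded_order\<close> above.\<close>

definition vilenkin_bound :: "(int \<Rightarrow> 'a::ab_group_add set) \<Rightarrow> nat" where
  "vilenkin_bound G = (SUP n. quotient_order G n)"

text \<open>Haar measure: a nonzero translation invariant Radon measure on the Borel sets.\<close>

definition haar_measure :: "'a::{topological_ab_group_add, t2_space} measure \<Rightarrow> bool" where
  "haar_measure \<mu> \<longleftrightarrow>
     sets \<mu> = sets borel \<and>
     emeasure \<mu> UNIV \<noteq> 0 \<and>
     (\<forall>a. \<forall>A\<in>sets borel. emeasure \<mu> ((+) a ` A) = emeasure \<mu> A) \<and>
     (\<forall>K. compact K \<longrightarrow> emeasure \<mu> K < \<infinity>) \<and>
     (\<forall>A\<in>sets borel. emeasure \<mu> A = (INF U\<in>{U. open U \<and> A \<subseteq> U}. emeasure \<mu> U)) \<and>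
     (\<forall>U. open U \<longrightarrow> emeasure \<mu> U = (SUP K\<in>{K. compact K \<and> K \<subseteq> U}. emeasure \<mu> K))"

definition vm :: "'a measure \<Rightarrow> (int \<Rightarrow> 'a set) \<Rightarrow> int \<Rightarrow> real" where
  "vm \<mu> G n = 1 / measure \<mu> (G n)"

text \<open>For \<open>x \<noteq> y\<close> in a Vilenkin group the index \<open>n\<close> below exists and is unique.\<close>

definition vdist :: "'a::ab_group_add measure \<Rightarrow> (int \<Rightarrow> 'a set) \<Rightarrow> 'a \<Rightarrow> 'a \<Rightarrow> real" where
  "vdist \<mu> G x y =
     (if x = y then 0 else 1 / vm \<mu> G (THE n. x - y \<in> G n - G (n + 1)))"


section \<open>Function spaces\<close>

definition supp :: "('a::topological_space \<Rightarrow> complex) \<Rightarrow> 'a set" where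
  "supp f = closure {x. f x \<noteq> 0}"

definition test_functions :: "(int \<Rightarrow> 'a::topological_ab_group_add set) \<Rightarrow> ('a \<Rightarrow> complex) set" where
  "test_functions G =
     {\<phi>. \<exists>k l. supp \<phi> \<subseteq> G k \<and> (\<forall>x. \<forall>y\<in>coset G x l. \<phi> y = \<phi> x)}"

text \<open>The (quasi-)norm of \<open>L\<^sup>p\<close> for \<open>0 < p < \<infinity>\<close>, with value \<open>\<infinity>\<close> for functions not in \<open>L\<^sup>p\<close>.\<close>

definition Lp_norm :: "'a measure \<Rightarrow> real \<Rightarrow> ('a \<Rightarrow> complex) \<Rightarrow> ennreal" where
  "Lp_norm \<mu> p f =
     (let J = \<integral>\<^sup>+ x. ennreal (norm (f x) powr p) \<partial>\<mu>
      in if J = \<infinity> then \<infinity> else ennreal (enn2real J powr (1 / p)))"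

definition morrey_norm ::
  "'a::ab_group_add measure \<Rightarrow> (int \<Rightarrow> 'a set) \<Rightarrow> real \<Rightarrow> ('a set \<Rightarrow> real) \<Rightarrow> ('a \<Rightarrow> complex) \<Rightarrow> ennreal" where
  "morrey_norm \<mu> G p u f =
     (SUP I\<in>cosets G. 1 / ennreal (u I) * Lp_norm \<mu> p (\<lambda>x. indicator I x * f x))"

definition morrey ::
  "'a::ab_group_add measure \<Rightarrow> (int \<Rightarrow> 'a set) \<Rightarrow> real \<Rightarrow> ('a set \<Rightarrow> real) \<Rightarrow> ('a \<Rightarrow> complex) set" where
  "morrey \<mu> G p u = {f \<in> borel_measurable \<mu>. morrey_norm \<mu> G p u f < \<infinity>}"


section \<open>Conditions on the weights\<close>

text \<open>If \<open>I = x + G\<^sub>l\<close> then \<open>I\<^sub>j = coset G x (l + j)\<close>.\<close>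

definition weight :: "(int \<Rightarrow> 'a::ab_group_add set) \<Rightarrow> ('a set \<Rightarrow> real) \<Rightarrow> bool" where
  "weight G u \<longleftrightarrow> (\<forall>I\<in>cosets G. 0 < u I)"

definition weight_doubling :: "(int \<Rightarrow> 'a::ab_group_add set) \<Rightarrow> ('a set \<Rightarrow> real) \<Rightarrow> bool" where
  "weight_doubling G u \<longleftrightarrow>
     (\<exists>C>0. \<forall>x l j. u (coset G x (l + (j - 1))) \<le> C * u (coset G x (l + j)))"

definition weight_summability ::
  "'a::ab_group_add measure \<Rightarrow> (int \<Rightarrow> 'a set) \<Rightarrow> real \<Rightarrow> ('a set \<Rightarrow> real) \<Rightarrow> bool" where
  "weight_summability \<mu> G p u \<longleftrightarrow>
     (\<exists>C>0. \<forall>x l.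
        let a = (\<lambda>j. measure \<mu> (coset G x l) powr (1 / p)
                     / measure \<mu> (coset G x (l + (j - 1))) powr (1 / p)
                     * u (coset G x (l + (j - 1))))
        in a summable_on {..-1} \<and> (\<Sum>\<^sub>\<infinity>j\<in>{..-1}. a j) \<le> C * u (coset G x l))"


section \<open>Bilinear Calderon-Zygmund operators\<close>

text \<open>The kernel is a function defined for all triples, but its values on the diagonal
  \<open>x = y\<^sub>1 = y\<^sub>2\<close> are irrelevant. Local integrability refers to the complement of the diagonal.\<close>

definition bilinear_CZ_kernel ::
  "'a::{topological_ab_group_add, t2_space} measure \<Rightarrow> (int \<Rightarrow> 'a set) \<Rightarrow> ('a \<Rightarrow> 'a \<Rightarrow> 'a \<Rightarrow> complex) \<Rightarrow> bool" where
  "bilinear_CZ_kernel \<mu> G K \<longleftrightarrow>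
     (\<forall>Q. compact Q \<and> Q \<subseteq> {(x, y1, y2). x \<noteq> y1 \<or> x \<noteq> y2} \<longrightarrow>
        set_integrable (\<mu> \<Otimes>\<^sub>M (\<mu> \<Otimes>\<^sub>M \<mu>)) Q (\<lambda>(x, y1, y2). K x y1 y2)) \<and>
     (let d = vdist \<mu> G in
      \<exists>C>0. \<exists>\<epsilon>>0. \<forall>x y1 y2. x \<noteq> y1 \<or> x \<noteq> y2 \<longrightarrow>
        norm (K x y1 y2) \<le> C / (d x y1 + d x y2)\<^sup>2 \<and>
        (\<forall>x'. d x x' \<le> 1 / 2 * max (d x y1) (d x y2) \<longrightarrow>
           norm (K x y1 y2 - K x' y1 y2)
             \<le> C * d x x' powr \<epsilon> / (d x y1 + d x y2) powr (2 + \<epsilon>)) \<and>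
        (\<forall>y1'. d y1 y1' \<le> 1 / 2 * max (d x y1) (d x y2) \<longrightarrow>
           norm (K x y1 y2 - K x y1' y2)
             \<le> C * d y1 y1' powr \<epsilon> / (d x y1 + d x y2) powr (2 + \<epsilon>)) \<and>
        (\<forall>y2'. d y2 y2' \<le> 1 / 2 * max (d x y1) (d x y2) \<longrightarrow>
           norm (K x y1 y2 - K x y1 y2')
             \<le> C * d y2 y2' powr \<epsilon> / (d x y1 + d x y2) powr (2 + \<epsilon>)))"

text \<open>Values of operators are measurable functions up to equality almost everywhere,
  so bilinearity is required almost everywhere.\<close>

definition bilinear_op ::
  "'a measure \<Rightarrow> ('a \<Rightarrow> complex) set \<Rightarrow> ('a \<Rightarrow> complex) set \<Rightarrow>
     (('a \<Rightarrow> complex) \<Rightarrow> ('a \<Rightarrow> complex) \<Rightarrow> ('a \<Rightarrow> complex)) \<Rightarrow> bool" where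
  "bilinear_op \<mu> X Y T \<longleftrightarrow>
     (\<forall>f\<in>X. \<forall>g\<in>Y. T f g \<in> borel_measurable \<mu>) \<and>
     (\<forall>f\<in>X. \<forall>f'\<in>X. \<forall>g\<in>Y. \<forall>a b.
        AE x in \<mu>. T (\<lambda>x. a * f x + b * f' x) g x = a * T f g x + b * T f' g x) \<and>
     (\<forall>f\<in>X. \<forall>g\<in>Y. \<forall>g'\<in>Y. \<forall>a b.
        AE x in \<mu>. T f (\<lambda>x. a * g x + b * g' x) x = a * T f g x + b * T f g' x)"

definition associated_with ::
  "'a::topological_ab_group_add measure \<Rightarrow> (int \<Rightarrow> 'a set) \<Rightarrow>
     (('a \<Rightarrow> complex) \<Rightarrow> ('a \<Rightarrow> complex) \<Rightarrow> ('a \<Rightarrow> complex)) \<Rightarrow> ('a \<Rightarrow> 'a \<Rightarrow> 'a \<Rightarrow> complex) \<Rightarrow> bool" where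
  "associated_with \<mu> G T K \<longleftrightarrow>
     (\<forall>f1\<in>test_functions G. \<forall>f2\<in>test_functions G. \<forall>x. x \<notin> supp f1 \<inter> supp f2 \<longrightarrow>
        T f1 f2 x = (\<integral>y2. (\<integral>y1. K x y1 y2 * f1 y1 * f2 y2 \<partial>\<mu>) \<partial>\<mu>))"

text \<open>Following the usual definition of a multilinear Calderon-Zygmund operator, an operator
  associated with a Calderon-Zygmund kernel is also bounded from \<open>L\<^sup>q\<^sup>1 \<times> L\<^sup>q\<^sup>2\<close> to \<open>L\<^sup>q\<close> for at
  least one triple of exponents (unrelated to the exponents of any Morrey space). By density it
  suffices to state the bound on test functions. Association with a kernel alone does not give
  any boundedness: pointwise multiplication \<open>(f\<^sub>1, f\<^sub>2) \<mapsto> g f\<^sub>1 f\<^sub>2\<close> by an arbitrary measurable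
  function \<open>g\<close> is associated with the kernel \<open>0\<close>.\<close>

definition bounded_on_some_Lp ::
  "'a::topological_ab_group_add measure \<Rightarrow> (int \<Rightarrow> 'a set) \<Rightarrow>
     (('a \<Rightarrow> complex) \<Rightarrow> ('a \<Rightarrow> complex) \<Rightarrow> ('a \<Rightarrow> complex)) \<Rightarrow> bool" where
  "bounded_on_some_Lp \<mu> G T \<longleftrightarrow>
     (\<exists>q q1 q2 C. 1 \<le> q1 \<and> 1 \<le> q2 \<and> 0 < q \<and> 1 / q = 1 / q1 + 1 / q2 \<and> 0 < C \<and>
        (\<forall>f1\<in>test_functions G. \<forall>f2\<in>test_functions G.
           Lp_norm \<mu> q (T f1 f2) \<le> ennreal C * Lp_norm \<mu> q1 f1 * Lp_norm \<mu> q2 f2))"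

definition bilinear_CZ_operator ::
  "'a::{topological_ab_group_add, t2_space} measure \<Rightarrow> (int \<Rightarrow> 'a set) \<Rightarrow>
     (('a \<Rightarrow> complex) \<Rightarrow> ('a \<Rightarrow> complex) \<Rightarrow> ('a \<Rightarrow> complex)) \<Rightarrow> bool" where
  "bilinear_CZ_operator \<mu> G T \<longleftrightarrow>
     bilinear_op \<mu> (test_functions G) (test_functions G) T \<and>
     (\<exists>K. bilinear_CZ_kernel \<mu> G K \<and> associated_with \<mu> G T K) \<and>
     bounded_on_some_Lp \<mu> G T"

end

theory Submission
  imports Defs
begin

text \<open>Restrict \<open>f\<close> and \<open>g\<close> to a coset \<open>Q\<close>. A Calderon-Zygmund decomposition, together with the a priori bound on
  one triple of Lebesgue exponents, gives a local weak type estimate: off a small part of \<open>Q\<close>,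
  \<open>T (f \<chi>\<^sub>Q) (g \<chi>\<^sub>Q)\<close> is dominated by the product of the averages of \<open>\<bar>f\<bar>\<close> and \<open>\<bar>g\<bar>\<close> over \<open>Q\<close>. On a
  coset \<open>P \<subseteq> Q\<close> where this first fails, \<open>T (f \<chi>\<^sub>Q) (g \<chi>\<^sub>Q)\<close> and \<open>T (f \<chi>\<^sub>P) (g \<chi>\<^sub>P)\<close> still differ only by a
  multiple of that product, since the difference is given by the kernel and hardly oscillates on \<open>P\<close>.
  Iterating over such \<open>P\<close> is a sparse domination; pairing it with powers of \<open>T f g\<close> and using the maximal
  function yields \<open>L\<^sup>p\<^sup>1 \<times> L\<^sup>p\<^sup>2 \<rightarrow> L\<^sup>p\<close> for test functions, hence an extension to all of \<open>L\<^sup>p\<^sup>1 \<times> L\<^sup>p\<^sup>2\<close>.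

  For Morrey functions, let \<open>T' f g\<close> be the limit of \<open>T (f \<chi>\<^sub>m) (g \<chi>\<^sub>m)\<close>, where \<open>\<chi>\<^sub>m\<close> is the characteristic
  function of \<open>G (-m)\<close>. On a coset \<open>I\<close> the contribution of \<open>f \<chi>\<^sub>I\<close>, \<open>g \<chi>\<^sub>I\<close> is
  controlled by the \<open>L\<^sup>p\<close> bound, and everything else by the size of the kernel, that is by
  \<open>\<Sum>\<^sub>J avg\<^sub>J \<bar>f\<bar> \<cdot> avg\<^sub>J \<bar>g\<bar>\<close> over the cosets \<open>J \<supseteq> I\<close>; the weight condition sums this series.\<close>

section \<open>Cosets, their measure, and the distance\<close>

text \<open>The a priori bound concerns one triple of exponents unrelated to \<open>p1\<close>,
  \<open>p2\<close>, \<open>p\<close>, whose target exponent may even lie below 1. So it is used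
  only for bounded functions on one coset, where these exponents cancel, and is turned into an
  estimate by averages that every other triple can use. Cosets are nested or disjoint, so stopping
  cosets need no dilation: just outside the coset that carries a function of mean zero, the
  regularity of the kernel already applies. The size of the kernel gives one term per shell without
  decay; decay comes only from oscillation, which is why a good point of the parent coset is sought
  in the sparse step. The function paired with the sparse majorant is a power of that majorant
  itself; stopping after \<open>N\<close> generations keeps the majorant bounded, so its own
  integral is finite and can be absorbed, with a final bound independent of \<open>N\<close>. Morrey
  functions are reached by truncation and pointwise limits instead of density, and the weight
  conditions bound the tails of \<open>f\<close> and \<open>g\<close> separately, the product of the
  two sums dominating the sum of the products.\<close>

locale vilenkin_haar = vilenkin_group G
  for G :: "int \<Rightarrow> 'a::{topological_ab_group_add, t2_space} set" +
  fixes \<mu> :: "'a measure" and B :: real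
  assumes haar: "haar_measure \<mu>"
    and unit: "emeasure \<mu> (G 0) = 1"
    and vm_growth: "2 * vm \<mu> G n \<le> vm \<mu> G (n + 1)" "vm \<mu> G (n + 1) \<le> B * vm \<mu> G n"
begin

abbreviation cs :: "'a \<Rightarrow> int \<Rightarrow> 'a set" where "cs \<equiv> coset G"

definition vol :: "int \<Rightarrow> real" where "vol k = measure \<mu> (G k)"

section \<open>Cosets as a countable base of compact open sets\<close>

lemma sets_mu [simp, measurable_cong]: "sets \<mu> = sets borel"
  using haar by (simp add: haar_measure_def)

lemma space_mu [simp]: "space \<mu> = UNIV"
  using sets_eq_imp_space_eq[OF sets_mu] by simp

lemma mem_coset: "y \<in> cs x k \<longleftrightarrow> y - x \<in> G k"
proof -
  have "y \<in> cs x k" if "y - x \<in> G k"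
    using that unfolding coset_def by (intro image_eqI[of _ _ "y - x"]) auto
  then show ?thesis by (auto simp: coset_def)
qed

lemma mem_coset_self [simp]: "x \<in> cs x k"
  by (simp add: mem_coset zero_mem)

lemma coset_sym: "y \<in> cs x k \<Longrightarrow> x \<in> cs y k"
  unfolding mem_coset using uminus_mem[of "y - x" k] by simp

lemma coset_eq: "y \<in> cs x k \<Longrightarrow> cs y k = cs x k"
proof (rule set_eqI)
  fix z assume y: "y \<in> cs x k"
  have "z - x \<in> G k" if "z - y \<in> G k"
    using add_mem[OF that y[unfolded mem_coset]] by simp
  moreover have "z - y \<in> G k" if "z - x \<in> G k"
    using add_mem[OF that coset_sym[OF y, unfolded mem_coset]] by simp
  ultimately show "z \<in> cs y k \<longleftrightarrow> z \<in> cs x k" unfolding mem_coset by blast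
qed

lemma G_mono: assumes "k \<le> l" shows "G l \<subseteq> G k"
  using assms
proof (induction l rule: int_ge_induct)
  case (step i) then show ?case using strictly_decreasing[of i] by blast
qed simp

lemma coset_mono: "k \<le> l \<Longrightarrow> cs x l \<subseteq> cs x k"
  using G_mono unfolding coset_def by blast

lemma coset_zero: "cs 0 k = G k"
  by (auto simp: mem_coset)

lemma coset_nested: "z \<in> cs x k \<Longrightarrow> z \<in> cs y l \<Longrightarrow> k \<le> l \<Longrightarrow> cs y l \<subseteq> cs x k"
  using coset_eq coset_mono by metis

lemma coset_nested': "y \<in> cs x k \<Longrightarrow> k \<le> l \<Longrightarrow> cs y l \<subseteq> cs x k"
  using coset_nested mem_coset_self by blast

lemma coset_le_eq: "y \<in> cs x k \<Longrightarrow> j \<le> k \<Longrightarrow> cs y j = cs x j"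
  by (meson coset_eq coset_mono in_mono)

lemma coset_vimage: "cs x k = (\<lambda>y. y - x) -` G k"
  by (auto simp: mem_coset)

lemma open_coset: "open (cs x k)"
  unfolding coset_vimage by (intro open_vimage "open" continuous_intros)

lemma compact_coset: "compact (cs x k)"
  unfolding coset_def by (intro compact_continuous_image compact continuous_intros)

lemma closed_coset: "closed (cs x k)"
  using compact_coset by (rule compact_imp_closed)

lemma coset_borel [measurable, simp]: "cs x k \<in> sets borel"
  by (rule borel_open[OF open_coset])

text \<open>Compactness of \<open>G 0\<close> is the reason. If no \<open>G k\<close> fitted into
  \<open>V\<close>, the closed sets \<open>G n - V\<close> would have the finite intersection
  property inside \<open>G 0\<close>; a common point would lie in every \<open>G n\<close>, hence be
  0, which belongs to \<open>V\<close>. So the cosets form a neighbourhood base.\<close>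

lemma coset_nbhd:
  assumes "open U" "x \<in> U"
  obtains k where "cs x k \<subseteq> U"
proof -
  define V where "V = (\<lambda>y. x + y) -` U"
  have V: "open V" "0 \<in> V"
    unfolding V_def using assms by (auto intro!: open_vimage continuous_intros)
  have "\<exists>k. G k \<subseteq> V"
  proof (rule ccontr)
    assume no: "\<nexists>k. G k \<subseteq> V"
    have "G 0 \<inter> \<Inter>((\<lambda>n. G n - V) ` UNIV) \<noteq> {}"
    proof (rule compact_imp_fip[OF compact])
      show "closed T" if "T \<in> range (\<lambda>n. G n - V)" for T
        using that V compact_imp_closed[OF compact] by (auto intro: closed_Diff)
      fix F' assume F: "finite F'" "F' \<subseteq> range (\<lambda>n. G n - V)"
      then obtain I where I: "finite I" "F' = (\<lambda>n. G n - V) ` I"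
        by (meson finite_subset_image)
      \<comment> \<open>Inserting 0 covers the empty index set and puts \<open>G m\<close> inside
        \<open>G 0\<close> as well.\<close>
      define m where "m = Max (insert 0 I)"
      have "G m \<subseteq> G i" if "i \<in> insert 0 I" for i
        using that I by (intro G_mono) (auto simp: m_def)
      moreover obtain z where "z \<in> G m" "z \<notin> V" using no by blast
      ultimately show "G 0 \<inter> \<Inter>F' \<noteq> {}" using I by blast
    qed
    then obtain z where "\<And>n. z \<in> G n - V" by blast
    then have "z \<in> (\<Inter>n. G n)" "z \<notin> V" by blast+
    then show False using V unfolding Inter_eq by blast
  qed
  then obtain k where "G k \<subseteq> V" by blast
  then have "cs x k \<subseteq> U" unfolding V_def coset_def by auto
  then show ?thesis by (rule that)
qed

lemma finite_cosets: "finite {cs x k | x. x \<in> cs z n}"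
proof -
  obtain D where D: "D \<subseteq> cs z n" "finite D" "cs z n \<subseteq> \<Union>((\<lambda>x. cs x k) ` D)"
  proof (rule compactE_image[of "cs z n" "cs z n" "\<lambda>x. cs x k"])
    show "compact (cs z n)" by (rule compact_coset)
    show "open (cs x k)" for x by (rule open_coset)
    show "cs z n \<subseteq> (\<Union>x\<in>cs z n. cs x k)" using mem_coset_self by fast
  qed
  have "{cs x k | x. x \<in> cs z n} \<subseteq> (\<lambda>x. cs x k) ` D"
  proof
    fix P assume "P \<in> {cs x k | x. x \<in> cs z n}"
    then obtain x where x: "x \<in> cs z n" "P = cs x k" by auto
    then obtain d where "d \<in> D" "x \<in> cs d k" using D(3) by auto
    then show "P \<in> (\<lambda>x. cs x k) ` D" using x(2) coset_eq by simp
  qed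
  then show ?thesis using D(2) by (meson finite_imageI finite_subset)
qed

text \<open>By compactness each \<open>G n\<close> meets only finitely many cosets of a given level,
  and the \<open>G n\<close> exhaust the group. This countable family takes over the role of a
  countable base in all measurability arguments.\<close>

lemma countable_cosets: "countable (cosets G)"
proof -
  have "P \<in> (\<Union>k. \<Union>n. {cs x k | x. x \<in> cs 0 n})" if P: "P \<in> cosets G" for P
  proof -
    obtain x k where P': "P = cs x k" using P unfolding cosets_def by auto
    have "x \<in> (\<Union>n. G n)" unfolding Union_eq by simp
    then show ?thesis unfolding P' coset_zero by blast
  qed
  moreover have "countable (\<Union>k. \<Union>n. {cs x k | x. x \<in> cs 0 n})"
    by (intro countable_UN countableI_type countable_finite[OF finite_cosets])
  ultimately show ?thesis by (meson countable_subset subsetI)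
qed

lemma coset_in_cosets [simp]: "cs x k \<in> cosets G"
  unfolding cosets_def by blast

section \<open>Measure of cosets\<close>

lemma emeasure_coset: "emeasure \<mu> (cs x k) = ennreal (vol k)"
proof -
  have "emeasure \<mu> (cs x k) = emeasure \<mu> (G k)"
    unfolding coset_def using haar borel_open[OF "open"] by (auto simp: haar_measure_def)
  moreover have "emeasure \<mu> (G k) < \<infinity>" using haar compact by (auto simp: haar_measure_def)
  ultimately show ?thesis by (simp add: vol_def emeasure_eq_ennreal_measure)
qed

lemma measure_coset: "measure \<mu> (cs x k) = vol k"
  using emeasure_coset[of x k] by (simp add: Sigma_Algebra.measure_def vol_def)

lemma vm_eq: "vm \<mu> G k = 1 / vol k"
  by (simp add: vm_def vol_def)

lemma vol_0: "vol 0 = 1"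
  using unit by (simp add: vol_def Sigma_Algebra.measure_def)

lemma vol_nonneg: "0 \<le> vol k"
  by (simp add: vol_def)

text \<open>Positivity spreads from \<open>vol 0 = 1\<close> in both directions. A null subgroup
  would have \<open>vm\<close> equal to 0, because division by 0 gives 0, and either growth
  inequality would then force a neighbouring \<open>1 / vol\<close> to be at most 0.\<close>

lemma vol_pos: "0 < vol k"
proof -
  have "vol k \<noteq> 0"
  proof (induction k rule: int_induct[where k = 0])
    case (step1 i)
    have "vol (i + 1) \<noteq> 0"
    proof
      assume "vol (i + 1) = 0"
      then have "2 * (1 / vol i) \<le> 0" using vm_growth(1)[of i] unfolding vm_eq by simp
      moreover have "0 < vol i" using step1 vol_nonneg[of i] by simp
      ultimately show False by (simp add: divide_le_0_iff)
    qed
    then show ?case .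
  next
    case (step2 i)
    have "vol (i - 1) \<noteq> 0"
    proof
      assume "vol (i - 1) = 0"
      then have "1 / vol i \<le> 0" using vm_growth(2)[of "i - 1"] unfolding vm_eq by simp
      moreover have "0 < vol i" using step2 vol_nonneg[of i] by simp
      ultimately show False by (simp add: divide_le_0_iff)
    qed
    then show ?case .
  qed (simp add: vol_0)
  then show ?thesis using vol_nonneg[of k] by simp
qed

lemma vol_halve: "2 * vol (k + 1) \<le> vol k"
  using vm_growth(1)[of k] vol_pos[of k] vol_pos[of "k + 1"]
  unfolding vm_eq by (simp add: divide_simps mult.commute)

lemma vol_le: "vol k \<le> B * vol (k + 1)"
  using vm_growth(2)[of k] vol_pos[of k] vol_pos[of "k + 1"]
  unfolding vm_eq by (simp add: divide_simps mult.commute)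

lemma B_ge: "2 \<le> B"
proof -
  have "2 * vol (0 + 1) \<le> B * vol (0 + 1)" using vol_halve[of 0] vol_le[of 0] by linarith
  then show ?thesis using vol_pos by (meson mult_le_cancel_right_pos)
qed

lemma vol_power: "2 ^ m * vol (k + int m) \<le> vol k"
proof (induction m)
  case (Suc m)
  have "2 ^ Suc m * vol (k + int (Suc m)) = 2 ^ m * (2 * vol ((k + int m) + 1))"
    by (simp add: algebra_simps)
  also have "\<dots> \<le> 2 ^ m * vol (k + int m)"
    by (intro mult_left_mono vol_halve) simp
  finally show ?case using Suc by linarith
qed simp

lemma vol_power': "i \<le> j \<Longrightarrow> 2 ^ nat (j - i) * vol j \<le> vol i"
  using vol_power[of "nat (j - i)" i] by simp

lemma vol_mono: "i \<le> j \<Longrightarrow> vol j \<le> vol i"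
proof -
  assume "i \<le> j"
  then have "2 ^ nat (j - i) * vol j \<le> vol i" by (rule vol_power')
  moreover have "1 * vol j \<le> 2 ^ nat (j - i) * vol j"
    by (intro mult_right_mono) (auto simp: vol_nonneg)
  ultimately show ?thesis by linarith
qed

lemma vol_less_half: "i < j \<Longrightarrow> 2 * vol j \<le> vol i"
  using vol_halve[of i] vol_mono[of "i + 1" j] by linarith

section \<open>Levels and the distance\<close>

lemma level_exists:
  assumes "x \<noteq> y"
  obtains j where "y \<in> cs x j" "y \<notin> cs x (j + 1)"
proof -
  have "y - x \<in> (\<Union>n. G n)" unfolding Union_eq by simp
  then obtain a where a: "y - x \<in> G a" by blast
  have "\<exists>b. y - x \<notin> G b"
  proof (rule ccontr)
    assume "\<nexists>b. y - x \<notin> G b"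
    then have "y - x \<in> (\<Inter>n. G n)" by blast
    then show False using assms unfolding Inter_eq by simp
  qed
  then obtain b where b: "y - x \<notin> G b" by blast
  have "\<exists>j. y - x \<in> G j \<and> y - x \<notin> G (j + 1)"
  proof (rule ccontr)
    assume no: "\<not> ?thesis"
    have "y - x \<in> G i" if "i \<ge> a" for i
      using that by (induction i rule: int_ge_induct) (use a no in auto)
    moreover have "a \<le> b" using b a G_mono[of b a] by force
    ultimately show False using b by auto
  qed
  then show ?thesis using that by (auto simp: mem_coset)
qed

lemma level_unique:
  assumes "y \<in> cs x j" "y \<notin> cs x (j + 1)" "y \<in> cs x i" "y \<notin> cs x (i + 1)"
  shows "i = j"
  using assms coset_mono[of "j + 1" i x] coset_mono[of "i + 1" j x] by force

lemma vdist_level: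
  assumes "y \<in> cs x j" "y \<notin> cs x (j + 1)"
  shows "vdist \<mu> G x y = vol j"
proof -
  have *: "x - y \<in> G n - G (n + 1) \<longleftrightarrow> y \<in> cs x n \<and> y \<notin> cs x (n + 1)" for n
    using coset_sym mem_coset by blast
  have "(THE n. x - y \<in> G n - G (n + 1)) = j"
    unfolding * by (rule the_equality) (use assms level_unique in blast)+
  moreover have "x \<noteq> y" using assms by auto
  ultimately show ?thesis by (simp add: vdist_def vm_eq)
qed

lemma vdist_self [simp]: "vdist \<mu> G x x = 0"
  by (simp add: vdist_def)

lemma vdist_le: assumes "y \<in> cs x j" shows "vdist \<mu> G x y \<le> vol j"
proof (cases "x = y")
  case True then show ?thesis by (simp add: vol_nonneg)
next
  case False
  then obtain i where i: "y \<in> cs x i" "y \<notin> cs x (i + 1)" by (rule level_exists)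
  then have "j \<le> i" using assms coset_mono[of "i + 1" j x] by force
  then show ?thesis using vdist_level[OF i] vol_mono by simp
qed

lemma vdist_nonneg: "0 \<le> vdist \<mu> G x y"
  by (simp add: vdist_def vm_def)

text \<open>The type is not assumed second countable, so a set that is open in the product need not
  be in the product sigma-algebra for topological reasons alone. Here the set is a union of products
  of cosets, and only countably many such products exist.\<close>

lemma rect_measurable:
  assumes "\<And>y z. (y, z) \<in> W \<Longrightarrow> \<exists>k. cs y k \<times> cs z k \<subseteq> W"
  shows "W \<in> sets (\<mu> \<Otimes>\<^sub>M \<mu>)"
proof -
  define R where "R = {(P, Q). P \<in> cosets G \<and> Q \<in> cosets G \<and> P \<times> Q \<subseteq> W}"
  have "countable R"
    by (rule countable_subset[OF _ countable_SIGMA[OF countable_cosets, of "\<lambda>_. cosets G"]])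
       (auto simp: R_def countable_cosets)
  have "W = (\<Union>(P, Q)\<in>R. P \<times> Q)"
  proof (intro equalityI subsetI)
    fix w assume "w \<in> W"
    obtain y z where w: "w = (y, z)" by (cases w)
    then obtain k where "cs y k \<times> cs z k \<subseteq> W" using assms \<open>w \<in> W\<close> by blast
    then have "(cs y k, cs z k) \<in> R" by (auto simp: R_def)
    moreover have "w \<in> cs y k \<times> cs z k" using w by auto
    ultimately show "w \<in> (\<Union>(P, Q)\<in>R. P \<times> Q)" by blast
  qed (auto simp: R_def)
  moreover have "(\<Union>(P, Q)\<in>R. P \<times> Q) \<in> sets (\<mu> \<Otimes>\<^sub>M \<mu>)"
    using \<open>countable R\<close> by (rule sets.countable_UN'')
      (auto simp: R_def cosets_def intro!: pair_measureI)
  ultimately show ?thesis by simp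
qed

lemma sigma_finite: "sigma_finite_measure \<mu>"
proof
  show "\<exists>A. countable A \<and> A \<subseteq> sets \<mu> \<and> \<Union>A = space \<mu> \<and> (\<forall>a\<in>A. emeasure \<mu> a \<noteq> \<infinity>)"
  proof (intro exI conjI)
    show "countable (range G)" by simp
    show "range G \<subseteq> sets \<mu>" using borel_open[OF "open"] by auto
    show "\<Union>(range G) = space \<mu>" using Union_eq by simp
    show "\<forall>a\<in>range G. emeasure \<mu> a \<noteq> \<infinity>"
      using emeasure_coset[of 0] by (simp add: coset_zero)
  qed
qed

sublocale sigma_finite_measure \<mu> by (rule sigma_finite)

sublocale pair: pair_sigma_finite \<mu> \<mu> ..

text \<open>A set is \<open>adapted\<close> to a level function \<open>\<kappa>\<close> if it is partitioned into the cosets \<open>cs x (\<kappa> x)\<close>, its \<open>pieces\<close>.\<close>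

definition adapted :: "('a \<Rightarrow> int) \<Rightarrow> 'a set \<Rightarrow> bool" where
  "adapted \<kappa> \<Omega> \<longleftrightarrow> (\<forall>x\<in>\<Omega>. \<forall>y\<in>cs x (\<kappa> x). y \<in> \<Omega> \<and> \<kappa> y = \<kappa> x)"

definition pieces :: "('a \<Rightarrow> int) \<Rightarrow> 'a set \<Rightarrow> 'a set set" where
  "pieces \<kappa> \<Omega> = (\<lambda>x. cs x (\<kappa> x)) ` \<Omega>"

lemma countable_pieces: "countable (pieces \<kappa> \<Omega>)"
  by (rule countable_subset[OF _ countable_cosets]) (auto simp: pieces_def)

lemma Union_pieces:
  assumes "adapted \<kappa> \<Omega>" shows "\<Union>(pieces \<kappa> \<Omega>) = \<Omega>"
proof (intro equalityI subsetI)
  fix y assume "y \<in> \<Union>(pieces \<kappa> \<Omega>)"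
  then obtain x where "x \<in> \<Omega>" "y \<in> cs x (\<kappa> x)" unfolding pieces_def by blast
  then show "y \<in> \<Omega>" using assms unfolding adapted_def by blast
next
  fix y assume "y \<in> \<Omega>"
  then show "y \<in> \<Union>(pieces \<kappa> \<Omega>)"
    unfolding pieces_def by (intro UnionI[OF imageI]) (auto simp: mem_coset_self)
qed

lemma disjoint_pieces:
  assumes "adapted \<kappa> \<Omega>" "P \<in> pieces \<kappa> \<Omega>" "Q \<in> pieces \<kappa> \<Omega>" "P \<noteq> Q"
  shows "P \<inter> Q = {}"
proof (rule ccontr)
  assume "P \<inter> Q \<noteq> {}"
  then obtain z where z: "z \<in> P" "z \<in> Q" by blast
  obtain x y where xy: "x \<in> \<Omega>" "P = cs x (\<kappa> x)" "y \<in> \<Omega>" "Q = cs y (\<kappa> y)"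
    using assms by (auto simp: pieces_def)
  then have "\<kappa> z = \<kappa> x" "\<kappa> z = \<kappa> y" using assms z unfolding adapted_def by blast+
  then have "P = Q" using xy z coset_eq by metis
  then show False using assms by simp
qed

lemma pieces_borel: "P \<in> pieces \<kappa> \<Omega> \<Longrightarrow> P \<in> sets borel"
  by (auto simp: pieces_def)

lemma open_adapted: assumes "adapted \<kappa> \<Omega>" shows "open \<Omega>"
proof -
  have "open (\<Union>(pieces \<kappa> \<Omega>))" by (auto simp: pieces_def open_coset)
  then show ?thesis using Union_pieces[OF assms] by simp
qed

lemma adapted_borel: "adapted \<kappa> \<Omega> \<Longrightarrow> \<Omega> \<in> sets borel"
  by (rule borel_open[OF open_adapted])

text \<open>Countable additivity of the measure with density \<open>F\<close>. The sum over the
  pieces is an integral against counting measure, so the pieces need not be enumerated.\<close>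

lemma nn_integral_pieces:
  assumes "adapted \<kappa> \<Omega>" and [measurable]: "F \<in> borel_measurable \<mu>"
  shows "(\<integral>\<^sup>+x. F x * indicator \<Omega> x \<partial>\<mu>) = (\<integral>\<^sup>+P. (\<integral>\<^sup>+x. F x * indicator P x \<partial>\<mu>) \<partial>count_space (pieces \<kappa> \<Omega>))"
proof -
  have [measurable]: "\<Omega> \<in> sets borel" by (rule adapted_borel[OF assms(1)])
  have "emeasure (density \<mu> F) (\<Union>P\<in>pieces \<kappa> \<Omega>. P) = (\<integral>\<^sup>+P. emeasure (density \<mu> F) P \<partial>count_space (pieces \<kappa> \<Omega>))"
    by (rule emeasure_UN_countable)
       (use disjoint_pieces[OF assms(1)] in \<open>auto simp: countable_pieces pieces_borel disjoint_family_on_def\<close>)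
  also have "(\<Union>P\<in>pieces \<kappa> \<Omega>. P) = \<Omega>" using Union_pieces[OF assms(1)] by simp
  finally have "emeasure (density \<mu> F) \<Omega> = (\<integral>\<^sup>+P. emeasure (density \<mu> F) P \<partial>count_space (pieces \<kappa> \<Omega>))" .
  moreover have "emeasure (density \<mu> F) \<Omega> = (\<integral>\<^sup>+x. F x * indicator \<Omega> x \<partial>\<mu>)"
    by (rule emeasure_density) auto
  moreover have "(\<integral>\<^sup>+P. emeasure (density \<mu> F) P \<partial>count_space (pieces \<kappa> \<Omega>)) =
      (\<integral>\<^sup>+P. (\<integral>\<^sup>+x. F x * indicator P x \<partial>\<mu>) \<partial>count_space (pieces \<kappa> \<Omega>))"
    by (rule nn_integral_cong) (auto intro!: emeasure_density simp: pieces_borel)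
  ultimately show ?thesis by simp
qed

text \<open>This is how stopping cosets enter all later estimates: the measure of an exceptional set
  and the integral of a sparse majorant are compared coset by coset, without writing sums.\<close>

lemma nn_integral_adapted_mono:
  assumes "adapted \<kappa> \<Omega>" "F \<in> borel_measurable \<mu>" "H \<in> borel_measurable \<mu>"
    and "\<And>x. x \<in> \<Omega> \<Longrightarrow> (\<integral>\<^sup>+y. F y * indicator (cs x (\<kappa> x)) y \<partial>\<mu>) \<le> (\<integral>\<^sup>+y. H y * indicator (cs x (\<kappa> x)) y \<partial>\<mu>)"
  shows "(\<integral>\<^sup>+x. F x * indicator \<Omega> x \<partial>\<mu>) \<le> (\<integral>\<^sup>+x. H x * indicator \<Omega> x \<partial>\<mu>)"
  unfolding nn_integral_pieces[OF assms(1,2)] nn_integral_pieces[OF assms(1,3)]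
  by (rule nn_integral_mono) (use assms(4) in \<open>auto simp: pieces_def\<close>)

lemma AE_adapted:
  assumes "adapted \<kappa> \<Omega>" and "\<And>x. x \<in> \<Omega> \<Longrightarrow> AE y in \<mu>. y \<in> cs x (\<kappa> x) \<longrightarrow> R y"
  shows "AE y in \<mu>. y \<in> \<Omega> \<longrightarrow> R y"
proof -
  have "AE y in \<mu>. \<forall>P\<in>pieces \<kappa> \<Omega>. y \<in> P \<longrightarrow> R y"
    by (subst AE_ball_countable[OF countable_pieces]) (use assms in \<open>auto simp: pieces_def\<close>)
  then show ?thesis
  proof (rule AE_mp, intro AE_I2 impI)
    fix y assume "\<forall>P\<in>pieces \<kappa> \<Omega>. y \<in> P \<longrightarrow> R y" "y \<in> \<Omega>"
    then show "R y" unfolding pieces_def using mem_coset_self by blast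
  qed
qed

text \<open>The second argument of \<open>F\<close> is the piece, so data chosen independently for
  each piece, such as the sparse majorants of the induction, are glued into one measurable function.
  Countability of the pieces suffices.\<close>

lemma measurable_adapted:
  fixes F :: "'a \<Rightarrow> 'a set \<Rightarrow> 'b::{topological_space}"
  assumes "adapted \<kappa> \<Omega>" "\<And>x. x \<in> \<Omega> \<Longrightarrow> (\<lambda>y. F y (cs x (\<kappa> x))) \<in> borel_measurable \<mu>"
    and "H \<in> borel_measurable \<mu>"
  shows "(\<lambda>x. if x \<in> \<Omega> then F x (cs x (\<kappa> x)) else H x) \<in> borel_measurable \<mu>"
proof (rule measurable_piecewise_restrict[of "insert (- \<Omega>) (pieces \<kappa> \<Omega>)"])
  show "countable (insert (- \<Omega>) (pieces \<kappa> \<Omega>))" by (simp add: countable_pieces)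
  show "space \<mu> \<subseteq> \<Union>(insert (- \<Omega>) (pieces \<kappa> \<Omega>))" using Union_pieces[OF assms(1)] by auto
  fix P assume "P \<in> insert (- \<Omega>) (pieces \<kappa> \<Omega>)"
  then consider "P = - \<Omega>" | x where "x \<in> \<Omega>" "P = cs x (\<kappa> x)" by (auto simp: pieces_def)
  then show "P \<inter> space \<mu> \<in> sets \<mu>" using adapted_borel[OF assms(1)] by cases (auto simp: borel_comp)
  from \<open>P \<in> insert (- \<Omega>) (pieces \<kappa> \<Omega>)\<close>
  consider "P = - \<Omega>" | x where "x \<in> \<Omega>" "P = cs x (\<kappa> x)" by (auto simp: pieces_def)
  then show "(\<lambda>x. if x \<in> \<Omega> then F x (cs x (\<kappa> x)) else H x) \<in> measurable (restrict_space \<mu> P) borel"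
  proof cases
    case 1
    have "H \<in> measurable (restrict_space \<mu> P) borel" using assms(3) by (rule measurable_restrict_space1)
    then show ?thesis
      by (rule measurable_cong[THEN iffD1, rotated]) (auto simp: 1 space_restrict_space)
  next
    case 2
    have "(\<lambda>y. F y (cs x (\<kappa> x))) \<in> measurable (restrict_space \<mu> P) borel"
      using assms(2)[OF 2(1)] by (rule measurable_restrict_space1)
    moreover have "F y (cs x (\<kappa> x)) = (if y \<in> \<Omega> then F y (cs y (\<kappa> y)) else H y)" if "y \<in> P" for y
    proof -
      have "y \<in> \<Omega>" "\<kappa> y = \<kappa> x" using assms(1) 2 that unfolding adapted_def by blast+
      then show ?thesis using coset_eq[of y x "\<kappa> x"] 2 that by simp
    qed
    ultimately show ?thesis
      by (rule measurable_cong[THEN iffD1, rotated]) (auto simp: space_restrict_space)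
  qed
qed

text \<open>The maximal cosets of level above \<open>n\<close> on which the (coset-invariant) stopping condition \<open>\<Phi>\<close> holds.\<close>

lemma stopping:
  assumes inv: "\<And>x y k. \<Phi> x k \<Longrightarrow> y \<in> cs x k \<Longrightarrow> \<Phi> y k"
    and \<Omega>: "\<Omega> = {x \<in> cs z n. \<exists>k>n. \<Phi> x k}"
  obtains \<kappa> where "adapted \<kappa> \<Omega>"
    "\<And>x. x \<in> \<Omega> \<Longrightarrow> n < \<kappa> x" "\<And>x. x \<in> \<Omega> \<Longrightarrow> \<Phi> x (\<kappa> x)"
    "\<And>x j. x \<in> \<Omega> \<Longrightarrow> n < j \<Longrightarrow> j < \<kappa> x \<Longrightarrow> \<not> \<Phi> x j"
proof -
  \<comment> \<open>The levels above \<open>n\<close> are numbered by naturals from 0, so that a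
    first one exists; the offset \<open>n + 1\<close> makes \<open>\<kappa>\<close> exceed
    \<open>n\<close> at every point.\<close>
  define \<nu> where "\<nu> x = (LEAST i. \<Phi> x (n + 1 + int i))" for x
  define \<kappa> where "\<kappa> x = n + 1 + int (\<nu> x)" for x
  have ex: "\<Phi> x (\<kappa> x)" if x: "x \<in> \<Omega>" for x
  proof -
    obtain k where "k > n" "\<Phi> x k" using x unfolding \<Omega> by blast
    then have "\<Phi> x (n + 1 + int (nat (k - n - 1)))" by simp
    then show ?thesis unfolding \<kappa>_def \<nu>_def by (rule LeastI)
  qed
  have gt: "n < \<kappa> x" for x by (simp add: \<kappa>_def)
  have least: "\<not> \<Phi> x j" if "n < j" "j < \<kappa> x" for x j
  proof -
    have "nat (j - n - 1) < \<nu> x" using that by (simp add: \<kappa>_def)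
    then have "\<not> \<Phi> x (n + 1 + int (nat (j - n - 1)))" unfolding \<nu>_def by (rule not_less_Least)
    then show ?thesis using that by simp
  qed
  have "adapted \<kappa> \<Omega>"
    unfolding adapted_def
  proof (intro ballI conjI)
    fix x y assume x: "x \<in> \<Omega>" and y: "y \<in> cs x (\<kappa> x)"
    have "y \<in> cs z n" using x y gt[of x] coset_nested'[of x z n "\<kappa> x"] unfolding \<Omega> by auto
    moreover have py: "\<Phi> y (\<kappa> x)" using inv[OF ex[OF x] y] .
    ultimately show yO: "y \<in> \<Omega>" using gt unfolding \<Omega> by blast
    \<comment> \<open>The condition is inherited by \<open>y\<close> at level
      \<open>\<kappa> x\<close>. It then passes back from \<open>y\<close> at the coarser level
      \<open>\<kappa> y\<close>, whose coset still contains \<open>x\<close>; so neither first level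
      precedes the other.\<close>
    have "\<kappa> y \<le> \<kappa> x" using least[of "\<kappa> x" y] py gt by force
    then have "\<Phi> x (\<kappa> y)" using inv[OF ex[OF yO]] coset_sym[OF y] coset_mono[of "\<kappa> y" "\<kappa> x" y] by blast
    then have "\<kappa> x \<le> \<kappa> y" using least[of "\<kappa> y" x] gt by force
    then show "\<kappa> y = \<kappa> x" using \<open>\<kappa> y \<le> \<kappa> x\<close> by simp
  qed
  then show ?thesis using that gt ex least by blast
qed

end

text \<open>Nothing is asked of \<open>f\<close> beyond the bound: a function that is not integrable
  has Bochner integral 0, and \<open>g\<close> is nonnegative.\<close>

lemma norm_integral_le:
  fixes f :: "'b \<Rightarrow> 'c::{banach, second_countable_topology}"
  assumes "integrable M g" "\<And>x. norm (f x) \<le> g x"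
  shows "norm (integral\<^sup>L M f) \<le> integral\<^sup>L M g"
proof (cases "integrable M f")
  case True
  have "norm (integral\<^sup>L M f) \<le> (\<integral>x. norm (f x) \<partial>M)" by (rule integral_norm_bound)
  also have "\<dots> \<le> integral\<^sup>L M g"
    by (rule integral_mono[OF integrable_norm[OF True] assms(1)]) (rule assms(2))
  finally show ?thesis .
next
  case False
  have "0 \<le> integral\<^sup>L M g" using assms(2) by (intro integral_nonneg_AE AE_I2) (meson norm_ge_zero order_trans)
  then show ?thesis using False by (simp add: not_integrable_integral_eq)
qed

lemma sum_powers_le:
  fixes \<rho> :: real
  assumes "0 < \<rho>" "\<rho> < 1"
  shows "(\<Sum>i\<in>{n..<r}. \<rho> ^ nat (r - i)) \<le> 1 / (1 - \<rho>)"
proof -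
  have "(\<Sum>i\<in>{n..<r}. \<rho> ^ nat (r - i)) = (\<Sum>m\<in>(\<lambda>i. nat (r - i)) ` {n..<r}. \<rho> ^ m)"
    by (subst sum.reindex) (auto simp: inj_on_def)
  also have "\<dots> \<le> (\<Sum>m. \<rho> ^ m)"
    using assms by (intro sum_le_suminf) auto
  also have "\<dots> = 1 / (1 - \<rho>)" using assms by (simp add: suminf_geometric)
  finally show ?thesis .
qed

section \<open>Test functions, averages and integrals on the product\<close>

context vilenkin_haar begin

abbreviation test :: "('a \<Rightarrow> complex) set" where "test \<equiv> test_functions G"

abbreviation rs :: "'a set \<Rightarrow> ('a \<Rightarrow> complex) \<Rightarrow> 'a \<Rightarrow> complex" where
  "rs P f \<equiv> (\<lambda>x. indicator P x * f x)"

definition avg :: "('a \<Rightarrow> 'b::real_normed_vector) \<Rightarrow> 'a \<Rightarrow> int \<Rightarrow> real" where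
  "avg f x k = (\<integral>y. indicator (cs x k) y * norm (f y) \<partial>\<mu>) / vol k"

lemma avg_coset: "y \<in> cs x k \<Longrightarrow> avg f y k = avg f x k"
  by (simp add: avg_def coset_eq)

lemma avg_nonneg: "0 \<le> avg f x k"
  unfolding avg_def by (intro divide_nonneg_nonneg vol_nonneg integral_nonneg_AE) simp

lemma integrable_bounded:
  fixes f :: "'a \<Rightarrow> 'b::{banach, second_countable_topology}"
  assumes "f \<in> borel_measurable \<mu>" "\<And>x. norm (f x) \<le> F" "\<And>x. x \<notin> cs z n \<Longrightarrow> f x = 0"
  shows "integrable \<mu> f"
  by (rule integrableI_bounded_set[of "cs z n" _ _ F]) (use assms in \<open>auto simp: emeasure_coset\<close>)

lemma supp_subset_iff: "closed S \<Longrightarrow> supp f \<subseteq> S \<longleftrightarrow> (\<forall>x. x \<notin> S \<longrightarrow> f x = 0)"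
  unfolding supp_def using closure_subset[of "{x. f x \<noteq> 0}"] closure_minimal[of "{x. f x \<noteq> 0}" S] by blast

lemma test_iff:
  "f \<in> test \<longleftrightarrow> (\<exists>k l. (\<forall>x. x \<notin> cs 0 k \<longrightarrow> f x = 0) \<and> (\<forall>x. \<forall>y\<in>cs x l. f y = f x))"
  unfolding test_functions_def using supp_subset_iff[OF closed_coset[of 0]] by (simp add: coset_zero)

lemma big_coset: obtains m where "m \<le> k" "x \<in> cs 0 m"
proof -
  have "x \<in> (\<Union>n. G n)" unfolding Union_eq by simp
  then obtain n where "x \<in> G n" by blast
  then have "x \<in> G (min n k)" using G_mono[of "min n k" n] by auto
  then show ?thesis by (intro that[of "min n k"]) (auto simp: coset_zero)
qed

lemma testI:
  assumes "\<And>x. x \<notin> cs z k \<Longrightarrow> f x = 0" "\<And>x y. y \<in> cs x l \<Longrightarrow> f y = f x"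
  shows "f \<in> test"
proof -
  obtain m where m: "m \<le> k" "z \<in> cs 0 m" by (rule big_coset)
  then have "cs z k \<subseteq> cs 0 m" using coset_nested' by blast
  then show ?thesis unfolding test_iff using assms by blast
qed

lemma testE:
  assumes "f \<in> test"
  obtains k l where "\<And>x. x \<notin> cs 0 k \<Longrightarrow> f x = 0" "\<And>x y. y \<in> cs x l \<Longrightarrow> f y = f x"
  using assms unfolding test_iff by blast

lemma test_const: assumes "f \<in> test" obtains l where "n \<le> l" "\<And>x y. y \<in> cs x l \<Longrightarrow> f y = f x"
proof -
  obtain k l where l: "\<And>x y. y \<in> cs x l \<Longrightarrow> f y = f x" by (rule testE[OF assms]) blast
  show ?thesis
    by (rule that[of "max n l"]) (use l coset_mono[of l "max n l"] in auto)
qed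

lemma locally_constant_measurable:
  assumes "\<And>x y. y \<in> cs x l \<Longrightarrow> f y = f x"
  shows "f \<in> borel_measurable \<mu>"
proof (rule borel_measurableI)
  fix S :: "'b::topological_space set"
  have "f -` S = (\<Union>x\<in>f -` S. cs x l)" using assms mem_coset_self by auto
  moreover have "open (\<Union>x\<in>f -` S. cs x l)" by (auto intro: open_coset)
  ultimately have "open (f -` S)" by simp
  then show "f -` S \<inter> space \<mu> \<in> sets \<mu>" by (simp add: borel_open)
qed

lemma test_measurable: "f \<in> test \<Longrightarrow> f \<in> borel_measurable \<mu>"
  by (erule testE) (rule locally_constant_measurable)

lemma test_bounded: assumes "f \<in> test" obtains F where "0 < F" "\<And>x. norm (f x) \<le> F"
proof -
  obtain k l where kl: "\<And>x. x \<notin> cs 0 k \<Longrightarrow> f x = 0" "\<And>x y. y \<in> cs x l \<Longrightarrow> f y = f x"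
    by (rule testE[OF assms]) blast
  \<comment> \<open>A test function takes one value on each of the finitely many cosets of level
    \<open>l\<close> that meet its support; each value is read off at a chosen
    representative.\<close>
  define N where "N = (\<lambda>P. norm (f (SOME x. x \<in> P))) ` {cs x l | x. x \<in> cs 0 k}"
  have fin: "finite N" unfolding N_def by (intro finite_imageI finite_cosets)
  define F where "F = Max N"
  show ?thesis
  proof (rule that[of "max 1 F"])
    fix x show "norm (f x) \<le> max 1 F"
    proof (cases "x \<in> cs 0 k")
      case True
      have "(SOME y. y \<in> cs x l) \<in> cs x l" by (rule someI[of _ x]) simp
      then have "norm (f (SOME y. y \<in> cs x l)) = norm (f x)" using kl(2) by simp
      moreover have "norm (f (SOME y. y \<in> cs x l)) \<in> N"
        unfolding N_def using True by (intro imageI) blast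
      ultimately have "norm (f x) \<le> F" unfolding F_def using Max_ge[OF fin] by simp
      then show ?thesis by simp
    qed (simp add: kl)
  qed simp
qed

lemma test_integrable: "f \<in> test \<Longrightarrow> integrable \<mu> f"
  by (metis integrable_bounded test_bounded test_measurable testE)

lemma coset_max: "y \<in> cs x (max k l) \<longleftrightarrow> y \<in> cs x k \<and> y \<in> cs x l"
  using coset_mono[of k l x] coset_mono[of l k x] by (auto simp: max_def)

lemma coset_min: "y \<in> cs x (min k l) \<longleftrightarrow> y \<in> cs x k \<or> y \<in> cs x l"
  using coset_mono[of k l x] coset_mono[of l k x] by (auto simp: min_def)

lemma test_lin: assumes "f \<in> test" "g \<in> test" shows "(\<lambda>x. a * f x + b * g x) \<in> test"
proof -
  obtain k l where f: "\<And>x. x \<notin> cs 0 k \<Longrightarrow> f x = 0" "\<And>x y. y \<in> cs x l \<Longrightarrow> f y = f x"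
    by (rule testE[OF assms(1)]) blast
  obtain k' l' where g: "\<And>x. x \<notin> cs 0 k' \<Longrightarrow> g x = 0" "\<And>x y. y \<in> cs x l' \<Longrightarrow> g y = g x"
    by (rule testE[OF assms(2)]) blast
  show ?thesis
  proof (rule testI[of 0 "min k k'" _ "max l l'"])
    fix x assume "x \<notin> cs 0 (min k k')"
    then have "x \<notin> cs 0 k" "x \<notin> cs 0 k'" by (auto simp: coset_min)
    then show "a * f x + b * g x = 0" using f g by simp
  next
    fix x y assume "y \<in> cs x (max l l')"
    then have "y \<in> cs x l" "y \<in> cs x l'" by (auto simp: coset_max)
    then have "f y = f x" "g y = g x" using f(2) g(2) by blast+
    then show "a * f y + b * g y = a * f x + b * g x" by simp
  qed
qed

lemma test_add: "f \<in> test \<Longrightarrow> g \<in> test \<Longrightarrow> (\<lambda>x. f x + g x) \<in> test"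
  using test_lin[of f g 1 1] by simp

lemma test_diff: "f \<in> test \<Longrightarrow> g \<in> test \<Longrightarrow> (\<lambda>x. f x - g x) \<in> test"
  using test_lin[of f g 1 "-1"] by simp

lemma test_zero: "(\<lambda>x. 0) \<in> test"
  by (rule testI[of 0 0 _ 0]) auto

lemma test_scale: "f \<in> test \<Longrightarrow> (\<lambda>x. a * f x) \<in> test"
  using test_lin[of f f a 0] by simp

lemma indicator_coset_const: "y \<in> cs x k \<Longrightarrow> (indicator (cs z k) y :: 'b::zero_neq_one) = indicator (cs z k) x"
  using coset_eq coset_sym by (smt (verit) indicator_simps)

lemma test_indicator: "(\<lambda>x. indicator (cs z k) x) \<in> test"
  by (rule testI[of z k _ k]) (auto simp: indicator_coset_const)

lemma test_rs: assumes "f \<in> test" shows "rs (cs z n) f \<in> test"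
proof -
  obtain k l where f: "\<And>x. x \<notin> cs 0 k \<Longrightarrow> f x = 0" "\<And>x y. y \<in> cs x l \<Longrightarrow> f y = f x"
    by (rule testE[OF assms]) blast
  show ?thesis
  proof (rule testI[of z n _ "max n l"])
    fix x y assume "y \<in> cs x (max n l)"
    then have "y \<in> cs x n" "y \<in> cs x l" by (auto simp: coset_max)
    then have "f y = f x" "(indicator (cs z n) y :: complex) = indicator (cs z n) x"
      using f(2) indicator_coset_const by blast+
    then show "indicator (cs z n) y * f y = indicator (cs z n) x * f x" by simp
  qed auto
qed

text \<open>Continuity, expressed through products of cosets, makes the preimage of an open set a
  set of the kind treated in \<open>rect_measurable\<close>. It is applied to the kernel with its
  first variable fixed, away from the diagonal.\<close>

lemma cont_rect_measurable:
  fixes F :: "'a \<Rightarrow> 'a \<Rightarrow> complex"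
  assumes "\<And>y z e. (y, z) \<in> S \<Longrightarrow> 0 < e \<Longrightarrow>
     \<exists>k. \<forall>y'\<in>cs y k. \<forall>z'\<in>cs z k. (y', z') \<in> S \<and> norm (F y' z' - F y z) < e"
  shows "(\<lambda>(y, z). if (y, z) \<in> S then F y z else 0) \<in> borel_measurable (\<mu> \<Otimes>\<^sub>M \<mu>)" (is "?H \<in> _")
proof (rule borel_measurableI)
  fix O' :: "complex set" assume O': "open O'"
  have S: "S \<in> sets (\<mu> \<Otimes>\<^sub>M \<mu>)"
  proof (rule rect_measurable)
    fix y z assume "(y, z) \<in> S"
    then show "\<exists>k. cs y k \<times> cs z k \<subseteq> S" using assms[of y z 1] by (metis mem_Times_iff prod.collapse subsetI zero_less_one)
  qed
  have W: "{(y, z). (y, z) \<in> S \<and> F y z \<in> O'} \<in> sets (\<mu> \<Otimes>\<^sub>M \<mu>)"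
  proof (rule rect_measurable)
    fix y z assume "(y, z) \<in> {(y, z). (y, z) \<in> S \<and> F y z \<in> O'}"
    then have yz: "(y, z) \<in> S" "F y z \<in> O'" by auto
    obtain e where e: "0 < e" "ball (F y z) e \<subseteq> O'" using O' yz(2) by (meson openE)
    obtain k where k: "\<forall>y'\<in>cs y k. \<forall>z'\<in>cs z k. (y', z') \<in> S \<and> norm (F y' z' - F y z) < e"
      using assms[OF yz(1) e(1)] by blast
    have "cs y k \<times> cs z k \<subseteq> {(y, z). (y, z) \<in> S \<and> F y z \<in> O'}"
    proof
      fix p assume "p \<in> cs y k \<times> cs z k"
      then obtain y' z' where p: "p = (y', z')" "y' \<in> cs y k" "z' \<in> cs z k" by auto
      then have "(y', z') \<in> S" "F y' z' \<in> ball (F y z) e"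
        using k by (auto simp: dist_norm norm_minus_commute)
      then show "p \<in> {(y, z). (y, z) \<in> S \<and> F y z \<in> O'}" using e p by auto
    qed
    then show "\<exists>k. cs y k \<times> cs z k \<subseteq> {(y, z). (y, z) \<in> S \<and> F y z \<in> O'}" by blast
  qed
  have sp: "space (\<mu> \<Otimes>\<^sub>M \<mu>) = UNIV" by (simp add: space_pair_measure)
  have "?H -` O' \<inter> space (\<mu> \<Otimes>\<^sub>M \<mu>) = {(y, z). (y, z) \<in> S \<and> F y z \<in> O'} \<union> (if 0 \<in> O' then space (\<mu> \<Otimes>\<^sub>M \<mu>) - S else {})"
    by (auto simp: sp split: if_splits)
  also have "\<dots> \<in> sets (\<mu> \<Otimes>\<^sub>M \<mu>)"
    using sets.Un[OF W sets.compl_sets[OF S]] W by (cases "0 \<in> O'") simp_all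
  finally show "?H -` O' \<inter> space (\<mu> \<Otimes>\<^sub>M \<mu>) \<in> sets (\<mu> \<Otimes>\<^sub>M \<mu>)" .
qed

lemma prod_integral:
  fixes f g :: "'a \<Rightarrow> real"
  assumes "integrable \<mu> f" "integrable \<mu> g"
  shows "integrable (\<mu> \<Otimes>\<^sub>M \<mu>) (\<lambda>(y, z). f y * g z)"
    and "(\<integral>(y, z). f y * g z \<partial>(\<mu> \<Otimes>\<^sub>M \<mu>)) = (\<integral>y. f y \<partial>\<mu>) * (\<integral>z. g z \<partial>\<mu>)"
proof -
  have [measurable]: "f \<in> borel_measurable \<mu>" "g \<in> borel_measurable \<mu>" using assms by auto
  show i: "integrable (\<mu> \<Otimes>\<^sub>M \<mu>) (\<lambda>(y, z). f y * g z)"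
    by (rule pair.Fubini_integrable) (use assms in \<open>auto simp: abs_mult\<close>)
  have "(\<integral>(y, z). f y * g z \<partial>(\<mu> \<Otimes>\<^sub>M \<mu>)) = (\<integral>y. (\<integral>z. f y * g z \<partial>\<mu>) \<partial>\<mu>)"
    using pair.integral_fst[OF i] by simp
  then show "(\<integral>(y, z). f y * g z \<partial>(\<mu> \<Otimes>\<^sub>M \<mu>)) = (\<integral>y. f y \<partial>\<mu>) * (\<integral>z. g z \<partial>\<mu>)" by simp
qed

text \<open>A discrete intermediate value argument. With \<open>R i\<close> saying that points still
  lie in the coset of level \<open>i\<close> it finds their shell.\<close>

lemma shell_exists:
  assumes "R n" "\<not> R r" "n \<le> r"
  shows "\<exists>i::int. n \<le> i \<and> i < r \<and> R i \<and> \<not> R (i + 1)"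
proof (rule ccontr)
  assume no: "\<not> ?thesis"
  have "i \<le> r \<longrightarrow> R i" if "n \<le> i" for i
    using that
  proof (induction i rule: int_ge_induct)
    case (step i) then show ?case using no by force
  qed (use assms in auto)
  then show False using assms by auto
qed

end

section \<open>The operator in shell form\<close>

text \<open>The kernel conditions are restated without the distance: if \<open>i\<close> is the last level with \<open>y, z \<in> cs x i\<close>, then
  \<open>d(x,y) + d(x,z)\<close> is comparable to \<open>vol i\<close>, and moving a variable within its coset of level \<open>j > i\<close> gains
  \<open>(vol j / vol i)\<^sup>\<epsilon> \<le> \<rho> ^ (j - i)\<close> with \<open>\<rho> = 2 powr (-\<epsilon>)\<close>, because \<open>vol\<close> at least halves at every level.\<close>

locale czo = vilenkin_haar G \<mu> B
  for G :: "int \<Rightarrow> 'a::{topological_ab_group_add, t2_space} set" and \<mu> B +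
  fixes T :: "('a \<Rightarrow> complex) \<Rightarrow> ('a \<Rightarrow> complex) \<Rightarrow> ('a \<Rightarrow> complex)"
    and K :: "'a \<Rightarrow> 'a \<Rightarrow> 'a \<Rightarrow> complex" and C \<rho> :: real
  assumes bil: "bilinear_op \<mu> (test_functions G) (test_functions G) T"
    and C_pos: "0 < C" and \<rho>_pos: "0 < \<rho>" and \<rho>_less: "\<rho> < 1"
    and K_size: "\<lbrakk>y \<in> coset G x i; z \<in> coset G x i; y \<notin> coset G x (i + 1) \<or> z \<notin> coset G x (i + 1)\<rbrakk>
      \<Longrightarrow> norm (K x y z) \<le> C / (vilenkin_haar.vol G \<mu> i)\<^sup>2"
    and K_reg0: "\<lbrakk>y \<in> coset G x i; z \<in> coset G x i; y \<notin> coset G x (i + 1) \<or> z \<notin> coset G x (i + 1); i < j; x' \<in> coset G x j\<rbrakk>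
      \<Longrightarrow> norm (K x y z - K x' y z) \<le> C * \<rho> ^ nat (j - i) / (vilenkin_haar.vol G \<mu> i)\<^sup>2"
    and K_reg1: "\<lbrakk>y \<in> coset G x i; z \<in> coset G x i; y \<notin> coset G x (i + 1) \<or> z \<notin> coset G x (i + 1); i < j; y' \<in> coset G y j\<rbrakk>
      \<Longrightarrow> norm (K x y z - K x y' z) \<le> C * \<rho> ^ nat (j - i) / (vilenkin_haar.vol G \<mu> i)\<^sup>2"
    and K_reg2: "\<lbrakk>y \<in> coset G x i; z \<in> coset G x i; y \<notin> coset G x (i + 1) \<or> z \<notin> coset G x (i + 1); i < j; z' \<in> coset G z j\<rbrakk>
      \<Longrightarrow> norm (K x y z - K x y z') \<le> C * \<rho> ^ nat (j - i) / (vilenkin_haar.vol G \<mu> i)\<^sup>2"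
    and rep_integrable: "\<lbrakk>f \<in> test_functions G; g \<in> test_functions G; x \<notin> supp f \<inter> supp g\<rbrakk>
      \<Longrightarrow> integrable (\<mu> \<Otimes>\<^sub>M \<mu>) (\<lambda>(y, z). K x y z * f y * g z)"
    and rep: "\<lbrakk>f \<in> test_functions G; g \<in> test_functions G; x \<notin> supp f \<inter> supp g\<rbrakk>
      \<Longrightarrow> T f g x = (\<integral>(y, z). K x y z * f y * g z \<partial>(\<mu> \<Otimes>\<^sub>M \<mu>))"
    and Lq: "bounded_on_some_Lp \<mu> G T"

text \<open>In the shell \<open>i\<close> at least one of \<open>y\<close>, \<open>z\<close> has
  left \<open>cs x (i + 1)\<close>, so the larger of the two distances is exactly
  \<open>vol i\<close>. A move inside a coset of level \<open>j > i\<close> has length at most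
  \<open>vol j\<close>, which is at most half of \<open>vol i\<close> by the growth condition, so it
  is admissible for the regularity estimates.\<close>

lemma (in vilenkin_haar) kernel_shell:
  assumes "bilinear_CZ_kernel \<mu> G K"
  obtains C \<rho> where "0 < C" "0 < \<rho>" "\<rho> < 1"
    "\<And>x y z i. \<lbrakk>y \<in> cs x i; z \<in> cs x i; y \<notin> cs x (i + 1) \<or> z \<notin> cs x (i + 1)\<rbrakk> \<Longrightarrow> norm (K x y z) \<le> C / (vol i)\<^sup>2"
    "\<And>x x' y z i j. \<lbrakk>y \<in> cs x i; z \<in> cs x i; y \<notin> cs x (i + 1) \<or> z \<notin> cs x (i + 1); i < j; x' \<in> cs x j\<rbrakk>
      \<Longrightarrow> norm (K x y z - K x' y z) \<le> C * \<rho> ^ nat (j - i) / (vol i)\<^sup>2"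
    "\<And>x y y' z i j. \<lbrakk>y \<in> cs x i; z \<in> cs x i; y \<notin> cs x (i + 1) \<or> z \<notin> cs x (i + 1); i < j; y' \<in> cs y j\<rbrakk>
      \<Longrightarrow> norm (K x y z - K x y' z) \<le> C * \<rho> ^ nat (j - i) / (vol i)\<^sup>2"
    "\<And>x y z z' i j. \<lbrakk>y \<in> cs x i; z \<in> cs x i; y \<notin> cs x (i + 1) \<or> z \<notin> cs x (i + 1); i < j; z' \<in> cs z j\<rbrakk>
      \<Longrightarrow> norm (K x y z - K x y z') \<le> C * \<rho> ^ nat (j - i) / (vol i)\<^sup>2"
proof -
  let ?d = "vdist \<mu> G"
  define R where "R C \<epsilon> x y1 y2 \<longleftrightarrow>
        norm (K x y1 y2) \<le> C / (?d x y1 + ?d x y2)\<^sup>2 \<and>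
        (\<forall>x'. ?d x x' \<le> 1 / 2 * max (?d x y1) (?d x y2) \<longrightarrow>
           norm (K x y1 y2 - K x' y1 y2) \<le> C * ?d x x' powr \<epsilon> / (?d x y1 + ?d x y2) powr (2 + \<epsilon>)) \<and>
        (\<forall>y1'. ?d y1 y1' \<le> 1 / 2 * max (?d x y1) (?d x y2) \<longrightarrow>
           norm (K x y1 y2 - K x y1' y2) \<le> C * ?d y1 y1' powr \<epsilon> / (?d x y1 + ?d x y2) powr (2 + \<epsilon>)) \<and>
        (\<forall>y2'. ?d y2 y2' \<le> 1 / 2 * max (?d x y1) (?d x y2) \<longrightarrow>
           norm (K x y1 y2 - K x y1 y2') \<le> C * ?d y2 y2' powr \<epsilon> / (?d x y1 + ?d x y2) powr (2 + \<epsilon>))" for C \<epsilon> x y1 y2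
  have "\<exists>C>0. \<exists>\<epsilon>>0. \<forall>x y1 y2. x \<noteq> y1 \<or> x \<noteq> y2 \<longrightarrow> R C \<epsilon> x y1 y2"
    using assms unfolding bilinear_CZ_kernel_def Let_def R_def by (rule conjunct2)
  then obtain C \<epsilon> where C: "0 < C" "0 < \<epsilon>" and R: "\<forall>x y1 y2. x \<noteq> y1 \<or> x \<noteq> y2 \<longrightarrow> R C \<epsilon> x y1 y2"
    by blast
  have ker: "norm (K x y1 y2) \<le> C / (?d x y1 + ?d x y2)\<^sup>2 \<and>
        (\<forall>x'. ?d x x' \<le> 1 / 2 * max (?d x y1) (?d x y2) \<longrightarrow>
           norm (K x y1 y2 - K x' y1 y2) \<le> C * ?d x x' powr \<epsilon> / (?d x y1 + ?d x y2) powr (2 + \<epsilon>)) \<and>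
        (\<forall>y1'. ?d y1 y1' \<le> 1 / 2 * max (?d x y1) (?d x y2) \<longrightarrow>
           norm (K x y1 y2 - K x y1' y2) \<le> C * ?d y1 y1' powr \<epsilon> / (?d x y1 + ?d x y2) powr (2 + \<epsilon>)) \<and>
        (\<forall>y2'. ?d y2 y2' \<le> 1 / 2 * max (?d x y1) (?d x y2) \<longrightarrow>
           norm (K x y1 y2 - K x y1 y2') \<le> C * ?d y2 y2' powr \<epsilon> / (?d x y1 + ?d x y2) powr (2 + \<epsilon>))" if "x \<noteq> y1 \<or> x \<noteq> y2" for x y1 y2
    using R that unfolding R_def by simp
  define \<rho> where "\<rho> = 2 powr (- \<epsilon>)"
  have \<rho>: "0 < \<rho>" "\<rho> < 1" unfolding \<rho>_def using C by (auto simp: powr_less_one)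
  have sum_ge: "vol i \<le> ?d x y + ?d x z" "x \<noteq> y \<or> x \<noteq> z" "vol i \<le> max (?d x y) (?d x z)"
    if "y \<in> cs x i" "z \<in> cs x i" "y \<notin> cs x (i + 1) \<or> z \<notin> cs x (i + 1)" for x y z i
    using that(3) vdist_level[OF that(1)] vdist_level[OF that(2)] vdist_nonneg[of x y] vdist_nonneg[of x z] by auto
  \<comment> \<open>Here \<open>s\<close> stands for the sum of the two distances. Since
    \<open>vol j\<close> is at most \<open>vol i / 2 ^ (j - i)\<close>, the power
    \<open>\<epsilon>\<close> of the displacement yields \<open>\<rho> ^ (j - i)\<close>, while
    \<open>vol i powr \<epsilon>\<close> cancels against the denominator.\<close>
  have tail: "C * ?d w w' powr \<epsilon> / s powr (2 + \<epsilon>) \<le> C * \<rho> ^ nat (j - i) / (vol i)\<^sup>2"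
    if "i < j" "w' \<in> cs w j" "vol i \<le> s" for i j w w' s
  proof -
    have "2 ^ nat (j - i) * ?d w w' \<le> 2 ^ nat (j - i) * vol j"
      by (intro mult_left_mono vdist_le that) simp
    also have "\<dots> \<le> vol i" using that by (intro vol_power') simp
    finally have "2 ^ nat (j - i) * ?d w w' \<le> vol i" .
    then have "?d w w' \<le> vol i / 2 ^ nat (j - i)" by (simp add: field_simps)
    then have "?d w w' powr \<epsilon> \<le> (vol i / 2 ^ nat (j - i)) powr \<epsilon>"
      using C vdist_nonneg by (intro powr_mono2) auto
    also have "\<dots> = vol i powr \<epsilon> * \<rho> ^ nat (j - i)"
      by (simp add: powr_divide vol_nonneg \<rho>_def powr_minus powr_realpow[symmetric] powr_powr
           powr_power field_simps)
    finally have "C * ?d w w' powr \<epsilon> / s powr (2 + \<epsilon>) \<le> C * (vol i powr \<epsilon> * \<rho> ^ nat (j - i)) / vol i powr (2 + \<epsilon>)"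
      using C vol_pos[of i] \<rho> that(3) by (intro frac_le mult_left_mono powr_mono2) auto
    also have "vol i powr (2 + \<epsilon>) = (vol i)\<^sup>2 * vol i powr \<epsilon>"
      using vol_pos[of i] by (simp add: powr_add powr_numeral)
    finally show ?thesis using vol_pos[of i] by simp
  qed
  have half: "?d w w' \<le> 1 / 2 * m" if "i < j" "w' \<in> cs w j" "vol i \<le> m" for i j w w' m
    using vdist_le[OF that(2)] vol_less_half[OF that(1)] that(3) by linarith
  show ?thesis
  proof (rule that[OF C(1) \<rho>])
    fix x y z i assume a: "y \<in> cs x i" "z \<in> cs x i" "y \<notin> cs x (i + 1) \<or> z \<notin> cs x (i + 1)"
    have "norm (K x y z) \<le> C / (?d x y + ?d x z)\<^sup>2" using ker[OF sum_ge(2)[OF a]] by blast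
    also have "\<dots> \<le> C / (vol i)\<^sup>2"
      using sum_ge(1)[OF a] vol_pos[of i] C by (intro frac_le power_mono) auto
    finally show "norm (K x y z) \<le> C / (vol i)\<^sup>2" .
  next
    fix x x' y z i j assume a: "y \<in> cs x i" "z \<in> cs x i" "y \<notin> cs x (i + 1) \<or> z \<notin> cs x (i + 1)"
      and b: "i < j" "x' \<in> cs x j"
    show "norm (K x y z - K x' y z) \<le> C * \<rho> ^ nat (j - i) / (vol i)\<^sup>2"
      using ker[OF sum_ge(2)[OF a]] half[OF b sum_ge(3)[OF a]] tail[OF b sum_ge(1)[OF a]] order_trans by blast
  next
    fix x y y' z i j assume a: "y \<in> cs x i" "z \<in> cs x i" "y \<notin> cs x (i + 1) \<or> z \<notin> cs x (i + 1)"
      and b: "i < j" "y' \<in> cs y j"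
    show "norm (K x y z - K x y' z) \<le> C * \<rho> ^ nat (j - i) / (vol i)\<^sup>2"
      using ker[OF sum_ge(2)[OF a]] half[OF b sum_ge(3)[OF a]] tail[OF b sum_ge(1)[OF a]] order_trans by blast
  next
    fix x y z z' i j assume a: "y \<in> cs x i" "z \<in> cs x i" "y \<notin> cs x (i + 1) \<or> z \<notin> cs x (i + 1)"
      and b: "i < j" "z' \<in> cs z j"
    show "norm (K x y z - K x y z') \<le> C * \<rho> ^ nat (j - i) / (vol i)\<^sup>2"
      using ker[OF sum_ge(2)[OF a]] half[OF b sum_ge(3)[OF a]] tail[OF b sum_ge(1)[OF a]] order_trans by blast
  qed
qed

context vilenkin_haar begin

lemma shell_below:
  assumes "\<not> (y \<in> cs x k \<and> z \<in> cs x k)"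
  obtains i where "i < k" "y \<in> cs x i" "z \<in> cs x i" "y \<notin> cs x (i + 1) \<or> z \<notin> cs x (i + 1)"
proof -
  have "y - x \<in> (\<Union>n. G n)" "z - x \<in> (\<Union>n. G n)" unfolding Union_eq by simp_all
  then obtain a b where "y \<in> cs x a" "z \<in> cs x b" unfolding mem_coset by blast
  then have "y \<in> cs x (min k (min a b))" "z \<in> cs x (min k (min a b))" by (simp_all add: coset_min)
  then have "\<exists>i. min k (min a b) \<le> i \<and> i < k \<and> (y \<in> cs x i \<and> z \<in> cs x i) \<and> \<not> (y \<in> cs x (i + 1) \<and> z \<in> cs x (i + 1))"
    using assms by (intro shell_exists) auto
  then show ?thesis using that by blast
qed

lemma not_in_supp: "x \<notin> supp f \<Longrightarrow> f x = 0"
  unfolding supp_def using closure_subset[THEN subsetD, of x "{x. f x \<noteq> 0}"] by auto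

lemma not_in_small_coset: assumes "y \<noteq> x" obtains k where "y \<notin> cs x k"
  using level_exists[of x y] assms by metis

text \<open>Regularity in \<open>y\<close> and \<open>z\<close> makes each slice of the kernel
  measurable off the diagonal. If \<open>x\<close> misses one of the supports, then
  \<open>f y * g z\<close> vanishes for \<open>y\<close>, \<open>z\<close> close to
  \<open>x\<close>, and on the rest the size estimate bounds the kernel. Hence the integrand is
  integrable on the product, and Fubini turns the iterated integral of the association into a double
  integral.\<close>

lemma czo_of_operator:
  assumes "bilinear_CZ_operator \<mu> G T"
  obtains K C \<rho> where "czo G \<mu> B T K C \<rho>"
proof -
  obtain K where K: "bilinear_CZ_kernel \<mu> G K" "associated_with \<mu> G T K"
    using assms unfolding bilinear_CZ_operator_def by (elim conjE exE) (rule that)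
  obtain C \<rho> where C: "0 < C" "0 < \<rho>" "\<rho> < 1"
    and K0: "\<And>x y z i. \<lbrakk>y \<in> cs x i; z \<in> cs x i; y \<notin> cs x (i + 1) \<or> z \<notin> cs x (i + 1)\<rbrakk> \<Longrightarrow> norm (K x y z) \<le> C / (vol i)\<^sup>2"
    and K1: "\<And>x x' y z i j. \<lbrakk>y \<in> cs x i; z \<in> cs x i; y \<notin> cs x (i + 1) \<or> z \<notin> cs x (i + 1); i < j; x' \<in> cs x j\<rbrakk>
      \<Longrightarrow> norm (K x y z - K x' y z) \<le> C * \<rho> ^ nat (j - i) / (vol i)\<^sup>2"
    and K2: "\<And>x y y' z i j. \<lbrakk>y \<in> cs x i; z \<in> cs x i; y \<notin> cs x (i + 1) \<or> z \<notin> cs x (i + 1); i < j; y' \<in> cs y j\<rbrakk>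
      \<Longrightarrow> norm (K x y z - K x y' z) \<le> C * \<rho> ^ nat (j - i) / (vol i)\<^sup>2"
    and K3: "\<And>x y z z' i j. \<lbrakk>y \<in> cs x i; z \<in> cs x i; y \<notin> cs x (i + 1) \<or> z \<notin> cs x (i + 1); i < j; z' \<in> cs z j\<rbrakk>
      \<Longrightarrow> norm (K x y z - K x y z') \<le> C * \<rho> ^ nat (j - i) / (vol i)\<^sup>2"
    by (rule kernel_shell[OF K(1)]) blast
  \<comment> \<open>The value at the single point \<open>(x, x)\<close> is arbitrary and is replaced
    by 0.\<close>
  have meas: "(\<lambda>(y, z). if (y, z) \<in> - {(x, x)} then K x y z else 0) \<in> borel_measurable (\<mu> \<Otimes>\<^sub>M \<mu>)" for x
  proof (rule cont_rect_measurable)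
    fix y z and e :: real assume yz: "(y, z) \<in> - {(x, x)}" and e: "0 < e"
    then consider "y \<noteq> x" | "z \<noteq> x" by auto
    then obtain k where "\<not> (y \<in> cs x k \<and> z \<in> cs x k)"
    proof cases
      case 1 then obtain k where "y \<notin> cs x k" by (rule not_in_small_coset)
      then show ?thesis using that by blast
    next
      case 2 then obtain k where "z \<notin> cs x k" by (rule not_in_small_coset)
      then show ?thesis using that by blast
    qed
    then obtain i where i: "y \<in> cs x i" "z \<in> cs x i" "y \<notin> cs x (i + 1) \<or> z \<notin> cs x (i + 1)"
      by (rule shell_below)
    have "(\<lambda>m. C * \<rho> ^ m / (vol i)\<^sup>2) \<longlonglongrightarrow> C * 0 / (vol i)\<^sup>2"
      using C vol_pos[of i] by (intro tendsto_intros LIMSEQ_power_zero) auto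
    then have "eventually (\<lambda>m. C * \<rho> ^ m / (vol i)\<^sup>2 < e / 2) sequentially"
      using e by (intro order_tendstoD(2)) auto
    then obtain m0 where m0: "\<And>m. m \<ge> m0 \<Longrightarrow> C * \<rho> ^ m / (vol i)\<^sup>2 < e / 2"
      unfolding eventually_sequentially by blast
    \<comment> \<open>With \<open>m \<ge> 1\<close> the level \<open>j\<close> is at least
      \<open>i + 1\<close>, so moving \<open>y\<close> and \<open>z\<close> inside their cosets of
      level \<open>j\<close> changes membership neither in \<open>cs x i\<close> nor in
      \<open>cs x (i + 1)\<close>: the shell stays the same.\<close>
    define m where "m = max 1 m0"
    have m: "C * \<rho> ^ m / (vol i)\<^sup>2 < e / 2" "m \<ge> 1" using m0[of m] by (simp_all add: m_def)
    define j where "j = i + int m"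
    have j: "i < j" "nat (j - i) = m" "i + 1 \<le> j" using m(2) by (auto simp: j_def)
    show "\<exists>k. \<forall>y'\<in>cs y k. \<forall>z'\<in>cs z k. (y', z') \<in> - {(x, x)} \<and> norm (K x y' z' - K x y z) < e"
    proof (intro exI[of _ j] ballI conjI)
      fix y' z' assume y': "y' \<in> cs y j" and z': "z' \<in> cs z j"
      have stay: "w' \<in> cs x l \<longleftrightarrow> w \<in> cs x l" if "w' \<in> cs w j" "l \<le> j" for w w' l
        using coset_le_eq[OF that] coset_sym[of x w l] coset_sym[of x w' l] coset_sym[of w x l] coset_sym[of w' x l] by blast
      have i': "y' \<in> cs x i" "z \<in> cs x i" "y' \<notin> cs x (i + 1) \<or> z \<notin> cs x (i + 1)"
        using i stay[OF y', of i] stay[OF y', of "i + 1"] j by auto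
      have i'': "z' \<in> cs x i" "y' \<notin> cs x (i + 1) \<or> z' \<notin> cs x (i + 1)"
        using i' stay[OF z', of i] stay[OF z', of "i + 1"] j by auto
      then show "(y', z') \<in> - {(x, x)}" by auto
      have "norm (K x y' z' - K x y z) \<le> norm (K x y z - K x y' z) + norm (K x y' z - K x y' z')"
        by (metis norm_minus_commute norm_triangle_ineq diff_add_cancel add_diff_eq add.commute)
      also have "\<dots> \<le> C * \<rho> ^ m / (vol i)\<^sup>2 + C * \<rho> ^ m / (vol i)\<^sup>2"
        using K2[OF i j(1) y'] K3[OF i' j(1) z'] unfolding j(2) by (rule add_mono)
      also have "\<dots> < e" using m(1) by linarith
      finally show "norm (K x y' z' - K x y z) < e" .
    qed
  qed
  have int: "integrable (\<mu> \<Otimes>\<^sub>M \<mu>) (\<lambda>(y, z). K x y z * f y * g z)"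
    if fg: "f \<in> test" "g \<in> test" "x \<notin> supp f \<inter> supp g" for x f g
  proof -
    obtain F where F: "0 < F" "\<And>x. norm (f x) \<le> F" by (rule test_bounded[OF fg(1)]) blast
    obtain F' where F': "0 < F'" "\<And>x. norm (g x) \<le> F'" by (rule test_bounded[OF fg(2)]) blast
    obtain n where n: "\<And>x. x \<notin> cs 0 n \<Longrightarrow> f x = 0" by (rule testE[OF fg(1)]) blast
    obtain n' where n': "\<And>x. x \<notin> cs 0 n' \<Longrightarrow> g x = 0" by (rule testE[OF fg(2)]) blast
    \<comment> \<open>Supports are closed, so a whole coset around \<open>x\<close> misses the
      support that does not contain \<open>x\<close>.\<close>
    obtain k where k: "f y = 0 \<or> g z = 0" if "y \<in> cs x k" "z \<in> cs x k" for y z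
    proof (cases "x \<in> supp f")
      case True
      then have x: "x \<in> - supp g" using fg(3) by blast
      have "open (- supp g)" unfolding supp_def by (rule open_Compl[OF closed_closure])
      from this x obtain k where k: "cs x k \<subseteq> - supp g" by (rule coset_nbhd)
      show ?thesis
      proof (rule that[of k])
        fix y z assume "y \<in> cs x k" "z \<in> cs x k"
        then have "z \<notin> supp g" using k by blast
        then have "g z = 0" by (rule not_in_supp)
        then show "f y = 0 \<or> g z = 0" ..
      qed
    next
      case False
      then have x: "x \<in> - supp f" by blast
      have "open (- supp f)" unfolding supp_def by (rule open_Compl[OF closed_closure])
      from this x obtain k where k: "cs x k \<subseteq> - supp f" by (rule coset_nbhd)
      show ?thesis
      proof (rule that[of k])
        fix y z assume "y \<in> cs x k" "z \<in> cs x k"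
        then have "y \<notin> supp f" using k by blast
        then have "f y = 0" by (rule not_in_supp)
        then show "f y = 0 \<or> g z = 0" ..
      qed
    qed
    have [measurable]: "f \<in> borel_measurable \<mu>" "g \<in> borel_measurable \<mu>" using fg by (auto intro: test_measurable)
    \<comment> \<open>On the diagonal point the factor \<open>f x * g x\<close> is 0, so the kernel
      may be replaced there by its measurable modification.\<close>
    have *: "(\<lambda>(y, z). K x y z * f y * g z) = (\<lambda>p. (case p of (y, z) \<Rightarrow> if (y, z) \<in> - {(x, x)} then K x y z else 0) * f (fst p) * g (snd p))"
      using k[OF mem_coset_self mem_coset_self] by (auto simp: fun_eq_iff)
    show ?thesis
    proof (rule integrableI_bounded_set[of "cs 0 n \<times> cs 0 n'" _ _ "C / (vol k)\<^sup>2 * F * F'"])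
      show "cs 0 n \<times> cs 0 n' \<in> sets (\<mu> \<Otimes>\<^sub>M \<mu>)" by (intro pair_measureI) auto
      show "(\<lambda>(y, z). K x y z * f y * g z) \<in> borel_measurable (\<mu> \<Otimes>\<^sub>M \<mu>)"
        unfolding * using meas[of x] by measurable
      show "emeasure (\<mu> \<Otimes>\<^sub>M \<mu>) (cs 0 n \<times> cs 0 n') < \<infinity>"
        by (subst emeasure_pair_measure_Times) (auto simp: emeasure_coset ennreal_mult[symmetric] vol_nonneg)
      show "AE p in \<mu> \<Otimes>\<^sub>M \<mu>. p \<in> cs 0 n \<times> cs 0 n' \<longrightarrow> norm (case p of (y, z) \<Rightarrow> K x y z * f y * g z) \<le> C / (vol k)\<^sup>2 * F * F'"
      proof (intro AE_I2 impI)
        fix p :: "'a \<times> 'a"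
        obtain y z where p: "p = (y, z)" by (cases p)
        have "norm (K x y z * f y * g z) \<le> C / (vol k)\<^sup>2 * F * F'"
        proof (cases "f y = 0 \<or> g z = 0")
          case True then show ?thesis using C F F' by auto
        next
          case False
          then have "\<not> (y \<in> cs x k \<and> z \<in> cs x k)" using k by blast
          then obtain i where i: "i < k" "y \<in> cs x i" "z \<in> cs x i" "y \<notin> cs x (i + 1) \<or> z \<notin> cs x (i + 1)"
            by (rule shell_below)
          have "norm (K x y z) \<le> C / (vol i)\<^sup>2" by (rule K0[OF i(2-4)])
          also have "\<dots> \<le> C / (vol k)\<^sup>2"
            using C vol_mono[of i k] i(1) by (intro frac_le power_mono zero_less_power vol_pos) (simp_all add: vol_nonneg)
          finally show ?thesis unfolding norm_mult
            using F F' C by (intro mult_mono) auto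
        qed
        then show "norm (case p of (y, z) \<Rightarrow> K x y z * f y * g z) \<le> C / (vol k)\<^sup>2 * F * F'" by (simp add: p)
      qed
      show "AE p in \<mu> \<Otimes>\<^sub>M \<mu>. p \<notin> cs 0 n \<times> cs 0 n' \<longrightarrow> (case p of (y, z) \<Rightarrow> K x y z * f y * g z) = 0"
      proof (intro AE_I2 impI)
        fix p :: "'a \<times> 'a" assume np: "p \<notin> cs 0 n \<times> cs 0 n'"
        obtain y z where p: "p = (y, z)" by (cases p)
        then have "f y = 0 \<or> g z = 0" using np n[of y] n'[of z] by blast
        then show "(case p of (y, z) \<Rightarrow> K x y z * f y * g z) = 0" by (auto simp: p)
      qed
    qed
  qed
  have rep: "T f g x = (\<integral>(y, z). K x y z * f y * g z \<partial>(\<mu> \<Otimes>\<^sub>M \<mu>))"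
    if fg: "f \<in> test" "g \<in> test" "x \<notin> supp f \<inter> supp g" for x f g
    using K(2) fg pair.integral_snd[OF int[OF fg]] unfolding associated_with_def by simp
  have "czo G \<mu> B T K C \<rho>"
    by (intro czo.intro czo_axioms.intro)
       (use assms C K0 K1 K2 K3 int rep vilenkin_haar_axioms in \<open>simp_all only: bilinear_CZ_operator_def simp_thms\<close>)
  then show ?thesis by (rule that)
qed

end

section \<open>Bilinearity and symmetry of the operator\<close>

context czo begin

lemma T_measurable [measurable]: "f \<in> test \<Longrightarrow> g \<in> test \<Longrightarrow> T f g \<in> borel_measurable \<mu>"
  using bil unfolding bilinear_op_def by blast

lemma T_lin1: "f \<in> test \<Longrightarrow> f' \<in> test \<Longrightarrow> g \<in> test \<Longrightarrow>
  AE x in \<mu>. T (\<lambda>x. a * f x + b * f' x) g x = a * T f g x + b * T f' g x"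
  using bil unfolding bilinear_op_def by blast

lemma T_lin2: "f \<in> test \<Longrightarrow> g \<in> test \<Longrightarrow> g' \<in> test \<Longrightarrow>
  AE x in \<mu>. T f (\<lambda>x. a * g x + b * g' x) x = a * T f g x + b * T f g' x"
  using bil unfolding bilinear_op_def by blast

lemma T_add1: "f \<in> test \<Longrightarrow> f' \<in> test \<Longrightarrow> g \<in> test \<Longrightarrow>
  AE x in \<mu>. T (\<lambda>x. f x + f' x) g x = T f g x + T f' g x"
  using T_lin1[of f f' g 1 1] by simp

lemma T_add2: "f \<in> test \<Longrightarrow> g \<in> test \<Longrightarrow> g' \<in> test \<Longrightarrow>
  AE x in \<mu>. T f (\<lambda>x. g x + g' x) x = T f g x + T f g' x"
  using T_lin2[of f g g' 1 1] by simp

text \<open>Exchanging the two arguments gives an operator of the same kind with the same constants,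
  so estimates proved for the first argument carry over to the second.\<close>

lemma swap: "czo G \<mu> B (\<lambda>f g. T g f) (\<lambda>x y z. K x z y) C \<rho>"
proof (intro czo.intro czo_axioms.intro vilenkin_haar_axioms C_pos \<rho>_pos \<rho>_less)
  show "bilinear_op \<mu> test test (\<lambda>f g. T g f)"
    using bil unfolding bilinear_op_def by blast
  show "bounded_on_some_Lp \<mu> G (\<lambda>f g. T g f)"
  proof -
    obtain q q1 q2 D where "1 \<le> q1" "1 \<le> q2" "0 < q" "1 / q = 1 / q1 + 1 / q2" "0 < D"
      "\<And>f1 f2. f1 \<in> test \<Longrightarrow> f2 \<in> test \<Longrightarrow> Lp_norm \<mu> q (T f1 f2) \<le> ennreal D * Lp_norm \<mu> q1 f1 * Lp_norm \<mu> q2 f2"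
      using Lq unfolding bounded_on_some_Lp_def by metis
    then show ?thesis unfolding bounded_on_some_Lp_def
      by (intro exI[of _ q] exI[of _ q2] exI[of _ q1] exI[of _ D]) (auto simp: ac_simps)
  qed
  show "norm (K x z y) \<le> C / (vol i)\<^sup>2"
    if "y \<in> cs x i" "z \<in> cs x i" "y \<notin> cs x (i + 1) \<or> z \<notin> cs x (i + 1)" for x y z i
    using that by (intro K_size) auto
  show "norm (K x z y - K x' z y) \<le> C * \<rho> ^ nat (j - i) / (vol i)\<^sup>2"
    if "y \<in> cs x i" "z \<in> cs x i" "y \<notin> cs x (i + 1) \<or> z \<notin> cs x (i + 1)" "i < j" "x' \<in> cs x j" for x x' y z i j
    using that by (intro K_reg0) auto
  show "norm (K x z y - K x z y') \<le> C * \<rho> ^ nat (j - i) / (vol i)\<^sup>2"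
    if "y \<in> cs x i" "z \<in> cs x i" "y \<notin> cs x (i + 1) \<or> z \<notin> cs x (i + 1)" "i < j" "y' \<in> cs y j" for x y' y z i j
    using that by (intro K_reg2) auto
  show "norm (K x z y - K x z' y) \<le> C * \<rho> ^ nat (j - i) / (vol i)\<^sup>2"
    if "y \<in> cs x i" "z \<in> cs x i" "y \<notin> cs x (i + 1) \<or> z \<notin> cs x (i + 1)" "i < j" "z' \<in> cs z j" for x z' y z i j
    using that by (intro K_reg1) auto
  fix f g x assume fg: "f \<in> test" "g \<in> test" "x \<notin> supp f \<inter> supp g"
  then have gf: "x \<notin> supp g \<inter> supp f" by blast
  have i: "integrable (\<mu> \<Otimes>\<^sub>M \<mu>) (\<lambda>(y, z). K x y z * g y * f z)" by (rule rep_integrable[OF fg(2,1) gf])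
  have *: "(\<lambda>(y, z). K x z y * f y * g z) = (\<lambda>(y, z). (\<lambda>(y, z). K x y z * g y * f z) (z, y))"
    by (auto simp: fun_eq_iff ac_simps)
  show "integrable (\<mu> \<Otimes>\<^sub>M \<mu>) (\<lambda>(y, z). K x z y * f y * g z)"
    unfolding * using i by (rule pair.integrable_product_swap)
  show "T g f x = (\<integral>(y, z). K x z y * f y * g z \<partial>(\<mu> \<Otimes>\<^sub>M \<mu>))"
    unfolding * rep[OF fg(2,1) gf]
    by (rule pair.integral_product_swap[symmetric]) (use i in simp)
qed

end

context vilenkin_haar begin

lemma avg_integrable: "f \<in> test \<Longrightarrow> integrable \<mu> (\<lambda>y. indicator (cs x i) y * norm (f y))"
proof -
  assume "f \<in> test"
  then have "integrable \<mu> (\<lambda>y. indicator (cs x i) y *\<^sub>R norm (f y))"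
    by (intro integrable_mult_indicator integrable_norm test_integrable) auto
  then show ?thesis by simp
qed

lemma vol_avg: "vol k * avg f x k = (\<integral>y. indicator (cs x k) y * norm (f y) \<partial>\<mu>)"
  using vol_pos[of k] by (simp add: avg_def)

text \<open>On the product, the term of level \<open>i\<close> integrates to
  \<open>c i / (vol i)\<^sup>2\<close> times
  \<open>(vol i * avg f x i) * (vol i * avg g x i)\<close>: the volumes cancel, and one product of
  averages per shell is left.\<close>

lemma shell_sum_bound:
  fixes H :: "'a \<times> 'a \<Rightarrow> complex"
  assumes "f \<in> test" "g \<in> test"
    and H: "\<And>y z. norm (H (y, z)) \<le> (\<Sum>i\<in>{n..<r}. c i / (vol i)\<^sup>2 *
      ((indicator (cs x i) y * norm (f y)) * (indicator (cs x i) z * norm (g z))))"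
  shows "norm (\<integral>p. H p \<partial>(\<mu> \<Otimes>\<^sub>M \<mu>)) \<le> (\<Sum>i\<in>{n..<r}. c i * avg f x i * avg g x i)"
proof -
  let ?F = "\<lambda>i. \<lambda>(y, z). (indicator (cs x i) y * norm (f y)) * (indicator (cs x i) z * norm (g z))"
  have F: "integrable (\<mu> \<Otimes>\<^sub>M \<mu>) (?F i)" "(\<integral>p. ?F i p \<partial>(\<mu> \<Otimes>\<^sub>M \<mu>)) = (vol i)\<^sup>2 * (avg f x i * avg g x i)" for i
    using prod_integral[OF avg_integrable[OF assms(1)] avg_integrable[OF assms(2)], of x i x i]
    unfolding vol_avg[symmetric] by (simp_all only: power2_eq_square mult_ac)
  have "norm (\<integral>p. H p \<partial>(\<mu> \<Otimes>\<^sub>M \<mu>)) \<le> (\<integral>p. (\<Sum>i\<in>{n..<r}. c i / (vol i)\<^sup>2 * ?F i p) \<partial>(\<mu> \<Otimes>\<^sub>M \<mu>))"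
    by (rule norm_integral_le)
       (use F H in \<open>auto intro!: Bochner_Integration.integrable_sum integrable_mult_right simp del: times_divide_eq_left\<close>)
  also have "\<dots> = (\<Sum>i\<in>{n..<r}. c i / (vol i)\<^sup>2 * (\<integral>p. ?F i p \<partial>(\<mu> \<Otimes>\<^sub>M \<mu>)))"
    using F by (subst Bochner_Integration.integral_sum) (auto intro!: integrable_mult_right simp del: times_divide_eq_left)
  also have "\<dots> = (\<Sum>i\<in>{n..<r}. c i * avg f x i * avg g x i)"
    using vol_pos by (intro sum.cong refl) (simp add: F less_imp_neq[symmetric])
  finally show ?thesis .
qed

end

section \<open>The effect of restricting both arguments to a smaller coset\<close>

context czo begin

text \<open>For \<open>w \<in> cs x r\<close> this is the change in \<open>T f g w\<close> when both arguments are cut down from \<open>cs x n\<close> to \<open>cs x r\<close>: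
  the diagonal is excluded from the integral, so the kernel represents it.\<close>

definition rem :: "'a \<Rightarrow> int \<Rightarrow> int \<Rightarrow> ('a \<Rightarrow> complex) \<Rightarrow> ('a \<Rightarrow> complex) \<Rightarrow> 'a \<Rightarrow> complex" where
  "rem x n r f g w = (\<integral>(y, z). K w y z * f y * g z *
     of_bool (y \<in> cs x n \<and> z \<in> cs x n \<and> \<not> (y \<in> cs x r \<and> z \<in> cs x r)) \<partial>(\<mu> \<Otimes>\<^sub>M \<mu>))"

text \<open>With \<open>fD\<close>, \<open>gD\<close> the parts of \<open>f\<close>,
  \<open>g\<close> on the larger coset outside the smaller one, bilinearity splits the difference
  into \<open>T fD (rs Q g) + T (rs R f) gD\<close>, where \<open>Q\<close> and \<open>R\<close> are
  the two cosets. In each term one argument vanishes on the open coset \<open>R\<close>, so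
  \<open>w\<close> is off its support and the kernel represents the value. The identity holds almost
  everywhere because bilinearity does.\<close>

lemma rem_rep:
  assumes fg: "f \<in> test" "g \<in> test" and nr: "n \<le> r"
  shows "AE w in \<mu>. w \<in> cs x r \<longrightarrow>
      T (rs (cs x n) f) (rs (cs x n) g) w - T (rs (cs x r) f) (rs (cs x r) g) w = rem x n r f g w"
    and "w \<in> cs x r \<Longrightarrow> integrable (\<mu> \<Otimes>\<^sub>M \<mu>) (\<lambda>(y, z). K w y z * f y * g z *
     of_bool (y \<in> cs x n \<and> z \<in> cs x n \<and> \<not> (y \<in> cs x r \<and> z \<in> cs x r)))"
proof -
  let ?Q = "cs x n" and ?R = "cs x r"
  have RQ: "?R \<subseteq> ?Q" using nr by (rule coset_mono)
  define fD where "fD = (\<lambda>x. rs ?Q f x - rs ?R f x)"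
  define gD where "gD = (\<lambda>x. rs ?Q g x - rs ?R g x)"
  have t: "rs ?Q f \<in> test" "rs ?R f \<in> test" "rs ?Q g \<in> test" "rs ?R g \<in> test" "fD \<in> test" "gD \<in> test"
    unfolding fD_def gD_def by (auto intro!: test_rs test_diff fg)
  have "fD y = 0" "gD y = 0" if "y \<in> ?R" for y
    using that RQ by (auto simp: fD_def gD_def)
  then have "supp fD \<subseteq> - ?R" "supp gD \<subseteq> - ?R"
    using supp_subset_iff[of "- ?R"] open_coset[of x r] by (simp_all add: closed_Compl)
  then have ns: "w \<notin> supp fD \<inter> supp (rs ?Q g)" "w \<notin> supp (rs ?R f) \<inter> supp gD" if "w \<in> ?R" for w
    using that by auto
  let ?k = "\<lambda>w (y, z). K w y z * f y * g z * of_bool (y \<in> ?Q \<and> z \<in> ?Q \<and> \<not> (y \<in> ?R \<and> z \<in> ?R))"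
  have split: "?k w = (\<lambda>p. (case p of (y, z) \<Rightarrow> K w y z * fD y * rs ?Q g z) + (case p of (y, z) \<Rightarrow> K w y z * rs ?R f y * gD z))" for w
    using RQ by (auto simp: fun_eq_iff fD_def gD_def indicator_def)
  have i1: "integrable (\<mu> \<Otimes>\<^sub>M \<mu>) (\<lambda>(y, z). K w y z * fD y * rs ?Q g z)" if "w \<in> ?R" for w
    by (rule rep_integrable[OF t(5,3) ns(1)[OF that]])
  have i2: "integrable (\<mu> \<Otimes>\<^sub>M \<mu>) (\<lambda>(y, z). K w y z * rs ?R f y * gD z)" if "w \<in> ?R" for w
    by (rule rep_integrable[OF t(2,6) ns(2)[OF that]])
  show "integrable (\<mu> \<Otimes>\<^sub>M \<mu>) (?k w)" if "w \<in> ?R" for w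
    unfolding split using i1[OF that] i2[OF that] by (rule Bochner_Integration.integrable_add)
  have rem: "rem x n r f g w = T fD (rs ?Q g) w + T (rs ?R f) gD w" if "w \<in> ?R" for w
    unfolding rem_def split rep[OF t(5,3) ns(1)[OF that]] rep[OF t(2,6) ns(2)[OF that]]
    using i1[OF that] i2[OF that] by (rule Bochner_Integration.integral_add)
  have "AE w in \<mu>. T (\<lambda>x. rs ?R f x + fD x) (rs ?Q g) w = T (rs ?R f) (rs ?Q g) w + T fD (rs ?Q g) w"
    by (rule T_add1) (use t in auto)
  then have 1: "AE w in \<mu>. T (rs ?Q f) (rs ?Q g) w = T (rs ?R f) (rs ?Q g) w + T fD (rs ?Q g) w"
    by (simp add: fD_def)
  have "AE w in \<mu>. T (rs ?R f) (\<lambda>x. rs ?R g x + gD x) w = T (rs ?R f) (rs ?R g) w + T (rs ?R f) gD w"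
    by (rule T_add2) (use t in auto)
  then have 2: "AE w in \<mu>. T (rs ?R f) (rs ?Q g) w = T (rs ?R f) (rs ?R g) w + T (rs ?R f) gD w"
    by (simp add: gD_def)
  show "AE w in \<mu>. w \<in> ?R \<longrightarrow> T (rs ?Q f) (rs ?Q g) w - T (rs ?R f) (rs ?R g) w = rem x n r f g w"
    using 1 2 by eventually_elim (simp add: rem)
qed

text \<open>For \<open>w\<close> in \<open>cs x r\<close> the cosets of \<open>w\<close> and of
  \<open>x\<close> agree at all levels up to \<open>r\<close>, in particular at \<open>i\<close> and
  \<open>i + 1\<close>; hence the shells around \<open>w\<close> are the shells around
  \<open>x\<close>.\<close>

lemma rem_shell:
  assumes nr: "n \<le> r" and "w \<in> cs x r" and yz: "y \<in> cs x n" "z \<in> cs x n" "\<not> (y \<in> cs x r \<and> z \<in> cs x r)"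
  obtains i where "i \<in> {n..<r}" "y \<in> cs x i" "z \<in> cs x i"
    "y \<in> cs w i" "z \<in> cs w i" "y \<notin> cs w (i + 1) \<or> z \<notin> cs w (i + 1)"
proof -
  have "\<exists>i. n \<le> i \<and> i < r \<and> (y \<in> cs x i \<and> z \<in> cs x i) \<and> \<not> (y \<in> cs x (i + 1) \<and> z \<in> cs x (i + 1))"
    using assms by (intro shell_exists) auto
  then obtain i where i: "n \<le> i" "i < r" "y \<in> cs x i" "z \<in> cs x i" "\<not> (y \<in> cs x (i + 1) \<and> z \<in> cs x (i + 1))"
    by blast
  have "cs w i = cs x i" "cs w (i + 1) = cs x (i + 1)"
    using coset_le_eq[OF assms(2)] i by simp_all
  then show ?thesis using that[of i] i by auto
qed

text \<open>One product of averages per shell and no decay. So it serves where only one shell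
  occurs, or where the averages themselves are summable, as for Morrey functions.\<close>

lemma rem_size:
  assumes fg: "f \<in> test" "g \<in> test" and nr: "n \<le> r" and w: "w \<in> cs x r"
  shows "norm (rem x n r f g w) \<le> (\<Sum>i\<in>{n..<r}. C * avg f x i * avg g x i)"
  unfolding rem_def
proof (rule shell_sum_bound[OF fg])
  fix y z
  let ?S = "\<Sum>i\<in>{n..<r}. C / (vol i)\<^sup>2 * ((indicator (cs x i) y * norm (f y)) * (indicator (cs x i) z * norm (g z)))"
  show "norm (case (y, z) of (y, z) \<Rightarrow> K w y z * f y * g z * of_bool (y \<in> cs x n \<and> z \<in> cs x n \<and> \<not> (y \<in> cs x r \<and> z \<in> cs x r))) \<le> ?S"
  proof (cases "y \<in> cs x n \<and> z \<in> cs x n \<and> \<not> (y \<in> cs x r \<and> z \<in> cs x r)")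
    case True
    then obtain i where i: "i \<in> {n..<r}" "y \<in> cs x i" "z \<in> cs x i"
      and s: "y \<in> cs w i" "z \<in> cs w i" "y \<notin> cs w (i + 1) \<or> z \<notin> cs w (i + 1)"
      using rem_shell[OF nr w] by blast
    have "norm (K w y z * f y * g z) \<le> C / (vol i)\<^sup>2 * norm (f y) * norm (g z)"
      unfolding norm_mult by (intro mult_right_mono K_size s norm_ge_zero)
    also have "\<dots> = C / (vol i)\<^sup>2 * ((indicator (cs x i) y * norm (f y)) * (indicator (cs x i) z * norm (g z)))"
      using i by simp
    also have "\<dots> \<le> ?S"
      using i(1) C_pos by (intro member_le_sum[of i]) auto
    finally show ?thesis using True by simp
  next
    case False
    then show ?thesis using C_pos by (auto intro!: sum_nonneg)
  qed
qed

text \<open>Regularity in the first variable replaces the size estimate. The factor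
  \<open>\<rho> ^ (r - i)\<close> makes the shell sum geometric, so bounded averages suffice,
  however many levels lie between \<open>n\<close> and \<open>r\<close>.\<close>

lemma rem_osc:
  assumes fg: "f \<in> test" "g \<in> test" and nr: "n \<le> r" and w: "w \<in> cs x r" "w' \<in> cs x r"
  shows "norm (rem x n r f g w - rem x n r f g w') \<le> (\<Sum>i\<in>{n..<r}. C * \<rho> ^ nat (r - i) * avg f x i * avg g x i)"
proof -
  let ?o = "\<lambda>y z. y \<in> cs x n \<and> z \<in> cs x n \<and> \<not> (y \<in> cs x r \<and> z \<in> cs x r)"
  have eq: "rem x n r f g w - rem x n r f g w' =
     (\<integral>p. (case p of (y, z) \<Rightarrow> K w y z * f y * g z * of_bool (?o y z)) -
          (case p of (y, z) \<Rightarrow> K w' y z * f y * g z * of_bool (?o y z)) \<partial>(\<mu> \<Otimes>\<^sub>M \<mu>))"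
    unfolding rem_def
    using rem_rep(2)[OF fg nr w(1)] rem_rep(2)[OF fg nr w(2)] by (rule Bochner_Integration.integral_diff[symmetric])
  show ?thesis unfolding eq
  proof (rule shell_sum_bound[OF fg])
    fix y z
    let ?S = "\<Sum>i\<in>{n..<r}. C * \<rho> ^ nat (r - i) / (vol i)\<^sup>2 * ((indicator (cs x i) y * norm (f y)) * (indicator (cs x i) z * norm (g z)))"
    show "norm ((case (y, z) of (y, z) \<Rightarrow> K w y z * f y * g z * of_bool (?o y z)) -
      (case (y, z) of (y, z) \<Rightarrow> K w' y z * f y * g z * of_bool (?o y z))) \<le> ?S"
    proof (cases "?o y z")
      case True
      then obtain i where i: "i \<in> {n..<r}" "y \<in> cs x i" "z \<in> cs x i"
        and s: "y \<in> cs w i" "z \<in> cs w i" "y \<notin> cs w (i + 1) \<or> z \<notin> cs w (i + 1)"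
        using rem_shell[OF nr w(1)] by blast
      have "w' \<in> cs w r" using w coset_eq by blast
      then have "norm ((K w y z - K w' y z) * f y * g z) \<le> C * \<rho> ^ nat (r - i) / (vol i)\<^sup>2 * norm (f y) * norm (g z)"
        unfolding norm_mult using i(1) by (intro mult_right_mono K_reg0 s norm_ge_zero) auto
      also have "\<dots> = C * \<rho> ^ nat (r - i) / (vol i)\<^sup>2 * ((indicator (cs x i) y * norm (f y)) * (indicator (cs x i) z * norm (g z)))"
        using i by simp
      also have "\<dots> \<le> ?S"
        using i(1) C_pos \<rho>_pos by (intro member_le_sum[of i]) auto
      finally show ?thesis using True by (simp add: algebra_simps)
    next
      case False
      then show ?thesis using C_pos \<rho>_pos by (auto intro!: sum_nonneg)
    qed
  qed
qed

end

section \<open>A local weak type estimate\<close>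

context vilenkin_haar begin

text \<open>The codomain is general because averages are taken both of complex arguments of the
  operator and of the real functions with which the sparse majorant is paired.\<close>

definition locint :: "('a \<Rightarrow> 'b::{banach, second_countable_topology}) \<Rightarrow> bool" where
  "locint f \<longleftrightarrow> f \<in> borel_measurable \<mu> \<and> (\<forall>x k. integrable \<mu> (\<lambda>y. indicator (cs x k) y * norm (f y)))"

lemma locint_integrable: "locint f \<Longrightarrow> integrable \<mu> (\<lambda>y. indicator (cs x k) y * norm (f y))"
  by (simp add: locint_def)

lemma test_locint: "f \<in> test \<Longrightarrow> locint f"
  unfolding locint_def using test_measurable avg_integrable by blast

lemma bounded_locint:
  assumes [measurable]: "f \<in> borel_measurable \<mu>" and "\<And>x. norm (f x) \<le> F"
  shows "locint f"
  unfolding locint_def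
proof (intro conjI allI assms(1))
  fix x k
  show "integrable \<mu> (\<lambda>y. indicator (cs x k) y * norm (f y))"
  proof (rule integrable_bounded[of _ F x k])
    show "norm (indicator (cs x k) y * norm (f y)) \<le> F" for y
      using assms(2)[of y] norm_ge_zero[of "f y"] by (auto simp: indicator_def split: if_splits intro: order_trans[of 0 "norm (f y)"])
  qed auto
qed

lemma nn_avg:
  assumes "locint f"
  shows "(\<integral>\<^sup>+y. ennreal (norm (f y)) * indicator (cs x k) y \<partial>\<mu>) = ennreal (vol k * avg f x k)"
proof -
  have "(\<integral>\<^sup>+y. ennreal (norm (f y)) * indicator (cs x k) y \<partial>\<mu>) = (\<integral>\<^sup>+y. ennreal (indicator (cs x k) y * norm (f y)) \<partial>\<mu>)"
    by (rule nn_integral_cong) (simp add: indicator_def)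
  also have "\<dots> = ennreal (\<integral>y. indicator (cs x k) y * norm (f y) \<partial>\<mu>)"
    by (rule nn_integral_eq_integral[OF locint_integrable[OF assms]]) simp
  finally show ?thesis by (simp add: vol_avg)
qed

lemma avg_le_parent:
  assumes "locint f" "j \<le> k"
  shows "vol k * avg f x k \<le> vol j * avg f x j"
  unfolding vol_avg
proof (rule integral_mono[OF locint_integrable[OF assms(1)] locint_integrable[OF assms(1)]])
  fix y
  have "indicator (cs x k) y \<le> (indicator (cs x j) y :: real)"
    using coset_mono[OF assms(2), of x] by (auto simp: indicator_def)
  then show "indicator (cs x k) y * norm (f y) \<le> indicator (cs x j) y * norm (f y)"
    by (rule mult_right_mono) simp
qed

text \<open>Passing from a coset to one of the next level divides the volume by at most
  \<open>B\<close>. This keeps the good part of a decomposition bounded on the stopping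
  cosets.\<close>

lemma avg_le_B:
  assumes "locint f"
  shows "avg f x (k + 1) \<le> B * avg f x k"
proof -
  have "vol (k + 1) * avg f x (k + 1) \<le> vol k * avg f x k" by (rule avg_le_parent[OF assms]) simp
  also have "\<dots> \<le> (B * vol (k + 1)) * avg f x k" by (intro mult_right_mono vol_le avg_nonneg)
  finally show ?thesis using vol_pos[of "k + 1"] by (simp add: mult.assoc mult.left_commute)
qed

lemma avg_bounded:
  fixes f :: "'a \<Rightarrow> 'b::{banach, second_countable_topology}"
  assumes "f \<in> borel_measurable \<mu>" "\<And>x. norm (f x) \<le> F"
  shows "avg f x k \<le> F"
proof -
  have "vol k * avg f x k \<le> (\<integral>y. indicator (cs x k) y * F \<partial>\<mu>)"
    unfolding vol_avg
    by (intro integral_mono locint_integrable bounded_locint[OF assms] mult_left_mono assms(2))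
       (auto simp: emeasure_coset)
  also have "\<dots> = vol k * F" by (simp add: measure_coset)
  finally show ?thesis using vol_pos[of k] by simp
qed

lemma avg_const:
  assumes "\<And>y. y \<in> cs x k \<Longrightarrow> f y = f x"
  shows "avg f x k = norm (f x)"
proof -
  have "(\<lambda>y. indicator (cs x k) y * norm (f y)) = (\<lambda>y. indicator (cs x k) y * norm (f x))"
  proof
    fix y show "indicator (cs x k) y * norm (f y) = indicator (cs x k) y * norm (f x)"
      by (cases "y \<in> cs x k") (simp_all add: assms[of y])
  qed
  then have "vol k * avg f x k = vol k * norm (f x)" unfolding vol_avg by (simp add: measure_coset)
  then show ?thesis using vol_pos[of k] by simp
qed

lemma avg_rs: assumes "n \<le> k" "x \<in> cs z n" shows "avg (rs (cs z n) f) x k = avg f x k"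
proof -
  have "cs x k \<subseteq> cs z n" using assms(2,1) by (rule coset_nested')
  then have z: "y \<in> cs x k \<Longrightarrow> y \<in> cs z n" for y by blast
  have eq: "(\<lambda>y. indicator (cs x k) y * norm (rs (cs z n) f y)) = (\<lambda>y. indicator (cs x k) y * norm (f y))"
  proof
    fix y show "indicator (cs x k) y * norm (rs (cs z n) f y) = indicator (cs x k) y * norm (f y)"
      by (cases "y \<in> cs x k") (simp_all add: z)
  qed
  show ?thesis unfolding avg_def eq ..
qed

end

section \<open>The operator on functions of mean zero\<close>

context czo begin

text \<open>The vanishing mean of \<open>b\<close> lets the regularity of \<open>K x y w\<close> in \<open>y\<close> act; summing over the
  shells around \<open>x\<close> costs only the maximal average \<open>H\<close> of \<open>h\<close>.\<close>

lemma T_mean_zero_decay: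
  assumes b: "b \<in> test" "\<And>y. y \<notin> cs z k \<Longrightarrow> b y = 0" "(\<integral>y. b y \<partial>\<mu>) = 0"
    and h: "h \<in> test" "\<And>w. w \<notin> cs x n \<Longrightarrow> h w = 0"
    and x: "x \<in> cs z j" "x \<notin> cs z (j + 1)" "j < k" "n \<le> j"
    and H: "0 \<le> H" "\<And>i. n \<le> i \<Longrightarrow> avg h x i \<le> H"
  shows "norm (T b h x) \<le> C / (1 - \<rho>) * H * (\<integral>y. norm (b y) \<partial>\<mu>) * \<rho> ^ nat (k - 1 - j) / vol j"
proof -
  have xP: "x \<notin> cs z k" using x(2,3) coset_mono[of "j + 1" k z] by auto
  have "supp b \<subseteq> cs z k" using supp_subset_iff[OF closed_coset, of b z k] b(2) by blast
  then have ns: "x \<notin> supp b \<inter> supp h" using xP by blast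
  define Nb where "Nb = (\<integral>y. norm (b y) \<partial>\<mu>)"
  have ib: "integrable \<mu> b" by (rule test_integrable[OF b(1)])
  define \<beta> where "\<beta> m = C * \<rho> ^ nat (k - m) / (vol m)\<^sup>2" for m
  have \<beta>0: "0 \<le> \<beta> m" for m using C_pos \<rho>_pos by (simp add: \<beta>_def)
  \<comment> \<open>The coset of \<open>x\<close> at level \<open>j\<close> is the last one that
    contains the support of \<open>b\<close>. So shells around \<open>x\<close> are counted only up
    to \<open>j\<close>, and every \<open>w\<close> in \<open>cs x j\<close>, however close to
    \<open>x\<close>, belongs to the last one: there the first kernel variable \<open>y\<close>
    alone fixes the shell.\<close>
  define g where "g w = (\<Sum>m\<in>{n..<j+1}. \<beta> m * (indicator (cs x m) w * norm (h w)))" for w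
  have yj: "y \<in> cs x j" "y \<notin> cs x (j + 1)" if "y \<in> cs z k" for y
  proof -
    have "y \<in> cs z (j + 1)" "y \<in> cs z j" using that coset_mono[of "j + 1" k z] coset_mono[of j k z] x(3) by auto
    then show "y \<in> cs x j" "y \<notin> cs x (j + 1)" using coset_eq x(1,2) coset_sym by blast+
  qed
  have inner: "norm (\<integral>y. K x y w * b y * h w \<partial>\<mu>) \<le> g w * Nb" for w
  proof (cases "h w = 0 \<or> \<not> integrable \<mu> (\<lambda>y. K x y w * b y * h w)")
    case True
    then have "(\<integral>y. K x y w * b y * h w \<partial>\<mu>) = 0"
    proof
      assume "\<not> integrable \<mu> (\<lambda>y. K x y w * b y * h w)"
      then show ?thesis by (rule not_integrable_integral_eq)
    qed simp
    moreover have "0 \<le> g w * Nb"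
      unfolding g_def Nb_def by (intro mult_nonneg_nonneg sum_nonneg \<beta>0 integral_nonneg_AE) auto
    ultimately show ?thesis by (simp only: norm_zero)
  next
    case False
    then have w: "w \<in> cs x n" and i1: "integrable \<mu> (\<lambda>y. K x y w * b y * h w)" using h(2)[of w] by auto
    obtain m where m: "m \<in> {n..<j+1}" "w \<in> cs x m" "m = j \<or> w \<notin> cs x (m + 1)"
    proof (cases "w \<in> cs x j")
      case True then show ?thesis using that[of j] x(4) by simp
    next
      case False
      then have "\<exists>m. n \<le> m \<and> m < j \<and> w \<in> cs x m \<and> w \<notin> cs x (m + 1)"
        using w x(4) by (intro shell_exists[of "\<lambda>i. w \<in> cs x i"])
      then obtain m where "n \<le> m" "m < j" "w \<in> cs x m" "w \<notin> cs x (m + 1)" by blast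
      then show ?thesis using that[of m] by simp
    qed
    have diff: "norm (K x y w - K x z w) \<le> \<beta> m" if y: "y \<in> cs z k" for y
    proof -
      have "z \<in> cs x m" using yj(1)[of z] coset_mono[of m j x] m(1) by auto
      moreover have "z \<notin> cs x (m + 1) \<or> w \<notin> cs x (m + 1)" using yj(2)[of z] m(3) by auto
      ultimately have "norm (K x z w - K x y w) \<le> \<beta> m"
        unfolding \<beta>_def using m x(3) y by (intro K_reg1) auto
      then show ?thesis by (simp add: norm_minus_commute)
    qed
    have i2: "integrable \<mu> (\<lambda>y. K x z w * b y * h w)"
      using integrable_mult_right[OF ib, of "K x z w * h w"] by (simp add: ac_simps)
    have "(\<integral>y. K x z w * b y * h w \<partial>\<mu>) = (\<integral>y. (K x z w * h w) * b y \<partial>\<mu>)" by (simp add: ac_simps)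
    then have "(\<integral>y. K x z w * b y * h w \<partial>\<mu>) = 0" using b(3) by simp
    then have "(\<integral>y. K x y w * b y * h w \<partial>\<mu>) = (\<integral>y. K x y w * b y * h w - K x z w * b y * h w \<partial>\<mu>)"
      using Bochner_Integration.integral_diff[OF i1 i2] by simp
    also have "norm \<dots> \<le> (\<integral>y. (\<beta> m * norm (h w)) * norm (b y) \<partial>\<mu>)"
    proof (rule norm_integral_le)
      show "integrable \<mu> (\<lambda>y. (\<beta> m * norm (h w)) * norm (b y))" using ib by simp
      fix y
      show "norm (K x y w * b y * h w - K x z w * b y * h w) \<le> (\<beta> m * norm (h w)) * norm (b y)"
      proof (cases "y \<in> cs z k")
        case True
        have "norm ((K x y w - K x z w) * (h w * b y)) \<le> \<beta> m * norm (h w * b y)"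
          unfolding norm_mult[of "K x y w - K x z w"] by (intro mult_right_mono diff True norm_ge_zero)
        then show ?thesis by (simp add: algebra_simps norm_mult)
      qed (simp add: b(2))
    qed
    also have "\<dots> = \<beta> m * (indicator (cs x m) w * norm (h w)) * Nb" using m(2) by (simp add: Nb_def)
    also have "\<dots> \<le> g w * Nb" unfolding g_def
    proof (intro mult_right_mono member_le_sum)
      show "0 \<le> Nb" unfolding Nb_def by (intro integral_nonneg_AE) auto
    qed (use m \<beta>0 in auto)
    finally show ?thesis .
  qed
  have ig: "integrable \<mu> g" unfolding g_def
    by (intro Bochner_Integration.integrable_sum integrable_mult_right locint_integrable test_locint h(1))
  have "T b h x = (\<integral>w. (\<integral>y. K x y w * b y * h w \<partial>\<mu>) \<partial>\<mu>)"
    unfolding rep[OF b(1) h(1) ns] using pair.integral_snd[OF rep_integrable[OF b(1) h(1) ns]] by simp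
  then have "norm (T b h x) \<le> (\<integral>w. g w * Nb \<partial>\<mu>)"
    using norm_integral_le[OF integrable_mult_left[OF ig, of Nb] inner] by simp
  also have "(\<integral>w. g w * Nb \<partial>\<mu>) = Nb * integral\<^sup>L \<mu> g" by simp
  also have "integral\<^sup>L \<mu> g = (\<Sum>m\<in>{n..<j+1}. \<beta> m * (vol m * avg h x m))"
    unfolding g_def vol_avg
    by (subst Bochner_Integration.integral_sum) (intro integrable_mult_right locint_integrable test_locint h(1), simp)
  also have "(\<Sum>m\<in>{n..<j+1}. \<beta> m * (vol m * avg h x m)) \<le> (\<Sum>m\<in>{n..<j+1}. C * H * \<rho> ^ nat (k - 1 - j) / vol j * \<rho> ^ nat (j + 1 - m))"
  proof (rule sum_mono)
    fix m assume m: "m \<in> {n..<j+1}"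
    \<comment> \<open>The first factor is the decay in the position of \<open>x\<close> and leaves
      the sum; the second, with positive exponents, is summed over the shells as a geometric
      series.\<close>
    have "nat (k - m) = nat (k - 1 - j) + nat (j + 1 - m)" using m x(3) by auto
    then have p: "\<rho> ^ nat (k - m) = \<rho> ^ nat (k - 1 - j) * \<rho> ^ nat (j + 1 - m)" by (simp add: power_add)
    have "\<beta> m * (vol m * avg h x m) = C * \<rho> ^ nat (k - m) * avg h x m / vol m"
      using vol_pos[of m] by (simp add: \<beta>_def power2_eq_square)
    also have "\<dots> \<le> C * \<rho> ^ nat (k - m) * H / vol j"
      using C_pos \<rho>_pos m H vol_mono[of m j] by (intro frac_le mult_left_mono mult_nonneg_nonneg vol_pos) auto
    finally show "\<beta> m * (vol m * avg h x m) \<le> C * H * \<rho> ^ nat (k - 1 - j) / vol j * \<rho> ^ nat (j + 1 - m)"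
      by (simp add: p mult_ac)
  qed
  also have "\<dots> = C * H * \<rho> ^ nat (k - 1 - j) / vol j * (\<Sum>m\<in>{n..<j+1}. \<rho> ^ nat (j + 1 - m))"
    by (simp add: sum_distrib_left)
  also have "\<dots> \<le> C * H * \<rho> ^ nat (k - 1 - j) / vol j * (1 / (1 - \<rho>))"
    using C_pos H \<rho>_pos by (intro mult_left_mono sum_powers_le \<rho>_less) (auto simp: vol_nonneg)
  finally have "norm (T b h x) \<le> Nb * (C * H * \<rho> ^ nat (k - 1 - j) / vol j * (1 / (1 - \<rho>)))"
    by (simp add: mult_left_mono Nb_def integral_nonneg_AE)
  then show ?thesis by (simp add: Nb_def mult_ac)
qed

text \<open>One factor \<open>1 / (1 - \<rho>)\<close> sums the shells around \<open>x\<close>, the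
  other sums the shells around the support of \<open>b\<close> in which \<open>x\<close> may lie,
  and \<open>1 / \<rho>\<close> shifts the exponent \<open>k - 1 - j\<close> to
  \<open>k - j\<close>.\<close>

definition Dc :: real where "Dc = C / ((1 - \<rho>) * \<rho> * (1 - \<rho>))"

lemma Dc_pos: "0 < Dc"
  unfolding Dc_def using C_pos \<rho>_pos \<rho>_less by simp

text \<open>On the shell \<open>j\<close> around \<open>z\<close> the pointwise bound is a multiple
  of \<open>\<rho> ^ (k - 1 - j) / vol j\<close>. Integration over \<open>cs z j\<close> removes
  \<open>vol j\<close>, and a geometric series remains.\<close>

lemma T_mean_zero_integral:
  assumes b: "b \<in> test" "\<And>y. y \<notin> cs z k \<Longrightarrow> b y = 0" "(\<integral>y. b y \<partial>\<mu>) = 0"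
    and h: "h \<in> test" "\<And>w. w \<notin> cs z n \<Longrightarrow> h w = 0"
    and E: "E \<in> sets borel" "E \<subseteq> cs z n" "E \<inter> cs z k = {}" "n \<le> k"
    and H: "0 \<le> H" "\<And>x i. x \<in> E \<Longrightarrow> n \<le> i \<Longrightarrow> avg h x i \<le> H"
  shows "(\<integral>\<^sup>+x. ennreal (norm (T b h x)) * indicator E x \<partial>\<mu>) \<le> ennreal (Dc * H * (\<integral>y. norm (b y) \<partial>\<mu>))"
proof -
  define Nb where "Nb = (\<integral>y. norm (b y) \<partial>\<mu>)"
  have Nb: "0 \<le> Nb" unfolding Nb_def by (intro integral_nonneg_AE) auto
  define c where "c j = C / (1 - \<rho>) * H * Nb * \<rho> ^ nat (k - 1 - j) / vol j" for j
  have c: "0 \<le> c j" for j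
    unfolding c_def using C_pos \<rho>_pos \<rho>_less H Nb by (intro mult_nonneg_nonneg divide_nonneg_nonneg) (auto simp: vol_nonneg)
  have "(\<integral>\<^sup>+x. ennreal (norm (T b h x)) * indicator E x \<partial>\<mu>) \<le> (\<integral>\<^sup>+x. (\<Sum>j\<in>{n..<k}. ennreal (c j) * indicator (cs z j) x) \<partial>\<mu>)"
  proof (rule nn_integral_mono)
    fix x
    show "ennreal (norm (T b h x)) * indicator E x \<le> (\<Sum>j\<in>{n..<k}. ennreal (c j) * indicator (cs z j) x)"
    proof (cases "x \<in> E")
      case True
      then have "x \<in> cs z n" "x \<notin> cs z k" using E by auto
      then have "\<exists>j. n \<le> j \<and> j < k \<and> x \<in> cs z j \<and> x \<notin> cs z (j + 1)"
        by (intro shell_exists[of "\<lambda>i. x \<in> cs z i"] E(4))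
      then obtain j where j: "n \<le> j" "j < k" "x \<in> cs z j" "x \<notin> cs z (j + 1)" by blast
      have "cs x n = cs z n" using coset_eq \<open>x \<in> cs z n\<close> by blast
      then have "norm (T b h x) \<le> c j"
        unfolding c_def Nb_def using j h True H by (intro T_mean_zero_decay b) auto
      then have "ennreal (norm (T b h x)) * indicator E x \<le> ennreal (c j) * indicator (cs z j) x"
        using True j(3) by (simp add: ennreal_leI)
      also have "\<dots> \<le> (\<Sum>j\<in>{n..<k}. ennreal (c j) * indicator (cs z j) x)"
        using j by (intro member_le_sum) auto
      finally show ?thesis .
    qed simp
  qed
  also have "\<dots> = (\<Sum>j\<in>{n..<k}. ennreal (c j * vol j))"
    by (subst nn_integral_sum) (simp_all add: nn_integral_cmult emeasure_coset ennreal_mult c vol_nonneg)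
  also have "\<dots> = ennreal (\<Sum>j\<in>{n..<k}. c j * vol j)"
    by (rule sum_ennreal) (simp add: c vol_nonneg)
  also have "(\<Sum>j\<in>{n..<k}. c j * vol j) = (\<Sum>j\<in>{n..<k}. C / (1 - \<rho>) * H * Nb / \<rho> * \<rho> ^ nat (k - j))"
  proof (rule sum.cong[OF refl])
    fix j assume j: "j \<in> {n..<k}"
    have "nat (k - j) = Suc (nat (k - 1 - j))" using j by auto
    then show "c j * vol j = C / (1 - \<rho>) * H * Nb / \<rho> * \<rho> ^ nat (k - j)"
      using vol_pos[of j] \<rho>_pos by (simp add: c_def)
  qed
  also have "\<dots> = C / (1 - \<rho>) * H * Nb / \<rho> * (\<Sum>j\<in>{n..<k}. \<rho> ^ nat (k - j))"
    by (simp add: sum_distrib_left)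
  also have "ennreal \<dots> \<le> ennreal (C / (1 - \<rho>) * H * Nb / \<rho> * (1 / (1 - \<rho>)))"
    using C_pos \<rho>_pos \<rho>_less H Nb by (intro ennreal_leI mult_left_mono sum_powers_le) auto
  also have "C / (1 - \<rho>) * H * Nb / \<rho> * (1 / (1 - \<rho>)) = Dc * H * Nb" by (simp add: Dc_def field_simps)
  finally show ?thesis unfolding Nb_def .
qed

end

section \<open>Calderon-Zygmund decomposition and distribution inequalities\<close>

context vilenkin_haar begin

lemma sum_pieces:
  fixes c :: "'a set \<Rightarrow> 'b::semiring_1"
  assumes "adapted \<kappa> \<Omega>" "finite (pieces \<kappa> \<Omega>)"
  shows "(\<Sum>P\<in>pieces \<kappa> \<Omega>. indicator P x * c P) = (if x \<in> \<Omega> then c (cs x (\<kappa> x)) else 0)"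
proof (cases "x \<in> \<Omega>")
  case True
  let ?P = "cs x (\<kappa> x)"
  have P: "?P \<in> pieces \<kappa> \<Omega>" unfolding pieces_def using True by (rule imageI)
  have "(\<Sum>P\<in>pieces \<kappa> \<Omega> - {?P}. indicator P x * c P) = 0"
  proof (rule sum.neutral, rule ballI)
    fix P' assume "P' \<in> pieces \<kappa> \<Omega> - {?P}"
    then have "P' \<inter> ?P = {}" using disjoint_pieces[OF assms(1) _ P] by blast
    then have "x \<notin> P'" using mem_coset_self by blast
    then show "indicator P' x * c P' = 0" by simp
  qed
  then show ?thesis using sum.remove[OF assms(2) P, of "\<lambda>P. indicator P x * c P"] True by simp
next
  case False
  have "x \<notin> P" if "P \<in> pieces \<kappa> \<Omega>" for P using that Union_pieces[OF assms(1)] False by blast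
  then show ?thesis using False by (simp add: sum.neutral)
qed

lemma test_sum:
  "finite F \<Longrightarrow> (\<And>P. P \<in> F \<Longrightarrow> b P \<in> test) \<Longrightarrow> (\<lambda>x. \<Sum>P\<in>F. b P x) \<in> test"
proof (induction F rule: finite_induct)
  case (insert P F)
  then show ?case using test_add[of "b P" "\<lambda>x. \<Sum>P\<in>F. b P x"] by simp
qed (simp add: test_zero)

text \<open>The bad parts \<open>b P\<close> are finitely many because a test function is constant on the cosets of some level \<open>l\<close>,
  so that only levels up to \<open>l\<close> need to be considered.\<close>

lemma cz_decomposition:
  assumes f: "f \<in> test" "\<And>x. x \<notin> cs z n \<Longrightarrow> f x = 0" and s: "1 \<le> s"
  obtains g F b \<Omega> where
    "g \<in> test" "\<And>x. x \<notin> cs z n \<Longrightarrow> g x = 0" "\<And>x. norm (g x) \<le> B * s * avg f z n"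
    "\<And>x. f x = g x + (\<Sum>P\<in>F. b P x)"
    "finite F" "\<And>P. P \<in> F \<Longrightarrow> b P \<in> test"
    "\<And>P. P \<in> F \<Longrightarrow> \<exists>y k. n \<le> k \<and> P = cs y k \<and> P \<subseteq> \<Omega> \<and> y \<in> cs z n"
    "\<And>P x. P \<in> F \<Longrightarrow> x \<notin> P \<Longrightarrow> b P x = 0" "\<And>P. P \<in> F \<Longrightarrow> (\<integral>x. b P x \<partial>\<mu>) = 0"
    "(\<Sum>P\<in>F. \<integral>x. norm (b P x) \<partial>\<mu>) \<le> 2 * vol n * avg f z n"
    "\<Omega> \<in> sets borel" "emeasure \<mu> \<Omega> \<le> ennreal (vol n / s)"
    "\<And>x i. x \<in> cs z n - \<Omega> \<Longrightarrow> n \<le> i \<Longrightarrow> avg f x i \<le> s * avg f z n"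
proof -
  define a where "a = avg f z n"
  have a0: "0 \<le> a" by (simp add: a_def avg_nonneg)
  have asa: "a \<le> s * a" using s a0 mult_right_mono[of 1 s a] by simp
  obtain l where l: "n + 1 \<le> l" "\<And>x y. y \<in> cs x l \<Longrightarrow> f y = f x" by (rule test_const[OF f(1)]) blast
  have li: "locint f" by (rule test_locint[OF f(1)])
  define \<Phi> where "\<Phi> x k \<longleftrightarrow> k \<le> l \<and> s * a < avg f x k" for x k
  define \<Omega> where "\<Omega> = {x \<in> cs z n. \<exists>k>n. \<Phi> x k}"
  have inv: "\<Phi> y k" if "\<Phi> x k" "y \<in> cs x k" for x y k
    using that avg_coset[OF that(2), of f] by (simp add: \<Phi>_def)
  obtain \<kappa> where \<kappa>: "adapted \<kappa> \<Omega>" "\<And>x. x \<in> \<Omega> \<Longrightarrow> n < \<kappa> x" "\<And>x. x \<in> \<Omega> \<Longrightarrow> \<Phi> x (\<kappa> x)"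
    "\<And>x j. x \<in> \<Omega> \<Longrightarrow> n < j \<Longrightarrow> j < \<kappa> x \<Longrightarrow> \<not> \<Phi> x j"
    by (rule stopping[OF inv \<Omega>_def]) blast+
  have OQ: "x \<in> cs z n" if "x \<in> \<Omega>" for x using that by (simp add: \<Omega>_def)
  define F where "F = pieces \<kappa> \<Omega>"
  have fin: "finite F"
  proof (rule finite_subset)
    show "F \<subseteq> (\<Union>k\<in>{n<..l}. {cs x k | x. x \<in> cs z n})"
    proof
      fix P assume "P \<in> F"
      then obtain x where x: "x \<in> \<Omega>" "P = cs x (\<kappa> x)" unfolding F_def pieces_def by blast
      then have "\<kappa> x \<in> {n<..l}" using \<kappa>(2,3)[of x] by (simp add: \<Phi>_def)
      then show "P \<in> (\<Union>k\<in>{n<..l}. {cs x k | x. x \<in> cs z n})" using x OQ by blast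
    qed
  qed (intro finite_UN_I finite_cosets, simp)
  have FP: "\<exists>x. x \<in> \<Omega> \<and> P = cs x (\<kappa> x)" if "P \<in> F" for P using that unfolding F_def pieces_def by blast
  have PO: "P \<subseteq> \<Omega>" if "P \<in> F" for P using that Union_pieces[OF \<kappa>(1)] unfolding F_def by blast
  define m where "m P = (\<integral>y. indicator P y * f y \<partial>\<mu>) / of_real (measure \<mu> P)" for P
  define b where "b P x = indicator P x * (f x - m P)" for P x
  have m_le: "norm (m (cs x k)) \<le> avg f x k" for x k
  proof -
    have "norm (\<integral>y. indicator (cs x k) y * f y \<partial>\<mu>) \<le> (\<integral>y. indicator (cs x k) y * norm (f y) \<partial>\<mu>)"
      by (rule norm_integral_le[OF locint_integrable[OF li]]) (simp add: norm_mult indicator_def)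
    then show ?thesis unfolding m_def avg_def by (simp add: norm_divide measure_coset vol_nonneg divide_right_mono)
  qed
  have b_eq: "b P = (\<lambda>x. indicator P x * f x - m P * indicator P x)" for P
    by (auto simp: b_def fun_eq_iff algebra_simps)
  have bt: "b P \<in> test" if "P \<in> F" for P
    using FP[OF that] unfolding b_eq by (auto intro!: test_diff test_rs test_scale test_indicator f(1))
  have b0: "b P x = 0" if "x \<notin> P" for P x using that by (simp add: b_def)
  have bint: "(\<integral>x. b P x \<partial>\<mu>) = 0" if "P \<in> F" for P
  proof -
    obtain x where P: "P = cs x (\<kappa> x)" using FP[OF \<open>P \<in> F\<close>] by blast
    have i: "integrable \<mu> (\<lambda>x. indicator P x * f x)" "integrable \<mu> (\<lambda>x. m P * indicator P x)"
      unfolding P by (intro test_integrable test_rs test_scale test_indicator f(1))+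
    have "(\<integral>x. b P x \<partial>\<mu>) = (\<integral>x. indicator P x * f x \<partial>\<mu>) - m P * (\<integral>x. indicator P x \<partial>\<mu>)"
      unfolding b_eq by (subst Bochner_Integration.integral_diff[OF i]) simp
    also have "(\<integral>x. indicator P x \<partial>\<mu>) = (\<integral>x. complex_of_real (indicator P x) \<partial>\<mu>)"
      by (intro Bochner_Integration.integral_cong) (simp_all add: indicator_def)
    also have "\<dots> = of_real (\<integral>x. indicator P x \<partial>\<mu>)" by (rule integral_complex_of_real)
    also have "(\<integral>x. indicator P x \<partial>\<mu>) = measure \<mu> P" by simp
    also have "measure \<mu> P \<noteq> 0" unfolding P measure_coset using vol_pos[of "\<kappa> x"] by simp
    then have "m P * of_real (measure \<mu> P) = (\<integral>x. indicator P x * f x \<partial>\<mu>)" by (simp add: m_def)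
    finally show ?thesis by simp
  qed
  have bn: "(\<integral>x. norm (b P x) \<partial>\<mu>) \<le> (\<integral>x. indicator P x * (2 * norm (f x)) \<partial>\<mu>)" if "P \<in> F" for P
  proof -
    obtain x where P: "P = cs x (\<kappa> x)" using FP[OF \<open>P \<in> F\<close>] by blast
    have i: "integrable \<mu> (\<lambda>x. indicator P x * norm (f x))" "integrable \<mu> (\<lambda>x. indicator P x * norm (m P))"
      unfolding P by (intro locint_integrable li) (simp add: emeasure_coset)
    have "(\<integral>x. norm (b P x) \<partial>\<mu>) \<le> (\<integral>x. indicator P x * norm (f x) + indicator P x * norm (m P) \<partial>\<mu>)"
    proof (rule integral_mono)
      show "integrable \<mu> (\<lambda>x. norm (b P x))" by (intro integrable_norm test_integrable bt that)
      show "norm (b P x) \<le> indicator P x * norm (f x) + indicator P x * norm (m P)" for x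
        by (cases "x \<in> P") (simp_all add: b_def norm_triangle_ineq4)
    qed (rule Bochner_Integration.integrable_add[OF i])
    also have "\<dots> = (\<integral>x. indicator P x * norm (f x) \<partial>\<mu>) + measure \<mu> P * norm (m P)"
      by (subst Bochner_Integration.integral_add[OF i]) simp
    also have "measure \<mu> P * norm (m P) \<le> (\<integral>x. indicator P x * norm (f x) \<partial>\<mu>)"
      unfolding P measure_coset vol_avg[symmetric] by (intro mult_left_mono m_le vol_nonneg)
    also have "(\<integral>x. indicator P x * norm (f x) \<partial>\<mu>) + (\<integral>x. indicator P x * norm (f x) \<partial>\<mu>) = (\<integral>x. indicator P x * (2 * norm (f x)) \<partial>\<mu>)"
      by (simp add: mult.left_commute[of _ 2])
    finally show ?thesis by simp
  qed
  have sum_b: "(\<Sum>P\<in>F. \<integral>x. norm (b P x) \<partial>\<mu>) \<le> 2 * vol n * a"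
  proof -
    have i: "integrable \<mu> (\<lambda>x. indicator P x * (2 * norm (f x)))" if "P \<in> F" for P
      using FP[OF that] integrable_mult_right[OF locint_integrable[OF li], of 2] by (auto simp: mult.left_commute)
    have "(\<Sum>P\<in>F. \<integral>x. norm (b P x) \<partial>\<mu>) \<le> (\<Sum>P\<in>F. \<integral>x. indicator P x * (2 * norm (f x)) \<partial>\<mu>)"
      by (rule sum_mono[OF bn])
    also have "\<dots> = (\<integral>x. (\<Sum>P\<in>F. indicator P x * (2 * norm (f x))) \<partial>\<mu>)"
      by (rule Bochner_Integration.integral_sum[symmetric, OF i])
    also have "\<dots> \<le> (\<integral>x. 2 * (indicator (cs z n) x * norm (f x)) \<partial>\<mu>)"
    proof (rule integral_mono)
      show "integrable \<mu> (\<lambda>x. \<Sum>P\<in>F. indicator P x * (2 * norm (f x)))"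
        by (rule Bochner_Integration.integrable_sum[OF i])
      show "integrable \<mu> (\<lambda>x. 2 * (indicator (cs z n) x * norm (f x)))"
        by (intro integrable_mult_right locint_integrable li)
      show "(\<Sum>P\<in>F. indicator P x * (2 * norm (f x))) \<le> 2 * (indicator (cs z n) x * norm (f x))" for x
        using sum_pieces[OF \<kappa>(1) fin[unfolded F_def], of x "\<lambda>_. 2 * norm (f x)"] OQ[of x] unfolding F_def by auto
    qed
    finally show ?thesis by (simp add: vol_avg[symmetric] a_def)
  qed
  define g where "g x = f x - (\<Sum>P\<in>F. b P x)" for x
  have g_eq: "g x = (if x \<in> \<Omega> then m (cs x (\<kappa> x)) else f x)" for x
    using sum_pieces[OF \<kappa>(1) fin[unfolded F_def], of x "\<lambda>P. f x - m P"] unfolding g_def b_def F_def by simp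
  have small: "avg f x i \<le> s * a" if "x \<in> cs z n" "n \<le> i" "\<And>k. n < k \<Longrightarrow> k \<le> i \<Longrightarrow> \<not> \<Phi> x k" "i \<le> l" for x i
  proof (cases "i = n")
    case True then show ?thesis using avg_coset[OF that(1), of f] asa by (simp add: a_def)
  next
    case False then show ?thesis using that(3)[of i] that(2,4) by (simp add: \<Phi>_def not_less)
  qed
  \<comment> \<open>Beyond level \<open>l\<close> the function is constant on the coset, so its
    average is \<open>norm (f x)\<close>, which is also the average at level \<open>l\<close>;
    nothing is lost by stopping the search there.\<close>
  have small': "avg f x i \<le> s * a" if "x \<in> cs z n" "x \<notin> \<Omega>" "n \<le> i" for x i
  proof (cases "i \<le> l")
    case True then show ?thesis using that by (intro small) (auto simp: \<Omega>_def)
  next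
    case False
    have "avg f x i = norm (f x)" using l(2) coset_mono[of l i x] False by (intro avg_const) auto
    also have "\<dots> = avg f x l" using l(2) by (intro avg_const[symmetric]) auto
    also have "\<dots> \<le> s * a" using that l(1) by (intro small) (auto simp: \<Omega>_def)
    finally show ?thesis .
  qed
  have sa0: "0 \<le> s * a" using s a0 by simp
  have Bsa: "s * a \<le> B * (s * a)" using B_ge sa0 mult_right_mono[of 1 B "s * a"] by simp
  \<comment> \<open>On a stopping coset, \<open>g\<close> is the mean of \<open>f\<close>. The
    parent coset was not selected, or is \<open>cs z n\<close> itself, so its average is at most
    \<open>s * a\<close>, and one step down costs the factor \<open>B\<close>. Outside
    \<open>\<Omega>\<close>, \<open>g\<close> is \<open>f\<close> and equals its average at level
    \<open>l\<close> in norm.\<close>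
  have g_le: "norm (g x) \<le> B * s * a" for x
  proof (cases "x \<in> \<Omega>")
    case True
    have "norm (g x) \<le> avg f x ((\<kappa> x - 1) + 1)" using True m_le by (simp add: g_eq)
    also have "\<dots> \<le> B * avg f x (\<kappa> x - 1)" by (rule avg_le_B[OF li])
    also have "avg f x (\<kappa> x - 1) \<le> s * a"
    proof (rule small)
      show "\<kappa> x - 1 \<le> l" using \<kappa>(3)[OF True] by (simp add: \<Phi>_def)
    qed (use True OQ \<kappa>(2)[OF True] \<kappa>(4)[OF True] in auto)
    finally show ?thesis using B_ge by (simp add: mult.assoc)
  next
    case xO: False
    show ?thesis
    proof (cases "x \<in> cs z n")
      case True
      have "norm (g x) = avg f x l" using xO l(2) by (subst avg_const) (auto simp: g_eq)
      also have "\<dots> \<le> s * a" using small'[OF True xO, of l] l(1) by simp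
      finally show ?thesis using Bsa by (simp add: mult.assoc)
    next
      case False
      then show ?thesis using xO f(2) Bsa sa0 by (simp add: g_eq mult.assoc)
    qed
  qed
  have Ob: "\<Omega> \<in> sets borel" by (rule adapted_borel[OF \<kappa>(1)])
  \<comment> \<open>Each stopping coset carries average more than \<open>s * a\<close>, so
    \<open>s * a\<close> times the measure of \<open>\<Omega>\<close> is at most the integral of
    \<open>norm (f x)\<close>. A nonempty \<open>\<Omega>\<close> forces \<open>a > 0\<close>, which
    permits the division.\<close>
  have Om: "emeasure \<mu> \<Omega> \<le> ennreal (vol n / s)"
  proof (cases "\<Omega> = {}")
    case False
    then obtain x where x: "x \<in> \<Omega>" by blast
    have "0 < avg f x (\<kappa> x)" using \<kappa>(3)[OF x] sa0 by (simp add: \<Phi>_def)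
    then have "0 < vol (\<kappa> x) * avg f x (\<kappa> x)" by (simp add: vol_pos)
    also have "\<dots> \<le> vol n * avg f x n" using \<kappa>(2)[OF x] by (intro avg_le_parent[OF li]) simp
    finally have "0 < vol n * avg f x n" .
    then have apos: "0 < a" using avg_coset[OF OQ[OF x], of f] vol_pos[of n] a0 by (simp add: a_def zero_less_mult_iff)
    have [measurable]: "f \<in> borel_measurable \<mu>" using f(1) by (rule test_measurable)
    have "ennreal (s * a) * emeasure \<mu> \<Omega> = (\<integral>\<^sup>+x. ennreal (s * a) * indicator \<Omega> x \<partial>\<mu>)"
      using Ob by (subst nn_integral_cmult_indicator) auto
    also have "\<dots> \<le> (\<integral>\<^sup>+x. ennreal (norm (f x)) * indicator \<Omega> x \<partial>\<mu>)"
    proof (rule nn_integral_adapted_mono[OF \<kappa>(1)])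
      fix x assume x: "x \<in> \<Omega>"
      have "(\<integral>\<^sup>+y. ennreal (s * a) * indicator (cs x (\<kappa> x)) y \<partial>\<mu>) = ennreal ((s * a) * vol (\<kappa> x))"
        by (subst nn_integral_cmult_indicator) (simp_all add: emeasure_coset ennreal_mult[OF sa0 vol_nonneg])
      also have "(s * a) * vol (\<kappa> x) = vol (\<kappa> x) * (s * a)" by (rule mult.commute)
      also have "\<dots> \<le> ennreal (vol (\<kappa> x) * avg f x (\<kappa> x))"
        using \<kappa>(3)[OF x] by (intro ennreal_leI mult_left_mono vol_nonneg) (simp add: \<Phi>_def)
      finally show "(\<integral>\<^sup>+y. ennreal (s * a) * indicator (cs x (\<kappa> x)) y \<partial>\<mu>) \<le> (\<integral>\<^sup>+y. ennreal (norm (f y)) * indicator (cs x (\<kappa> x)) y \<partial>\<mu>)"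
        unfolding nn_avg[OF li] .
    qed auto
    also have "\<dots> \<le> (\<integral>\<^sup>+x. ennreal (norm (f x)) * indicator (cs z n) x \<partial>\<mu>)"
      using OQ by (intro nn_integral_mono) (auto simp: indicator_def)
    also have "\<dots> = ennreal (vol n * a)" unfolding nn_avg[OF li] a_def ..
    finally have le: "ennreal (s * a) * emeasure \<mu> \<Omega> \<le> ennreal (vol n * a)" .
    have "emeasure \<mu> \<Omega> = ennreal (1 / (s * a)) * (ennreal (s * a) * emeasure \<mu> \<Omega>)"
      using s apos by (simp add: mult.assoc[symmetric] ennreal_mult[symmetric])
    also have "\<dots> \<le> ennreal (1 / (s * a)) * ennreal (vol n * a)" by (intro mult_left_mono le) simp
    also have "\<dots> = ennreal (vol n / s)"
      using s apos vol_nonneg[of n] by (simp add: ennreal_mult[symmetric])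
    finally show ?thesis .
  qed simp
  show ?thesis
  proof (rule that[of g b F \<Omega>])
    show "g \<in> test" unfolding g_def by (intro test_diff f(1) test_sum fin bt)
    show "g x = 0" if "x \<notin> cs z n" for x using that OQ f(2) by (auto simp: g_eq)
    show "f x = g x + (\<Sum>P\<in>F. b P x)" for x by (simp add: g_def)
    show "\<exists>y k. n \<le> k \<and> P = cs y k \<and> P \<subseteq> \<Omega> \<and> y \<in> cs z n" if "P \<in> F" for P
    proof -
      obtain x where "x \<in> \<Omega>" "P = cs x (\<kappa> x)" using FP[OF \<open>P \<in> F\<close>] by blast
      then show ?thesis using PO[OF that] \<kappa>(2)[of x] OQ[of x] by (intro exI[of _ x] exI[of _ "\<kappa> x"]) simp
    qed
  qed (use g_le fin bt b0 bint sum_b Ob Om small' in \<open>simp_all add: a_def\<close>)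
qed

text \<open>The integral behind \<open>Lp_norm\<close>, before the root is taken. Working with it in
  \<open>ennreal\<close> avoids roots and the case of infinite norm, and allows exponents below
  1.\<close>

definition Np :: "real \<Rightarrow> ('a \<Rightarrow> complex) \<Rightarrow> ennreal" where
  "Np p f = (\<integral>\<^sup>+x. ennreal (norm (f x) powr p) \<partial>\<mu>)"

lemma Lp_norm_le_iff:
  assumes "0 < p" "0 \<le> K"
  shows "Lp_norm \<mu> p f \<le> ennreal K \<longleftrightarrow> Np p f \<le> ennreal (K powr p)"
proof (cases "Np p f = \<infinity>")
  case True
  then show ?thesis unfolding Lp_norm_def Np_def by (simp add: top_unique)
next
  case False
  then obtain j where j: "0 \<le> j" "Np p f = ennreal j" by (metis ennreal_cases infinity_ennreal_def)
  have "Lp_norm \<mu> p f = ennreal (j powr (1 / p))"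
    using j unfolding Lp_norm_def Np_def by simp
  moreover have "j powr (1 / p) \<le> K \<longleftrightarrow> j \<le> K powr p"
  proof
    assume "j powr (1 / p) \<le> K"
    then have "(j powr (1 / p)) powr p \<le> K powr p" using assms by (intro powr_mono2) auto
    then show "j \<le> K powr p" using assms j by (simp add: powr_powr)
  next
    assume "j \<le> K powr p"
    then have "j powr (1 / p) \<le> (K powr p) powr (1 / p)" using assms j by (intro powr_mono2) auto
    then show "j powr (1 / p) \<le> K" using assms by (simp add: powr_powr)
  qed
  ultimately show ?thesis using j assms by simp
qed

lemma Np_le_bounded:
  assumes "\<And>x. norm (f x) \<le> F" "\<And>x. x \<notin> cs z n \<Longrightarrow> f x = 0" "0 < p"
  shows "Np p f \<le> ennreal ((F * vol n powr (1 / p)) powr p)"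
proof -
  have F: "0 \<le> F" using assms(1)[of z] norm_ge_zero order_trans by blast
  have "Np p f \<le> (\<integral>\<^sup>+x. ennreal (F powr p) * indicator (cs z n) x \<partial>\<mu>)"
    unfolding Np_def
  proof (rule nn_integral_mono)
    fix x show "ennreal (norm (f x) powr p) \<le> ennreal (F powr p) * indicator (cs z n) x"
      using assms(1)[of x] assms(2)[of x] assms(3)
      by (cases "x \<in> cs z n") (auto intro!: ennreal_leI powr_mono2)
  qed
  also have "\<dots> = ennreal (F powr p * vol n)"
    by (subst nn_integral_cmult_indicator) (auto simp: emeasure_coset ennreal_mult vol_nonneg)
  also have "F powr p * vol n = (F * vol n powr (1 / p)) powr p"
    using F assms(3) vol_nonneg[of n] by (simp add: powr_mult powr_powr)
  finally show ?thesis .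
qed

lemma emeasure_superlevel_le:
  assumes [measurable]: "f \<in> borel_measurable \<mu>" "E \<in> sets borel" and c: "0 < c"
    and I: "(\<integral>\<^sup>+x. ennreal (f x) * indicator E x \<partial>\<mu>) \<le> ennreal I" "0 \<le> I"
  shows "emeasure \<mu> {x \<in> E. c < f x} \<le> ennreal (I / c)"
proof -
  have "emeasure \<mu> {x \<in> E. c < f x} = (\<integral>\<^sup>+x. indicator {x \<in> E. c < f x} x \<partial>\<mu>)"
    by (subst nn_integral_indicator) auto
  also have "\<dots> \<le> (\<integral>\<^sup>+x. ennreal (1 / c) * (ennreal (f x) * indicator E x) \<partial>\<mu>)"
  proof (rule nn_integral_mono)
    fix x
    have "1 \<le> ennreal (1 / c) * ennreal (f x)" if "c < f x"
      using that c by (simp add: ennreal_mult[symmetric] flip: ennreal_1)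
    then show "indicator {x \<in> E. c < f x} x \<le> ennreal (1 / c) * (ennreal (f x) * indicator E x)"
      by (auto simp: indicator_def)
  qed
  also have "\<dots> = ennreal (1 / c) * (\<integral>\<^sup>+x. ennreal (f x) * indicator E x \<partial>\<mu>)"
    by (rule nn_integral_cmult) measurable
  also have "\<dots> \<le> ennreal (1 / c) * ennreal I" by (rule mult_left_mono[OF I(1)]) simp
  also have "\<dots> = ennreal (I / c)" using c I(2) by (simp add: ennreal_mult[symmetric])
  finally show ?thesis .
qed

text \<open>A test function is constant on cosets of positive measure, so vanishing almost
  everywhere means vanishing everywhere. This settles the degenerate case of the weak type
  estimate.\<close>

lemma avg_zero_imp:
  assumes f: "f \<in> test" "\<And>x. x \<notin> cs z n \<Longrightarrow> f x = 0" and a: "avg f z n = 0"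
  shows "f = (\<lambda>x. 0)"
proof
  fix x
  obtain l where l: "n \<le> l" "\<And>x y. y \<in> cs x l \<Longrightarrow> f y = f x" by (rule test_const[OF f(1)]) blast
  show "f x = 0"
  proof (cases "x \<in> cs z n")
    case True
    have "vol l * norm (f x) = vol l * avg f x l" using l(2) by (subst avg_const) auto
    also have "\<dots> \<le> vol n * avg f x n" by (rule avg_le_parent[OF test_locint[OF f(1)] l(1)])
    also have "avg f x n = 0" using a avg_coset[OF True, of f] by simp
    finally show ?thesis using vol_pos[of l] by (simp add: mult_le_0_iff)
  qed (rule f(2))
qed

end

section \<open>The weak type estimate at the product of the averages\<close>

context czo begin

lemma T_zero1: "h \<in> test \<Longrightarrow> AE x in \<mu>. T (\<lambda>x. 0) h x = 0"
  using T_lin1[of h h h 0 0] by simp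

lemma T_zero2: "h \<in> test \<Longrightarrow> AE x in \<mu>. T h (\<lambda>x. 0) x = 0"
  using T_lin2[of h h h 0 0] by simp

lemma T_sum1:
  "finite F \<Longrightarrow> (\<And>P. P \<in> F \<Longrightarrow> b P \<in> test) \<Longrightarrow> h \<in> test \<Longrightarrow>
    AE x in \<mu>. T (\<lambda>x. \<Sum>P\<in>F. b P x) h x = (\<Sum>P\<in>F. T (b P) h x)"
proof (induction F rule: finite_induct)
  case empty then show ?case using T_zero1 by simp
next
  case (insert P F)
  have "AE x in \<mu>. T (\<lambda>x. b P x + (\<Sum>P\<in>F. b P x)) h x = T (b P) h x + T (\<lambda>x. \<Sum>P\<in>F. b P x) h x"
    using insert by (intro T_add1 test_sum) auto
  moreover have "AE x in \<mu>. T (\<lambda>x. \<Sum>P\<in>F. b P x) h x = (\<Sum>P\<in>F. T (b P) h x)"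
    using insert by auto
  ultimately have "AE x in \<mu>. T (\<lambda>x. b P x + (\<Sum>P\<in>F. b P x)) h x = T (b P) h x + (\<Sum>P\<in>F. T (b P) h x)"
    by eventually_elim simp
  then show ?case using insert(1,2) by simp
qed

lemma T_sum2:
  "finite F \<Longrightarrow> (\<And>P. P \<in> F \<Longrightarrow> b P \<in> test) \<Longrightarrow> h \<in> test \<Longrightarrow>
    AE x in \<mu>. T h (\<lambda>x. \<Sum>P\<in>F. b P x) x = (\<Sum>P\<in>F. T h (b P) x)"
  by (rule czo.T_sum1[OF swap])

lemma T_mean_zero_sum_integral:
  assumes "finite F" and b: "\<And>P. P \<in> F \<Longrightarrow> b P \<in> test"
    "\<And>P. P \<in> F \<Longrightarrow> \<exists>y k. n \<le> k \<and> P = cs y k \<and> P \<subseteq> \<Omega> \<and> y \<in> cs z n"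
    "\<And>P x. P \<in> F \<Longrightarrow> x \<notin> P \<Longrightarrow> b P x = 0" "\<And>P. P \<in> F \<Longrightarrow> (\<integral>x. b P x \<partial>\<mu>) = 0"
    "(\<Sum>P\<in>F. \<integral>x. norm (b P x) \<partial>\<mu>) \<le> N"
    and h: "h \<in> test" "\<And>w. w \<notin> cs z n \<Longrightarrow> h w = 0"
    and E: "E \<in> sets borel" "E \<subseteq> cs z n" "E \<inter> \<Omega> = {}"
    and H: "0 \<le> H" "\<And>x i. x \<in> E \<Longrightarrow> n \<le> i \<Longrightarrow> avg h x i \<le> H"
  shows "(\<integral>\<^sup>+x. ennreal (\<Sum>P\<in>F. norm (T (b P) h x)) * indicator E x \<partial>\<mu>) \<le> ennreal (Dc * H * N)"
proof -
  have m: "T (b P) h \<in> borel_measurable \<mu>" if "P \<in> F" for P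
    using b(1)[OF that] h(1) by (rule T_measurable)
  have "(\<integral>\<^sup>+x. ennreal (\<Sum>P\<in>F. norm (T (b P) h x)) * indicator E x \<partial>\<mu>) =
      (\<integral>\<^sup>+x. (\<Sum>P\<in>F. ennreal (norm (T (b P) h x)) * indicator E x) \<partial>\<mu>)"
    by (simp add: sum_distrib_right[symmetric] sum_ennreal)
  also have "\<dots> = (\<Sum>P\<in>F. \<integral>\<^sup>+x. ennreal (norm (T (b P) h x)) * indicator E x \<partial>\<mu>)"
  proof (rule nn_integral_sum)
    fix P assume P: "P \<in> F"
    have [measurable]: "T (b P) h \<in> borel_measurable \<mu>" "E \<in> sets borel" using m[OF P] E(1) by auto
    show "(\<lambda>x. ennreal (norm (T (b P) h x)) * indicator E x) \<in> borel_measurable \<mu>" by measurable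
  qed
  also have "\<dots> \<le> (\<Sum>P\<in>F. ennreal (Dc * H * (\<integral>x. norm (b P x) \<partial>\<mu>)))"
  proof (rule sum_mono)
    fix P assume P: "P \<in> F"
    then obtain y k where yk: "n \<le> k" "P = cs y k" "P \<subseteq> \<Omega>" "y \<in> cs z n" using b(2) by blast
    have q: "cs y n = cs z n" by (rule coset_eq[OF yk(4)])
    show "(\<integral>\<^sup>+x. ennreal (norm (T (b P) h x)) * indicator E x \<partial>\<mu>) \<le> ennreal (Dc * H * (\<integral>x. norm (b P x) \<partial>\<mu>))"
      by (rule T_mean_zero_integral[where k = k and z = y and n = n])
         (use b P yk h E H q in \<open>auto\<close>)
  qed
  also have "\<dots> = ennreal (Dc * H * (\<Sum>P\<in>F. \<integral>x. norm (b P x) \<partial>\<mu>))"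
    using Dc_pos H(1) by (subst sum_ennreal) (auto simp: sum_distrib_left intro!: mult_nonneg_nonneg integral_nonneg_AE)
  also have "\<dots> \<le> ennreal (Dc * H * N)"
    using Dc_pos H(1) b(5) by (intro ennreal_leI mult_left_mono) auto
  finally show ?thesis .
qed

text \<open>The only form in which the a priori bound is used. For functions bounded by
  \<open>F\<close> and \<open>F'\<close> on one coset the powers of the volume multiply to
  \<open>vol n powr (1 / q)\<close>, so \<open>q1\<close> and \<open>q2\<close> disappear.\<close>

lemma Lq_Np:
  "\<exists>q>0. \<exists>D>0. \<forall>f\<in>test. \<forall>g\<in>test. \<forall>F F' z n.
     (\<forall>x. norm (f x) \<le> F) \<longrightarrow> (\<forall>x. norm (g x) \<le> F') \<longrightarrow>
     (\<forall>x. x \<notin> cs z n \<longrightarrow> f x = 0) \<longrightarrow> (\<forall>x. x \<notin> cs z n \<longrightarrow> g x = 0) \<longrightarrow>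
      Np q (T f g) \<le> ennreal ((D * F * F') powr q * vol n)"
proof -
  obtain q q1 q2 D where q: "1 \<le> q1" "1 \<le> q2" "0 < q" "1 / q = 1 / q1 + 1 / q2" "0 < D"
    and bd: "\<forall>f1\<in>test. \<forall>f2\<in>test. Lp_norm \<mu> q (T f1 f2) \<le> ennreal D * Lp_norm \<mu> q1 f1 * Lp_norm \<mu> q2 f2"
    using Lq unfolding bounded_on_some_Lp_def by (elim exE conjE) (rule that)
  show ?thesis
  proof (rule exI[of _ q], rule conjI[OF q(3)], rule exI[of _ D], rule conjI[OF q(5)], intro ballI allI impI)
    fix f g F F' z n
    assume fg: "f \<in> test" "g \<in> test" "\<forall>x. norm (f x) \<le> F" "\<forall>x. norm (g x) \<le> F'"
      "\<forall>x. x \<notin> cs z n \<longrightarrow> f x = 0" "\<forall>x. x \<notin> cs z n \<longrightarrow> g x = 0"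
    then have f: "f \<in> test" "\<And>x. norm (f x) \<le> F" "\<And>x. x \<notin> cs z n \<Longrightarrow> f x = 0"
      and g: "g \<in> test" "\<And>x. norm (g x) \<le> F'" "\<And>x. x \<notin> cs z n \<Longrightarrow> g x = 0" by simp_all
    have F: "0 \<le> F" "0 \<le> F'" using f(2)[of z] g(2)[of z] norm_ge_zero order_trans by blast+
    have 1: "Lp_norm \<mu> q1 f \<le> ennreal (F * vol n powr (1 / q1))"
      using Np_le_bounded[OF f(2,3), where p = q1] q F by (subst Lp_norm_le_iff) auto
    have 2: "Lp_norm \<mu> q2 g \<le> ennreal (F' * vol n powr (1 / q2))"
      using Np_le_bounded[OF g(2,3), where p = q2] q F by (subst Lp_norm_le_iff) auto
    have "Lp_norm \<mu> q (T f g) \<le> ennreal D * Lp_norm \<mu> q1 f * Lp_norm \<mu> q2 g" using bd f(1) g(1) by blast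
    also have "\<dots> \<le> ennreal D * ennreal (F * vol n powr (1 / q1)) * ennreal (F' * vol n powr (1 / q2))"
      by (intro mult_mono 1 2) auto
    also have "\<dots> = ennreal (D * F * F' * (vol n powr (1 / q1) * vol n powr (1 / q2)))"
      using q F by (simp add: ennreal_mult[symmetric] mult_ac)
    also have "vol n powr (1 / q1) * vol n powr (1 / q2) = vol n powr (1 / q)"
      by (simp add: powr_add[symmetric] q(4))
    finally have "Np q (T f g) \<le> ennreal ((D * F * F' * vol n powr (1 / q)) powr q)"
      using q F by (subst (asm) Lp_norm_le_iff) auto
    also have "(D * F * F' * vol n powr (1 / q)) powr q = (D * F * F') powr q * vol n"
    proof -
      have "(vol n powr (1 / q)) powr q = vol n" using q(3) vol_nonneg[of n] by (simp add: powr_powr)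
      then show ?thesis using F q(5) by (simp add: powr_mult)
    qed
    finally show "Np q (T f g) \<le> ennreal ((D * F * F') powr q * vol n)" .
  qed
qed

text \<open>Writing \<open>f\<close> and \<open>g\<close> as good part plus bad part,
  \<open>T f g\<close> becomes \<open>T f1 g1\<close>, plus \<open>T f1\<close> of the bad part of
  \<open>g\<close>, plus \<open>T\<close> of the bad part of \<open>f\<close> against all of
  \<open>g\<close>. No separate term with two bad parts arises, because the mean zero estimate needs
  only the averages of the other function at points outside the exceptional sets. The good term is
  handled by the a priori bound, the other two by integration off the exceptional sets.\<close>

lemma weak_type_supported:
  assumes "0 < \<eta>"
  shows "\<exists>M>0. (\<forall>f\<in>test. \<forall>g\<in>test. \<forall>z n. (\<forall>x. x \<notin> cs z n \<longrightarrow> f x = 0) \<longrightarrow> (\<forall>x. x \<notin> cs z n \<longrightarrow> g x = 0) \<longrightarrow>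
      emeasure \<mu> {x \<in> cs z n. M * (avg f z n * avg g z n) < norm (T f g x)} \<le> ennreal (\<eta> * vol n))"
proof -
  obtain q D where q: "0 < q" "0 < D" and good: "\<forall>f\<in>test. \<forall>g\<in>test. \<forall>F F' z n.
     (\<forall>x. norm (f x) \<le> F) \<longrightarrow> (\<forall>x. norm (g x) \<le> F') \<longrightarrow>
     (\<forall>x. x \<notin> cs z n \<longrightarrow> f x = 0) \<longrightarrow> (\<forall>x. x \<notin> cs z n \<longrightarrow> g x = 0) \<longrightarrow>
      Np q (T f g) \<le> ennreal ((D * F * F') powr q * vol n)"
    using Lq_Np by (elim exE conjE) (rule that)
  \<comment> \<open>Each of the two exceptional sets is to take up at most a quarter of
    \<open>\<eta> * vol n\<close>; the other two quarters are for the superlevel sets of the good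
    and of the bad terms.\<close>
  define s where "s = max 1 (4 / \<eta>)"
  have s: "1 \<le> s" "1 / s \<le> \<eta> / 4" using assms by (auto simp: s_def field_simps max_def)
  define A where "A = Dc * (2 * s) + Dc * (2 * (B * s))"
  have A: "0 < A" unfolding A_def using Dc_pos s B_ge by (intro add_pos_pos mult_pos_pos) auto
  \<comment> \<open>The level is split into halves: \<open>M1\<close> makes the good term exceed its
    half on at most a quarter of the allowed measure, and \<open>M2\<close> does the same for the
    sum of the bad terms, whose integral is controlled by \<open>A\<close>.\<close>
  define M1 where "M1 = 2 * (D * (B * s) * (B * s)) / (\<eta> / 4) powr (1 / q)"
  define M2 where "M2 = 8 * A / \<eta>"
  define M where "M = max M1 M2"
  have M1: "0 < M1" unfolding M1_def using q B_ge s assms by simp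
  have M2: "0 < M2" unfolding M2_def using A assms by simp
  have M: "0 < M" "M1 \<le> M" "M2 \<le> M" using M1 by (auto simp: M_def)
  show ?thesis
  proof (intro exI[of _ M] conjI M(1) ballI allI impI)
    fix f g z n
    assume fg: "f \<in> test" "g \<in> test" "\<forall>x. x \<notin> cs z n \<longrightarrow> f x = 0" "\<forall>x. x \<notin> cs z n \<longrightarrow> g x = 0"
    then have f: "f \<in> test" "\<And>x. x \<notin> cs z n \<Longrightarrow> f x = 0" and g: "g \<in> test" "\<And>x. x \<notin> cs z n \<Longrightarrow> g x = 0"
      by simp_all
    let ?a = "avg f z n" and ?b = "avg g z n"
    have a0: "0 \<le> ?a" "0 \<le> ?b" by (simp_all add: avg_nonneg)
    have [measurable]: "T f g \<in> borel_measurable \<mu>" by (rule T_measurable[OF f(1) g(1)])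
    show "emeasure \<mu> {x \<in> cs z n. M * (?a * ?b) < norm (T f g x)} \<le> ennreal (\<eta> * vol n)"
    proof (cases "?a = 0 \<or> ?b = 0")
      case True
      \<comment> \<open>At level 0 a distribution inequality is void. But an average 0 makes the
        function itself 0, so \<open>T f g\<close> vanishes almost everywhere and the set is
        null.\<close>
      then have "f = (\<lambda>x. 0) \<or> g = (\<lambda>x. 0)" using avg_zero_imp f g by blast
      then have "AE x in \<mu>. T f g x = 0" using T_zero1[OF g(1)] T_zero2[OF f(1)] by auto
      then have "AE x in \<mu>. x \<notin> {x \<in> cs z n. M * (?a * ?b) < norm (T f g x)}"
      proof eventually_elim
        case (elim x)
        then show ?case using True by auto
      qed
      then have "emeasure \<mu> {x \<in> cs z n. M * (?a * ?b) < norm (T f g x)} = 0"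
        by (subst AE_iff_measurable[symmetric, where P = "\<lambda>x. x \<notin> {x \<in> cs z n. M * (?a * ?b) < norm (T f g x)}"]) auto
      then show ?thesis by simp
    next
      case False
      then have ab: "0 < ?a" "0 < ?b" using a0 by auto
      obtain f1 b1 F1 \<Omega>1 where f1: "f1 \<in> test" "\<And>x. x \<notin> cs z n \<Longrightarrow> f1 x = 0" "\<And>x. norm (f1 x) \<le> B * s * ?a"
        and fe: "\<And>x. f x = f1 x + (\<Sum>P\<in>F1. b1 P x)"
        and F1: "finite F1" "\<And>P. P \<in> F1 \<Longrightarrow> b1 P \<in> test"
        "\<And>P. P \<in> F1 \<Longrightarrow> \<exists>y k. n \<le> k \<and> P = cs y k \<and> P \<subseteq> \<Omega>1 \<and> y \<in> cs z n"
        "\<And>P x. P \<in> F1 \<Longrightarrow> x \<notin> P \<Longrightarrow> b1 P x = 0" "\<And>P. P \<in> F1 \<Longrightarrow> (\<integral>x. b1 P x \<partial>\<mu>) = 0"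
        "(\<Sum>P\<in>F1. \<integral>x. norm (b1 P x) \<partial>\<mu>) \<le> 2 * vol n * ?a"
        and O1: "\<Omega>1 \<in> sets borel" "emeasure \<mu> \<Omega>1 \<le> ennreal (vol n / s)"
        "\<And>x i. x \<in> cs z n - \<Omega>1 \<Longrightarrow> n \<le> i \<Longrightarrow> avg f x i \<le> s * ?a"
        by (rule cz_decomposition[OF f s(1)]) blast+
      obtain g1 b2 F2 \<Omega>2 where g1: "g1 \<in> test" "\<And>x. x \<notin> cs z n \<Longrightarrow> g1 x = 0" "\<And>x. norm (g1 x) \<le> B * s * ?b"
        and ge: "\<And>x. g x = g1 x + (\<Sum>P\<in>F2. b2 P x)"
        and F2: "finite F2" "\<And>P. P \<in> F2 \<Longrightarrow> b2 P \<in> test"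
        "\<And>P. P \<in> F2 \<Longrightarrow> \<exists>y k. n \<le> k \<and> P = cs y k \<and> P \<subseteq> \<Omega>2 \<and> y \<in> cs z n"
        "\<And>P x. P \<in> F2 \<Longrightarrow> x \<notin> P \<Longrightarrow> b2 P x = 0" "\<And>P. P \<in> F2 \<Longrightarrow> (\<integral>x. b2 P x \<partial>\<mu>) = 0"
        "(\<Sum>P\<in>F2. \<integral>x. norm (b2 P x) \<partial>\<mu>) \<le> 2 * vol n * ?b"
        and O2: "\<Omega>2 \<in> sets borel" "emeasure \<mu> \<Omega>2 \<le> ennreal (vol n / s)"
        "\<And>x i. x \<in> cs z n - \<Omega>2 \<Longrightarrow> n \<le> i \<Longrightarrow> avg g x i \<le> s * ?b"
        by (rule cz_decomposition[OF g s(1)]) blast+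
      note [measurable] = O1(1) O2(1)
      define E where "E = cs z n - (\<Omega>1 \<union> \<Omega>2)"
      have E [measurable]: "E \<in> sets borel" unfolding E_def by (intro sets.Diff sets.Un coset_borel O1 O2)
      have fe': "(\<lambda>x. f1 x + (\<Sum>P\<in>F1. b1 P x)) = f" and ge': "(\<lambda>x. g1 x + (\<Sum>P\<in>F2. b2 P x)) = g"
        using fe ge by auto
      have tb1: "(\<lambda>x. \<Sum>P\<in>F1. b1 P x) \<in> test" by (rule test_sum[OF F1(1)]) (rule F1(2))
      have tb2: "(\<lambda>x. \<Sum>P\<in>F2. b2 P x) \<in> test" by (rule test_sum[OF F2(1)]) (rule F2(2))
      have sp1: "AE x in \<mu>. T f g x = T f1 g x + T (\<lambda>x. \<Sum>P\<in>F1. b1 P x) g x"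
        using T_add1[OF f1(1) tb1 g(1)] unfolding fe' .
      have sp2: "AE x in \<mu>. T (\<lambda>x. \<Sum>P\<in>F1. b1 P x) g x = (\<Sum>P\<in>F1. T (b1 P) g x)"
        by (intro T_sum1 F1 g)
      have sp3: "AE x in \<mu>. T f1 g x = T f1 g1 x + T f1 (\<lambda>x. \<Sum>P\<in>F2. b2 P x) x"
        using T_add2[OF f1(1) g1(1) tb2] unfolding ge' .
      have sp4: "AE x in \<mu>. T f1 (\<lambda>x. \<Sum>P\<in>F2. b2 P x) x = (\<Sum>P\<in>F2. T f1 (b2 P) x)"
        by (intro T_sum2 F2 f1)
      have split: "AE x in \<mu>. T f g x = T f1 g1 x + (\<Sum>P\<in>F2. T f1 (b2 P) x) + (\<Sum>P\<in>F1. T (b1 P) g x)"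
        using sp1 sp2 sp3 sp4 by eventually_elim simp
      define U where "U x = (\<Sum>P\<in>F1. norm (T (b1 P) g x)) + (\<Sum>P\<in>F2. norm (T f1 (b2 P) x))" for x
      define \<tau> where "\<tau> = M * (?a * ?b)"
      have l0: "0 < \<tau>" using M ab by (simp add: \<tau>_def)
      have mT1: "T (b1 P) g \<in> borel_measurable \<mu>" if "P \<in> F1" for P using F1(2)[OF that] g(1) by (rule T_measurable)
      have mT2: "T f1 (b2 P) \<in> borel_measurable \<mu>" if "P \<in> F2" for P using f1(1) F2(2)[OF that] by (rule T_measurable)
      have mU1: "(\<lambda>x. \<Sum>P\<in>F1. norm (T (b1 P) g x)) \<in> borel_measurable \<mu>"
        by (intro borel_measurable_sum measurable_compose[OF mT1 borel_measurable_norm])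
      have mU2: "(\<lambda>x. \<Sum>P\<in>F2. norm (T f1 (b2 P) x)) \<in> borel_measurable \<mu>"
        by (intro borel_measurable_sum measurable_compose[OF mT2 borel_measurable_norm])
      have mU [measurable]: "U \<in> borel_measurable \<mu>" unfolding U_def using mU1 mU2 by (rule borel_measurable_add)
      have mg [measurable]: "T f1 g1 \<in> borel_measurable \<mu>" by (rule T_measurable[OF f1(1) g1(1)])
      \<comment> \<open>The second argument is the whole of \<open>g\<close>: at points outside
        \<open>\<Omega>2\<close> its averages at all levels from \<open>n\<close> on are at most
        \<open>s\<close> times the top average.\<close>
      have U1: "(\<integral>\<^sup>+x. ennreal (\<Sum>P\<in>F1. norm (T (b1 P) g x)) * indicator E x \<partial>\<mu>) \<le> ennreal (Dc * (s * ?b) * (2 * vol n * ?a))"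
        by (rule T_mean_zero_sum_integral[OF F1 g E]) (use O2(3) s a0 in \<open>auto simp: E_def\<close>)
      \<comment> \<open>The roles are exchanged by \<open>swap\<close>; here the other argument is
        the bounded good part \<open>f1\<close>, whose averages are controlled everywhere.\<close>
      have U2: "(\<integral>\<^sup>+x. ennreal (\<Sum>P\<in>F2. norm (T f1 (b2 P) x)) * indicator E x \<partial>\<mu>) \<le> ennreal (Dc * (B * s * ?a) * (2 * vol n * ?b))"
        by (rule czo.T_mean_zero_sum_integral[OF swap F2 f1(1,2) E])
           (use s a0 B_ge avg_bounded[OF test_measurable[OF f1(1)] f1(3)] in \<open>auto simp: E_def\<close>)
      have "(\<integral>\<^sup>+x. ennreal (U x) * indicator E x \<partial>\<mu>) =
          (\<integral>\<^sup>+x. ennreal (\<Sum>P\<in>F1. norm (T (b1 P) g x)) * indicator E x + ennreal (\<Sum>P\<in>F2. norm (T f1 (b2 P) x)) * indicator E x \<partial>\<mu>)"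
        unfolding U_def by (simp add: ennreal_plus sum_nonneg distrib_right del: sum_ennreal)
      also have "\<dots> = (\<integral>\<^sup>+x. ennreal (\<Sum>P\<in>F1. norm (T (b1 P) g x)) * indicator E x \<partial>\<mu>) +
          (\<integral>\<^sup>+x. ennreal (\<Sum>P\<in>F2. norm (T f1 (b2 P) x)) * indicator E x \<partial>\<mu>)"
        using mU1 mU2 E by (intro nn_integral_add borel_measurable_times_ennreal measurable_compose[OF _ measurable_ennreal] borel_measurable_indicator) auto
      also have "\<dots> \<le> ennreal (Dc * (s * ?b) * (2 * vol n * ?a)) + ennreal (Dc * (B * s * ?a) * (2 * vol n * ?b))"
        by (intro add_mono U1 U2)
      also have "\<dots> = ennreal (A * (?a * ?b) * vol n)"
        using Dc_pos s a0 vol_nonneg[of n] B_ge by (subst ennreal_plus[symmetric]) (auto simp: A_def algebra_simps)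
      finally have UI: "(\<integral>\<^sup>+x. ennreal (U x) * indicator E x \<partial>\<mu>) \<le> ennreal (A * (?a * ?b) * vol n)" .
      have bad: "emeasure \<mu> {x \<in> E. \<tau> / 2 < U x} \<le> ennreal (\<eta> / 4 * vol n)"
      proof -
        have "emeasure \<mu> {x \<in> E. \<tau> / 2 < U x} \<le> ennreal (A * (?a * ?b) * vol n / (\<tau> / 2))"
          using l0 A a0 vol_nonneg by (intro emeasure_superlevel_le mU E UI) auto
        also have "A * (?a * ?b) * vol n / (\<tau> / 2) = 2 * A / M * vol n"
          using ab M by (simp add: \<tau>_def)
        also have "ennreal (2 * A / M * vol n) \<le> ennreal (2 * A / M2 * vol n)"
          using M M2 A by (intro ennreal_leI mult_right_mono divide_left_mono) (auto simp: vol_nonneg)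
        also have "2 * A / M2 = \<eta> / 4" using A assms by (simp add: M2_def)
        finally show ?thesis .
      qed
      have gd: "emeasure \<mu> {x \<in> UNIV. (\<tau> / 2) powr q < norm (T f1 g1 x) powr q} \<le> ennreal (\<eta> / 4 * vol n)"
      proof -
        have "Np q (T f1 g1) \<le> ennreal ((D * (B * s * ?a) * (B * s * ?b)) powr q * vol n)"
          by (rule good[rule_format, OF f1(1) g1(1) f1(3) g1(3) f1(2) g1(2)])
        then have "emeasure \<mu> {x \<in> UNIV. (\<tau> / 2) powr q < norm (T f1 g1 x) powr q} \<le>
            ennreal ((D * (B * s * ?a) * (B * s * ?b)) powr q * vol n / (\<tau> / 2) powr q)"
          using l0 vol_nonneg by (intro emeasure_superlevel_le) (auto simp: Np_def)
        also have "(D * (B * s * ?a) * (B * s * ?b)) powr q * vol n / (\<tau> / 2) powr q = ((D * (B * s * ?a) * (B * s * ?b)) / (\<tau> / 2)) powr q * vol n"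
          using q B_ge s a0 l0 by (subst powr_divide) auto
        also have "(D * (B * s * ?a) * (B * s * ?b)) / (\<tau> / 2) = 2 * (D * (B * s) * (B * s)) / M"
          using ab M by (simp add: \<tau>_def field_simps)
        also have "ennreal ((2 * (D * (B * s) * (B * s)) / M) powr q * vol n) \<le> ennreal ((2 * (D * (B * s) * (B * s)) / M1) powr q * vol n)"
          using M M1 q B_ge s by (intro ennreal_leI mult_right_mono powr_mono2 divide_left_mono) (auto simp: vol_nonneg)
        also have "2 * (D * (B * s) * (B * s)) / M1 = (\<eta> / 4) powr (1 / q)"
          using q B_ge s assms by (simp add: M1_def)
        also have "((\<eta> / 4) powr (1 / q)) powr q = \<eta> / 4" using q assms by (simp add: powr_powr)
        finally show ?thesis .
      qed
      let ?S1 = "{x \<in> E. \<tau> / 2 < U x}" and ?S2 = "{x \<in> UNIV. (\<tau> / 2) powr q < norm (T f1 g1 x) powr q}"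
      have m1: "?S1 \<in> sets \<mu>" "?S2 \<in> sets \<mu>" "\<Omega>1 \<in> sets \<mu>" "\<Omega>2 \<in> sets \<mu>" by measurable
      have "emeasure \<mu> {x \<in> cs z n. \<tau> < norm (T f g x)} \<le> emeasure \<mu> ((?S1 \<union> ?S2) \<union> (\<Omega>1 \<union> \<Omega>2))"
      proof (rule emeasure_mono_AE)
        show "AE x in \<mu>. x \<in> {x \<in> cs z n. \<tau> < norm (T f g x)} \<longrightarrow> x \<in> (?S1 \<union> ?S2) \<union> (\<Omega>1 \<union> \<Omega>2)"
          using split
        proof eventually_elim
          case (elim x)
          show ?case
          proof (intro impI, rule ccontr)
            assume x: "x \<in> {x \<in> cs z n. \<tau> < norm (T f g x)}" "x \<notin> (?S1 \<union> ?S2) \<union> (\<Omega>1 \<union> \<Omega>2)"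
            then have xE: "x \<in> E" by (simp add: E_def)
            then have u: "U x \<le> \<tau> / 2" using x by auto
            have "norm (T f1 g1 x) powr q \<le> (\<tau> / 2) powr q" using x by auto
            then have t: "norm (T f1 g1 x) \<le> \<tau> / 2"
              using powr_less_mono2[of q "\<tau> / 2" "norm (T f1 g1 x)"] q l0 by (force simp: not_le[symmetric])
            have "norm (T f g x) \<le> norm (T f1 g1 x) + norm (\<Sum>P\<in>F2. T f1 (b2 P) x) + norm (\<Sum>P\<in>F1. T (b1 P) g x)"
              unfolding elim by (intro order_trans[OF norm_triangle_ineq] add_mono norm_triangle_ineq order_refl)
            also have "\<dots> \<le> norm (T f1 g1 x) + U x"
              using norm_sum[of "\<lambda>P. T f1 (b2 P) x" F2] norm_sum[of "\<lambda>P. T (b1 P) g x" F1] unfolding U_def by simp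
            also have "\<dots> \<le> \<tau>" using u t by simp
            finally show False using x by simp
          qed
        qed
      qed (use m1 in auto)
      also have "\<dots> \<le> emeasure \<mu> (?S1 \<union> ?S2) + emeasure \<mu> (\<Omega>1 \<union> \<Omega>2)"
        by (rule emeasure_subadditive) (use m1 in auto)
      also have "\<dots> \<le> (emeasure \<mu> ?S1 + emeasure \<mu> ?S2) + (emeasure \<mu> \<Omega>1 + emeasure \<mu> \<Omega>2)"
        by (intro add_mono emeasure_subadditive m1)
      also have "\<dots> \<le> (ennreal (\<eta> / 4 * vol n) + ennreal (\<eta> / 4 * vol n)) + (ennreal (\<eta> / 4 * vol n) + ennreal (\<eta> / 4 * vol n))"
      proof (intro add_mono bad gd)
        have "ennreal (vol n / s) \<le> ennreal (\<eta> / 4 * vol n)"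
          using mult_right_mono[OF s(2), of "vol n"] vol_nonneg[of n] by (intro ennreal_leI) simp
        then show "emeasure \<mu> \<Omega>1 \<le> ennreal (\<eta> / 4 * vol n)" "emeasure \<mu> \<Omega>2 \<le> ennreal (\<eta> / 4 * vol n)"
          using O1(2) O2(2) order_trans by blast+
      qed
      also have "\<dots> = ennreal (\<eta> * vol n)"
        using assms vol_nonneg[of n] by (simp add: ennreal_plus[symmetric] del: ennreal_plus)
      finally show ?thesis unfolding \<tau>_def .
    qed
  qed
qed

lemma weak_type:
  assumes "0 < \<eta>"
  obtains M where "0 < M"
    "\<And>f g z n. f \<in> test \<Longrightarrow> g \<in> test \<Longrightarrow>
      emeasure \<mu> {x \<in> cs z n. M * (avg f z n * avg g z n) < norm (T (rs (cs z n) f) (rs (cs z n) g) x)} \<le> ennreal (\<eta> * vol n)"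
proof -
  obtain M where M: "0 < M" "(\<forall>f\<in>test. \<forall>g\<in>test. \<forall>z n. (\<forall>x. x \<notin> cs z n \<longrightarrow> f x = 0) \<longrightarrow> (\<forall>x. x \<notin> cs z n \<longrightarrow> g x = 0) \<longrightarrow>
      emeasure \<mu> {x \<in> cs z n. M * (avg f z n * avg g z n) < norm (T f g x)} \<le> ennreal (\<eta> * vol n))"
    using weak_type_supported[OF assms] by (elim exE conjE) (rule that)
  show ?thesis
  proof (rule that[OF M(1)])
    fix f g z n assume "f \<in> test" "g \<in> test"
    then show "emeasure \<mu> {x \<in> cs z n. M * (avg f z n * avg g z n) < norm (T (rs (cs z n) f) (rs (cs z n) g) x)} \<le> ennreal (\<eta> * vol n)"
      using M(2)[rule_format, of "rs (cs z n) f" "rs (cs z n) g" z n] by (simp add: avg_rs test_rs)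
  qed
qed

end

section \<open>Sparse domination\<close>

context vilenkin_haar begin

text \<open>In the sparse step the bad set is enlarged to an open set, so that around each bad point
  a whole coset is bad. This takes the place of a density theorem and holds at every point.\<close>

lemma outer_open:
  assumes "E \<in> sets borel" "emeasure \<mu> E < c"
  obtains U where "open U" "E \<subseteq> U" "emeasure \<mu> U < c"
proof -
  have "emeasure \<mu> E = (INF U\<in>{U. open U \<and> E \<subseteq> U}. emeasure \<mu> U)"
    using haar assms(1) unfolding haar_measure_def by blast
  then have "(INF U\<in>{U. open U \<and> E \<subseteq> U}. emeasure \<mu> U) < c" using assms(2) by simp
  then obtain U where "U \<in> {U. open U \<and> E \<subseteq> U}" "emeasure \<mu> U < c" unfolding INF_less_iff by blast
  then show ?thesis using that by blast
qed

lemma coset_nbhd_deep: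
  assumes "open U" "x \<in> U"
  obtains k where "n \<le> k" "cs x k \<subseteq> U"
proof -
  obtain k where k: "cs x k \<subseteq> U" by (rule coset_nbhd[OF assms])
  show ?thesis by (rule that[of "max n k"]) (use k coset_mono[of k "max n k" x] in auto)
qed

end

context czo begin

text \<open>One step of the sparse domination on \<open>Q = cs z n\<close>, with exceptional set \<open>\<Omega>\<close>. In \<open>step_bound_exists\<close>, \<open>\<Omega>\<close> consists
  of the maximal cosets on which an average exceeds \<open>8\<close> times that over \<open>Q\<close>, or which lie to more than a
  quarter in the bad set of the weak type estimate. The parent of such a coset
  satisfies none of these conditions, so it contains a good point, and the value of \<open>rem\<close> there bounds
  \<open>rem\<close> on the whole parent by \<open>rem_osc\<close>.\<close>

definition step_bound :: "real \<Rightarrow> ('a \<Rightarrow> complex) \<Rightarrow> ('a \<Rightarrow> complex) \<Rightarrow> 'a \<Rightarrow> int \<Rightarrow> ('a \<Rightarrow> int) \<Rightarrow> 'a set \<Rightarrow> bool" where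
  "step_bound A f g z n \<kappa> \<Omega> \<longleftrightarrow> adapted \<kappa> \<Omega> \<and> \<Omega> \<subseteq> cs z n \<and> (\<forall>x\<in>\<Omega>. n < \<kappa> x) \<and>
     emeasure \<mu> \<Omega> \<le> ennreal (vol n / 2) \<and>
     (\<forall>x\<in>cs z n - \<Omega>. norm (T (rs (cs z n) f) (rs (cs z n) g) x) \<le> A * (avg f z n * avg g z n)) \<and>
     (\<forall>x\<in>\<Omega>. AE y in \<mu>. y \<in> cs x (\<kappa> x) \<longrightarrow>
        norm (T (rs (cs z n) f) (rs (cs z n) g) y - T (rs (cs x (\<kappa> x)) f) (rs (cs x (\<kappa> x)) g) y) \<le> A * (avg f z n * avg g z n))"

text \<open>One known value plus oscillation. With averages bounded by \<open>F\<close> and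
  \<open>F'\<close> the oscillation is a geometric sum, whereas the size estimate would grow with
  \<open>r - n\<close>.\<close>

lemma rem_bound_from_point:
  assumes f: "f \<in> test" and g: "g \<in> test" and nr: "n \<le> r"
    and Fa: "\<And>i. n \<le> i \<Longrightarrow> i \<le> r \<Longrightarrow> avg f x i \<le> F" and Ga: "\<And>i. n \<le> i \<Longrightarrow> i \<le> r \<Longrightarrow> avg g x i \<le> F'"
    and F0: "0 \<le> F" "0 \<le> F'"
    and y0: "y0 \<in> cs x r" "norm (rem x n r f g y0) \<le> L" and y: "y \<in> cs x r"
  shows "norm (rem x n r f g y) \<le> L + C * (F * F') / (1 - \<rho>)"
proof -
  have "norm (rem x n r f g y) \<le> norm (rem x n r f g y0) + norm (rem x n r f g y - rem x n r f g y0)"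
    using norm_triangle_ineq[of "rem x n r f g y0" "rem x n r f g y - rem x n r f g y0"] by simp
  also have "norm (rem x n r f g y - rem x n r f g y0) \<le> (\<Sum>i\<in>{n..<r}. C * \<rho> ^ nat (r - i) * avg f x i * avg g x i)"
    by (rule rem_osc[OF f g nr y y0(1)])
  also have "\<dots> \<le> (\<Sum>i\<in>{n..<r}. C * (F * F') * \<rho> ^ nat (r - i))"
  proof (rule sum_mono)
    fix i assume i: "i \<in> {n..<r}"
    have "(C * \<rho> ^ nat (r - i)) * (avg f x i * avg g x i) \<le> (C * \<rho> ^ nat (r - i)) * (F * F')"
      using i C_pos \<rho>_pos F0 by (intro mult_left_mono mult_mono Fa Ga avg_nonneg) auto
    then show "C * \<rho> ^ nat (r - i) * avg f x i * avg g x i \<le> C * (F * F') * \<rho> ^ nat (r - i)"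
      by (simp add: mult_ac)
  qed
  also have "\<dots> = C * (F * F') * (\<Sum>i\<in>{n..<r}. \<rho> ^ nat (r - i))" by (simp add: sum_distrib_left)
  also have "\<dots> \<le> C * (F * F') * (1 / (1 - \<rho>))"
    using C_pos F0 by (intro mult_left_mono sum_powers_le \<rho>_pos \<rho>_less) auto
  finally show ?thesis using y0(2) by simp
qed

lemma step_bound_exists: "\<exists>A>0. \<forall>f\<in>test. \<forall>g\<in>test. \<forall>z n. \<exists>\<kappa> \<Omega>. step_bound A f g z n \<kappa> \<Omega>"
proof -
  \<comment> \<open>With \<open>1 / 64\<close> the bad set fits into an open set of measure below
    \<open>vol n / 32\<close>. That keeps \<open>\<Omega>\<close> below half of the coset, and
    inside a parent coset a quarter plus \<open>1 / 64\<close> still leaves good points.\<close>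
  obtain M where M: "0 < M"
    and weak: "\<And>f g z n. f \<in> test \<Longrightarrow> g \<in> test \<Longrightarrow>
      emeasure \<mu> {x \<in> cs z n. M * (avg f z n * avg g z n) < norm (T (rs (cs z n) f) (rs (cs z n) g) x)} \<le> ennreal (1 / 64 * vol n)"
    by (rule weak_type[of "1 / 64"]) auto
  \<comment> \<open>At the good point, \<open>M\<close> bounds the operator on the top coset and
    \<open>64 * M\<close> that on the parent, with averages up to \<open>8 * a\<close> and
    \<open>8 * b\<close>. The terms with \<open>C\<close> are the oscillation over the parent and
    the single shell from the parent to the stopping coset.\<close>
  define A where "A = (65 * M + 64 * C / (1 - \<rho>)) + 64 * C"
  have A: "0 < A" "M \<le> A"
    using M C_pos \<rho>_less by (auto simp: A_def intro!: add_pos_pos add_increasing2)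
  have "\<exists>\<kappa> \<Omega>. step_bound A f g z n \<kappa> \<Omega>" if f: "f \<in> test" and g: "g \<in> test" for f g z n
  proof -
    let ?Q = "cs z n"
    let ?TQ = "T (rs ?Q f) (rs ?Q g)"
    define a where "a = avg f z n"
    define b where "b = avg g z n"
    have a0: "0 \<le> a" "0 \<le> b" by (simp_all add: a_def b_def avg_nonneg)
    have lf: "locint f" and lg: "locint g" using f g by (auto intro: test_locint)
    have [measurable]: "f \<in> borel_measurable \<mu>" "g \<in> borel_measurable \<mu>" using f g by (auto intro: test_measurable)
    have TQm [measurable]: "?TQ \<in> borel_measurable \<mu>" by (intro T_measurable test_rs f g)
    define Eb where "Eb = {x \<in> ?Q. M * (a * b) < norm (?TQ x)}"
    have Eb: "Eb \<in> sets \<mu>" unfolding Eb_def by measurable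
    have "emeasure \<mu> Eb \<le> ennreal (1 / 64 * vol n)" unfolding Eb_def a_def b_def by (rule weak[OF f g])
    also have "\<dots> < ennreal (1 / 32 * vol n)" using vol_pos[of n] by (intro ennreal_lessI) auto
    finally have "emeasure \<mu> Eb < ennreal (1 / 32 * vol n)" .
    then obtain U where U: "open U" "Eb \<subseteq> U" "emeasure \<mu> U < ennreal (1 / 32 * vol n)"
      using Eb outer_open[of Eb] by auto
    have Um [measurable]: "U \<in> sets borel" using U(1) by (rule borel_open)
    define w where "w x k = emeasure \<mu> (U \<inter> cs x k)" for x k
    define \<Phi> where "\<Phi> x k \<longleftrightarrow> 8 * a < avg f x k \<or> 8 * b < avg g x k \<or> ennreal (vol k / 4) < w x k" for x k
    define \<Omega> where "\<Omega> = {x \<in> ?Q. \<exists>k>n. \<Phi> x k}"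
    have inv: "\<Phi> y k" if "\<Phi> x k" "y \<in> cs x k" for x y k
      using that avg_coset[OF that(2), of f] avg_coset[OF that(2), of g] coset_eq[OF that(2)] by (simp add: \<Phi>_def w_def)
    obtain \<kappa> where \<kappa>: "adapted \<kappa> \<Omega>" "\<And>x. x \<in> \<Omega> \<Longrightarrow> n < \<kappa> x" "\<And>x. x \<in> \<Omega> \<Longrightarrow> \<Phi> x (\<kappa> x)"
      "\<And>x j. x \<in> \<Omega> \<Longrightarrow> n < j \<Longrightarrow> j < \<kappa> x \<Longrightarrow> \<not> \<Phi> x j"
      by (rule stopping[OF inv \<Omega>_def]) blast+
    have OQ: "x \<in> ?Q" if "x \<in> \<Omega>" for x using that by (simp add: \<Omega>_def)
    have aQ: "avg f x n = a" "avg g x n = b" if "x \<in> ?Q" for x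
      using avg_coset[OF that] by (simp_all add: a_def b_def)
    have pos: "0 < avg h z n" if "0 < avg h x k" "x \<in> ?Q" "n \<le> k" "locint h" for h :: "'a \<Rightarrow> complex" and x k
    proof -
      have "0 < vol k * avg h x k" using that(1) by (simp add: vol_pos)
      also have "\<dots> \<le> vol n * avg h x n" by (rule avg_le_parent[OF that(4,3)])
      also have "avg h x n = avg h z n" by (rule avg_coset[OF that(2)])
      finally show ?thesis using vol_pos[of n] by (simp add: zero_less_mult_iff)
    qed
    \<comment> \<open>Each of the three stopping conditions makes one summand integrate to at least
      the volume of the stopping coset. For \<open>a = 0\<close> the coefficient is 0 by convention,
      but then all averages of \<open>f\<close> below vanish and the first condition never occurs;
      likewise for \<open>b\<close>.\<close>
    define H where "H x = ennreal (1 / (8 * a)) * ennreal (norm (f x)) + ennreal (1 / (8 * b)) * ennreal (norm (g x)) + 4 * indicator U x" for x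
    have Hm [measurable]: "H \<in> borel_measurable \<mu>" unfolding H_def by measurable
    have HP: "(\<integral>\<^sup>+y. H y * indicator (cs x k) y \<partial>\<mu>) = ennreal (1 / (8 * a)) * ennreal (vol k * avg f x k)
        + ennreal (1 / (8 * b)) * ennreal (vol k * avg g x k) + 4 * w x k" for x k
    proof -
      have "(\<integral>\<^sup>+y. H y * indicator (cs x k) y \<partial>\<mu>) = (\<integral>\<^sup>+y. (ennreal (1 / (8 * a)) * (ennreal (norm (f y)) * indicator (cs x k) y)
         + ennreal (1 / (8 * b)) * (ennreal (norm (g y)) * indicator (cs x k) y)) + 4 * indicator (U \<inter> cs x k) y \<partial>\<mu>)"
        by (rule nn_integral_cong) (simp add: H_def indicator_def)
      also have "\<dots> = (\<integral>\<^sup>+y. ennreal (1 / (8 * a)) * (ennreal (norm (f y)) * indicator (cs x k) y)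
         + ennreal (1 / (8 * b)) * (ennreal (norm (g y)) * indicator (cs x k) y) \<partial>\<mu>) + (\<integral>\<^sup>+y. 4 * indicator (U \<inter> cs x k) y \<partial>\<mu>)"
        by (rule nn_integral_add) measurable
      also have "\<dots> = ((\<integral>\<^sup>+y. ennreal (1 / (8 * a)) * (ennreal (norm (f y)) * indicator (cs x k) y) \<partial>\<mu>)
         + (\<integral>\<^sup>+y. ennreal (1 / (8 * b)) * (ennreal (norm (g y)) * indicator (cs x k) y) \<partial>\<mu>)) + (\<integral>\<^sup>+y. 4 * indicator (U \<inter> cs x k) y \<partial>\<mu>)"
        by (subst nn_integral_add) simp_all
      also have "\<dots> = ennreal (1 / (8 * a)) * ennreal (vol k * avg f x k)
        + ennreal (1 / (8 * b)) * ennreal (vol k * avg g x k) + 4 * w x k"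
        by (simp add: nn_integral_cmult nn_avg lf lg w_def nn_integral_cmult_indicator)
      finally show ?thesis .
    qed
    have Om: "emeasure \<mu> \<Omega> \<le> ennreal (vol n / 2)"
    proof -
      have Ob: "\<Omega> \<in> sets \<mu>" using adapted_borel[OF \<kappa>(1)] by simp
      have "emeasure \<mu> \<Omega> = (\<integral>\<^sup>+x. 1 * indicator \<Omega> x \<partial>\<mu>)" using Ob by simp
      also have "\<dots> \<le> (\<integral>\<^sup>+x. H x * indicator \<Omega> x \<partial>\<mu>)"
      proof (rule nn_integral_adapted_mono[OF \<kappa>(1) _ Hm])
        fix x assume x: "x \<in> \<Omega>"
        let ?k = "\<kappa> x"
        have nk: "n \<le> ?k" using \<kappa>(2)[OF x] by simp
        have key: "ennreal (vol ?k) \<le> ennreal (1 / (8 * c)) * ennreal (vol ?k * v)" if "8 * c < v" "0 < c" for c v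
        proof -
          have "vol ?k * 1 \<le> vol ?k * (v / (8 * c))" using that by (intro mult_left_mono vol_nonneg) simp
          then show ?thesis using that vol_nonneg[of ?k] by (simp add: ennreal_mult[symmetric] mult_ac)
        qed
        have "ennreal (vol ?k) \<le> ennreal (1 / (8 * a)) * ennreal (vol ?k * avg f x ?k)
          + ennreal (1 / (8 * b)) * ennreal (vol ?k * avg g x ?k) + 4 * w x ?k"
          using \<kappa>(3)[OF x] unfolding \<Phi>_def
        proof (elim disjE)
          assume h: "8 * a < avg f x ?k"
          then have "0 < a" using pos[of f x ?k] a0 OQ[OF x] nk lf by (simp add: a_def)
          from key[OF h this] show ?thesis by (simp add: add.assoc add_increasing2)
        next
          assume h: "8 * b < avg g x ?k"
          then have "0 < b" using pos[of g x ?k] a0 OQ[OF x] nk lg by (simp add: b_def)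
          from key[OF h this] show ?thesis by (simp add: add_increasing add_increasing2)
        next
          assume "ennreal (vol ?k / 4) < w x ?k"
          then have "4 * ennreal (vol ?k / 4) \<le> 4 * w x ?k" by (intro mult_left_mono) auto
          moreover have "4 * ennreal (vol ?k / 4) = ennreal (vol ?k)"
            using ennreal_mult[of 4 "vol ?k / 4"] vol_nonneg[of ?k] by simp
          ultimately show ?thesis by (simp add: add_increasing)
        qed
        then show "(\<integral>\<^sup>+y. 1 * indicator (cs x ?k) y \<partial>\<mu>) \<le> (\<integral>\<^sup>+y. H y * indicator (cs x ?k) y \<partial>\<mu>)"
          unfolding HP by (simp add: emeasure_coset)
      qed simp
      also have "\<dots> \<le> (\<integral>\<^sup>+x. H x * indicator ?Q x \<partial>\<mu>)"
        using OQ by (intro nn_integral_mono) (auto simp: indicator_def)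
      also have "\<dots> = ennreal (1 / (8 * a)) * ennreal (vol n * a) + ennreal (1 / (8 * b)) * ennreal (vol n * b) + 4 * w z n"
        unfolding HP a_def b_def ..
      also have "\<dots> \<le> ennreal (vol n / 8) + ennreal (vol n / 8) + ennreal (vol n / 4)"
      proof (intro add_mono)
        have *: "ennreal (1 / (8 * c)) * ennreal (vol n * c) \<le> ennreal (vol n / 8)" if "0 \<le> c" for c
          using that vol_nonneg[of n] by (cases "c = 0") (auto simp: ennreal_mult[symmetric])
        show "ennreal (1 / (8 * a)) * ennreal (vol n * a) \<le> ennreal (vol n / 8)"
          "ennreal (1 / (8 * b)) * ennreal (vol n * b) \<le> ennreal (vol n / 8)" using * a0 by blast+
        have "w z n \<le> emeasure \<mu> U" unfolding w_def by (intro emeasure_mono) auto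
        also have "\<dots> \<le> ennreal (1 / 32 * vol n)" using U(3) by simp
        also have "\<dots> \<le> ennreal (vol n / 16)" using vol_nonneg[of n] by (intro ennreal_leI) simp
        finally have "4 * w z n \<le> 4 * ennreal (vol n / 16)" by (intro mult_left_mono) auto
        also have "\<dots> = ennreal (vol n / 4)" using ennreal_mult[of 4 "vol n / 16"] vol_nonneg[of n] by simp
        finally show "4 * w z n \<le> ennreal (vol n / 4)" .
      qed
      also have "\<dots> = ennreal (vol n / 2)" using vol_nonneg[of n] by (simp add: ennreal_plus[symmetric] del: ennreal_plus)
      finally show ?thesis .
    qed
    have off: "norm (?TQ x) \<le> A * (a * b)" if x: "x \<in> ?Q - \<Omega>" for x
    proof -
      \<comment> \<open>A bad point has a coset of level above \<open>n\<close> inside the open set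
        \<open>U\<close>. That coset meets the third stopping condition, so the point would belong
        to \<open>\<Omega>\<close>.\<close>
      have "x \<notin> Eb"
      proof
        assume "x \<in> Eb"
        then have "x \<in> U" using U(2) by blast
        then obtain k where k: "n + 1 \<le> k" "cs x k \<subseteq> U" using coset_nbhd_deep[OF U(1)] by metis
        then have "U \<inter> cs x k = cs x k" by blast
        then have "w x k = ennreal (vol k)" by (simp add: w_def emeasure_coset)
        moreover have "ennreal (vol k / 4) < ennreal (vol k)" using vol_pos[of k] by (intro ennreal_lessI) auto
        ultimately have "\<Phi> x k" by (simp add: \<Phi>_def)
        then show False using x k(1) by (auto simp: \<Omega>_def)
      qed
      then have "norm (?TQ x) \<le> M * (a * b)" using x by (simp add: Eb_def)
      also have "\<dots> \<le> A * (a * b)" using A a0 by (intro mult_right_mono) auto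
      finally show ?thesis .
    qed
    have on: "AE y in \<mu>. y \<in> cs x (\<kappa> x) \<longrightarrow> norm (?TQ y - T (rs (cs x (\<kappa> x)) f) (rs (cs x (\<kappa> x)) g) y) \<le> A * (a * b)"
      if x: "x \<in> \<Omega>" for x
    proof -
      define r where "r = \<kappa> x - 1"
      have nr: "n \<le> r" and kr: "\<kappa> x = r + 1" using \<kappa>(2)[OF x] by (auto simp: r_def)
      have QQ: "cs z n = cs x n" using coset_eq[OF OQ[OF x]] by simp
      have nP: "\<not> \<Phi> x i" if "n < i" "i \<le> r" for i using \<kappa>(4)[OF x that(1)] that(2) kr by simp
      have af: "avg f x i \<le> 8 * a" if "n \<le> i" "i \<le> r" for i
        using nP[of i] aQ(1)[OF OQ[OF x]] a0 that by (cases "i = n") (auto simp: \<Phi>_def)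
      have ag: "avg g x i \<le> 8 * b" if "n \<le> i" "i \<le> r" for i
        using nP[of i] aQ(2)[OF OQ[OF x]] a0 that by (cases "i = n") (auto simp: \<Phi>_def)
      have wr: "w x r \<le> ennreal (vol r / 4)"
      proof (cases "r = n")
        case True
        have "w x r \<le> emeasure \<mu> U" unfolding w_def by (intro emeasure_mono) auto
        also have "\<dots> \<le> ennreal (1 / 32 * vol n)" using U(3) by simp
        also have "\<dots> \<le> ennreal (vol r / 4)" using vol_nonneg[of n] True by (intro ennreal_leI) simp
        finally show ?thesis .
      next
        case False
        then show ?thesis using nP[of r] nr by (simp add: \<Phi>_def not_less)
      qed
      \<comment> \<open>The change from the top coset to the stopping coset \<open>?P\<close> is
        made through its parent \<open>?R\<close>: down to \<open>?R\<close> the averages are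
        controlled and the oscillation bound applies, and from \<open>?R\<close> to
        \<open>?P\<close> there is one shell, whose averages are those of \<open>?R\<close>. The
        averages over \<open>?P\<close> never enter.\<close>
      let ?R = "cs x r" and ?P = "cs x (\<kappa> x)"
      let ?TR = "T (rs ?R f) (rs ?R g)"
      have rep1: "AE y in \<mu>. y \<in> ?R \<longrightarrow> ?TQ y - ?TR y = rem x n r f g y"
        using rem_rep(1)[OF f g nr, of x] unfolding QQ .
      have rep2: "AE y in \<mu>. y \<in> ?P \<longrightarrow> ?TR y - T (rs ?P f) (rs ?P g) y = rem x r (r + 1) f g y"
        using rem_rep(1)[OF f g, of r "r + 1" x] unfolding kr by simp
      define S where "S = {y \<in> ?R. M * (avg f x r * avg g x r) < norm (?TR y)}"
      have TRm [measurable]: "?TR \<in> borel_measurable \<mu>" by (intro T_measurable test_rs f g)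
      have Sm [measurable]: "S \<in> sets \<mu>" unfolding S_def by measurable
      \<comment> \<open>\<open>U\<close> takes at most a quarter of the parent, the bad set
        \<open>S\<close> of the parent at most \<open>1 / 64\<close>, and the representation fails
        only on a null set; so some point avoids all three.\<close>
      have "\<exists>y0\<in>?R. y0 \<notin> U \<and> y0 \<notin> S \<and> ?TQ y0 - ?TR y0 = rem x n r f g y0"
      proof (rule ccontr)
        assume no: "\<not> ?thesis"
        have "emeasure \<mu> ?R \<le> emeasure \<mu> ((U \<inter> ?R) \<union> S)"
        proof (rule emeasure_mono_AE)
          show "AE y in \<mu>. y \<in> ?R \<longrightarrow> y \<in> (U \<inter> ?R) \<union> S"
            using rep1 by eventually_elim (use no in blast)
        qed (use Um Sm in auto)
        also have "\<dots> \<le> emeasure \<mu> (U \<inter> ?R) + emeasure \<mu> S" by (rule emeasure_subadditive) (use Um Sm in auto)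
        also have "\<dots> \<le> ennreal (vol r / 4) + ennreal (1 / 64 * vol r)"
          using wr weak[OF f g, of x r] unfolding S_def w_def by (rule add_mono)
        also have "\<dots> = ennreal (vol r / 4 + 1 / 64 * vol r)" using vol_nonneg[of r] by (subst ennreal_plus) auto
        also have "\<dots> < ennreal (vol r)" using vol_pos[of r] by (intro ennreal_lessI) auto
        finally show False by (simp add: emeasure_coset)
      qed
      then obtain y0 where y0: "y0 \<in> ?R" "y0 \<notin> U" "y0 \<notin> S" "?TQ y0 - ?TR y0 = rem x n r f g y0" by blast
      have y0Q: "y0 \<in> ?Q" using y0(1) coset_mono[OF nr, of x] QQ by blast
      have "norm (?TQ y0) \<le> M * (a * b)" using y0(2) U(2) y0Q by (auto simp: Eb_def not_less)
      moreover have "norm (?TR y0) \<le> M * (avg f x r * avg g x r)" using y0(1,3) by (simp add: S_def not_less)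
      moreover have "M * (avg f x r * avg g x r) \<le> M * ((8 * a) * (8 * b))"
        using M a0 nr by (intro mult_left_mono mult_mono af ag avg_nonneg) auto
      ultimately have r0: "norm (rem x n r f g y0) \<le> 65 * M * (a * b)"
        unfolding y0(4)[symmetric] using norm_triangle_ineq4[of "?TQ y0" "?TR y0"] by (simp add: algebra_simps)
      have bd1: "norm (rem x n r f g y) \<le> (65 * M + 64 * C / (1 - \<rho>)) * (a * b)" if "y \<in> ?R" for y
      proof -
        have "norm (rem x n r f g y) \<le> 65 * M * (a * b) + C * ((8 * a) * (8 * b)) / (1 - \<rho>)"
          by (rule rem_bound_from_point[OF f g nr af ag _ _ y0(1) r0 that]) (use a0 in auto)
        then show ?thesis by (simp add: algebra_simps add_divide_distrib)
      qed
      have bd2: "norm (rem x r (r + 1) f g y) \<le> 64 * C * (a * b)" if "y \<in> ?P" for y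
      proof -
        have "norm (rem x r (r + 1) f g y) \<le> (\<Sum>i\<in>{r..<r+1}. C * avg f x i * avg g x i)"
          using that unfolding kr by (intro rem_size f g) auto
        also have "{r..<r+1} = {r}" by auto
        also have "(\<Sum>i\<in>{r}. C * avg f x i * avg g x i) = C * (avg f x r * avg g x r)" by simp
        also have "\<dots> \<le> C * ((8 * a) * (8 * b))"
          using C_pos a0 nr by (intro mult_left_mono mult_mono af ag avg_nonneg) auto
        finally show ?thesis by (simp add: mult_ac)
      qed
      show ?thesis
        using rep1 rep2
      proof eventually_elim
        case (elim y)
        show ?case
        proof
          assume yP: "y \<in> ?P"
          then have yR: "y \<in> ?R" using coset_mono[of r "\<kappa> x" x] kr by auto
          have "?TQ y - T (rs ?P f) (rs ?P g) y = (?TQ y - ?TR y) + (?TR y - T (rs ?P f) (rs ?P g) y)" by simp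
          also have "\<dots> = rem x n r f g y + rem x r (r + 1) f g y" using elim yP yR by simp
          also have "norm \<dots> \<le> (65 * M + 64 * C / (1 - \<rho>)) * (a * b) + 64 * C * (a * b)"
            by (rule norm_triangle_le[OF add_mono[OF bd1[OF yR] bd2[OF yP]]])
          also have "\<dots> = A * (a * b)" by (simp add: A_def algebra_simps)
          finally show "norm (?TQ y - T (rs ?P f) (rs ?P g) y) \<le> A * (a * b)" .
        qed
      qed
    qed
    have "step_bound A f g z n \<kappa> \<Omega>"
      unfolding step_bound_def a_def[symmetric] b_def[symmetric]
      using \<kappa>(1,2) OQ Om off on by blast
    then show ?thesis by blast
  qed
  then show ?thesis using A(1) by blast
qed

end

section \<open>The maximal function\<close>

context vilenkin_haar begin

text \<open>The supremum is meaningful only for bounded \<open>h\<close> (see \<open>bdd_avg\<close>).\<close>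

definition maxf :: "int \<Rightarrow> ('a \<Rightarrow> 'b::real_normed_vector) \<Rightarrow> 'a \<Rightarrow> real" where
  "maxf n h x = (SUP k\<in>{n..}. avg h x k)"

lemma avg_measurable: "(\<lambda>x. avg h x k) \<in> borel_measurable \<mu>"
  by (rule locally_constant_measurable[of k]) (rule avg_coset)

lemma bdd_avg:
  fixes h :: "'a \<Rightarrow> 'b::{banach, second_countable_topology}"
  assumes "h \<in> borel_measurable \<mu>" "\<And>x. norm (h x) \<le> F"
  shows "bdd_above ((\<lambda>k. avg h x k) ` I)"
  using avg_bounded[OF assms] by (auto intro!: bdd_aboveI2)

lemma avg_le_maxf:
  fixes h :: "'a \<Rightarrow> 'b::{banach, second_countable_topology}"
  assumes "h \<in> borel_measurable \<mu>" "\<And>x. norm (h x) \<le> F" "n \<le> k"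
  shows "avg h x k \<le> maxf n h x"
  unfolding maxf_def by (rule cSUP_upper) (use assms(3) bdd_avg[OF assms(1,2)] in auto)

lemma maxf_le:
  fixes h :: "'a \<Rightarrow> 'b::{banach, second_countable_topology}"
  assumes "h \<in> borel_measurable \<mu>" "\<And>x. norm (h x) \<le> F"
  shows "maxf n h x \<le> F"
  unfolding maxf_def by (rule cSUP_least) (use avg_bounded[OF assms] in auto)

lemma maxf_nonneg:
  fixes h :: "'a \<Rightarrow> 'b::{banach, second_countable_topology}"
  assumes "h \<in> borel_measurable \<mu>" "\<And>x. norm (h x) \<le> F"
  shows "0 \<le> maxf n h x"
proof -
  have "avg h x n \<le> maxf n h x" by (rule avg_le_maxf[OF assms order_refl])
  then show ?thesis using avg_nonneg[of h x n] by simp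
qed

lemma maxf_measurable:
  fixes h :: "'a \<Rightarrow> 'b::{banach, second_countable_topology}"
  assumes "h \<in> borel_measurable \<mu>" "\<And>x. norm (h x) \<le> F"
  shows "maxf n h \<in> borel_measurable \<mu>"
  unfolding maxf_def
  by (rule borel_measurable_cSUP) (auto intro: avg_measurable bdd_avg[OF assms])

lemma less_maxf_iff:
  fixes h :: "'a \<Rightarrow> 'b::{banach, second_countable_topology}"
  assumes "h \<in> borel_measurable \<mu>" "\<And>x. norm (h x) \<le> F"
  shows "c < maxf n h x \<longleftrightarrow> (\<exists>k\<ge>n. c < avg h x k)"
  unfolding maxf_def using less_cSUP_iff[of "{n..}" "\<lambda>k. avg h x k" c] bdd_avg[OF assms] by auto

text \<open>The superlevel set is itself a stopping set: it is partitioned into maximal cosets with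
  average above \<open>c\<close>, and the inequality holds on each of them.\<close>

lemma maximal_weak:
  fixes h :: "'a \<Rightarrow> 'b::{banach, second_countable_topology}"
  assumes h [measurable]: "h \<in> borel_measurable \<mu>" and hF: "\<And>x. norm (h x) \<le> F" and c: "0 < c"
  shows "ennreal c * emeasure \<mu> {x \<in> cs z n. c < maxf n h x} \<le> (\<integral>\<^sup>+x. ennreal (norm (h x)) * indicator (cs z n) x \<partial>\<mu>)"
proof -
  have lh: "locint h" by (rule bounded_locint[OF h hF])
  \<comment> \<open>Stopping looks only at levels strictly above its starting level. To include
    level \<open>n\<close> it starts at \<open>n - 1\<close>, and membership in
    \<open>cs z n\<close> becomes part of the condition.\<close>
  define \<Phi> where "\<Phi> x k \<longleftrightarrow> x \<in> cs z n \<and> n \<le> k \<and> c < avg h x k" for x k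
  define \<Omega> where "\<Omega> = {x \<in> cs z (n - 1). \<exists>k>n - 1. \<Phi> x k}"
  have inv: "\<Phi> y k" if "\<Phi> x k" "y \<in> cs x k" for x y k
  proof -
    have "y \<in> cs z n" using that coset_nested'[of x z n k] by (auto simp: \<Phi>_def)
    then show ?thesis using that avg_coset[OF that(2), of h] by (simp add: \<Phi>_def)
  qed
  obtain \<kappa> where \<kappa>: "adapted \<kappa> \<Omega>" "\<And>x. x \<in> \<Omega> \<Longrightarrow> n - 1 < \<kappa> x" "\<And>x. x \<in> \<Omega> \<Longrightarrow> \<Phi> x (\<kappa> x)"
    by (rule stopping[OF inv \<Omega>_def]) blast+
  have sub: "cs z n \<subseteq> cs z (n - 1)" by (rule coset_mono) simp
  have eq: "\<Omega> = {x \<in> cs z n. c < maxf n h x}"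
  proof (rule set_eqI)
    fix x
    have "x \<in> \<Omega> \<longleftrightarrow> x \<in> cs z n \<and> (\<exists>k\<ge>n. c < avg h x k)"
      using sub unfolding \<Omega>_def \<Phi>_def by (auto intro!: exI)
    then show "x \<in> \<Omega> \<longleftrightarrow> x \<in> {x \<in> cs z n. c < maxf n h x}" using less_maxf_iff[OF h hF] by simp
  qed
  have "ennreal c * emeasure \<mu> \<Omega> = (\<integral>\<^sup>+x. ennreal c * indicator \<Omega> x \<partial>\<mu>)"
    using adapted_borel[OF \<kappa>(1)] by (simp add: nn_integral_cmult_indicator)
  also have "\<dots> \<le> (\<integral>\<^sup>+x. ennreal (norm (h x)) * indicator \<Omega> x \<partial>\<mu>)"
  proof (rule nn_integral_adapted_mono[OF \<kappa>(1)])
    fix x assume x: "x \<in> \<Omega>"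
    have "(\<integral>\<^sup>+y. ennreal c * indicator (cs x (\<kappa> x)) y \<partial>\<mu>) = ennreal (c * vol (\<kappa> x))"
      using c by (simp add: nn_integral_cmult_indicator emeasure_coset ennreal_mult vol_nonneg)
    also have "\<dots> \<le> ennreal (vol (\<kappa> x) * avg h x (\<kappa> x))"
      using \<kappa>(3)[OF x] vol_nonneg[of "\<kappa> x"] unfolding \<Phi>_def
      by (subst mult.commute) (intro ennreal_leI mult_left_mono, auto)
    finally show "(\<integral>\<^sup>+y. ennreal c * indicator (cs x (\<kappa> x)) y \<partial>\<mu>) \<le> (\<integral>\<^sup>+y. ennreal (norm (h y)) * indicator (cs x (\<kappa> x)) y \<partial>\<mu>)"
      unfolding nn_avg[OF lh] .
  qed measurable
  also have "\<dots> \<le> (\<integral>\<^sup>+x. ennreal (norm (h x)) * indicator (cs z n) x \<partial>\<mu>)"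
    unfolding eq by (intro nn_integral_mono) (auto simp: indicator_def)
  finally show ?thesis unfolding eq .
qed

text \<open>The part of \<open>h\<close> of size at most \<open>c\<close> contributes at most
  \<open>c\<close> to any average. So where the maximal function exceeds \<open>2 * c\<close>, that
  of the remaining part exceeds \<open>c\<close>, and only large values of \<open>h\<close> are
  integrated, as interpolation requires.\<close>

lemma maximal_weak_truncated:
  fixes h :: "'a \<Rightarrow> 'b::{banach, second_countable_topology}"
  assumes h [measurable]: "h \<in> borel_measurable \<mu>" and hF: "\<And>x. norm (h x) \<le> F" and c: "0 < c"
  shows "emeasure \<mu> {x \<in> cs z n. 2 * c < maxf n h x} \<le>
    (\<integral>\<^sup>+x. ennreal (if c < norm (h x) then norm (h x) / c else 0) * indicator (cs z n) x \<partial>\<mu>)"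
proof -
  define h' where "h' x = (if c < norm (h x) then norm (h x) else 0)" for x
  have h'm [measurable]: "h' \<in> borel_measurable \<mu>" unfolding h'_def by measurable
  have F0: "0 \<le> F" using hF[of z] norm_ge_zero[of "h z"] by linarith
  have h'F: "norm (h' x) \<le> F" for x using hF[of x] F0 by (simp add: h'_def)
  have le: "avg h x k \<le> avg h' x k + c" for x k
  proof -
    have i1: "integrable \<mu> (\<lambda>y. indicator (cs x k) y * norm (h' y))" by (intro locint_integrable bounded_locint[OF h'm h'F])
    have i2: "integrable \<mu> (\<lambda>y. indicator (cs x k) y * c)" by (simp add: emeasure_coset)
    have "vol k * avg h x k \<le> (\<integral>y. indicator (cs x k) y * norm (h' y) + indicator (cs x k) y * c \<partial>\<mu>)"
      unfolding vol_avg
    proof (rule integral_mono)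
      show "integrable \<mu> (\<lambda>y. indicator (cs x k) y * norm (h y))" by (intro locint_integrable bounded_locint[OF h hF])
      show "integrable \<mu> (\<lambda>y. indicator (cs x k) y * norm (h' y) + indicator (cs x k) y * c)"
        by (rule Bochner_Integration.integrable_add[OF i1 i2])
      show "indicator (cs x k) y * norm (h y) \<le> indicator (cs x k) y * norm (h' y) + indicator (cs x k) y * c" for y
        using c by (auto simp: h'_def indicator_def)
    qed
    also have "\<dots> = vol k * avg h' x k + vol k * c"
      unfolding vol_avg
      by (subst Bochner_Integration.integral_add[OF i1 i2]) (simp add: measure_coset)
    finally have "vol k * avg h x k \<le> vol k * (avg h' x k + c)" by (simp add: distrib_left)
    then show ?thesis using vol_pos[of k] by simp
  qed
  have M'm [measurable]: "maxf n h' \<in> borel_measurable \<mu>" by (rule maxf_measurable[OF h'm h'F])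
  have "emeasure \<mu> {x \<in> cs z n. 2 * c < maxf n h x} \<le> emeasure \<mu> {x \<in> cs z n. c < maxf n h' x}"
  proof (rule emeasure_mono)
    show "{x \<in> cs z n. 2 * c < maxf n h x} \<subseteq> {x \<in> cs z n. c < maxf n h' x}"
    proof
      fix x assume x: "x \<in> {x \<in> cs z n. 2 * c < maxf n h x}"
      then obtain k where k: "n \<le> k" "2 * c < avg h x k" unfolding less_maxf_iff[OF h hF] by blast
      then have "c < avg h' x k" using le[of x k] by simp
      then show "x \<in> {x \<in> cs z n. c < maxf n h' x}" using x k(1) less_maxf_iff[OF h'm h'F] by auto
    qed
  qed measurable
  also have "\<dots> = ennreal (1 / c) * (ennreal c * emeasure \<mu> {x \<in> cs z n. c < maxf n h' x})"
    using c by (simp add: mult.assoc[symmetric] ennreal_mult[symmetric])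
  also have "\<dots> \<le> ennreal (1 / c) * (\<integral>\<^sup>+x. ennreal (norm (h' x)) * indicator (cs z n) x \<partial>\<mu>)"
    by (intro mult_left_mono maximal_weak[OF h'm h'F c]) simp
  also have "\<dots> = (\<integral>\<^sup>+x. ennreal (1 / c) * (ennreal (norm (h' x)) * indicator (cs z n) x) \<partial>\<mu>)"
    by (rule nn_integral_cmult[symmetric]) measurable
  also have "\<dots> = (\<integral>\<^sup>+x. ennreal (if c < norm (h x) then norm (h x) / c else 0) * indicator (cs z n) x \<partial>\<mu>)"
    using c by (intro nn_integral_cong) (simp add: h'_def mult.assoc[symmetric] ennreal_mult[symmetric])
  finally show ?thesis .
qed

text \<open>\<open>min (F / 2 ^ i) t powr \<alpha>\<close> decreases in \<open>i\<close> and drops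
  by the fraction \<open>1 - 2 powr (- \<alpha>)\<close> at each index that counts. The sum
  telescopes, and the first such index need not be located.\<close>

lemma geometric_tail:
  fixes F t \<alpha> :: real
  assumes "0 < \<alpha>" "0 < F" "0 < t"
  shows "(\<Sum>i<N. if F / 2 ^ i < t then (F / 2 ^ i) powr \<alpha> else 0) \<le> t powr \<alpha> / (1 - 2 powr (- \<alpha>))"
proof -
  define \<phi> where "\<phi> i = (min (F / 2 ^ i) t) powr \<alpha>" for i :: nat
  define \<theta> where "\<theta> = (2 :: real) powr (- \<alpha>)"
  have \<theta>: "0 < \<theta>" "\<theta> < 1" unfolding \<theta>_def using assms by (auto simp: powr_less_one)
  have mono: "\<phi> (Suc i) \<le> \<phi> i" for i
    unfolding \<phi>_def using assms by (intro powr_mono2) (auto simp: min_def field_simps)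
  have step: "(1 - \<theta>) * (if F / 2 ^ i < t then (F / 2 ^ i) powr \<alpha> else 0) \<le> \<phi> i - \<phi> (Suc i)" for i
  proof (cases "F / 2 ^ i < t")
    case True
    have "F / 2 ^ Suc i \<le> F / 2 ^ i" using assms by (simp add: field_simps)
    then have m: "\<phi> i = (F / 2 ^ i) powr \<alpha>" "\<phi> (Suc i) = (F / 2 ^ Suc i) powr \<alpha>" using True by (auto simp: \<phi>_def min_def)
    have "F / 2 ^ Suc i = (F / 2 ^ i) * (1 / 2)" by simp
    then have "\<phi> (Suc i) = (F / 2 ^ i) powr \<alpha> * (1 / 2) powr \<alpha>" unfolding m using assms by (simp only: powr_mult)
    also have "(1 / 2 :: real) powr \<alpha> = \<theta>" by (simp add: \<theta>_def powr_minus powr_divide inverse_eq_divide)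
    finally show ?thesis using True m by (simp add: algebra_simps)
  next
    case False then show ?thesis using mono[of i] by simp
  qed
  have "(1 - \<theta>) * (\<Sum>i<N. if F / 2 ^ i < t then (F / 2 ^ i) powr \<alpha> else 0) \<le> (\<Sum>i<N. \<phi> i - \<phi> (Suc i))"
    unfolding sum_distrib_left by (rule sum_mono) (rule step)
  also have "\<dots> = \<phi> 0 - \<phi> N" by (rule sum_lessThan_telescope')
  also have "\<dots> \<le> \<phi> 0" by (simp add: \<phi>_def)
  also have "\<dots> \<le> t powr \<alpha>" unfolding \<phi>_def using assms by (intro powr_mono2) auto
  finally show ?thesis using \<theta> by (simp add: \<theta>_def[symmetric] field_simps)
qed

text \<open>Interpolation between the weak type bound and the trivial bound by the supremum, over
  dyadic levels descending from a bound of \<open>h\<close>. A point is charged to the first level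
  whose half is exceeded; after exchanging sum and integral the truncated levels form a geometric
  series. The bound \<open>F\<close> fixes where the levels start and does not enter the
  constant.\<close>

lemma maximal_Lr:
  fixes h :: "'a \<Rightarrow> 'b::{banach, second_countable_topology}"
  assumes r: "1 < r" and h [measurable]: "h \<in> borel_measurable \<mu>" and hF: "\<And>x. norm (h x) \<le> F"
  shows "(\<integral>\<^sup>+x. ennreal (maxf n h x powr r) * indicator (cs z n) x \<partial>\<mu>) \<le>
    ennreal (4 powr r / (1 - 2 powr (1 - r))) * (\<integral>\<^sup>+x. ennreal (norm (h x) powr r) * indicator (cs z n) x \<partial>\<mu>)"
proof -
  define F' where "F' = max F 1"
  have F': "0 < F'" "norm (h x) \<le> F'" for x using hF[of x] by (auto simp: F'_def)
  have hF': "\<And>x. norm (h x) \<le> F'" by (rule F'(2))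
  define e where "e i = F' / 2 ^ i" for i :: nat
  have e: "0 < e i" for i using F' by (simp add: e_def)
  have [measurable]: "maxf n h \<in> borel_measurable \<mu>" by (rule maxf_measurable[OF h hF])
  let ?Q = "cs z n"
  have pt: "ennreal (maxf n h x powr r) \<le> (\<Sum>i. ennreal (e i powr r) * indicator {x. e i / 2 < maxf n h x} x)" for x
  proof (cases "maxf n h x = 0")
    case False
    then have m0: "0 < maxf n h x" using maxf_nonneg[OF h hF, where n = n and x = x] by simp
    have "\<exists>i. e i / 2 < maxf n h x"
    proof -
      obtain i where "F' / maxf n h x < 2 ^ i" using real_arch_pow[of 2 "F' / maxf n h x"] by auto
      then have "e i < maxf n h x" using m0 by (simp add: e_def field_simps)
      then have "e i / 2 < maxf n h x" using e[of i] by simp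
      then show ?thesis by blast
    qed
    define i where "i = (LEAST i. e i / 2 < maxf n h x)"
    have i: "e i / 2 < maxf n h x" unfolding i_def by (rule LeastI_ex) fact
    have up: "maxf n h x \<le> e i"
    proof (cases i)
      case 0 then show ?thesis using maxf_le[OF h hF', where n = n and x = x] by (simp add: e_def)
    next
      case (Suc j)
      then have "j < i" by simp
      then have "\<not> e j / 2 < maxf n h x" unfolding i_def by (rule not_less_Least)
      then show ?thesis using Suc by (simp add: e_def)
    qed
    have "ennreal (maxf n h x powr r) \<le> ennreal (e i powr r) * indicator {x. e i / 2 < maxf n h x} x"
      using i up m0 r by (simp add: ennreal_leI powr_mono2)
    also have "\<dots> \<le> (\<Sum>i. ennreal (e i powr r) * indicator {x. e i / 2 < maxf n h x} x)"
    proof -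
      have "u i \<le> suminf u" for u :: "nat \<Rightarrow> ennreal" using sum_le_suminf[of u "{i}"] by simp
      then show ?thesis .
    qed
    finally show ?thesis .
  qed (use r in simp)
  \<comment> \<open>The superlevel set belongs to \<open>e i / 2\<close>, so the truncation takes
    place at half of that, \<open>e i / 4\<close>.\<close>
  define w where "w i x = (if e i / 4 < norm (h x) then norm (h x) / (e i / 4) else 0)" for i x
  have w0: "0 \<le> w i x" for i x using e[of i] by (simp add: w_def)
  have [measurable]: "w i \<in> borel_measurable \<mu>" for i unfolding w_def by measurable
  have "(\<integral>\<^sup>+x. ennreal (maxf n h x powr r) * indicator ?Q x \<partial>\<mu>) \<le>
      (\<integral>\<^sup>+x. (\<Sum>i. ennreal (e i powr r) * indicator {x \<in> ?Q. e i / 2 < maxf n h x} x) \<partial>\<mu>)"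
  proof (rule nn_integral_mono)
    fix x
    show "ennreal (maxf n h x powr r) * indicator ?Q x \<le> (\<Sum>i. ennreal (e i powr r) * indicator {x \<in> ?Q. e i / 2 < maxf n h x} x)"
      using pt[of x] by (cases "x \<in> ?Q") (simp_all add: indicator_def)
  qed
  also have "\<dots> = (\<Sum>i. ennreal (e i powr r) * emeasure \<mu> {x \<in> ?Q. e i / 2 < maxf n h x})"
    by (subst nn_integral_suminf) (simp_all add: nn_integral_cmult_indicator)
  also have "\<dots> \<le> (\<Sum>i. ennreal (e i powr r) * (\<integral>\<^sup>+x. ennreal (w i x) * indicator ?Q x \<partial>\<mu>))"
  proof (rule suminf_le)
    fix i
    show "ennreal (e i powr r) * emeasure \<mu> {x \<in> ?Q. e i / 2 < maxf n h x} \<le> ennreal (e i powr r) * (\<integral>\<^sup>+x. ennreal (w i x) * indicator ?Q x \<partial>\<mu>)"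
      using maximal_weak_truncated[OF h hF, of "e i / 4" z n] e[of i] unfolding w_def by (intro mult_left_mono) auto
  qed auto
  also have "\<dots> = (\<integral>\<^sup>+x. (\<Sum>i. ennreal (e i powr r) * (ennreal (w i x) * indicator ?Q x)) \<partial>\<mu>)"
    by (subst nn_integral_suminf) (simp_all add: nn_integral_cmult)
  also have "\<dots> \<le> (\<integral>\<^sup>+x. ennreal (4 powr r / (1 - 2 powr (1 - r))) * (ennreal (norm (h x) powr r) * indicator ?Q x) \<partial>\<mu>)"
  proof (rule nn_integral_mono)
    fix x
    have "(\<Sum>i. ennreal (e i powr r * w i x)) \<le> ennreal (4 powr r / (1 - 2 powr (1 - r)) * norm (h x) powr r)"
    proof (cases "h x = 0")
      case True
      then have "w i x = 0" for i using e[of i] by (simp add: w_def)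
      then show ?thesis by simp
    next
      case False
      then have t: "0 < norm (h x)" by simp
      have trm: "e i powr r * w i x = 4 * norm (h x) * (if F' / 2 ^ i < 4 * norm (h x) then (F' / 2 ^ i) powr (r - 1) else 0)" for i
      proof -
        have "e i powr r = e i * e i powr (r - 1)" using e[of i] by (simp add: powr_mult_base)
        then show ?thesis using e[of i] by (auto simp: w_def e_def[symmetric])
      qed
      have "(\<Sum>i<N. ennreal (e i powr r * w i x)) + 0 \<le> ennreal (4 powr r / (1 - 2 powr (1 - r)) * norm (h x) powr r)" for N
      proof -
        have "(\<Sum>i<N. e i powr r * w i x) = 4 * norm (h x) * (\<Sum>i<N. if F' / 2 ^ i < 4 * norm (h x) then (F' / 2 ^ i) powr (r - 1) else 0)"
          unfolding trm by (simp add: sum_distrib_left)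
        also have "\<dots> \<le> 4 * norm (h x) * ((4 * norm (h x)) powr (r - 1) / (1 - 2 powr (- (r - 1))))"
          using r t F' by (intro mult_left_mono geometric_tail) auto
        also have "\<dots> = (4 * norm (h x)) powr r / (1 - 2 powr (1 - r))"
          using t powr_mult_base[of "4 * norm (h x)" "r - 1"] by simp
        also have "\<dots> = 4 powr r / (1 - 2 powr (1 - r)) * norm (h x) powr r" by (simp add: powr_mult)
        finally have "ennreal (\<Sum>i<N. e i powr r * w i x) \<le> ennreal (4 powr r / (1 - 2 powr (1 - r)) * norm (h x) powr r)"
          by (rule ennreal_leI)
        then show ?thesis using w0 by (simp add: sum_ennreal)
      qed
      then have "(\<Sum>i. ennreal (e i powr r * w i x)) + 0 \<le> ennreal (4 powr r / (1 - 2 powr (1 - r)) * norm (h x) powr r)"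
        by (rule ennreal_suminf_bound_add)
      then show ?thesis by simp
    qed
    moreover have "0 \<le> 4 powr r / (1 - 2 powr (1 - r))"
      using r powr_less_one[of 2 "1 - r"] by simp
    ultimately have "(\<Sum>i. ennreal (e i powr r) * ennreal (w i x)) \<le> ennreal (4 powr r / (1 - 2 powr (1 - r))) * ennreal (norm (h x) powr r)"
      using w0 by (simp add: ennreal_mult[symmetric] del: times_divide_eq_left)
    then show "(\<Sum>i. ennreal (e i powr r) * (ennreal (w i x) * indicator ?Q x)) \<le>
        ennreal (4 powr r / (1 - 2 powr (1 - r))) * (ennreal (norm (h x) powr r) * indicator ?Q x)"
      by (cases "x \<in> ?Q") simp_all
  qed
  also have "\<dots> = ennreal (4 powr r / (1 - 2 powr (1 - r))) * (\<integral>\<^sup>+x. ennreal (norm (h x) powr r) * indicator ?Q x \<partial>\<mu>)"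
    by (rule nn_integral_cmult) measurable
  finally show ?thesis .
qed

end

section \<open>Bounds on Lebesgue spaces for test functions\<close>

text \<open>One compares \<open>y\<close> with \<open>(L * x) powr (p - 1)\<close>. A large
  \<open>L\<close> makes the second term small, which is what the absorption argument needs; sharp
  constants are irrelevant.\<close>

lemma young_split:
  fixes x y L p :: real
  assumes "0 \<le> x" "0 \<le> y" "1 < p" "0 < L"
  shows "x * y \<le> L powr (p - 1) * x powr p + y powr (p / (p - 1)) / L"
proof (cases "y \<le> (L * x) powr (p - 1)")
  case True
  then have "x * y \<le> x * (L * x) powr (p - 1)" using assms by (intro mult_left_mono) auto
  also have "\<dots> = L powr (p - 1) * (x * x powr (p - 1))" using assms by (simp add: powr_mult)
  also have "x * x powr (p - 1) = x powr p" using assms powr_mult_base[of x "p - 1"] by simp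
  finally show ?thesis using assms by (simp add: add_increasing2)
next
  case False
  then have "((L * x) powr (p - 1)) powr (1 / (p - 1)) \<le> y powr (1 / (p - 1))"
    using assms by (intro powr_mono2) auto
  then have "L * x \<le> y powr (1 / (p - 1))" using assms by (simp add: powr_powr)
  then have "x \<le> y powr (1 / (p - 1)) / L" using assms by (simp add: field_simps)
  then have "x * y \<le> y powr (1 / (p - 1)) / L * y" using assms by (intro mult_right_mono) auto
  also have "\<dots> = (y * y powr (1 / (p - 1))) / L" by simp
  also have "y * y powr (1 / (p - 1)) = y powr (p / (p - 1))"
    using assms powr_mult_base[of y "1 / (p - 1)"] by (simp add: field_simps)
  finally show ?thesis using assms by (simp add: add_increasing)
qed

text \<open>The product is controlled by the larger of the two powers. This takes the place of
  Hoelder's inequality; the resulting sum of norms becomes a product later by scaling.\<close>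

lemma product_powr_le:
  fixes x y p p1 p2 :: real
  assumes "0 \<le> x" "0 \<le> y" "0 < p" "0 < p1" "0 < p2" "1 / p = 1 / p1 + 1 / p2"
  shows "(x * y) powr p \<le> x powr p1 + y powr p2"
proof -
  have *: "(x * y) powr p \<le> y powr p2"
    if "0 \<le> x" "0 \<le> y" "0 < p1" "0 < p2" "1 / p = 1 / p1 + 1 / p2" "x powr p1 \<le> y powr p2" for x y p1 p2 :: real
  proof -
    have "(x powr p1) powr (1 / p1) \<le> (y powr p2) powr (1 / p1)" using that by (intro powr_mono2) auto
    then have "x \<le> y powr (p2 / p1)" using that by (simp add: powr_powr)
    then have "x * y \<le> y powr (p2 / p1) * y" using that by (intro mult_right_mono) auto
    also have "\<dots> = y powr (1 + p2 / p1)" using that powr_mult_base[of y "p2 / p1"] by (simp add: mult.commute)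
    finally have "(x * y) powr p \<le> (y powr (1 + p2 / p1)) powr p" using that assms by (intro powr_mono2) auto
    also have "\<dots> = y powr ((1 + p2 / p1) * p)" by (simp add: powr_powr)
    also have "(1 + p2 / p1) * p = p2 * (1 / p1 + 1 / p2) * p" using that by (simp add: field_simps)
    also have "\<dots> = p2 * (1 / p) * p" by (simp only: that(5))
    also have "\<dots> = p2" using assms(3) by simp
    finally show ?thesis .
  qed
  show ?thesis
  proof (cases "x powr p1 \<le> y powr p2")
    case True
    then have "(x * y) powr p \<le> y powr p2" using assms by (intro *) auto
    then show ?thesis by (simp add: add_increasing)
  next
    case False
    then have "(y * x) powr p \<le> x powr p1" using assms by (intro *[where ?p1.0 = p2]) auto
    then show ?thesis by (simp add: add_increasing2 mult.commute)
  qed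
qed

section \<open>Construction of the sparse majorants\<close>

context czo begin

text \<open>\<open>S\<close> is the sum of the bounds of the first \<open>N\<close> generations of cosets below \<open>Q\<close>, and \<open>Om\<close> the exceptional set left
  after them. The last clause is the sparse form tested against \<open>h\<close>: as every coset of the family keeps
  half of its measure outside the next generation, the sum over cosets is at most twice an integral of
  maximal functions.\<close>

definition sparse :: "real \<Rightarrow> ('a \<Rightarrow> complex) \<Rightarrow> ('a \<Rightarrow> complex) \<Rightarrow> int \<Rightarrow> real \<Rightarrow> nat \<Rightarrow> 'a set \<Rightarrow> ('a \<Rightarrow> real) \<Rightarrow> 'a set \<Rightarrow> bool" where
  "sparse A f g n0 D N Q S Om \<longleftrightarrow>
     S \<in> borel_measurable \<mu> \<and> (\<forall>x. 0 \<le> S x \<and> S x \<le> real N * D) \<and> (\<forall>x. x \<notin> Q \<longrightarrow> S x = 0) \<and>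
     Om \<in> sets \<mu> \<and> Om \<subseteq> Q \<and> emeasure \<mu> Om \<le> ennreal (measure \<mu> Q / 2 ^ N) \<and>
     (AE x in \<mu>. x \<in> Q - Om \<longrightarrow> norm (T (rs Q f) (rs Q g) x) \<le> S x) \<and>
     (\<forall>h::'a \<Rightarrow> real. h \<in> borel_measurable \<mu> \<and> (\<forall>x. 0 \<le> h x) \<and> (\<exists>H. \<forall>x. h x \<le> H) \<longrightarrow>
       (\<integral>\<^sup>+x. ennreal (S x * h x) * indicator Q x \<partial>\<mu>) \<le>
       (\<integral>\<^sup>+x. ennreal (2 * A * (maxf n0 f x * maxf n0 g x) * maxf n0 h x) * indicator Q x \<partial>\<mu>))"

text \<open>The family unfolds from the top: the step bound is applied to \<open>Q\<close>, the
  induction hypothesis inside every stopping coset, and the results are glued. The level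
  \<open>n0\<close> stays fixed, so all generations are measured by the same maximal
  functions.\<close>

lemma sparse_exists:
  assumes A: "0 < A" and step: "\<And>z n. \<exists>\<kappa> \<Omega>. step_bound A f g z n \<kappa> \<Omega>"
    and f: "f \<in> test" "\<And>x. norm (f x) \<le> F" and g: "g \<in> test" "\<And>x. norm (g x) \<le> F'"
  shows "n0 \<le> n \<Longrightarrow> \<exists>S Om. sparse A f g n0 (A * (F * F')) N (cs z n) S Om"
proof (induction N arbitrary: z n)
  case 0
  \<comment> \<open>With no generation the majorant is 0 and the whole coset is still
    exceptional.\<close>
  have "sparse A f g n0 (A * (F * F')) 0 (cs z n) (\<lambda>x. 0) (cs z n)"
    unfolding sparse_def by (auto simp: emeasure_coset measure_coset)
  then show ?case by blast
next
  case (Suc N)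
  let ?Q = "cs z n"
  let ?D = "A * (F * F')"
  have F0: "0 \<le> F" "0 \<le> F'" using f(2)[of z] g(2)[of z] norm_ge_zero[of "f z"] norm_ge_zero[of "g z"] by linarith+
  have fm: "f \<in> borel_measurable \<mu>" and gm: "g \<in> borel_measurable \<mu>" using f g by (auto intro: test_measurable)
  obtain \<kappa> \<Omega> where "step_bound A f g z n \<kappa> \<Omega>" using step by blast
  then have \<kappa>: "adapted \<kappa> \<Omega>" and OQ: "\<Omega> \<subseteq> ?Q" and nk: "\<And>x. x \<in> \<Omega> \<Longrightarrow> n < \<kappa> x"
    and Om: "emeasure \<mu> \<Omega> \<le> ennreal (vol n / 2)"
    and off: "\<And>x. x \<in> ?Q - \<Omega> \<Longrightarrow> norm (T (rs ?Q f) (rs ?Q g) x) \<le> A * (avg f z n * avg g z n)"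
    and on: "\<And>x. x \<in> \<Omega> \<Longrightarrow> AE y in \<mu>. y \<in> cs x (\<kappa> x) \<longrightarrow>
        norm (T (rs ?Q f) (rs ?Q g) y - T (rs (cs x (\<kappa> x)) f) (rs (cs x (\<kappa> x)) g) y) \<le> A * (avg f z n * avg g z n)"
    unfolding step_bound_def by blast+
  have "\<forall>P\<in>pieces \<kappa> \<Omega>. \<exists>so. sparse A f g n0 ?D N P (fst so) (snd so)"
  proof
    fix P assume "P \<in> pieces \<kappa> \<Omega>"
    then obtain x where x: "x \<in> \<Omega>" "P = cs x (\<kappa> x)" unfolding pieces_def by blast
    have "n0 \<le> \<kappa> x" using nk[OF x(1)] Suc.prems by simp
    then show "\<exists>so. sparse A f g n0 ?D N P (fst so) (snd so)" using Suc.IH[of "\<kappa> x" x] x by auto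
  qed
  then obtain so where so: "\<forall>P\<in>pieces \<kappa> \<Omega>. sparse A f g n0 ?D N P (fst (so P)) (snd (so P))" by metis
  define SS where "SS P = fst (so P)" for P
  define OB where "OB P = snd (so P)" for P
  have sp: "sparse A f g n0 ?D N (cs x (\<kappa> x)) (SS (cs x (\<kappa> x))) (OB (cs x (\<kappa> x)))" if "x \<in> \<Omega>" for x
  proof -
    have "cs x (\<kappa> x) \<in> pieces \<kappa> \<Omega>" unfolding pieces_def using that by (rule imageI)
    then show ?thesis unfolding SS_def OB_def by (rule bspec[OF so])
  qed
  have same: "y \<in> \<Omega>" "cs y (\<kappa> y) = cs x (\<kappa> x)" if "x \<in> \<Omega>" "y \<in> cs x (\<kappa> x)" for x y
  proof -
    have "y \<in> \<Omega> \<and> \<kappa> y = \<kappa> x" using \<kappa> that unfolding adapted_def by blast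
    then show "y \<in> \<Omega>" "cs y (\<kappa> y) = cs x (\<kappa> x)" using coset_eq[OF that(2)] by simp_all
  qed
  define c where "c = A * (avg f z n * avg g z n)"
  have c0: "0 \<le> c" unfolding c_def using A by (intro mult_nonneg_nonneg avg_nonneg) auto
  have cD: "c \<le> ?D" unfolding c_def using A F0 f g fm gm
    by (intro mult_left_mono mult_mono avg_bounded avg_nonneg) auto
  define S' where "S' x = (if x \<in> \<Omega> then SS (cs x (\<kappa> x)) x else 0)" for x
  define S where "S x = c * indicator ?Q x + S' x" for x
  define Om' where "Om' = {x \<in> \<Omega>. x \<in> OB (cs x (\<kappa> x))}"
  have S'm [measurable]: "S' \<in> borel_measurable \<mu>"
    unfolding S'_def
  proof (rule measurable_adapted[OF \<kappa>])
    fix x assume "x \<in> \<Omega>"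
    then show "SS (cs x (\<kappa> x)) \<in> borel_measurable \<mu>" using sp unfolding sparse_def by blast
  qed simp
  have "(\<lambda>x. if x \<in> \<Omega> then indicator (OB (cs x (\<kappa> x))) x else 0 :: real) \<in> borel_measurable \<mu>"
  proof (rule measurable_adapted[OF \<kappa>])
    fix x assume "x \<in> \<Omega>"
    then have "OB (cs x (\<kappa> x)) \<in> sets \<mu>" using sp unfolding sparse_def by blast
    then show "(\<lambda>y. indicator (OB (cs x (\<kappa> x))) y :: real) \<in> borel_measurable \<mu>" by (rule borel_measurable_indicator)
  qed simp
  then have "{x \<in> space \<mu>. (if x \<in> \<Omega> then indicator (OB (cs x (\<kappa> x))) x else 0 :: real) = 1} \<in> sets \<mu>" by measurable
  also have "{x \<in> space \<mu>. (if x \<in> \<Omega> then indicator (OB (cs x (\<kappa> x))) x else 0 :: real) = 1} = Om'"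
    unfolding Om'_def by (auto simp: indicator_def split: if_splits)
  finally have Om'm [measurable]: "Om' \<in> sets \<mu>" .
  have Obm [measurable]: "\<Omega> \<in> sets borel" by (rule adapted_borel[OF \<kappa>])
  have S'0: "0 \<le> S' x" "S' x \<le> real N * ?D" for x
    using sp[of x] A F0 unfolding S'_def sparse_def by auto
  have Om'le: "emeasure \<mu> Om' \<le> ennreal (vol n / 2 ^ Suc N)"
  proof -
    have "emeasure \<mu> Om' = (\<integral>\<^sup>+x. indicator Om' x * indicator \<Omega> x \<partial>\<mu>)"
      unfolding nn_integral_indicator[OF Om'm, symmetric]
      by (intro nn_integral_cong) (auto simp: Om'_def indicator_def)
    also have "\<dots> \<le> (\<integral>\<^sup>+x. ennreal (1 / 2 ^ N) * indicator \<Omega> x \<partial>\<mu>)"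
    proof (rule nn_integral_adapted_mono[OF \<kappa>])
      fix x assume x: "x \<in> \<Omega>"
      let ?P = "cs x (\<kappa> x)"
      have OP: "OB ?P \<in> sets \<mu>" "emeasure \<mu> (OB ?P) \<le> ennreal (measure \<mu> ?P / 2 ^ N)" using sp[OF x] unfolding sparse_def by blast+
      have "(\<integral>\<^sup>+y. indicator Om' y * indicator ?P y \<partial>\<mu>) \<le> (\<integral>\<^sup>+y. indicator (OB ?P) y \<partial>\<mu>)"
      proof (rule nn_integral_mono)
        fix y show "indicator Om' y * indicator ?P y \<le> (indicator (OB ?P) y :: ennreal)"
          using same[OF x, of y] by (auto simp: Om'_def indicator_def)
      qed
      also have "\<dots> \<le> ennreal (vol (\<kappa> x) / 2 ^ N)" using OP by (simp add: measure_coset)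
      also have "\<dots> = (\<integral>\<^sup>+y. ennreal (1 / 2 ^ N) * indicator ?P y \<partial>\<mu>)"
        by (simp add: nn_integral_cmult_indicator emeasure_coset ennreal_mult[symmetric] vol_nonneg)
      finally show "(\<integral>\<^sup>+y. indicator Om' y * indicator ?P y \<partial>\<mu>) \<le> (\<integral>\<^sup>+y. ennreal (1 / 2 ^ N) * indicator ?P y \<partial>\<mu>)" .
    qed measurable
    also have "\<dots> = ennreal (1 / 2 ^ N) * emeasure \<mu> \<Omega>" by (simp add: nn_integral_cmult_indicator)
    also have "\<dots> \<le> ennreal (1 / 2 ^ N) * ennreal (vol n / 2)" by (intro mult_left_mono Om) simp
    also have "\<dots> = ennreal (vol n / 2 ^ Suc N)" by (simp add: ennreal_mult[symmetric] vol_nonneg mult.commute)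
    finally show ?thesis .
  qed
  have bound: "AE x in \<mu>. x \<in> ?Q - Om' \<longrightarrow> norm (T (rs ?Q f) (rs ?Q g) x) \<le> S x"
  proof -
    have "AE y in \<mu>. y \<in> \<Omega> \<longrightarrow> (y \<notin> Om' \<longrightarrow> norm (T (rs ?Q f) (rs ?Q g) y) \<le> S y)"
    proof (rule AE_adapted[OF \<kappa>])
      fix x assume x: "x \<in> \<Omega>"
      let ?P = "cs x (\<kappa> x)"
      have "AE y in \<mu>. y \<in> ?P - OB ?P \<longrightarrow> norm (T (rs ?P f) (rs ?P g) y) \<le> SS ?P y"
        using sp[OF x] unfolding sparse_def by blast
      then show "AE y in \<mu>. y \<in> ?P \<longrightarrow> (y \<notin> Om' \<longrightarrow> norm (T (rs ?Q f) (rs ?Q g) y) \<le> S y)"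
        using on[OF x]
      proof eventually_elim
        case (elim y)
        show ?case
        proof (intro impI)
          assume y: "y \<in> ?P" "y \<notin> Om'"
          have yO: "y \<in> \<Omega>" "cs y (\<kappa> y) = ?P" using same[OF x y(1)] by auto
          then have "y \<notin> OB ?P" using y(2) by (simp add: Om'_def)
          then have "norm (T (rs ?P f) (rs ?P g) y) \<le> SS ?P y" using elim(1) y(1) by blast
          moreover have "norm (T (rs ?Q f) (rs ?Q g) y - T (rs ?P f) (rs ?P g) y) \<le> c" using elim(2) y(1) unfolding c_def by blast
          ultimately have "norm (T (rs ?Q f) (rs ?Q g) y) \<le> c + SS ?P y"
            using norm_triangle_ineq[of "T (rs ?Q f) (rs ?Q g) y - T (rs ?P f) (rs ?P g) y" "T (rs ?P f) (rs ?P g) y"] by simp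
          moreover have "y \<in> ?Q" using yO(1) OQ by blast
          ultimately show "norm (T (rs ?Q f) (rs ?Q g) y) \<le> S y" using yO by (simp add: S_def S'_def)
        qed
      qed
    qed
    then show ?thesis
    proof eventually_elim
      case (elim x)
      show ?case
      proof
        assume x: "x \<in> ?Q - Om'"
        show "norm (T (rs ?Q f) (rs ?Q g) x) \<le> S x"
        proof (cases "x \<in> \<Omega>")
          case True then show ?thesis using elim x by blast
        next
          case False
          then have "norm (T (rs ?Q f) (rs ?Q g) x) \<le> c" using off[of x] x unfolding c_def by blast
          then show ?thesis using x S'0(1)[of x] by (simp add: S_def)
        qed
      qed
    qed
  qed
  have dual: "(\<integral>\<^sup>+x. ennreal (S x * h x) * indicator ?Q x \<partial>\<mu>) \<le>
       (\<integral>\<^sup>+x. ennreal (2 * A * (maxf n0 f x * maxf n0 g x) * maxf n0 h x) * indicator ?Q x \<partial>\<mu>)"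
    if hm [measurable]: "h \<in> borel_measurable \<mu>" and h0: "\<And>x. 0 \<le> h x" and hH: "\<And>x. h x \<le> H" for h :: "'a \<Rightarrow> real" and H
  proof -
    have hn: "norm (h x) \<le> H" for x using h0[of x] hH[of x] by simp
    define R where "R x = ennreal (2 * A * (maxf n0 f x * maxf n0 g x) * maxf n0 h x)" for x
    have [measurable]: "maxf n0 f \<in> borel_measurable \<mu>" "maxf n0 g \<in> borel_measurable \<mu>" "maxf n0 h \<in> borel_measurable \<mu>"
      by (rule maxf_measurable[OF fm f(2)], rule maxf_measurable[OF gm g(2)], rule maxf_measurable[OF hm hn])
    have Rm [measurable]: "R \<in> borel_measurable \<mu>" unfolding R_def by measurable
    have "(\<integral>\<^sup>+x. ennreal (S' x * h x) * indicator \<Omega> x \<partial>\<mu>) \<le> (\<integral>\<^sup>+x. R x * indicator \<Omega> x \<partial>\<mu>)"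
    proof (rule nn_integral_adapted_mono[OF \<kappa> _ Rm])
      fix x assume x: "x \<in> \<Omega>"
      let ?P = "cs x (\<kappa> x)"
      have "(\<integral>\<^sup>+y. ennreal (S' y * h y) * indicator ?P y \<partial>\<mu>) = (\<integral>\<^sup>+y. ennreal (SS ?P y * h y) * indicator ?P y \<partial>\<mu>)"
      proof (rule nn_integral_cong)
        fix y show "ennreal (S' y * h y) * indicator ?P y = ennreal (SS ?P y * h y) * indicator ?P y"
          using same[OF x, of y] by (cases "y \<in> ?P") (simp_all add: S'_def)
      qed
      also have "\<dots> \<le> (\<integral>\<^sup>+y. R y * indicator ?P y \<partial>\<mu>)"
        using sp[OF x] hm h0 hH unfolding sparse_def R_def by blast
      finally show "(\<integral>\<^sup>+y. ennreal (S' y * h y) * indicator ?P y \<partial>\<mu>) \<le> (\<integral>\<^sup>+y. R y * indicator ?P y \<partial>\<mu>)" .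
    qed measurable
    \<comment> \<open>The new constant \<open>c\<close> is charged to \<open>?Q - \<Omega>\<close>,
      which has at least half of the measure of \<open>?Q\<close>, whence the factor 2. The deeper
      generations are charged to \<open>\<Omega>\<close>, so no part of the right-hand integral is
      used twice.\<close>
    moreover have "(\<integral>\<^sup>+x. ennreal (c * h x) * indicator ?Q x \<partial>\<mu>) \<le> (\<integral>\<^sup>+x. R x * indicator (?Q - \<Omega>) x \<partial>\<mu>)"
    proof -
      define ah where "ah = avg h z n"
      have ah: "0 \<le> ah" by (simp add: ah_def avg_nonneg)
      have "(\<integral>\<^sup>+x. ennreal (c * h x) * indicator ?Q x \<partial>\<mu>) = (\<integral>\<^sup>+x. ennreal c * (ennreal (norm (h x)) * indicator ?Q x) \<partial>\<mu>)"
        using h0 c0 by (intro nn_integral_cong) (simp add: ennreal_mult mult.assoc)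
      also have "\<dots> = ennreal c * ennreal (vol n * ah)"
        unfolding ah_def nn_avg[OF bounded_locint[OF hm hn], symmetric] by (rule nn_integral_cmult) measurable
      also have "\<dots> = ennreal (2 * c * ah) * ennreal (vol n / 2)"
        using c0 ah vol_nonneg[of n] by (simp add: ennreal_mult[symmetric] mult_ac)
      also have "ennreal (vol n / 2) \<le> emeasure \<mu> (?Q - \<Omega>)"
      proof -
        have "ennreal (vol n / 2) = ennreal (vol n) - ennreal (vol n / 2)"
          using ennreal_minus[of "vol n / 2" "vol n"] vol_nonneg[of n] by simp
        also have "\<dots> \<le> emeasure \<mu> ?Q - emeasure \<mu> \<Omega>"
          unfolding emeasure_coset by (rule ennreal_mono_minus[OF Om])
        also have "\<dots> = emeasure \<mu> (?Q - \<Omega>)"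
          by (rule emeasure_Diff[symmetric]) (use Om OQ top.extremum_strict in \<open>auto simp: top_unique\<close>)
        finally show ?thesis .
      qed
      also have "ennreal (2 * c * ah) * emeasure \<mu> (?Q - \<Omega>) = (\<integral>\<^sup>+x. ennreal (2 * c * ah) * indicator (?Q - \<Omega>) x \<partial>\<mu>)"
        by (simp add: nn_integral_cmult_indicator)
      also have "\<dots> \<le> (\<integral>\<^sup>+x. R x * indicator (?Q - \<Omega>) x \<partial>\<mu>)"
      proof (rule nn_integral_mono)
        fix x
        show "ennreal (2 * c * ah) * indicator (?Q - \<Omega>) x \<le> R x * indicator (?Q - \<Omega>) x"
        proof (cases "x \<in> ?Q - \<Omega>")
          case True
          then have xQ: "x \<in> ?Q" by simp
          have m: "avg f z n \<le> maxf n0 f x" "avg g z n \<le> maxf n0 g x" "ah \<le> maxf n0 h x"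
            using avg_le_maxf[OF fm f(2) Suc.prems, of x] avg_le_maxf[OF gm g(2) Suc.prems, of x] avg_le_maxf[OF hm hn Suc.prems, of x]
            unfolding ah_def avg_coset[OF xQ] by auto
          have "2 * c * ah = 2 * A * (avg f z n * avg g z n) * ah" by (simp add: c_def)
          also have "\<dots> \<le> 2 * A * (maxf n0 f x * maxf n0 g x) * maxf n0 h x"
            using A ah by (intro mult_mono m mult_nonneg_nonneg maxf_nonneg[OF fm f(2)] maxf_nonneg[OF gm g(2)] avg_nonneg) auto
          finally show ?thesis unfolding R_def by (intro mult_right_mono ennreal_leI) auto
        qed simp
      qed
      finally show ?thesis by (simp add: mult_left_mono)
    qed
    moreover have "(\<integral>\<^sup>+x. ennreal (S x * h x) * indicator ?Q x \<partial>\<mu>) =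
        (\<integral>\<^sup>+x. ennreal (c * h x) * indicator ?Q x \<partial>\<mu>) + (\<integral>\<^sup>+x. ennreal (S' x * h x) * indicator \<Omega> x \<partial>\<mu>)"
    proof (subst nn_integral_add[symmetric])
      show "(\<integral>\<^sup>+x. ennreal (S x * h x) * indicator ?Q x \<partial>\<mu>) =
        (\<integral>\<^sup>+x. ennreal (c * h x) * indicator ?Q x + ennreal (S' x * h x) * indicator \<Omega> x \<partial>\<mu>)"
      proof (rule nn_integral_cong)
        fix x
        have "x \<notin> \<Omega> \<Longrightarrow> S' x = 0" "x \<in> \<Omega> \<Longrightarrow> x \<in> ?Q" using OQ by (auto simp: S'_def)
        then show "ennreal (S x * h x) * indicator ?Q x = ennreal (c * h x) * indicator ?Q x + ennreal (S' x * h x) * indicator \<Omega> x"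
          using c0 h0[of x] S'0(1)[of x]
          by (cases "x \<in> ?Q"; cases "x \<in> \<Omega>") (auto simp: S_def distrib_right ennreal_plus)
      qed
    qed measurable
    moreover have "(\<integral>\<^sup>+x. R x * indicator ?Q x \<partial>\<mu>) = (\<integral>\<^sup>+x. R x * indicator (?Q - \<Omega>) x \<partial>\<mu>) + (\<integral>\<^sup>+x. R x * indicator \<Omega> x \<partial>\<mu>)"
    proof (subst nn_integral_add[symmetric])
      show "(\<integral>\<^sup>+x. R x * indicator ?Q x \<partial>\<mu>) = (\<integral>\<^sup>+x. R x * indicator (?Q - \<Omega>) x + R x * indicator \<Omega> x \<partial>\<mu>)"
        using OQ by (intro nn_integral_cong) (auto simp: indicator_def)
    qed measurable
    ultimately show ?thesis unfolding R_def by (simp add: add_mono)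
  qed
  have "sparse A f g n0 ?D (Suc N) ?Q S Om'"
    unfolding sparse_def
  proof (intro conjI allI impI bound Om'm)
    show "S \<in> borel_measurable \<mu>" unfolding S_def by measurable
    show "0 \<le> S x" for x using c0 S'0(1)[of x] by (simp add: S_def)
    show "S x \<le> real (Suc N) * ?D" for x
    proof -
      have "c * indicator ?Q x \<le> ?D" using c0 cD by (auto simp: indicator_def)
      then show ?thesis using S'0(2)[of x] unfolding S_def by (simp add: distrib_right add_mono)
    qed
    show "S x = 0" if "x \<notin> ?Q" for x using that OQ by (auto simp: S_def S'_def)
    show "Om' \<subseteq> ?Q" using OQ by (auto simp: Om'_def)
    show "emeasure \<mu> Om' \<le> ennreal (measure \<mu> ?Q / 2 ^ Suc N)" using Om'le by (simp add: measure_coset)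
  qed (use dual in blast)
  then show ?case by blast
qed

end

text \<open>Fatou's lemma, so the sets \<open>E m\<close> need not increase: it is enough that
  almost every point lies in all of them from some index on.\<close>

lemma nn_integral_le_exhaust:
  assumes [measurable]: "u \<in> borel_measurable M" "\<And>m. E m \<in> sets M"
    and ev: "AE x in M. eventually (\<lambda>m::nat. x \<in> E m) sequentially"
    and bd: "\<And>m. start \<le> m \<Longrightarrow> (\<integral>\<^sup>+x. u x * indicator (E m) x \<partial>M) \<le> R"
  shows "(\<integral>\<^sup>+x. u x \<partial>M) \<le> R"
proof -
  have "(\<integral>\<^sup>+x. u x \<partial>M) \<le> (\<integral>\<^sup>+x. liminf (\<lambda>m. u x * indicator (E m) x) \<partial>M)"
  proof (rule nn_integral_mono_AE)
    show "AE x in M. u x \<le> liminf (\<lambda>m. u x * indicator (E m) x)"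
      using ev
    proof eventually_elim
      case (elim x)
      have "(\<lambda>m. u x * indicator (E m) x) \<longlonglongrightarrow> u x"
        by (rule tendsto_eventually) (use elim in \<open>auto elim!: eventually_mono\<close>)
      then have "liminf (\<lambda>m. u x * indicator (E m) x) = u x" by (intro lim_imp_Liminf) simp
      then show ?case by simp
    qed
  qed
  also have "\<dots> \<le> liminf (\<lambda>m. \<integral>\<^sup>+x. u x * indicator (E m) x \<partial>M)"
    by (rule nn_integral_liminf) measurable
  also have "\<dots> \<le> liminf (\<lambda>m. R)"
    by (rule Liminf_mono) (use bd in \<open>auto simp: eventually_sequentially\<close>)
  also have "\<dots> = R" by (simp add: Liminf_const)
  finally show ?thesis .
qed

context vilenkin_haar begin

lemma Np_cong_AE: "AE x in \<mu>. f x = g x \<Longrightarrow> Np p f = Np p g"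
  unfolding Np_def by (rule nn_integral_cong_AE) auto

lemma Np_cmult:
  assumes [measurable]: "f \<in> borel_measurable \<mu>"
  shows "Np p (\<lambda>x. c * f x) = ennreal (norm c powr p) * Np p f"
proof -
  have "Np p (\<lambda>x. c * f x) = (\<integral>\<^sup>+x. ennreal (norm c powr p) * ennreal (norm (f x) powr p) \<partial>\<mu>)"
    unfolding Np_def by (rule nn_integral_cong) (simp add: norm_mult powr_mult ennreal_mult)
  then show ?thesis unfolding Np_def by (simp add: nn_integral_cmult)
qed

lemma eventually_big_coset: "eventually (\<lambda>m. x \<in> cs 0 (- int m)) sequentially"
proof -
  obtain k where k: "k \<le> 0" "x \<in> cs 0 k" by (rule big_coset)
  have "x \<in> cs 0 (- int m)" if "nat (- k) \<le> m" for m
  proof -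
    have "- int m \<le> k" using that by linarith
    then show ?thesis using k(2) coset_mono by blast
  qed
  then show ?thesis unfolding eventually_sequentially by blast
qed

lemma test_rs_big:
  assumes "f \<in> test"
  shows "eventually (\<lambda>m. rs (cs 0 (- int m)) f = f) sequentially"
proof -
  obtain k where k: "\<And>x. x \<notin> cs 0 k \<Longrightarrow> f x = 0" by (rule testE[OF assms]) blast
  have "rs (cs 0 (- int m)) f = f" if "nat (- k) \<le> m" for m
  proof
    fix x
    have "cs 0 k \<subseteq> cs 0 (- int m)" by (rule coset_mono) (use that in linarith)
    then show "rs (cs 0 (- int m)) f x = f x" using k[of x] by (cases "x \<in> cs 0 (- int m)") auto
  qed
  then show ?thesis unfolding eventually_sequentially by blast
qed

end

lemma ennreal_absorb_half:
  assumes "I \<le> X + ennreal (1 / 2) * I" "I < \<infinity>"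
  shows "I \<le> 2 * X"
proof (cases X)
  case (real x)
  obtain i where i: "0 \<le> i" "I = ennreal i" using assms(2) by (cases I) auto
  have "ennreal (1 / 2) * ennreal i = ennreal (1 / 2 * i)" by (rule ennreal_mult[symmetric]) (use i in auto)
  moreover have "ennreal x + ennreal (1 / 2 * i) = ennreal (x + 1 / 2 * i)" by (rule ennreal_plus[symmetric]) (use i real in auto)
  ultimately have "ennreal i \<le> ennreal (x + 1 / 2 * i)" using assms(1) unfolding i(2) real(2) by simp
  then have "i \<le> x + 1 / 2 * i" using i real by (subst (asm) ennreal_le_iff) auto
  then have "ennreal i \<le> ennreal (2 * x)" by (intro ennreal_leI) simp
  then show ?thesis using i real by (simp add: ennreal_mult)
next
  case top
  then show ?thesis by simp
qed

section \<open>From sparse majorants to bounds for all exponents\<close>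

context czo begin

text \<open>The majorant \<open>S N\<close> is paired with \<open>S N powr (p - 1)\<close>, so the
  left side of the sparse inequality is the integral of \<open>S N powr p\<close>. Young's
  inequality and the maximal theorem bound the right side by the norms of \<open>f\<close> and
  \<open>g\<close> plus half of the same integral, since \<open>(p - 1) * p'\<close> equals
  \<open>p\<close>. That half is absorbed.\<close>

lemma Lp_test_local:
  assumes p: "1 < p" "1 < p1" "1 < p2" "1 / p = 1 / p1 + 1 / p2"
  shows "\<exists>D>0. \<forall>f\<in>test. \<forall>g\<in>test. \<forall>z n.
    (\<integral>\<^sup>+x. ennreal (norm (T (rs (cs z n) f) (rs (cs z n) g) x) powr p) * indicator (cs z n) x \<partial>\<mu>) \<le>
    ennreal D * ((\<integral>\<^sup>+x. ennreal (norm (f x) powr p1) * indicator (cs z n) x \<partial>\<mu>) +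
      (\<integral>\<^sup>+x. ennreal (norm (g x) powr p2) * indicator (cs z n) x \<partial>\<mu>))"
proof -
  obtain A where A: "0 < A" and step: "\<forall>f\<in>test. \<forall>g\<in>test. \<forall>z n. \<exists>\<kappa> \<Omega>. step_bound A f g z n \<kappa> \<Omega>"
    using step_bound_exists by blast
  define c where "c r = 4 powr r / (1 - 2 powr (1 - r))" for r :: real
  have c0: "0 < c r" if "1 < r" for r using that by (simp add: c_def powr_less_one)
  define p' where "p' = p / (p - 1)"
  have p': "1 < p'" unfolding p'_def using p by simp
  \<comment> \<open>Chosen so that the coefficient \<open>2 * A / L * c p'\<close> of the returning
    integral is exactly one half.\<close>
  define L where "L = 4 * A * c p'"
  have L: "0 < L" unfolding L_def using A c0[OF p'] by simp
  define D where "D = 2 * (2 * A * L powr (p - 1)) * (c p1 + c p2)"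
  have D: "0 < D" unfolding D_def using A L c0[OF p(2)] c0[OF p(3)] by (intro mult_pos_pos add_pos_pos) auto
  have main: "(\<integral>\<^sup>+x. ennreal (norm (T (rs (cs z n) f) (rs (cs z n) g) x) powr p) * indicator (cs z n) x \<partial>\<mu>) \<le>
    ennreal D * ((\<integral>\<^sup>+x. ennreal (norm (f x) powr p1) * indicator (cs z n) x \<partial>\<mu>) +
      (\<integral>\<^sup>+x. ennreal (norm (g x) powr p2) * indicator (cs z n) x \<partial>\<mu>))" (is "_ \<le> ennreal D * (?If + ?Ig)")
    if f: "f \<in> test" and g: "g \<in> test" for f g z n
  proof -
    let ?Q = "cs z n"
    let ?TQ = "T (rs ?Q f) (rs ?Q g)"
    obtain F where F: "0 < F" "\<And>x. norm (f x) \<le> F" by (rule test_bounded[OF f]) blast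
    obtain F' where F': "0 < F'" "\<And>x. norm (g x) \<le> F'" by (rule test_bounded[OF g]) blast
    have fm [measurable]: "f \<in> borel_measurable \<mu>" and gm [measurable]: "g \<in> borel_measurable \<mu>" using f g by (auto intro: test_measurable)
    have TQm [measurable]: "?TQ \<in> borel_measurable \<mu>" by (intro T_measurable test_rs f g)
    have Mfm [measurable]: "maxf n f \<in> borel_measurable \<mu>" by (rule maxf_measurable[OF fm F(2)])
    have Mgm [measurable]: "maxf n g \<in> borel_measurable \<mu>" by (rule maxf_measurable[OF gm F'(2)])
    have "\<forall>N. \<exists>so. sparse A f g n (A * (F * F')) N ?Q (fst so) (snd so)"
    proof
      fix N
      have "\<exists>S Om. sparse A f g n (A * (F * F')) N ?Q S Om"
        by (rule sparse_exists[OF A _ f F(2) g F'(2) order_refl]) (use step f g in blast)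
      then show "\<exists>so. sparse A f g n (A * (F * F')) N ?Q (fst so) (snd so)" by auto
    qed
    then obtain so where so: "\<forall>N. sparse A f g n (A * (F * F')) N ?Q (fst (so N)) (snd (so N))" by (rule choice[THEN exE])
    define S where "S N = fst (so N)" for N
    define Om where "Om N = snd (so N)" for N
    have sp: "sparse A f g n (A * (F * F')) N ?Q (S N) (Om N)" for N
      unfolding S_def Om_def using so by (rule spec)
    define W where "W x = maxf n f x * maxf n g x" for x
    have W0: "0 \<le> W x" for x unfolding W_def by (intro mult_nonneg_nonneg maxf_nonneg[OF fm F(2)] maxf_nonneg[OF gm F'(2)])
    have Wm [measurable]: "W \<in> borel_measurable \<mu>" unfolding W_def by measurable
    define R where "R = ennreal D * (?If + ?Ig)"
    have WI: "(\<integral>\<^sup>+x. ennreal (W x powr p) * indicator ?Q x \<partial>\<mu>) \<le> ennreal (c p1 + c p2) * (?If + ?Ig)"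
    proof -
      have "(\<integral>\<^sup>+x. ennreal (W x powr p) * indicator ?Q x \<partial>\<mu>) \<le>
        (\<integral>\<^sup>+x. ennreal (maxf n f x powr p1) * indicator ?Q x + ennreal (maxf n g x powr p2) * indicator ?Q x \<partial>\<mu>)"
      proof (rule nn_integral_mono)
        fix x
        have "W x powr p \<le> maxf n f x powr p1 + maxf n g x powr p2"
          unfolding W_def using p
          by (intro product_powr_le maxf_nonneg[OF fm F(2)] maxf_nonneg[OF gm F'(2)]) auto
        then have "ennreal (W x powr p) \<le> ennreal (maxf n f x powr p1) + ennreal (maxf n g x powr p2)"
          by (simp add: ennreal_plus[symmetric] ennreal_leI del: ennreal_plus)
        then show "ennreal (W x powr p) * indicator ?Q x \<le> ennreal (maxf n f x powr p1) * indicator ?Q x + ennreal (maxf n g x powr p2) * indicator ?Q x"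
          by (cases "x \<in> ?Q") simp_all
      qed
      also have "\<dots> = (\<integral>\<^sup>+x. ennreal (maxf n f x powr p1) * indicator ?Q x \<partial>\<mu>) + (\<integral>\<^sup>+x. ennreal (maxf n g x powr p2) * indicator ?Q x \<partial>\<mu>)"
        by (rule nn_integral_add) measurable
      also have "\<dots> \<le> ennreal (c p1) * ?If + ennreal (c p2) * ?Ig"
        unfolding c_def by (intro add_mono maximal_Lr[OF p(2) fm F(2)] maximal_Lr[OF p(3) gm F'(2)])
      also have "\<dots> \<le> ennreal (c p1 + c p2) * ?If + ennreal (c p1 + c p2) * ?Ig"
        using c0[OF p(2)] c0[OF p(3)] by (intro add_mono mult_right_mono ennreal_leI) auto
      finally show ?thesis by (simp add: distrib_left)
    qed
    have SN: "(\<integral>\<^sup>+x. ennreal (S N x powr p) * indicator ?Q x \<partial>\<mu>) \<le> R" for N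
    proof -
      have Sm [measurable]: "S N \<in> borel_measurable \<mu>" and S0: "\<And>x. 0 \<le> S N x" and SD: "\<And>x. S N x \<le> real N * (A * (F * F'))"
        using sp[of N] unfolding sparse_def by auto
      define h where "h x = S N x powr (p - 1)" for x
      have hm [measurable]: "h \<in> borel_measurable \<mu>" unfolding h_def by measurable
      have h0: "0 \<le> h x" for x by (simp add: h_def)
      have hH: "h x \<le> (real N * (A * (F * F'))) powr (p - 1)" for x
        unfolding h_def using p S0 SD by (intro powr_mono2) auto
      have hn: "norm (h x) \<le> (real N * (A * (F * F'))) powr (p - 1)" for x using h0 hH by simp
      have Mhm [measurable]: "maxf n h \<in> borel_measurable \<mu>" by (rule maxf_measurable[OF hm hn])
      have Mh0: "0 \<le> maxf n h x" for x by (rule maxf_nonneg[OF hm hn])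
      define I where "I = (\<integral>\<^sup>+x. ennreal (S N x powr p) * indicator ?Q x \<partial>\<mu>)"
      have "I = (\<integral>\<^sup>+x. ennreal (S N x * h x) * indicator ?Q x \<partial>\<mu>)"
        unfolding I_def h_def using S0 by (simp add: powr_mult_base)
      also have "\<dots> \<le> (\<integral>\<^sup>+x. ennreal (2 * A * (maxf n f x * maxf n g x) * maxf n h x) * indicator ?Q x \<partial>\<mu>)"
        using sp[of N] hm h0 hH unfolding sparse_def by blast
      also have "\<dots> \<le> (\<integral>\<^sup>+x. ennreal (2 * A * L powr (p - 1)) * (ennreal (W x powr p) * indicator ?Q x) +
          ennreal (2 * A / L) * (ennreal (maxf n h x powr p') * indicator ?Q x) \<partial>\<mu>)"
      proof (rule nn_integral_mono)
        fix x
        have "2 * A * (W x * maxf n h x) \<le> 2 * A * (L powr (p - 1) * W x powr p + maxf n h x powr p' / L)"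
          unfolding p'_def using A by (intro mult_left_mono young_split W0 Mh0 p L) auto
        then have "ennreal (2 * A * (maxf n f x * maxf n g x) * maxf n h x) \<le>
          ennreal ((2 * A * L powr (p - 1)) * W x powr p + (2 * A / L) * maxf n h x powr p')"
          by (intro ennreal_leI) (simp add: W_def algebra_simps)
        also have "\<dots> = ennreal (2 * A * L powr (p - 1)) * ennreal (W x powr p) + ennreal (2 * A / L) * ennreal (maxf n h x powr p')"
          using A L by (subst ennreal_plus) (simp_all only: ennreal_mult[symmetric] powr_ge_zero mult_nonneg_nonneg less_imp_le divide_nonneg_nonneg zero_le_numeral)
        finally show "ennreal (2 * A * (maxf n f x * maxf n g x) * maxf n h x) * indicator ?Q x \<le>
          ennreal (2 * A * L powr (p - 1)) * (ennreal (W x powr p) * indicator ?Q x) + ennreal (2 * A / L) * (ennreal (maxf n h x powr p') * indicator ?Q x)"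
          by (cases "x \<in> ?Q") simp_all
      qed
      also have "\<dots> = ennreal (2 * A * L powr (p - 1)) * (\<integral>\<^sup>+x. ennreal (W x powr p) * indicator ?Q x \<partial>\<mu>) +
          ennreal (2 * A / L) * (\<integral>\<^sup>+x. ennreal (maxf n h x powr p') * indicator ?Q x \<partial>\<mu>)"
        by (simp add: nn_integral_add nn_integral_cmult)
      also have "\<dots> \<le> ennreal (2 * A * L powr (p - 1)) * (ennreal (c p1 + c p2) * (?If + ?Ig)) +
          ennreal (2 * A / L) * (ennreal (c p') * I)"
      proof (intro add_mono mult_left_mono WI)
        have "(\<integral>\<^sup>+x. ennreal (maxf n h x powr p') * indicator ?Q x \<partial>\<mu>) \<le> ennreal (c p') * (\<integral>\<^sup>+x. ennreal (norm (h x) powr p') * indicator ?Q x \<partial>\<mu>)"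
          unfolding c_def by (rule maximal_Lr[OF p' hm hn])
        also have "(\<integral>\<^sup>+x. ennreal (norm (h x) powr p') * indicator ?Q x \<partial>\<mu>) = I"
          unfolding I_def h_def p'_def using p by (simp add: powr_powr)
        finally show "(\<integral>\<^sup>+x. ennreal (maxf n h x powr p') * indicator ?Q x \<partial>\<mu>) \<le> ennreal (c p') * I" .
      qed auto
      also have "ennreal (2 * A / L) * (ennreal (c p') * I) = ennreal (1 / 2) * I"
      proof -
        have "ennreal (2 * A / L) * ennreal (c p') = ennreal (2 * A / L * c p')"
          using A L c0[OF p'] by (intro ennreal_mult[symmetric]) auto
        also have "2 * A / L * c p' = 1 / 2" using A c0[OF p'] by (simp add: L_def)
        finally show ?thesis by (simp add: mult.assoc[symmetric])
      qed
      finally have "I \<le> ennreal (2 * A * L powr (p - 1)) * (ennreal (c p1 + c p2) * (?If + ?Ig)) + ennreal (1 / 2) * I" .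
      \<comment> \<open>The absorption subtracts \<open>I / 2\<close>, which requires a finite
        \<open>I\<close>. It is finite because finitely many generations give a bounded majorant on
        a coset of finite measure; this bound depends on \<open>N\<close>, the resulting estimate
        does not.\<close>
      moreover have "I < \<infinity>"
      proof -
        have "I \<le> (\<integral>\<^sup>+x. ennreal ((real N * (A * (F * F'))) powr p) * indicator ?Q x \<partial>\<mu>)"
          unfolding I_def using S0 SD p by (intro nn_integral_mono mult_right_mono ennreal_leI powr_mono2) auto
        also have "\<dots> < \<infinity>" by (simp add: nn_integral_cmult_indicator emeasure_coset ennreal_mult_less_top)
        finally show ?thesis .
      qed
      ultimately have "I \<le> 2 * (ennreal (2 * A * L powr (p - 1)) * (ennreal (c p1 + c p2) * (?If + ?Ig)))"
        by (rule ennreal_absorb_half)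
      also have "\<dots> = (ennreal 2 * ennreal (2 * A * L powr (p - 1)) * ennreal (c p1 + c p2)) * (?If + ?Ig)"
        by (simp add: mult.assoc)
      also have "ennreal 2 * ennreal (2 * A * L powr (p - 1)) * ennreal (c p1 + c p2) = ennreal D"
        unfolding D_def using A L c0[OF p(2)] c0[OF p(3)] by (simp only: ennreal_mult[symmetric] mult_nonneg_nonneg powr_ge_zero less_imp_le add_nonneg_nonneg zero_le_numeral)
      finally show ?thesis unfolding I_def R_def .
    qed
    have "(\<integral>\<^sup>+x. ennreal (norm (?TQ x) powr p) * indicator ?Q x \<partial>\<mu>) \<le> R"
    \<comment> \<open>The exceptional sets are chosen separately for each \<open>N\<close> and need
      not be nested. Their measures are summable, so by Borel-Cantelli almost every point eventually
      avoids them.\<close>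
    proof (rule nn_integral_le_exhaust[where E = "\<lambda>N. - Om N" and start = 0])
      have Omm: "Om N \<in> sets \<mu>" "Om N \<subseteq> ?Q" "emeasure \<mu> (Om N) \<le> ennreal (vol n / 2 ^ N)" for N
        using sp[of N] unfolding sparse_def by (auto simp: measure_coset)
      then show "- Om N \<in> sets \<mu>" for N by (metis sets.compl_sets space_mu Compl_eq_Diff_UNIV)
      have fin: "emeasure \<mu> (Om N) < \<infinity>" for N using Omm(3)[of N] by (rule order_le_less_trans) simp
      have ms: "measure \<mu> (Om N) \<le> vol n * (1 / 2) ^ N" for N
      proof -
        have "ennreal (measure \<mu> (Om N)) \<le> ennreal (vol n / 2 ^ N)"
          using Omm(3)[of N] fin[of N] by (simp add: emeasure_eq_ennreal_measure)
        then show ?thesis using vol_nonneg[of n] by (simp add: power_one_over)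
      qed
      have "summable (\<lambda>N. measure \<mu> (Om N))"
      proof (rule summable_comparison_test'[of _ 0])
        show "summable (\<lambda>N. vol n * (1 / 2) ^ N)" by (intro summable_mult summable_geometric) simp
        show "norm (measure \<mu> (Om N)) \<le> vol n * (1 / 2) ^ N" if "0 \<le> N" for N using ms[of N] by simp
      qed
      then have "AE x in \<mu>. eventually (\<lambda>N. x \<in> space \<mu> - Om N) sequentially"
        by (intro borel_cantelli_AE1 Omm fin)
      then show "AE x in \<mu>. eventually (\<lambda>N. x \<in> - Om N) sequentially" by simp
      fix N :: nat
      have "(\<integral>\<^sup>+x. ennreal (norm (?TQ x) powr p) * indicator ?Q x * indicator (- Om N) x \<partial>\<mu>) \<le> (\<integral>\<^sup>+x. ennreal (S N x powr p) * indicator ?Q x \<partial>\<mu>)"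
      proof (rule nn_integral_mono_AE)
        have "AE x in \<mu>. x \<in> ?Q - Om N \<longrightarrow> norm (?TQ x) \<le> S N x" using sp[of N] unfolding sparse_def by blast
        then show "AE x in \<mu>. ennreal (norm (?TQ x) powr p) * indicator ?Q x * indicator (- Om N) x \<le> ennreal (S N x powr p) * indicator ?Q x"
        proof eventually_elim
          case (elim x)
          show ?case
          proof (cases "x \<in> ?Q - Om N")
            case True
            then have "norm (?TQ x) powr p \<le> S N x powr p" using elim p by (intro powr_mono2) auto
            then show ?thesis using True by (simp add: ennreal_leI)
          qed (auto simp: indicator_def)
        qed
      qed
      also have "\<dots> \<le> R" by (rule SN)
      finally show "(\<integral>\<^sup>+x. ennreal (norm (?TQ x) powr p) * indicator ?Q x * indicator (- Om N) x \<partial>\<mu>) \<le> R" .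
    qed measurable
    then show ?thesis unfolding R_def .
  qed
  show ?thesis using D main by blast
qed

text \<open>Restriction to a large enough coset leaves a test function unchanged, and the local
  constant does not depend on the coset.\<close>

lemma Lp_test:
  assumes p: "1 < p" "1 < p1" "1 < p2" "1 / p = 1 / p1 + 1 / p2"
  shows "\<exists>D>0. \<forall>f\<in>test. \<forall>g\<in>test. Np p (T f g) \<le> ennreal D * (Np p1 f + Np p2 g)"
proof -
  obtain D where D: "0 < D" and loc: "\<forall>f\<in>test. \<forall>g\<in>test. \<forall>z n.
    (\<integral>\<^sup>+x. ennreal (norm (T (rs (cs z n) f) (rs (cs z n) g) x) powr p) * indicator (cs z n) x \<partial>\<mu>) \<le>
    ennreal D * ((\<integral>\<^sup>+x. ennreal (norm (f x) powr p1) * indicator (cs z n) x \<partial>\<mu>) +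
      (\<integral>\<^sup>+x. ennreal (norm (g x) powr p2) * indicator (cs z n) x \<partial>\<mu>))"
    using Lp_test_local[OF p] by blast
  have "Np p (T f g) \<le> ennreal D * (Np p1 f + Np p2 g)" if f: "f \<in> test" and g: "g \<in> test" for f g
  proof -
    have [measurable]: "T f g \<in> borel_measurable \<mu>" by (rule T_measurable[OF f g])
    have "eventually (\<lambda>m. rs (cs 0 (- int m)) f = f \<and> rs (cs 0 (- int m)) g = g) sequentially"
      by (intro eventually_conj test_rs_big f g)
    then obtain m0 where m0: "\<And>m. m0 \<le> m \<Longrightarrow> rs (cs 0 (- int m)) f = f \<and> rs (cs 0 (- int m)) g = g"
      unfolding eventually_sequentially by blast
    show ?thesis
      unfolding Np_def[of p "T f g"]
    proof (rule nn_integral_le_exhaust[where E = "\<lambda>m. cs 0 (- int m)" and start = m0])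
      show "AE x in \<mu>. eventually (\<lambda>m. x \<in> cs 0 (- int m)) sequentially" by (intro AE_I2 eventually_big_coset)
      fix m assume "m0 \<le> m"
      then have e: "rs (cs 0 (- int m)) f = f" "rs (cs 0 (- int m)) g = g" using m0 by auto
      have "(\<integral>\<^sup>+x. ennreal (norm (T f g x) powr p) * indicator (cs 0 (- int m)) x \<partial>\<mu>) \<le>
        ennreal D * ((\<integral>\<^sup>+x. ennreal (norm (f x) powr p1) * indicator (cs 0 (- int m)) x \<partial>\<mu>) +
      (\<integral>\<^sup>+x. ennreal (norm (g x) powr p2) * indicator (cs 0 (- int m)) x \<partial>\<mu>))"
        using loc[rule_format, OF f g, of 0 "- int m"] unfolding e .
      also have "\<dots> \<le> ennreal D * (Np p1 f + Np p2 g)"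
        unfolding Np_def by (intro mult_left_mono add_mono nn_integral_mono) (auto simp: indicator_def)
      finally show "(\<integral>\<^sup>+x. ennreal (norm (T f g x) powr p) * indicator (cs 0 (- int m)) x \<partial>\<mu>) \<le> ennreal D * (Np p1 f + Np p2 g)" .
    qed measurable
  qed
  then show ?thesis using D by blast
qed

text \<open>Dividing \<open>f\<close> by \<open>a\<close> and \<open>g\<close> by \<open>b\<close>
  makes both norms at most 1, where the additive bound is a constant; scaling back gives the
  product. For \<open>a\<close> or \<open>b\<close> equal to 0 the positive numbers
  \<open>a + 1 / (n + 1)\<close> and \<open>b + 1 / (n + 1)\<close> are used, followed by a
  limit.\<close>

lemma Lp_test_norm:
  assumes p: "1 < p" "1 < p1" "1 < p2" "1 / p = 1 / p1 + 1 / p2"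
  shows "\<exists>D>0. \<forall>f\<in>test. \<forall>g\<in>test. \<forall>a\<ge>0. \<forall>b\<ge>0. Np p1 f \<le> ennreal (a powr p1) \<longrightarrow> Np p2 g \<le> ennreal (b powr p2) \<longrightarrow>
    Np p (T f g) \<le> ennreal ((D * a * b) powr p)"
proof -
  obtain D0 where D0: "0 < D0" and bd: "\<forall>f\<in>test. \<forall>g\<in>test. Np p (T f g) \<le> ennreal D0 * (Np p1 f + Np p2 g)"
    using Lp_test[OF p] by blast
  define D where "D = (D0 * 2) powr (1 / p)"
  have D: "0 < D" using D0 by (simp add: D_def)
  have Dp: "D powr p = D0 * 2" unfolding D_def using D0 p(1) by (simp add: powr_powr)
  have pos: "Np p (T f g) \<le> ennreal ((D * a * b) powr p)"
    if f: "f \<in> test" and g: "g \<in> test" and ab: "0 < a" "0 < b"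
      and fa: "Np p1 f \<le> ennreal (a powr p1)" and gb: "Np p2 g \<le> ennreal (b powr p2)" for f g a b
  proof -
    define f' where "f' x = of_real (1 / a) * f x" for x
    define g' where "g' x = of_real (1 / b) * g x" for x
    have t: "f' \<in> test" "g' \<in> test" unfolding f'_def g'_def by (intro test_scale f g)+
    have one: "Np r (\<lambda>x. of_real (1 / c) * h x) \<le> 1" if "h \<in> test" "0 < c" "Np r h \<le> ennreal (c powr r)" for h c r
    proof -
      have "Np r (\<lambda>x. of_real (1 / c) * h x) = ennreal ((1 / c) powr r) * Np r h"
        using that(2) by (subst Np_cmult[OF test_measurable[OF that(1)]]) (simp add: norm_divide)
      also have "\<dots> \<le> ennreal ((1 / c) powr r) * ennreal (c powr r)" by (intro mult_left_mono that) simp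
      also have "\<dots> = 1" using that(2) by (simp add: ennreal_mult[symmetric] powr_mult[symmetric])
      finally show ?thesis .
    qed
    have "Np p (T f' g') \<le> ennreal D0 * (Np p1 f' + Np p2 g')" using bd t by blast
    also have "\<dots> \<le> ennreal D0 * (1 + 1)"
      unfolding f'_def g'_def by (intro mult_left_mono add_mono one f g ab fa gb) simp
    also have "\<dots> = ennreal (D powr p)" using D0 by (simp add: Dp ennreal_mult)
    finally have 1: "Np p (T f' g') \<le> ennreal (D powr p)" .
    have fe: "(\<lambda>x. of_real a * f' x + 0 * f' x) = f" and ge: "(\<lambda>x. of_real b * g' x + 0 * g' x) = g"
      using ab by (auto simp: f'_def g'_def)
    have l1: "AE x in \<mu>. T f g x = of_real a * T f' g x + 0 * T f' g x" using T_lin1[OF t(1,1) g, of "of_real a" 0] unfolding fe .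
    have l2: "AE x in \<mu>. T f' g x = of_real b * T f' g' x + 0 * T f' g' x" using T_lin2[OF t(1,2,2), of "of_real b" 0] unfolding ge .
    have "AE x in \<mu>. T f g x = of_real (a * b) * T f' g' x" using l1 l2 by eventually_elim simp
    then have "Np p (T f g) = Np p (\<lambda>x. of_real (a * b) * T f' g' x)" by (rule Np_cong_AE)
    also have "\<dots> = ennreal ((a * b) powr p) * Np p (T f' g')"
      using ab by (subst Np_cmult[OF T_measurable[OF t]]) (simp add: norm_mult)
    also have "\<dots> \<le> ennreal ((a * b) powr p) * ennreal (D powr p)" by (intro mult_left_mono 1) simp
    also have "\<dots> = ennreal ((D * a * b) powr p)"
      by (simp add: ennreal_mult[symmetric] powr_mult mult_ac)
    finally show ?thesis .
  qed
  have "Np p (T f g) \<le> ennreal ((D * a * b) powr p)"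
    if f: "f \<in> test" and g: "g \<in> test" and ab: "0 \<le> a" "0 \<le> b"
      and fa: "Np p1 f \<le> ennreal (a powr p1)" and gb: "Np p2 g \<le> ennreal (b powr p2)" for f g a b
  proof (rule LIMSEQ_le_const)
    let ?e = "\<lambda>n. 1 / real (Suc n)"
    have z: "?e \<longlonglongrightarrow> 0" by (rule LIMSEQ_Suc[OF lim_1_over_n])
    have "(\<lambda>n. (D * (a + ?e n) * (b + ?e n)) powr p) \<longlonglongrightarrow> (D * (a + 0) * (b + 0)) powr p"
      using p D ab by (intro tendsto_powr' tendsto_intros z) (auto intro!: always_eventually)
    then show "(\<lambda>n. ennreal ((D * (a + ?e n) * (b + ?e n)) powr p)) \<longlonglongrightarrow> ennreal ((D * a * b) powr p)"
      by (intro tendsto_ennrealI) simp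
    have "Np p (T f g) \<le> ennreal ((D * (a + ?e n) * (b + ?e n)) powr p)" for n
    proof (rule pos[OF f g])
      show "Np p1 f \<le> ennreal ((a + ?e n) powr p1)"
        by (rule order_trans[OF fa]) (use ab p in \<open>auto intro!: ennreal_leI powr_mono2\<close>)
      show "Np p2 g \<le> ennreal ((b + ?e n) powr p2)"
        by (rule order_trans[OF gb]) (use ab p in \<open>auto intro!: ennreal_leI powr_mono2\<close>)
    qed (use ab in \<open>auto intro: add_nonneg_pos\<close>)
    then show "\<exists>N. \<forall>n\<ge>N. Np p (T f g) \<le> ennreal ((D * (a + ?e n) * (b + ?e n)) powr p)" by blast
  qed
  then show ?thesis using D by blast
qed

end

section \<open>Extension to Lebesgue spaces\<close>

context vilenkin_haar begin

definition Lp :: "real \<Rightarrow> ('a \<Rightarrow> complex) set" where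
  "Lp p = {f \<in> borel_measurable \<mu>. Np p f < \<infinity>}"

text \<open>The norm as a real number. An infinite norm is mapped to 0, so every use is accompanied
  by membership in \<open>Lp p\<close>.\<close>

definition Nr :: "real \<Rightarrow> ('a \<Rightarrow> complex) \<Rightarrow> real" where
  "Nr p f = enn2real (Np p f) powr (1 / p)"

lemma Nr_nonneg: "0 \<le> Nr p f" by (simp add: Nr_def)

lemma Lp_measurable: "f \<in> Lp p \<Longrightarrow> f \<in> borel_measurable \<mu>" by (simp add: Lp_def)

lemma Np_Nr: assumes "f \<in> Lp p" "0 < p" shows "Np p f = ennreal (Nr p f powr p)"
proof -
  obtain j where "0 \<le> j" "Np p f = ennreal j" using assms(1) by (cases "Np p f") (auto simp: Lp_def)
  then show ?thesis using assms(2) by (simp add: Nr_def powr_powr)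
qed

lemma Nr_le:
  assumes "f \<in> borel_measurable \<mu>" "Np p f \<le> ennreal (a powr p)" "0 \<le> a" "0 < p"
  shows "f \<in> Lp p" "Nr p f \<le> a"
proof -
  have "Np p f < \<infinity>" using assms(2) by (rule order_le_less_trans) simp
  then show L: "f \<in> Lp p" using assms(1) by (simp add: Lp_def)
  have "Nr p f powr p \<le> a powr p" using assms(2) unfolding Np_Nr[OF L assms(4)] by simp
  then show "Nr p f \<le> a" using assms(3,4) Nr_nonneg[of p f] powr_less_mono2[of p a "Nr p f"] by force
qed

lemma Nr_mono:
  assumes "g \<in> Lp p" "f \<in> borel_measurable \<mu>" "AE x in \<mu>. norm (f x) \<le> c * norm (g x)" "0 \<le> c" "0 < p"
  shows "f \<in> Lp p" "Nr p f \<le> c * Nr p g"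
proof -
  have "Np p f \<le> Np p (\<lambda>x. of_real c * g x)"
    unfolding Np_def
  proof (rule nn_integral_mono_AE)
    show "AE x in \<mu>. ennreal (norm (f x) powr p) \<le> ennreal (norm (of_real c * g x) powr p)"
      using assms(3) by eventually_elim (use assms(4,5) in \<open>auto simp: norm_mult intro!: ennreal_leI powr_mono2\<close>)
  qed
  also have "\<dots> = ennreal (c powr p) * Np p g" using Lp_measurable[OF assms(1)] assms(4) by (simp add: Np_cmult)
  also have "\<dots> = ennreal ((c * Nr p g) powr p)"
    unfolding Np_Nr[OF assms(1,5)] by (simp add: ennreal_mult[symmetric] powr_mult)
  finally have "Np p f \<le> ennreal ((c * Nr p g) powr p)" .
  then show "f \<in> Lp p" "Nr p f \<le> c * Nr p g" using Nr_le[OF assms(2)] assms(4,5) Nr_nonneg by auto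
qed

lemma Nr_cong_AE: "AE x in \<mu>. f x = g x \<Longrightarrow> Nr p f = Nr p g"
  using Np_cong_AE[of f g p] by (simp add: Nr_def)

lemma add_powr_le:
  fixes x y :: real
  assumes "0 \<le> x" "0 \<le> y" "0 < p"
  shows "(x + y) powr p \<le> 2 powr p * (x powr p + y powr p)"
proof -
  have "(x + y) powr p \<le> (2 * max x y) powr p" using assms by (intro powr_mono2) auto
  also have "\<dots> = 2 powr p * (max x y) powr p" using assms by (simp add: powr_mult)
  also have "(max x y) powr p \<le> x powr p + y powr p" by (simp add: max_def)
  finally show ?thesis by simp
qed

lemma powr_add_superadd:
  fixes a b :: real
  assumes "0 \<le> a" "0 \<le> b" "1 \<le> p"
  shows "a powr p + b powr p \<le> (a + b) powr p"
proof -
  have h: "x * x powr (p - 1) = x powr p" if "0 \<le> x" for x :: real using that powr_mult_base[of x "p - 1"] by simp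
  have "a powr p + b powr p = a * a powr (p - 1) + b * b powr (p - 1)" using h assms by simp
  also have "\<dots> \<le> a * (a + b) powr (p - 1) + b * (a + b) powr (p - 1)"
    using assms by (intro add_mono mult_left_mono powr_mono2) auto
  also have "\<dots> = (a + b) powr p" using h[of "a + b"] assms by (simp add: distrib_right)
  finally show ?thesis .
qed

text \<open>A triangle inequality with factor 2, from pointwise convexity-free bounds on powers.
  Only limits and boundedness matter later, so the factor is harmless.\<close>

lemma Nr_add:
  assumes f: "f \<in> Lp p" and g: "g \<in> Lp p" and p: "1 < p"
  shows "(\<lambda>x. f x + g x) \<in> Lp p" "Nr p (\<lambda>x. f x + g x) \<le> 2 * (Nr p f + Nr p g)"
proof -
  have [measurable]: "f \<in> borel_measurable \<mu>" "g \<in> borel_measurable \<mu>" using f g by (auto simp: Lp_def)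
  have "Np p (\<lambda>x. f x + g x) \<le> (\<integral>\<^sup>+x. ennreal (2 powr p) * (ennreal (norm (f x) powr p) + ennreal (norm (g x) powr p)) \<partial>\<mu>)"
    unfolding Np_def
  proof (rule nn_integral_mono)
    fix x
    have "norm (f x + g x) powr p \<le> (norm (f x) + norm (g x)) powr p"
      using p by (intro powr_mono2 norm_triangle_ineq) auto
    also have "\<dots> \<le> 2 powr p * (norm (f x) powr p + norm (g x) powr p)" using p by (intro add_powr_le) auto
    finally show "ennreal (norm (f x + g x) powr p) \<le> ennreal (2 powr p) * (ennreal (norm (f x) powr p) + ennreal (norm (g x) powr p))"
      by (simp add: ennreal_mult[symmetric] ennreal_plus[symmetric] ennreal_leI del: ennreal_plus)
  qed
  also have "\<dots> = ennreal (2 powr p) * (Np p f + Np p g)"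
    unfolding Np_def by (simp add: nn_integral_cmult nn_integral_add)
  also have "\<dots> = ennreal (2 powr p * (Nr p f powr p + Nr p g powr p))"
    using p by (simp add: Np_Nr f g ennreal_mult[symmetric] ennreal_plus[symmetric] del: ennreal_plus)
  also have "\<dots> \<le> ennreal (2 powr p * (Nr p f + Nr p g) powr p)"
    using p by (intro ennreal_leI mult_left_mono powr_add_superadd Nr_nonneg) auto
  also have "\<dots> = ennreal ((2 * (Nr p f + Nr p g)) powr p)"
    using Nr_nonneg[of p f] Nr_nonneg[of p g] powr_mult[of 2 "Nr p f + Nr p g" p] by simp
  finally have "Np p (\<lambda>x. f x + g x) \<le> ennreal ((2 * (Nr p f + Nr p g)) powr p)" .
  then show "(\<lambda>x. f x + g x) \<in> Lp p" "Nr p (\<lambda>x. f x + g x) \<le> 2 * (Nr p f + Nr p g)"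
    using Nr_le[of "\<lambda>x. f x + g x" p "2 * (Nr p f + Nr p g)"] p Nr_nonneg[of p f] Nr_nonneg[of p g] by auto
qed

lemma Nr_scale:
  assumes "f \<in> Lp p" "0 < p"
  shows "(\<lambda>x. c * f x) \<in> Lp p" "Nr p (\<lambda>x. c * f x) \<le> norm c * Nr p f"
  using Nr_mono[OF assms(1), of "\<lambda>x. c * f x" "norm c"] assms(2) Lp_measurable[OF assms(1)] by (auto simp: norm_mult)

lemma Nr_diff:
  assumes f: "f \<in> Lp p" and g: "g \<in> Lp p" and p: "1 < p"
  shows "(\<lambda>x. f x - g x) \<in> Lp p" "Nr p (\<lambda>x. f x - g x) \<le> 2 * (Nr p f + Nr p g)"
  using Nr_add[OF f Nr_scale(1)[OF g, of "-1"] p] Nr_scale(2)[OF g, of "-1"] p by auto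

lemma Nr_triangle:
  assumes "(\<lambda>x. f x - g x) \<in> Lp p" "(\<lambda>x. g x - h x) \<in> Lp p" "1 < p"
  shows "(\<lambda>x. f x - h x) \<in> Lp p" "Nr p (\<lambda>x. f x - h x) \<le> 2 * (Nr p (\<lambda>x. f x - g x) + Nr p (\<lambda>x. g x - h x))"
  using Nr_add[OF assms] by simp_all

lemma Nr_minus_commute: "Nr p (\<lambda>x. f x - g x) = Nr p (\<lambda>x. g x - f x)"
  unfolding Nr_def Np_def by (simp add: norm_minus_commute)

lemma Lp_lin:
  assumes "f \<in> Lp p" "g \<in> Lp p" "1 < p"
  shows "(\<lambda>x. a * f x + b * g x) \<in> Lp p"
  using assms by (intro Nr_add Nr_scale) auto

lemma test_Lp: assumes "f \<in> test" "0 < p" shows "f \<in> Lp p"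
proof -
  obtain F where F: "\<And>x. norm (f x) \<le> F" by (rule test_bounded[OF assms(1)]) blast
  obtain k where k: "\<And>x. x \<notin> cs 0 k \<Longrightarrow> f x = 0" by (rule testE[OF assms(1)]) blast
  have "Np p f \<le> ennreal ((F * vol k powr (1 / p)) powr p)" by (rule Np_le_bounded[OF F k assms(2)])
  then have "Np p f < \<infinity>" by (rule order_le_less_trans) simp
  then show ?thesis using test_measurable[OF assms(1)] by (simp add: Lp_def)
qed

lemma rs_Lp:
  assumes "f \<in> Lp p" "0 < p" "P \<in> sets borel"
  shows "rs P f \<in> Lp p" "Nr p (rs P f) \<le> Nr p f"
proof -
  have "rs P f \<in> borel_measurable \<mu>" using Lp_measurable[OF assms(1)] assms(3) by measurable
  moreover have "AE x in \<mu>. norm (rs P f x) \<le> 1 * norm (f x)" by (intro AE_I2) (auto simp: indicator_def norm_mult)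
  ultimately show "rs P f \<in> Lp p" "Nr p (rs P f) \<le> Nr p f" using Nr_mono[OF assms(1), of "rs P f" 1] assms(2) by auto
qed

text \<open>Membership in the closure of the test functions. It is stable under sums and multiples,
  which reduces density to indicators.\<close>

definition dense_in :: "real \<Rightarrow> ('a \<Rightarrow> complex) \<Rightarrow> bool" where
  "dense_in p f \<longleftrightarrow> f \<in> Lp p \<and> (\<forall>e>0. \<exists>\<phi>\<in>test. Nr p (\<lambda>x. \<phi> x - f x) \<le> e)"

lemma dense_in_add:
  assumes "dense_in p f" "dense_in p g" "1 < p"
  shows "dense_in p (\<lambda>x. f x + g x)"
  unfolding dense_in_def
proof (intro conjI allI impI)
  have f: "f \<in> Lp p" and g: "g \<in> Lp p" using assms by (auto simp: dense_in_def)
  show "(\<lambda>x. f x + g x) \<in> Lp p" by (rule Nr_add[OF f g assms(3)])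
  fix e :: real assume "0 < e"
  then have "0 < e / 4" by simp
  then obtain \<phi> \<psi> where \<phi>: "\<phi> \<in> test" "Nr p (\<lambda>x. \<phi> x - f x) \<le> e / 4" and \<psi>: "\<psi> \<in> test" "Nr p (\<lambda>x. \<psi> x - g x) \<le> e / 4"
    using assms unfolding dense_in_def by blast
  have d: "(\<lambda>x. \<phi> x - f x) \<in> Lp p" "(\<lambda>x. \<psi> x - g x) \<in> Lp p"
    using assms(3) by (intro Nr_diff test_Lp \<phi> \<psi> f g; simp)+
  have "Nr p (\<lambda>x. (\<phi> x + \<psi> x) - (f x + g x)) = Nr p (\<lambda>x. (\<phi> x - f x) + (\<psi> x - g x))"
    by (simp add: algebra_simps)
  also have "\<dots> \<le> 2 * (e / 4 + e / 4)" 
    by (rule order_trans[OF Nr_add(2)[OF d assms(3)]]) (intro mult_left_mono add_mono \<phi> \<psi>; simp)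
  finally show "\<exists>\<phi>\<in>test. Nr p (\<lambda>x. \<phi> x - (f x + g x)) \<le> e"
    by (intro bexI[of _ "\<lambda>x. \<phi> x + \<psi> x"] test_add \<phi> \<psi>) simp
qed

lemma dense_in_scale:
  assumes "dense_in p f" "1 < p"
  shows "dense_in p (\<lambda>x. c * f x)"
  unfolding dense_in_def
proof (intro conjI allI impI)
  have f: "f \<in> Lp p" using assms by (auto simp: dense_in_def)
  show "(\<lambda>x. c * f x) \<in> Lp p" using assms(2) by (intro Nr_scale f) simp
  fix e :: real assume "0 < e"
  then have "0 < e / (norm c + 1)" by (simp add: add_nonneg_pos)
  then obtain \<phi> where \<phi>: "\<phi> \<in> test" "Nr p (\<lambda>x. \<phi> x - f x) \<le> e / (norm c + 1)"
    using assms unfolding dense_in_def by blast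
  have d: "(\<lambda>x. \<phi> x - f x) \<in> Lp p"
    using assms(2) by (intro Nr_diff test_Lp \<phi> f; simp)
  have "Nr p (\<lambda>x. c * \<phi> x - c * f x) = Nr p (\<lambda>x. c * (\<phi> x - f x))" by (simp add: algebra_simps)
  also have "\<dots> \<le> norm c * Nr p (\<lambda>x. \<phi> x - f x)" using assms(2) by (intro Nr_scale d) simp
  also have "\<dots> \<le> (norm c + 1) * (e / (norm c + 1))" using \<phi>(2) Nr_nonneg by (intro mult_mono) auto
  also have "\<dots> = e" by (simp add: add_nonneg_eq_0_iff)
  finally show "\<exists>\<phi>\<in>test. Nr p (\<lambda>x. \<phi> x - c * f x) \<le> e"
    by (intro bexI[of _ "\<lambda>x. c * \<phi> x"] test_scale \<phi>) simp
qed

lemma dense_in_sum: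
  assumes "1 < p"
  shows "finite Y \<Longrightarrow> (\<And>y. y \<in> Y \<Longrightarrow> dense_in p (h y)) \<Longrightarrow> dense_in p (\<lambda>x. \<Sum>y\<in>Y. h y x)"
proof (induction Y rule: finite_induct)
  case empty
  have "(\<lambda>x. 0) \<in> Lp p" using assms by (intro test_Lp test_zero) simp
  moreover have "Nr p (\<lambda>x. 0) = 0" by (simp add: Nr_def Np_def)
  ultimately show ?case unfolding dense_in_def by (auto intro!: bexI[OF _ test_zero])
next
  case (insert y Y)
  then show ?case using dense_in_add[OF _ _ assms, of "h y" "\<lambda>x. \<Sum>y\<in>Y. h y x"] by simp
qed

text \<open>Outer regularity replaces \<open>A\<close> by an open set \<open>U\<close>. The set
  \<open>V m\<close> collects the cosets of level \<open>m\<close> that lie in \<open>U\<close>,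
  within \<open>G (- m)\<close>; its indicator is a test function, and the \<open>V m\<close>
  increase to \<open>U\<close>, which has finite measure.\<close>

lemma dense_in_indicator:
  assumes A: "A \<in> sets borel" "emeasure \<mu> A < \<infinity>" and p: "1 < p"
  shows "dense_in p (\<lambda>x. indicator A x)"
  unfolding dense_in_def
proof (intro conjI allI impI)
  have Np_ind: "Np p (\<lambda>x. indicator E x) = emeasure \<mu> E" if "E \<in> sets borel" for E
  proof -
    have "Np p (\<lambda>x. indicator E x) = (\<integral>\<^sup>+x. indicator E x \<partial>\<mu>)"
      unfolding Np_def using p by (intro nn_integral_cong) (simp add: indicator_def)
    then show ?thesis using that by simp
  qed
  show L: "(\<lambda>x. indicator A x) \<in> Lp p" using A by (simp add: Lp_def Np_ind)
  fix e :: real assume e: "0 < e"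
  \<comment> \<open>Half of the allowed error is for \<open>U - A\<close>, the other half for
    \<open>U - V m\<close>.\<close>
  define d where "d = e powr p / 2"
  have d: "0 < d" using e by (simp add: d_def)
  have "emeasure \<mu> A < emeasure \<mu> A + ennreal d" 
  proof -
    obtain a where "0 \<le> a" "emeasure \<mu> A = ennreal a" using A(2) by (cases "emeasure \<mu> A") auto
    then show ?thesis using d by (simp add: ennreal_plus[symmetric] ennreal_lessI del: ennreal_plus)
  qed
  then obtain U where U: "open U" "A \<subseteq> U" "emeasure \<mu> U < emeasure \<mu> A + ennreal d" by (rule outer_open[OF A(1)])
  have Ub: "U \<in> sets borel" using U(1) by (rule borel_open)
  have UA: "emeasure \<mu> (U - A) \<le> ennreal d"
  proof -
    have "emeasure \<mu> A + emeasure \<mu> (U - A) = emeasure \<mu> U"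
      using A Ub U(2) by (subst plus_emeasure) (auto simp: Un_absorb1)
    then have "emeasure \<mu> A + emeasure \<mu> (U - A) \<le> emeasure \<mu> A + ennreal d" using U(3) by simp
    then show ?thesis using A(2) by (auto simp: ennreal_add_left_cancel_le)
  qed
  define V where "V m = {x \<in> cs 0 (- int m). cs x (int m) \<subseteq> U}" for m :: nat
  have Vt: "(\<lambda>x. indicator (V m) x) \<in> test" for m
  proof (rule testI[of 0 "- int m" _ "int m"])
    show "indicator (V m) x = 0" if "x \<notin> cs 0 (- int m)" for x using that by (simp add: V_def)
    fix x y assume y: "y \<in> cs x (int m)"
    have "cs y (int m) = cs x (int m)" "cs y (- int m) = cs x (- int m)"
      using coset_eq[OF y] coset_le_eq[OF y, of "- int m"] by auto
    moreover have "w \<in> cs 0 (- int m) \<longleftrightarrow> 0 \<in> cs w (- int m)" for w by (meson coset_sym)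
    ultimately show "indicator (V m) y = indicator (V m) x" by (simp add: V_def indicator_def)
  qed
  have Vb: "V m \<in> sets borel" for m
  proof -
    have "{x \<in> space \<mu>. indicator (V m) x = (1 :: complex)} \<in> sets \<mu>" using test_measurable[OF Vt[of m]] by measurable
    moreover have "{x \<in> space \<mu>. indicator (V m) x = (1 :: complex)} = V m" by (auto simp: indicator_def split: if_splits)
    ultimately show ?thesis by simp
  qed
  have VU: "V m \<subseteq> U" for m using mem_coset_self unfolding V_def by blast
  have lim: "(\<lambda>m. emeasure \<mu> (U - V m)) \<longlonglongrightarrow> emeasure \<mu> (\<Inter>m. U - V m)"
  proof (rule Lim_emeasure_decseq)
    show "range (\<lambda>m. U - V m) \<subseteq> sets \<mu>" using Ub Vb by auto
    show "decseq (\<lambda>m. U - V m)"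
    proof (rule decseq_SucI)
      fix m
      have "V m \<subseteq> V (Suc m)"
      proof
        fix x assume x: "x \<in> V m"
        have "cs x (int (Suc m)) \<subseteq> cs x (int m)" "cs 0 (- int m) \<subseteq> cs 0 (- int (Suc m))" by (rule coset_mono; simp)+
        then show "x \<in> V (Suc m)" using x unfolding V_def by blast
      qed
      then show "U - V (Suc m) \<le> U - V m" by blast
    qed
    have "emeasure \<mu> (U - V m) \<le> emeasure \<mu> U" for m using Ub by (intro emeasure_mono) auto
    moreover have "emeasure \<mu> U < \<infinity>" using U(3) by (rule order_less_le_trans) simp
    ultimately show "emeasure \<mu> (U - V m) \<noteq> \<infinity>" for m by (metis order_le_less_trans less_irrefl)
  qed
  have inter: "(\<Inter>m. U - V m) = {}"
  proof -
    have "\<exists>m. x \<in> V m" if x: "x \<in> U" for x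
    proof -
      obtain k where k: "cs x k \<subseteq> U" by (rule coset_nbhd[OF U(1) x])
      obtain k' where k': "k' \<le> 0" "x \<in> cs 0 k'" by (rule big_coset)
      define m where "m = max (nat k) (nat (- k'))"
      have "cs x (int m) \<subseteq> cs x k" "cs 0 k' \<subseteq> cs 0 (- int m)" unfolding m_def by (rule coset_mono; linarith)+
      then have "x \<in> V m" using k k'(2) unfolding V_def by blast
      then show ?thesis by blast
    qed
    then show ?thesis by blast
  qed
  have "(\<lambda>m. emeasure \<mu> (U - V m)) \<longlonglongrightarrow> 0" using lim unfolding inter emeasure_empty .
  then have "eventually (\<lambda>m. emeasure \<mu> (U - V m) < ennreal d) sequentially"
    using d by (intro order_tendstoD(2)) auto
  then obtain m where m: "emeasure \<mu> (U - V m) < ennreal d" unfolding eventually_sequentially by blast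
  have "Np p (\<lambda>x. indicator (V m) x - indicator A x) \<le> Np p (\<lambda>x. indicator ((U - V m) \<union> (U - A)) x)"
    unfolding Np_def
  proof (rule nn_integral_mono)
    fix x
    have "norm (indicator (V m) x - indicator A x :: complex) \<le> norm (indicator ((U - V m) \<union> (U - A)) x :: complex)"
      using VU[of m] U(2) by (auto simp: indicator_def)
    then show "ennreal (norm (indicator (V m) x - indicator A x :: complex) powr p) \<le> ennreal (norm (indicator ((U - V m) \<union> (U - A)) x :: complex) powr p)"
      using p by (intro ennreal_leI powr_mono2) auto
  qed
  also have "\<dots> = emeasure \<mu> ((U - V m) \<union> (U - A))" using Ub Vb A by (intro Np_ind) auto
  also have "\<dots> \<le> emeasure \<mu> (U - V m) + emeasure \<mu> (U - A)" using Ub Vb A by (intro emeasure_subadditive) auto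
  also have "\<dots> \<le> ennreal d + ennreal d" using m UA by (intro add_mono) auto
  also have "\<dots> = ennreal (e powr p)" using d by (simp add: d_def ennreal_plus[symmetric] del: ennreal_plus)
  finally have "Np p (\<lambda>x. indicator (V m) x - indicator A x) \<le> ennreal (e powr p)" .
  moreover have "(\<lambda>x. indicator (V m) x - indicator A x :: complex) \<in> borel_measurable \<mu>" using Vb A by measurable
  ultimately have "Nr p (\<lambda>x. indicator (V m) x - indicator A x) \<le> e" using e p by (intro Nr_le) auto
  then show "\<exists>\<phi>\<in>test. Nr p (\<lambda>x. \<phi> x - indicator A x) \<le> e" using Vt by blast
qed

lemma dense_in_simple:
  assumes s: "simple_function \<mu> s" and L: "s \<in> Lp p" and p: "1 < p"
  shows "dense_in p s"
proof -
  define Y where "Y = s ` UNIV"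
  have fin: "finite Y" using simple_functionD(1)[OF s] by (simp add: Y_def)
  have sb: "s -` {y} \<in> sets borel" for y using simple_functionD(2)[OF s, of "{y}"] by simp
  have "s = (\<lambda>x. \<Sum>y\<in>Y. y * indicator (s -` {y}) x)"
  proof
    fix x
    have "(\<Sum>y\<in>Y. y * indicator (s -` {y}) x) = (\<Sum>y\<in>Y. if y = s x then y else 0)"
      by (rule sum.cong) (auto simp: indicator_def)
    also have "\<dots> = s x" using fin by (simp add: Y_def)
    finally show "s x = (\<Sum>y\<in>Y. y * indicator (s -` {y}) x)" by simp
  qed
  moreover have "dense_in p (\<lambda>x. \<Sum>y\<in>Y. y * indicator (s -` {y}) x)"
  proof (rule dense_in_sum[OF p fin])
    fix y
    show "dense_in p (\<lambda>x. y * indicator (s -` {y}) x)"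
    \<comment> \<open>The preimage of 0 may have infinite measure, but its term vanishes; every
      other value has a preimage of finite measure.\<close>
    proof (cases "y = 0")
      case True
      have "dense_in p (\<lambda>x. 0 * indicator {} x)" by (intro dense_in_scale dense_in_indicator p) auto
      then show ?thesis using True by simp
    next
      case False
      have "ennreal (norm y powr p) * emeasure \<mu> (s -` {y}) = (\<integral>\<^sup>+x. ennreal (norm y powr p) * indicator (s -` {y}) x \<partial>\<mu>)"
        using sb by (simp add: nn_integral_cmult_indicator)
      also have "\<dots> \<le> Np p s" unfolding Np_def by (intro nn_integral_mono) (auto simp: indicator_def)
      also have "\<dots> < \<infinity>" using L by (simp add: Lp_def)
      finally have "emeasure \<mu> (s -` {y}) < \<infinity>"
        using False by (auto simp: ennreal_mult_less_top)
      then show ?thesis by (intro dense_in_scale dense_in_indicator sb p)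
    qed
  qed
  ultimately show ?thesis by simp
qed

lemma dense_in_Lp:
  assumes f: "f \<in> Lp p" and p: "1 < p"
  shows "dense_in p f"
  unfolding dense_in_def
proof (intro conjI allI impI f)
  fix e :: real assume e: "0 < e"
  have fm [measurable]: "f \<in> borel_measurable \<mu>" by (rule Lp_measurable[OF f])
  obtain s where s: "\<And>i. simple_function \<mu> (s i)" "\<And>x. (\<lambda>i. s i x) \<longlonglongrightarrow> f x" "\<And>i x. norm (s i x) \<le> 2 * norm (f x)"
    using borel_measurable_implies_sequence_metric[OF fm, of 0] unfolding norm_conv_dist by (auto simp: dist_commute)
  have sm [measurable]: "s i \<in> borel_measurable \<mu>" for i using s(1) by (rule borel_measurable_simple_function)
  have sL: "s i \<in> Lp p" for i using Nr_mono(1)[OF f sm[of i], of 2] s(3) p by auto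
  have "(\<lambda>i. Np p (\<lambda>x. s i x - f x)) \<longlonglongrightarrow> (\<integral>\<^sup>+x. 0 \<partial>\<mu>)"
    unfolding Np_def
  proof (rule nn_integral_dominated_convergence[where w = "\<lambda>x. ennreal (3 powr p) * ennreal (norm (f x) powr p)"])
    show "AE x in \<mu>. ennreal (norm (s j x - f x) powr p) \<le> ennreal (3 powr p) * ennreal (norm (f x) powr p)" for j
    proof (rule AE_I2)
      fix x
      have "norm (s j x - f x) \<le> 3 * norm (f x)" using norm_triangle_ineq4[of "s j x" "f x"] s(3)[of j x] by linarith
      then have "norm (s j x - f x) powr p \<le> (3 * norm (f x)) powr p" using p by (intro powr_mono2) auto
      then show "ennreal (norm (s j x - f x) powr p) \<le> ennreal (3 powr p) * ennreal (norm (f x) powr p)"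
        by (simp add: powr_mult ennreal_mult[symmetric] ennreal_leI)
    qed
    show "(\<integral>\<^sup>+x. ennreal (3 powr p) * ennreal (norm (f x) powr p) \<partial>\<mu>) < \<infinity>"
      using f by (simp add: nn_integral_cmult Lp_def Np_def ennreal_mult_less_top)
    show "AE x in \<mu>. (\<lambda>i. ennreal (norm (s i x - f x) powr p)) \<longlonglongrightarrow> 0"
    proof (rule AE_I2)
      fix x
      have "(\<lambda>i. norm (s i x - f x)) \<longlonglongrightarrow> 0" using s(2)[of x] by (simp add: LIM_zero tendsto_norm_zero)
      then have "(\<lambda>i. norm (s i x - f x) powr p) \<longlonglongrightarrow> 0 powr p"
        using p by (intro tendsto_powr' tendsto_const) (auto intro!: always_eventually)
      then have "(\<lambda>i. ennreal (norm (s i x - f x) powr p)) \<longlonglongrightarrow> ennreal (0 powr p)" by (rule tendsto_ennrealI)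
      then show "(\<lambda>i. ennreal (norm (s i x - f x) powr p)) \<longlonglongrightarrow> 0" by simp
    qed
  qed measurable
  then have "(\<lambda>i. Np p (\<lambda>x. s i x - f x)) \<longlonglongrightarrow> 0" by simp
  moreover have "0 < ennreal ((e / 4) powr p)" using e by simp
  ultimately have "eventually (\<lambda>i. Np p (\<lambda>x. s i x - f x) < ennreal ((e / 4) powr p)) sequentially"
    by (rule order_tendstoD(2))
  then obtain i where i: "Np p (\<lambda>x. s i x - f x) < ennreal ((e / 4) powr p)" unfolding eventually_sequentially by blast
  have d1: "(\<lambda>x. s i x - f x) \<in> Lp p" "Nr p (\<lambda>x. s i x - f x) \<le> e / 4"
    using Nr_le[of "\<lambda>x. s i x - f x" p "e / 4"] i e p by simp_all
  obtain \<phi> where \<phi>: "\<phi> \<in> test" "Nr p (\<lambda>x. \<phi> x - s i x) \<le> e / 4"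
    using dense_in_simple[OF s(1) sL p, of i] e unfolding dense_in_def by (metis divide_pos_pos zero_less_numeral)
  have d2: "(\<lambda>x. \<phi> x - s i x) \<in> Lp p" using p by (intro Nr_diff test_Lp \<phi> sL; simp)
  have "Nr p (\<lambda>x. \<phi> x - f x) \<le> 2 * (e / 4 + e / 4)"
    by (rule order_trans[OF Nr_triangle(2)[OF d2 d1(1) p]]) (intro mult_left_mono add_mono \<phi> d1; simp)
  then have "Nr p (\<lambda>x. \<phi> x - f x) \<le> e" by simp
  then show "\<exists>\<phi>\<in>test. Nr p (\<lambda>x. \<phi> x - f x) \<le> e" using \<phi>(1) by blast
qed

lemma test_sequence:
  assumes "f \<in> Lp p" "1 < p"
  shows "\<exists>\<phi>. \<forall>n. \<phi> n \<in> test \<and> Nr p (\<lambda>x. \<phi> n x - f x) \<le> (1 / 4) ^ n"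
proof (intro choice allI)
  fix n :: nat
  have "(0::real) < (1 / 4) ^ n" by simp
  then show "\<exists>\<phi>. \<phi> \<in> test \<and> Nr p (\<lambda>x. \<phi> x - f x) \<le> (1 / 4) ^ n"
    using dense_in_Lp[OF assms] unfolding dense_in_def by blast
qed

section \<open>Completeness and almost everywhere convergence\<close>

lemma Nr_zero_AE:
  assumes "f \<in> Lp p" "Nr p f = 0" "0 < p"
  shows "AE x in \<mu>. f x = 0"
proof -
  have [measurable]: "f \<in> borel_measurable \<mu>" using assms(1) by (rule Lp_measurable)
  have "Np p f = 0" using Np_Nr[OF assms(1,3)] assms(2) by simp
  then have "AE x in \<mu>. ennreal (norm (f x) powr p) = 0"
    unfolding Np_def by (subst (asm) nn_integral_0_iff_AE) auto
  then show ?thesis by eventually_elim (simp add: ennreal_eq_0_iff)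
qed

lemma Nr_limit_unique:
  assumes "\<And>n. (\<lambda>x. h n x - k x) \<in> Lp p" "\<And>n. (\<lambda>x. h n x - k' x) \<in> Lp p" "1 < p"
    and "(\<lambda>n. Nr p (\<lambda>x. h n x - k x)) \<longlonglongrightarrow> 0" "(\<lambda>n. Nr p (\<lambda>x. h n x - k' x)) \<longlonglongrightarrow> 0"
  shows "AE x in \<mu>. k x = k' x"
proof -
  have kh: "(\<lambda>x. k x - h n x) \<in> Lp p" for n using Nr_scale(1)[OF assms(1)[of n], of "-1"] assms(3) by simp
  have L: "(\<lambda>x. k x - k' x) \<in> Lp p" by (rule Nr_triangle(1)[OF kh[of 0] assms(2)[of 0] assms(3)])
  have "Nr p (\<lambda>x. k x - k' x) \<le> 2 * (Nr p (\<lambda>x. h n x - k x) + Nr p (\<lambda>x. h n x - k' x))" for n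
    using Nr_triangle(2)[OF kh[of n] assms(2)[of n] assms(3)] by (simp only: Nr_minus_commute[of p k "h n"])
  moreover have "(\<lambda>n. 2 * (Nr p (\<lambda>x. h n x - k x) + Nr p (\<lambda>x. h n x - k' x))) \<longlonglongrightarrow> 2 * (0 + 0)"
    by (intro tendsto_intros assms)
  ultimately have "Nr p (\<lambda>x. k x - k' x) \<le> 2 * (0 + 0)" by (intro LIMSEQ_le_const) auto
  then have "Nr p (\<lambda>x. k x - k' x) = 0" using Nr_nonneg[of p "\<lambda>x. k x - k' x"] by simp
  then have "AE x in \<mu>. k x - k' x = 0" using Nr_zero_AE[OF L] assms(3) by simp
  then show ?thesis by eventually_elim simp
qed

text \<open>Summing the \<open>p\<close>-th powers of the terms instead of the terms lets sum and
  integral be exchanged directly, without a triangle inequality for infinite sums.\<close>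

lemma AE_summable_powr:
  assumes d: "\<And>n. d n \<in> Lp p" "\<And>n. Nr p (d n) \<le> M * \<theta> ^ n" and p: "0 < p" and \<theta>: "0 < \<theta>" "\<theta> < 1" and M: "0 \<le> M"
  shows "(\<integral>\<^sup>+x. (\<Sum>n. ennreal (norm (d n x) powr p)) \<partial>\<mu>) \<le> ennreal (M powr p / (1 - \<theta> powr p))"
proof -
  have [measurable]: "d n \<in> borel_measurable \<mu>" for n using d(1) by (rule Lp_measurable)
  have \<theta>p: "0 < \<theta> powr p" "\<theta> powr p < 1" using \<theta> p powr_less_mono2[of p \<theta> 1] by auto
  have "(\<integral>\<^sup>+x. (\<Sum>n. ennreal (norm (d n x) powr p)) \<partial>\<mu>) = (\<Sum>n. Np p (d n))"
    unfolding Np_def by (rule nn_integral_suminf) measurable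
  also have "\<dots> \<le> (\<Sum>n. ennreal (M powr p * (\<theta> powr p) ^ n))"
  proof (rule suminf_le)
    fix n
    have "Nr p (d n) powr p \<le> (M * \<theta> ^ n) powr p" using d(2) p Nr_nonneg by (intro powr_mono2) auto
    also have "\<dots> = M powr p * (\<theta> powr p) ^ n"
      using M \<theta> by (simp add: powr_mult powr_realpow[symmetric] powr_powr mult.commute)
    finally show "Np p (d n) \<le> ennreal (M powr p * (\<theta> powr p) ^ n)"
      unfolding Np_Nr[OF d(1) p] by (rule ennreal_leI)
  qed auto
  also have "\<dots> = ennreal (M powr p / (1 - \<theta> powr p))"
  proof (rule suminf_ennreal_eq)
    have "(\<lambda>n. (\<theta> powr p) ^ n) sums (1 / (1 - \<theta> powr p))" using \<theta>p by (intro geometric_sums) simp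
    from sums_mult[OF this, of "M powr p"] show "(\<lambda>n. M powr p * (\<theta> powr p) ^ n) sums (M powr p / (1 - \<theta> powr p))" by simp
  qed simp
  finally show ?thesis .
qed

text \<open>The indices satisfy \<open>n \<le> r n\<close>, which is enough for \<open>r\<close> to
  tend to infinity; strict monotonicity is not asked for.\<close>

lemma AE_subsequence:
  assumes L: "\<And>n. (\<lambda>x. h n x - k x) \<in> Lp p" and p: "1 < p" and lim: "(\<lambda>n. Nr p (\<lambda>x. h n x - k x)) \<longlonglongrightarrow> 0"
  shows "\<exists>r. (\<forall>n. n \<le> r n) \<and> (AE x in \<mu>. (\<lambda>n. h (r n) x) \<longlonglongrightarrow> k x)"
proof -
  have "\<exists>m\<ge>n. Nr p (\<lambda>x. h m x - k x) \<le> (1 / 2) ^ n" for n :: nat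
  proof -
    have "eventually (\<lambda>m. Nr p (\<lambda>x. h m x - k x) < (1 / 2) ^ n) sequentially"
      by (rule order_tendstoD(2)[OF lim]) simp
    then obtain N where "\<And>m. N \<le> m \<Longrightarrow> Nr p (\<lambda>x. h m x - k x) < (1 / 2) ^ n" unfolding eventually_sequentially by blast
    then show ?thesis by (intro exI[of _ "max n N"]) (auto intro: less_imp_le)
  qed
  then obtain r where r: "\<And>n. n \<le> r n" "\<And>n. Nr p (\<lambda>x. h (r n) x - k x) \<le> (1 / 2) ^ n" by metis
  define d where "d n x = h (r n) x - k x" for n x
  have dL: "d n \<in> Lp p" for n unfolding d_def by (rule L)
  have [measurable]: "d n \<in> borel_measurable \<mu>" for n using dL by (rule Lp_measurable)
  have "(\<integral>\<^sup>+x. (\<Sum>n. ennreal (norm (d n x) powr p)) \<partial>\<mu>) \<le> ennreal (1 powr p / (1 - (1 / 2) powr p))"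
    using r(2) p by (intro AE_summable_powr dL) (auto simp: d_def)
  also have "\<dots> < \<infinity>" by simp
  finally have "AE x in \<mu>. (\<Sum>n. ennreal (norm (d n x) powr p)) \<noteq> \<infinity>"
    by (intro nn_integral_noteq_infinite) auto
  then have "AE x in \<mu>. (\<lambda>n. h (r n) x) \<longlonglongrightarrow> k x"
  proof eventually_elim
    case (elim x)
    then have "summable (\<lambda>n. norm (d n x) powr p)" by (intro summable_suminf_not_top) auto
    then have "(\<lambda>n. norm (d n x) powr p) \<longlonglongrightarrow> 0" by (rule summable_LIMSEQ_zero)
    then have "(\<lambda>n. (norm (d n x) powr p) powr (1 / p)) \<longlonglongrightarrow> 0 powr (1 / p)"
      using p by (intro tendsto_powr' tendsto_const) (auto intro!: always_eventually)
    then have "(\<lambda>n. d n x) \<longlonglongrightarrow> 0" using p by (simp add: powr_powr tendsto_norm_zero_iff)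
    then show ?case unfolding d_def by (simp add: LIM_zero_iff)
  qed
  then show ?thesis using r(1) by blast
qed

lemma geometric_Cauchy:
  fixes u :: "nat \<Rightarrow> complex"
  assumes "\<And>n. norm (u (Suc n) - u n) \<le> g * (1 / 2) ^ n"
  shows "\<exists>l. u \<longlonglongrightarrow> l \<and> (\<forall>n. norm (u n - l) \<le> 2 * g * (1 / 2) ^ n)"
proof -
  have g0: "0 \<le> g" using order_trans[OF norm_ge_zero assms[of 0]] by simp
  have st: "norm (u (n + m) - u n) \<le> 2 * g * ((1 / 2) ^ n - (1 / 2) ^ (n + m))" for n m
  proof (induction m)
    case (Suc m)
    have "norm (u (n + Suc m) - u n) \<le> norm (u (Suc (n + m)) - u (n + m)) + norm (u (n + m) - u n)"
      using norm_triangle_ineq[of "u (Suc (n + m)) - u (n + m)" "u (n + m) - u n"] by simp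
    also have "\<dots> \<le> g * (1 / 2) ^ (n + m) + 2 * g * ((1 / 2) ^ n - (1 / 2) ^ (n + m))" by (intro add_mono assms Suc)
    also have "\<dots> = 2 * g * ((1 / 2) ^ n - (1 / 2) ^ (n + Suc m))" by (simp add: algebra_simps)
    finally show ?case .
  qed simp
  have st': "norm (u (n + m) - u n) \<le> 2 * g * (1 / 2) ^ n" for n m
    using order_trans[OF st[of n m], of "2 * g * (1 / 2) ^ n"] g0 by (simp add: algebra_simps)
  have z: "(\<lambda>n. 2 * g * (1 / 2) ^ n) \<longlonglongrightarrow> 0"
    using tendsto_mult_right_zero[OF LIMSEQ_power_zero[of "1 / 2 :: real"], of "2 * g"] by simp
  have "Cauchy u"
  proof (rule CauchyI')
    fix e :: real assume "0 < e"
    then obtain N where N: "2 * g * (1 / 2) ^ N < e / 2"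
      using order_tendstoD(2)[OF z, of "e / 2"] unfolding eventually_sequentially by auto
    have "norm (u m - u n) < e" if "N \<le> m" "m < n" for m n
    proof -
      have "norm (u m - u n) \<le> norm (u m - u N) + norm (u n - u N)"
        using norm_triangle_ineq4[of "u m - u N" "u n - u N"] by simp
      also have "\<dots> \<le> 2 * g * (1 / 2) ^ N + 2 * g * (1 / 2) ^ N"
        using st'[of N "m - N"] st'[of N "n - N"] that by (intro add_mono) auto
      also have "\<dots> < e" using N by linarith
      finally show ?thesis .
    qed
    then show "\<exists>M. \<forall>m\<ge>M. \<forall>n>m. dist (u m) (u n) < e" unfolding dist_norm by blast
  qed
  then obtain l where l: "u \<longlonglongrightarrow> l" by (auto simp: Cauchy_convergent_iff convergent_def)
  have "norm (u n - l) \<le> 2 * g * (1 / 2) ^ n" for n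
  proof -
    have "(\<lambda>m. norm (u (m + n) - u n)) \<longlonglongrightarrow> norm (l - u n)"
    by (intro tendsto_intros LIMSEQ_ignore_initial_segment l)
  then have "norm (l - u n) \<le> 2 * g * (1 / 2) ^ n"
    by (rule LIMSEQ_le_const2) (use st'[of n] in \<open>auto simp: add.commute\<close>)
  then show ?thesis by (simp add: norm_minus_commute)
  qed
  then show ?thesis using l by blast
qed

text \<open>The rate \<open>4 ^ (- n)\<close> leaves room for a weight \<open>2 ^ n\<close>: the
  weighted differences still have geometric norms, and \<open>Gs\<close>, the sum of their
  \<open>p\<close>-th powers, is finite almost everywhere. Hence successive differences are at most
  \<open>2 ^ (- n)\<close> times the root of \<open>Gs\<close>. This gives the pointwise limit, and
  also a majorant in \<open>L^p\<close> for the distance to it.\<close>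

lemma Lp_complete:
  assumes h: "\<And>n. h n \<in> borel_measurable \<mu>" and d: "\<And>n. (\<lambda>x. h (Suc n) x - h n x) \<in> Lp p"
    "\<And>n. Nr p (\<lambda>x. h (Suc n) x - h n x) \<le> M * (1 / 4) ^ n" and p: "1 < p" and M: "0 \<le> M"
  shows "\<exists>k. k \<in> borel_measurable \<mu> \<and> (\<forall>n. (\<lambda>x. h n x - k x) \<in> Lp p) \<and> (\<lambda>n. Nr p (\<lambda>x. h n x - k x)) \<longlonglongrightarrow> 0"
proof -
  define w where "w n x = 2 ^ n * (h (Suc n) x - h n x)" for n x
  have wL: "w n \<in> Lp p" and wN: "Nr p (w n) \<le> M * (1 / 2) ^ n" for n
  proof -
    show "w n \<in> Lp p" unfolding w_def using p by (intro Nr_scale d) simp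
    have "Nr p (w n) \<le> norm (2 ^ n :: complex) * Nr p (\<lambda>x. h (Suc n) x - h n x)"
      unfolding w_def using p by (intro Nr_scale d) simp
    also have "\<dots> \<le> 2 ^ n * (M * (1 / 4) ^ n)" by (simp add: norm_power d(2))
    also have "\<dots> = M * (2 * (1 / 4)) ^ n" by (simp add: power_mult_distrib[symmetric] mult.left_commute)
    finally show "Nr p (w n) \<le> M * (1 / 2) ^ n" by simp
  qed
  have [measurable]: "w n \<in> borel_measurable \<mu>" for n using wL by (rule Lp_measurable)
  have [measurable]: "h n \<in> borel_measurable \<mu>" for n by (rule h)
  define Gs where "Gs x = (\<Sum>n. ennreal (norm (w n x) powr p))" for x
  have Gm [measurable]: "Gs \<in> borel_measurable \<mu>" unfolding Gs_def by measurable
  define \<gamma> where "\<gamma> = (M powr p / (1 - (1 / 2) powr p)) powr (1 / p)"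
  have h1: "0 \<le> M powr p / (1 - (1 / 2) powr p)" using p powr_less_mono2[of p "1/2" 1] by simp
  have GI: "(\<integral>\<^sup>+x. Gs x \<partial>\<mu>) \<le> ennreal (\<gamma> powr p)"
  proof -
    have "(\<integral>\<^sup>+x. Gs x \<partial>\<mu>) \<le> ennreal (M powr p / (1 - (1 / 2) powr p))"
      unfolding Gs_def using p M by (intro AE_summable_powr wL wN) auto
    also have "M powr p / (1 - (1 / 2) powr p) = \<gamma> powr p"
    proof -
      have "(X powr (1 / p)) powr p = X" if "0 \<le> X" for X using that p by (simp add: powr_powr)
      from this[OF h1] show ?thesis unfolding \<gamma>_def by (rule sym)
    qed
    finally show ?thesis .
  qed
  then have "(\<integral>\<^sup>+x. Gs x \<partial>\<mu>) < \<infinity>" by (rule order_le_less_trans) simp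
  then have fin: "AE x in \<mu>. Gs x \<noteq> \<infinity>" by (intro nn_integral_noteq_infinite) auto
  define k where "k x = lim (\<lambda>n. h n x)" for x
  have km [measurable]: "k \<in> borel_measurable \<mu>" unfolding k_def by (rule borel_measurable_lim_metric) measurable
  have key: "AE x in \<mu>. \<forall>n. ennreal (norm (h n x - k x) powr p) \<le> ennreal ((2 * (1 / 2) ^ n) powr p) * Gs x"
    using fin
  proof eventually_elim
    case (elim x)
    define g where "g = enn2real (Gs x) powr (1 / p)"
    have G: "Gs x = ennreal (g powr p)"
    proof -
      obtain j where "0 \<le> j" "Gs x = ennreal j" using elim by (cases "Gs x") auto
      then show ?thesis using p by (simp add: g_def powr_powr)
    qed
    have step: "norm (h (Suc n) x - h n x) \<le> g * (1 / 2) ^ n" for n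
    proof -
      have "u n \<le> suminf u" for u :: "nat \<Rightarrow> ennreal" using sum_le_suminf[of u "{n}"] by simp
      then have "ennreal (norm (w n x) powr p) \<le> ennreal (g powr p)" unfolding G[symmetric] Gs_def .
      then have "norm (w n x) powr p \<le> g powr p" by simp
      then have "norm (w n x) \<le> g" using p powr_less_mono2[of p g "norm (w n x)"] unfolding g_def by force
      then have "2 ^ n * norm (h (Suc n) x - h n x) \<le> g" by (simp add: w_def norm_mult norm_power)
      then show ?thesis by (simp add: power_one_over field_simps)
    qed
    obtain l where l: "(\<lambda>n. h n x) \<longlonglongrightarrow> l" "\<forall>n. norm (h n x - l) \<le> 2 * g * (1 / 2) ^ n"
      using geometric_Cauchy[of "\<lambda>n. h n x", OF step] by blast
    have kl: "k x = l" unfolding k_def by (rule limI[OF l(1)])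
    show ?case
    proof
      fix n
      have "norm (h n x - k x) \<le> 2 * g * (1 / 2) ^ n" unfolding kl by (rule spec[OF l(2)])
      then have "norm (h n x - k x) powr p \<le> (2 * g * (1 / 2) ^ n) powr p" using p by (intro powr_mono2) auto
      also have "\<dots> = (2 * (1 / 2) ^ n) powr p * g powr p"
        using powr_mult[of "2 * (1 / 2) ^ n" g p] by (simp add: mult_ac g_def)
      finally show "ennreal (norm (h n x - k x) powr p) \<le> ennreal ((2 * (1 / 2) ^ n) powr p) * Gs x"
        unfolding G by (simp add: ennreal_mult[symmetric] ennreal_leI)
    qed
  qed
  have bound: "(\<lambda>x. h n x - k x) \<in> Lp p \<and> Nr p (\<lambda>x. h n x - k x) \<le> 2 * (1 / 2) ^ n * \<gamma>" for n
  proof -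
    have "Np p (\<lambda>x. h n x - k x) \<le> (\<integral>\<^sup>+x. ennreal ((2 * (1 / 2) ^ n) powr p) * Gs x \<partial>\<mu>)"
      unfolding Np_def by (rule nn_integral_mono_AE) (use key in \<open>eventually_elim, blast\<close>)
    also have "\<dots> = ennreal ((2 * (1 / 2) ^ n) powr p) * (\<integral>\<^sup>+x. Gs x \<partial>\<mu>)" by (rule nn_integral_cmult) measurable
    also have "\<dots> \<le> ennreal ((2 * (1 / 2) ^ n) powr p) * ennreal (\<gamma> powr p)" by (intro mult_left_mono GI) simp
    also have "\<dots> = ennreal ((2 * (1 / 2) ^ n * \<gamma>) powr p)"
      by (simp add: ennreal_mult[symmetric] powr_mult[symmetric] \<gamma>_def)
    finally have "Np p (\<lambda>x. h n x - k x) \<le> ennreal ((2 * (1 / 2) ^ n * \<gamma>) powr p)" .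
    then show ?thesis using Nr_le[of "\<lambda>x. h n x - k x" p "2 * (1 / 2) ^ n * \<gamma>"] p by (auto simp: \<gamma>_def)
  qed
  have "(\<lambda>n. Nr p (\<lambda>x. h n x - k x)) \<longlonglongrightarrow> 0"
  proof (rule tendsto_sandwich[where f = "\<lambda>_. 0" and h = "\<lambda>n. 2 * (1 / 2) ^ n * \<gamma>"])
    have "(\<lambda>n. 2 * (1 / 2) ^ n * \<gamma>) \<longlonglongrightarrow> 2 * 0 * \<gamma>" by (intro tendsto_intros LIMSEQ_power_zero) simp
    then show "(\<lambda>n. 2 * (1 / 2) ^ n * \<gamma>) \<longlonglongrightarrow> 0" by simp
  qed (use bound Nr_nonneg in auto)
  then show ?thesis using km bound by blast
qed

text \<open>The elementary inequality
  \<open>t \<le> \<tau> + \<tau> powr (1 - p) * t powr p\<close>, integrated over a coset, replaces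
  Hoelder's inequality; the factor 2 is the price of choosing \<open>\<tau>\<close> to balance both
  terms.\<close>

lemma locint_Lp:
  assumes f: "f \<in> Lp p" and p: "1 < p"
  shows "locint f" and "avg f x k \<le> 2 * Nr p (rs (cs x k) f) / vol k powr (1 / p)"
proof -
  have fm [measurable]: "f \<in> borel_measurable \<mu>" using f by (rule Lp_measurable)
  have pt: "t \<le> \<tau> + \<tau> powr (1 - p) * t powr p" if "0 \<le> t" "0 < \<tau>" for t \<tau> :: real
  proof (cases "t \<le> \<tau>")
    case False
    then have t: "0 < t" "\<tau> \<le> t" using that by auto
    have "1 = \<tau> powr (1 - p) * \<tau> powr (p - 1)" using that by (simp add: powr_add[symmetric])
    also have "\<dots> \<le> \<tau> powr (1 - p) * t powr (p - 1)" using t that p by (intro mult_left_mono powr_mono2) auto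
    finally have "t * 1 \<le> t * (\<tau> powr (1 - p) * t powr (p - 1))" using t by (intro mult_left_mono) auto
    also have "\<dots> = \<tau> powr (1 - p) * t powr p" using t powr_mult_base[of t "p - 1"] by (simp add: mult.left_commute)
    finally show ?thesis using that by simp
  qed (simp add: add_increasing2)
  have rsL: "rs (cs x k) f \<in> Lp p" for x k using p by (intro rs_Lp f) auto
  have int: "(\<integral>\<^sup>+y. ennreal (norm (f y)) * indicator (cs x k) y \<partial>\<mu>) \<le> ennreal (\<tau> * vol k + \<tau> powr (1 - p) * Nr p (rs (cs x k) f) powr p)"
    if l: "0 < \<tau>" for x k \<tau>
  proof -
    have rm [measurable]: "rs (cs x k) f \<in> borel_measurable \<mu>" using rsL by (rule Lp_measurable)
    have "(\<integral>\<^sup>+y. ennreal (norm (f y)) * indicator (cs x k) y \<partial>\<mu>) \<le>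
      (\<integral>\<^sup>+y. ennreal \<tau> * indicator (cs x k) y + ennreal (\<tau> powr (1 - p)) * ennreal (norm (rs (cs x k) f y) powr p) \<partial>\<mu>)"
    proof (rule nn_integral_mono)
      fix y
      have "ennreal (norm (f y)) \<le> ennreal \<tau> + ennreal (\<tau> powr (1 - p)) * ennreal (norm (f y) powr p)"
        using pt[of "norm (f y)" \<tau>] l by (simp add: ennreal_mult[symmetric] ennreal_plus[symmetric] ennreal_leI del: ennreal_plus)
      then show "ennreal (norm (f y)) * indicator (cs x k) y \<le> ennreal \<tau> * indicator (cs x k) y + ennreal (\<tau> powr (1 - p)) * ennreal (norm (rs (cs x k) f y) powr p)"
        by (cases "y \<in> cs x k") simp_all
    qed
    also have "\<dots> = ennreal \<tau> * ennreal (vol k) + ennreal (\<tau> powr (1 - p)) * Np p (rs (cs x k) f)"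
      unfolding Np_def by (subst nn_integral_add) (simp_all add: nn_integral_cmult nn_integral_cmult_indicator emeasure_coset)
    also have "\<dots> = ennreal (\<tau> * vol k + \<tau> powr (1 - p) * Nr p (rs (cs x k) f) powr p)"
      using l p vol_nonneg[of k] by (simp add: Np_Nr[OF rsL] ennreal_mult[symmetric] ennreal_plus[symmetric] del: ennreal_plus)
    finally show ?thesis .
  qed
  show li: "locint f"
    unfolding locint_def
  proof (intro conjI fm allI)
    fix x k
    show "integrable \<mu> (\<lambda>y. indicator (cs x k) y * norm (f y))"
    proof (rule integrableI_bounded)
      have "(\<integral>\<^sup>+y. ennreal (norm (indicator (cs x k) y * norm (f y))) \<partial>\<mu>) = (\<integral>\<^sup>+y. ennreal (norm (f y)) * indicator (cs x k) y \<partial>\<mu>)"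
        by (rule nn_integral_cong) (simp add: indicator_def)
      also have "\<dots> < \<infinity>" by (rule order_le_less_trans[OF int[of 1]]) auto
      finally show "(\<integral>\<^sup>+y. ennreal (norm (indicator (cs x k) y * norm (f y))) \<partial>\<mu>) < \<infinity>" .
    qed measurable
  qed
  define N where "N = Nr p (rs (cs x k) f)"
  define v where "v = vol k powr (1 / p)"
  have v: "0 < v" "v powr p = vol k" using vol_pos[of k] p by (auto simp: v_def powr_powr)
  have N0: "0 \<le> N" by (simp add: N_def Nr_nonneg)
  have "avg f x k \<le> 2 * N / v + 2 * e" if e: "0 < e" for e
  proof -
    \<comment> \<open>The balancing value is \<open>N / v\<close>; adding \<open>e\<close> keeps it
      positive when \<open>N = 0\<close>.\<close>
    define l where "l = N / v + e"
    have l: "0 < l" "N \<le> l * v" using N0 v e by (auto simp: l_def field_simps intro: add_nonneg_pos)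
    have "ennreal (vol k * avg f x k) \<le> ennreal (l * vol k + l powr (1 - p) * N powr p)"
      unfolding N_def nn_avg[OF li, symmetric] by (rule int[OF l(1)])
    then have "vol k * avg f x k \<le> l * vol k + l powr (1 - p) * N powr p"
      using l vol_nonneg[of k] by (subst (asm) ennreal_le_iff) auto
    moreover have "l powr (1 - p) * N powr p \<le> l * vol k"
    proof -
      have "N powr p \<le> (l * v) powr p" using l N0 p by (intro powr_mono2) auto
      also have "\<dots> = l powr p * vol k" using l v by (simp add: powr_mult)
      finally have "l powr (1 - p) * N powr p \<le> l powr (1 - p) * (l powr p * vol k)" by (rule mult_left_mono) simp
      also have "\<dots> = l * vol k" using l by (simp add: mult.assoc[symmetric] powr_add[symmetric])
      finally show ?thesis .
    qed
    ultimately have "vol k * avg f x k \<le> l * vol k + l * vol k" by linarith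
    then have "vol k * avg f x k \<le> vol k * (2 * l)" by (simp add: algebra_simps)
    then have "avg f x k \<le> 2 * l" using vol_pos[of k] by simp
    then show ?thesis by (simp add: l_def distrib_left)
  qed
  then have "avg f x k \<le> 2 * N / v + e" if "0 < e" for e using that by (metis field_sum_of_halves half_gt_zero mult_2)
  then show "avg f x k \<le> 2 * Nr p (rs (cs x k) f) / vol k powr (1 / p)"
    unfolding N_def v_def by (rule field_le_epsilon)
qed

lemma rs_rs: "P \<subseteq> Q \<Longrightarrow> rs P (rs Q f) = rs P f"
  by (auto simp: fun_eq_iff indicator_def)

lemma avg_diff_le:
  assumes f: "f \<in> Lp p" and g: "g \<in> Lp p" and p: "1 < p"
  shows "\<bar>avg f x k - avg g x k\<bar> \<le> 2 * Nr p (\<lambda>y. f y - g y) / vol k powr (1 / p)"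
proof -
  have d: "(\<lambda>y. f y - g y) \<in> Lp p" by (rule Nr_diff(1)[OF f g p])
  have i: "integrable \<mu> (\<lambda>y. indicator (cs x k) y * norm (f y))" "integrable \<mu> (\<lambda>y. indicator (cs x k) y * norm (g y))"
    "integrable \<mu> (\<lambda>y. indicator (cs x k) y * norm (f y - g y))"
    by (intro locint_integrable locint_Lp(1)[OF _ p] f g d)+
  have "vol k * (avg f x k - avg g x k) = (\<integral>y. indicator (cs x k) y * norm (f y) - indicator (cs x k) y * norm (g y) \<partial>\<mu>)"
    unfolding right_diff_distrib vol_avg by (rule Bochner_Integration.integral_diff[OF i(1,2), symmetric])
  also have "\<bar>\<dots>\<bar> \<le> (\<integral>y. indicator (cs x k) y * norm (f y - g y) \<partial>\<mu>)"
    unfolding real_norm_def[symmetric]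
  proof (rule norm_integral_le[OF i(3)])
    fix y
    show "norm (indicator (cs x k) y * norm (f y) - indicator (cs x k) y * norm (g y)) \<le> indicator (cs x k) y * norm (f y - g y)"
      using norm_triangle_ineq3[of "f y" "g y"] by (simp add: indicator_def)
  qed
  finally have "vol k * \<bar>avg f x k - avg g x k\<bar> \<le> vol k * avg (\<lambda>y. f y - g y) x k"
    unfolding vol_avg by (simp add: abs_mult vol_nonneg)
  then have "\<bar>avg f x k - avg g x k\<bar> \<le> avg (\<lambda>y. f y - g y) x k" using vol_pos[of k] by simp
  also have "\<dots> \<le> 2 * Nr p (rs (cs x k) (\<lambda>y. f y - g y)) / vol k powr (1 / p)" by (rule locint_Lp(2)[OF d p])
  also have "\<dots> \<le> 2 * Nr p (\<lambda>y. f y - g y) / vol k powr (1 / p)"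
    using rs_Lp(2)[OF d _ coset_borel, of x k] p by (intro divide_right_mono mult_left_mono) auto
  finally show ?thesis .
qed

definition approx :: "real \<Rightarrow> (nat \<Rightarrow> 'a \<Rightarrow> complex) \<Rightarrow> ('a \<Rightarrow> complex) \<Rightarrow> bool" where
  "approx p \<phi> f \<longleftrightarrow> (\<forall>n. \<phi> n \<in> test) \<and> (\<lambda>n. Nr p (\<lambda>x. \<phi> n x - f x)) \<longlonglongrightarrow> 0"

lemma approx_exists:
  assumes "f \<in> Lp p" "1 < p"
  shows "\<exists>\<phi>. approx p \<phi> f \<and> (\<forall>n. Nr p (\<lambda>x. \<phi> n x - f x) \<le> (1 / 4) ^ n)"
proof -
  obtain \<phi> where \<phi>: "\<forall>n. \<phi> n \<in> test \<and> Nr p (\<lambda>x. \<phi> n x - f x) \<le> (1 / 4) ^ n" using test_sequence[OF assms] by blast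
  have "(\<lambda>n. Nr p (\<lambda>x. \<phi> n x - f x)) \<longlonglongrightarrow> 0"
  proof (rule tendsto_sandwich[where f = "\<lambda>_. 0" and h = "\<lambda>n. (1 / 4) ^ n"])
    show "(\<lambda>n. (1 / 4 :: real) ^ n) \<longlonglongrightarrow> 0" by (rule LIMSEQ_power_zero) simp
  qed (use \<phi> Nr_nonneg in auto)
  then show ?thesis using \<phi> unfolding approx_def by blast
qed

lemma approx_const: "f \<in> test \<Longrightarrow> approx p (\<lambda>n. f) f"
  by (simp add: approx_def Nr_def Np_def)

lemma approx_test: "approx p \<phi> f \<Longrightarrow> \<phi> n \<in> test"
  by (simp add: approx_def)

lemma approx_Lp: "approx p \<phi> f \<Longrightarrow> 1 < p \<Longrightarrow> \<phi> n \<in> Lp p"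
  by (rule test_Lp[OF approx_test]) auto

lemma approx_diff_Lp: "approx p \<phi> f \<Longrightarrow> f \<in> Lp p \<Longrightarrow> 1 < p \<Longrightarrow> (\<lambda>x. \<phi> n x - f x) \<in> Lp p"
  by (rule Nr_diff(1)[OF approx_Lp])

lemma approx_diff:
  assumes "approx p \<phi> f" "approx p \<phi>' f" "f \<in> Lp p" "1 < p"
  shows "(\<lambda>n. Nr p (\<lambda>x. \<phi> n x - \<phi>' n x)) \<longlonglongrightarrow> 0"
proof (rule tendsto_sandwich[where f = "\<lambda>_. 0" and h = "\<lambda>n. 2 * (Nr p (\<lambda>x. \<phi> n x - f x) + Nr p (\<lambda>x. \<phi>' n x - f x))"])
  have "(\<lambda>n. 2 * (Nr p (\<lambda>x. \<phi> n x - f x) + Nr p (\<lambda>x. \<phi>' n x - f x))) \<longlonglongrightarrow> 2 * (0 + 0)"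
    using assms unfolding approx_def by (intro tendsto_intros) auto
  then show "(\<lambda>n. 2 * (Nr p (\<lambda>x. \<phi> n x - f x) + Nr p (\<lambda>x. \<phi>' n x - f x))) \<longlonglongrightarrow> 0" by simp
  have "Nr p (\<lambda>x. \<phi> n x - \<phi>' n x) \<le> 2 * (Nr p (\<lambda>x. \<phi> n x - f x) + Nr p (\<lambda>x. \<phi>' n x - f x))" for n
  proof -
    have b: "(\<lambda>x. f x - \<phi>' n x) \<in> Lp p" by (rule Nr_diff(1)[OF assms(3) approx_Lp[OF assms(2,4)] assms(4)])
    show ?thesis
      using Nr_triangle(2)[OF approx_diff_Lp[OF assms(1,3,4)] b assms(4)] by (simp only: Nr_minus_commute[of p f])
  qed
  then show "\<forall>\<^sub>F n in sequentially. Nr p (\<lambda>x. \<phi> n x - \<phi>' n x) \<le> 2 * (Nr p (\<lambda>x. \<phi> n x - f x) + Nr p (\<lambda>x. \<phi>' n x - f x))"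
    by simp
qed (use Nr_nonneg in auto)

lemma approx_Nr_le:
  assumes "approx p \<phi> f" "f \<in> Lp p" "1 < p"
  shows "Nr p (\<phi> n) \<le> 2 * (Nr p (\<lambda>x. \<phi> n x - f x) + Nr p f)"
  using Nr_add(2)[OF approx_diff_Lp[OF assms] assms(2,3)] by simp

lemma approx_add:
  assumes "approx p \<phi> f" "approx p \<phi>' f'" "f \<in> Lp p" "f' \<in> Lp p" "1 < p"
  shows "approx p (\<lambda>n x. a * \<phi> n x + b * \<phi>' n x) (\<lambda>x. a * f x + b * f' x)"
  unfolding approx_def
proof (intro conjI allI)
  show "(\<lambda>x. a * \<phi> n x + b * \<phi>' n x) \<in> test" for n using assms by (intro test_lin approx_test) auto
  show "(\<lambda>n. Nr p (\<lambda>x. a * \<phi> n x + b * \<phi>' n x - (a * f x + b * f' x))) \<longlonglongrightarrow> 0"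
  proof (rule tendsto_sandwich[where f = "\<lambda>_. 0" and h = "\<lambda>n. 2 * (norm a * Nr p (\<lambda>x. \<phi> n x - f x) + norm b * Nr p (\<lambda>x. \<phi>' n x - f' x))"])
    have "(\<lambda>n. 2 * (norm a * Nr p (\<lambda>x. \<phi> n x - f x) + norm b * Nr p (\<lambda>x. \<phi>' n x - f' x))) \<longlonglongrightarrow> 2 * (norm a * 0 + norm b * 0)"
      using assms unfolding approx_def by (intro tendsto_intros) auto
    then show "(\<lambda>n. 2 * (norm a * Nr p (\<lambda>x. \<phi> n x - f x) + norm b * Nr p (\<lambda>x. \<phi>' n x - f' x))) \<longlonglongrightarrow> 0" by simp
    have "Nr p (\<lambda>x. a * \<phi> n x + b * \<phi>' n x - (a * f x + b * f' x)) \<le> 2 * (norm a * Nr p (\<lambda>x. \<phi> n x - f x) + norm b * Nr p (\<lambda>x. \<phi>' n x - f' x))" for n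
    proof -
      have d: "(\<lambda>x. \<phi> n x - f x) \<in> Lp p" "(\<lambda>x. \<phi>' n x - f' x) \<in> Lp p" using assms by (intro approx_diff_Lp; simp)+
      have s: "(\<lambda>x. a * (\<phi> n x - f x)) \<in> Lp p" "(\<lambda>x. b * (\<phi>' n x - f' x)) \<in> Lp p" using assms(5) by (intro Nr_scale d; simp)+
      have "(\<lambda>x. a * \<phi> n x + b * \<phi>' n x - (a * f x + b * f' x)) = (\<lambda>x. a * (\<phi> n x - f x) + b * (\<phi>' n x - f' x))"
        by (simp add: fun_eq_iff algebra_simps)
      then have "Nr p (\<lambda>x. a * \<phi> n x + b * \<phi>' n x - (a * f x + b * f' x)) \<le> 2 * (Nr p (\<lambda>x. a * (\<phi> n x - f x)) + Nr p (\<lambda>x. b * (\<phi>' n x - f' x)))"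
        using Nr_add(2)[OF s assms(5)] by (simp only:)
      also have "\<dots> \<le> 2 * (norm a * Nr p (\<lambda>x. \<phi> n x - f x) + norm b * Nr p (\<lambda>x. \<phi>' n x - f' x))"
        using assms(5) by (intro mult_left_mono add_mono Nr_scale(2) d) auto
      finally show ?thesis .
    qed
    then show "\<forall>\<^sub>F n in sequentially. Nr p (\<lambda>x. a * \<phi> n x + b * \<phi>' n x - (a * f x + b * f' x)) \<le> 2 * (norm a * Nr p (\<lambda>x. \<phi> n x - f x) + norm b * Nr p (\<lambda>x. \<phi>' n x - f' x))"
      by simp
  qed (use Nr_nonneg in auto)
qed

lemma approx_rs:
  assumes "approx p \<phi> f" "f \<in> Lp p" "1 < p"
  shows "approx p (\<lambda>n. rs (cs z k) (\<phi> n)) (rs (cs z k) f)"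
  unfolding approx_def
proof (intro conjI allI)
  show "rs (cs z k) (\<phi> n) \<in> test" for n by (intro test_rs approx_test[OF assms(1)])
  show "(\<lambda>n. Nr p (\<lambda>x. rs (cs z k) (\<phi> n) x - rs (cs z k) f x)) \<longlonglongrightarrow> 0"
  proof (rule tendsto_sandwich[where f = "\<lambda>_. 0" and h = "\<lambda>n. Nr p (\<lambda>x. \<phi> n x - f x)"])
    show "(\<lambda>n. Nr p (\<lambda>x. \<phi> n x - f x)) \<longlonglongrightarrow> 0" using assms(1) by (simp add: approx_def)
    have "Nr p (\<lambda>x. rs (cs z k) (\<phi> n) x - rs (cs z k) f x) \<le> Nr p (\<lambda>x. \<phi> n x - f x)" for n
      using rs_Lp(2)[OF approx_diff_Lp[OF assms], of "cs z k" n] assms(3) by (simp add: right_diff_distrib)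
    then show "\<forall>\<^sub>F n in sequentially. Nr p (\<lambda>x. rs (cs z k) (\<phi> n) x - rs (cs z k) f x) \<le> Nr p (\<lambda>x. \<phi> n x - f x)" by simp
  qed (use Nr_nonneg in auto)
qed

lemma approx_avg:
  assumes "approx p \<phi> f" "f \<in> Lp p" "1 < p"
  shows "(\<lambda>n. avg (\<phi> n) x k) \<longlonglongrightarrow> avg f x k"
proof -
  have "(\<lambda>n. 2 * Nr p (\<lambda>y. \<phi> n y - f y) / vol k powr (1 / p)) \<longlonglongrightarrow> 2 * 0 / vol k powr (1 / p)"
    using assms(1) vol_pos[of k] unfolding approx_def by (intro tendsto_intros) auto
  then have z: "(\<lambda>n. 2 * Nr p (\<lambda>y. \<phi> n y - f y) / vol k powr (1 / p)) \<longlonglongrightarrow> 0" by simp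
  have "(\<lambda>n. avg (\<phi> n) x k - avg f x k) \<longlonglongrightarrow> 0"
  proof (rule Lim_null_comparison[OF _ z])
    show "\<forall>\<^sub>F n in sequentially. norm (avg (\<phi> n) x k - avg f x k) \<le> 2 * Nr p (\<lambda>y. \<phi> n y - f y) / vol k powr (1 / p)"
      using avg_diff_le[OF test_Lp[OF approx_test[OF assms(1)]] assms(2,3)] assms(3) by simp
  qed
  then show ?thesis by (simp add: LIM_zero_iff)
qed

end

section \<open>Extension of the operator by density\<close>

locale czo_Lp = czo G \<mu> B T K C \<rho>
  for G :: "int \<Rightarrow> 'a::{topological_ab_group_add, t2_space} set" and \<mu> B T K C \<rho> +
  fixes p p1 p2 D :: real
  assumes p: "1 < p" "1 < p1" "1 < p2" and D: "0 < D"
    and T_Np: "\<lbrakk>f \<in> test_functions G; g \<in> test_functions G; 0 \<le> a; 0 \<le> b;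
      vilenkin_haar.Np \<mu> p1 f \<le> ennreal (a powr p1); vilenkin_haar.Np \<mu> p2 g \<le> ennreal (b powr p2)\<rbrakk>
      \<Longrightarrow> vilenkin_haar.Np \<mu> p (T f g) \<le> ennreal ((D * a * b) powr p)"
begin

lemma T_Nr:
  assumes "f \<in> test" "g \<in> test"
  shows "T f g \<in> Lp p" "Nr p (T f g) \<le> D * Nr p1 f * Nr p2 g"
proof -
  have "Np p (T f g) \<le> ennreal ((D * Nr p1 f * Nr p2 g) powr p)"
    using p by (intro T_Np assms Nr_nonneg) (auto simp: Np_Nr test_Lp assms)
  then show "T f g \<in> Lp p" "Nr p (T f g) \<le> D * Nr p1 f * Nr p2 g"
    using Nr_le[OF T_measurable[OF assms], of p "D * Nr p1 f * Nr p2 g"] p D Nr_nonneg[of p1 f] Nr_nonneg[of p2 g] by auto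
qed

lemma T_diff_Nr:
  assumes t: "f \<in> test" "f' \<in> test" "g \<in> test" "g' \<in> test"
  shows "Nr p (\<lambda>x. T f g x - T f' g' x) \<le> 2 * (D * Nr p1 (\<lambda>x. f x - f' x) * Nr p2 g + D * Nr p1 f' * Nr p2 (\<lambda>x. g x - g' x))"
proof -
  have td: "(\<lambda>x. f x - f' x) \<in> test" "(\<lambda>x. g x - g' x) \<in> test" using t by (auto intro: test_diff)
  have 1: "AE x in \<mu>. T (\<lambda>x. f x - f' x) g x = T f g x - T f' g x" using T_lin1[OF t(1,2,3), of 1 "-1"] by simp
  have 2: "AE x in \<mu>. T f' (\<lambda>x. g x - g' x) x = T f' g x - T f' g' x" using T_lin2[OF t(2,3,4), of 1 "-1"] by simp
  have "AE x in \<mu>. T f g x - T f' g' x = T (\<lambda>x. f x - f' x) g x + T f' (\<lambda>x. g x - g' x) x"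
    using 1 2 by eventually_elim simp
  then have "Nr p (\<lambda>x. T f g x - T f' g' x) = Nr p (\<lambda>x. T (\<lambda>x. f x - f' x) g x + T f' (\<lambda>x. g x - g' x) x)" by (rule Nr_cong_AE)
  also have "\<dots> \<le> 2 * (Nr p (T (\<lambda>x. f x - f' x) g) + Nr p (T f' (\<lambda>x. g x - g' x)))"
    by (intro Nr_add T_Nr t td p)
  also have "\<dots> \<le> 2 * (D * Nr p1 (\<lambda>x. f x - f' x) * Nr p2 g + D * Nr p1 f' * Nr p2 (\<lambda>x. g x - g' x))"
    by (intro mult_left_mono add_mono T_Nr t td) simp
  finally show ?thesis .
qed

lemma T_approx_diff:
  assumes f: "approx p1 \<phi> f" "approx p1 \<phi>' f" "f \<in> Lp p1" and g: "approx p2 \<psi> g" "approx p2 \<psi>' g" "g \<in> Lp p2"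
  shows "(\<lambda>n. Nr p (\<lambda>x. T (\<phi> n) (\<psi> n) x - T (\<phi>' n) (\<psi>' n) x)) \<longlonglongrightarrow> 0"
proof (rule tendsto_sandwich[where f = "\<lambda>_. 0"
    and h = "\<lambda>n. 2 * (D * Nr p1 (\<lambda>x. \<phi> n x - \<phi>' n x) * (2 * (Nr p2 (\<lambda>x. \<psi> n x - g x) + Nr p2 g)) +
       D * (2 * (Nr p1 (\<lambda>x. \<phi>' n x - f x) + Nr p1 f)) * Nr p2 (\<lambda>x. \<psi> n x - \<psi>' n x))"])
  have "(\<lambda>n. 2 * (D * Nr p1 (\<lambda>x. \<phi> n x - \<phi>' n x) * (2 * (Nr p2 (\<lambda>x. \<psi> n x - g x) + Nr p2 g)) +
       D * (2 * (Nr p1 (\<lambda>x. \<phi>' n x - f x) + Nr p1 f)) * Nr p2 (\<lambda>x. \<psi> n x - \<psi>' n x)))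
      \<longlonglongrightarrow> 2 * (D * 0 * (2 * (0 + Nr p2 g)) + D * (2 * (0 + Nr p1 f)) * 0)"
    using approx_diff[OF f p(2)] approx_diff[OF g p(3)] f g unfolding approx_def by (intro tendsto_intros) auto
  then show "(\<lambda>n. 2 * (D * Nr p1 (\<lambda>x. \<phi> n x - \<phi>' n x) * (2 * (Nr p2 (\<lambda>x. \<psi> n x - g x) + Nr p2 g)) +
       D * (2 * (Nr p1 (\<lambda>x. \<phi>' n x - f x) + Nr p1 f)) * Nr p2 (\<lambda>x. \<psi> n x - \<psi>' n x))) \<longlonglongrightarrow> 0" by simp
  have "Nr p (\<lambda>x. T (\<phi> n) (\<psi> n) x - T (\<phi>' n) (\<psi>' n) x) \<le>
     2 * (D * Nr p1 (\<lambda>x. \<phi> n x - \<phi>' n x) * (2 * (Nr p2 (\<lambda>x. \<psi> n x - g x) + Nr p2 g)) +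
       D * (2 * (Nr p1 (\<lambda>x. \<phi>' n x - f x) + Nr p1 f)) * Nr p2 (\<lambda>x. \<psi> n x - \<psi>' n x))" for n
    by (rule order_trans[OF T_diff_Nr[OF approx_test[OF f(1)] approx_test[OF f(2)] approx_test[OF g(1)] approx_test[OF g(2)]]])
       (use D Nr_nonneg in \<open>intro mult_left_mono add_mono mult_right_mono approx_Nr_le[OF g(1,3) p(3)] approx_Nr_le[OF f(2,3) p(2)]; simp\<close>)
  then show "\<forall>\<^sub>F n in sequentially. Nr p (\<lambda>x. T (\<phi> n) (\<psi> n) x - T (\<phi>' n) (\<psi>' n) x) \<le>
     2 * (D * Nr p1 (\<lambda>x. \<phi> n x - \<phi>' n x) * (2 * (Nr p2 (\<lambda>x. \<psi> n x - g x) + Nr p2 g)) +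
       D * (2 * (Nr p1 (\<lambda>x. \<phi>' n x - f x) + Nr p1 f)) * Nr p2 (\<lambda>x. \<psi> n x - \<psi>' n x))" by simp
qed (use Nr_nonneg in auto)

text \<open>The limit is demanded along every pair of approximating sequences. So the function
  picked by choice serves linear combinations and restrictions alike, for which different sequences
  are convenient.\<close>

definition is_ext :: "('a \<Rightarrow> complex) \<Rightarrow> ('a \<Rightarrow> complex) \<Rightarrow> ('a \<Rightarrow> complex) \<Rightarrow> bool" where
  "is_ext f g h \<longleftrightarrow> h \<in> Lp p \<and> (\<forall>\<phi> \<psi>. approx p1 \<phi> f \<longrightarrow> approx p2 \<psi> g \<longrightarrow>
     (\<lambda>n. Nr p (\<lambda>x. T (\<phi> n) (\<psi> n) x - h x)) \<longlonglongrightarrow> 0)"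

text \<open>Approximations at the rate \<open>4 ^ (- n)\<close> make the images a fast Cauchy
  sequence, to which \<open>Lp_complete\<close> applies; other approximating sequences have images
  at a distance tending to 0 from these.\<close>

lemma ext_exists:
  assumes f: "f \<in> Lp p1" and g: "g \<in> Lp p2"
  shows "\<exists>h. is_ext f g h"
proof -
  obtain \<phi> where \<phi>: "approx p1 \<phi> f" "\<And>n. Nr p1 (\<lambda>x. \<phi> n x - f x) \<le> (1 / 4) ^ n" using approx_exists[OF f p(2)] by blast
  obtain \<psi> where \<psi>: "approx p2 \<psi> g" "\<And>n. Nr p2 (\<lambda>x. \<psi> n x - g x) \<le> (1 / 4) ^ n" using approx_exists[OF g p(3)] by blast
  have t: "\<phi> n \<in> test" "\<psi> n \<in> test" for n using approx_test \<phi>(1) \<psi>(1) by blast+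
  define F where "F = 2 * (1 + Nr p1 f)"
  define F' where "F' = 2 * (1 + Nr p2 g)"
  have F: "Nr p1 (\<phi> n) \<le> F" for n
  proof -
    have "Nr p1 (\<lambda>x. \<phi> n x - f x) \<le> 1" using \<phi>(2)[of n] by (rule order_trans) (simp add: power_le_one)
    then show ?thesis unfolding F_def by (intro order_trans[OF approx_Nr_le[OF \<phi>(1) f p(2)]] mult_left_mono add_mono) auto
  qed
  have F': "Nr p2 (\<psi> n) \<le> F'" for n
  proof -
    have "Nr p2 (\<lambda>x. \<psi> n x - g x) \<le> 1" using \<psi>(2)[of n] by (rule order_trans) (simp add: power_le_one)
    then show ?thesis unfolding F'_def by (intro order_trans[OF approx_Nr_le[OF \<psi>(1) g p(3)]] mult_left_mono add_mono) auto
  qed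
  have F0: "0 \<le> F" "0 \<le> F'" unfolding F_def F'_def using Nr_nonneg[of p1 f] Nr_nonneg[of p2 g] by auto
  have stepN: "Nr r (\<lambda>x. \<xi> (Suc n) x - \<xi> n x) \<le> 4 * (1 / 4) ^ n"
    if \<xi>: "approx r \<xi> k" "\<And>n. Nr r (\<lambda>x. \<xi> n x - k x) \<le> (1 / 4) ^ n" "k \<in> Lp r" "1 < r" for r \<xi> k n
  proof -
    have b: "(\<lambda>x. k x - \<xi> n x) \<in> Lp r" by (rule Nr_diff(1)[OF \<xi>(3) approx_Lp[OF \<xi>(1,4)] \<xi>(4)])
    have "Nr r (\<lambda>x. \<xi> (Suc n) x - \<xi> n x) \<le> 2 * (Nr r (\<lambda>x. \<xi> (Suc n) x - k x) + Nr r (\<lambda>x. k x - \<xi> n x))"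
      by (rule Nr_triangle(2)[OF approx_diff_Lp[OF \<xi>(1,3,4)] b \<xi>(4)])
    also have "Nr r (\<lambda>x. k x - \<xi> n x) = Nr r (\<lambda>x. \<xi> n x - k x)" by (rule Nr_minus_commute)
    also have "2 * (Nr r (\<lambda>x. \<xi> (Suc n) x - k x) + Nr r (\<lambda>x. \<xi> n x - k x)) \<le> 2 * ((1 / 4) ^ Suc n + (1 / 4) ^ n)"
      by (intro mult_left_mono add_mono \<xi>) simp
    also have "2 * ((1 / 4 :: real) ^ Suc n + (1 / 4) ^ n) \<le> 4 * (1 / 4) ^ n" by simp
    finally show ?thesis .
  qed
  define h where "h n = T (\<phi> n) (\<psi> n)" for n
  have hL: "h n \<in> Lp p" for n unfolding h_def by (intro T_Nr t)
  define M where "M = 2 * (D * 4 * F' + D * F * 4)"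
  have M0: "0 \<le> M" unfolding M_def using D F0 by simp
  have hd: "Nr p (\<lambda>x. h (Suc n) x - h n x) \<le> M * (1 / 4) ^ n" for n
  proof -
    have "Nr p (\<lambda>x. h (Suc n) x - h n x) \<le> 2 * (D * Nr p1 (\<lambda>x. \<phi> (Suc n) x - \<phi> n x) * Nr p2 (\<psi> (Suc n)) + D * Nr p1 (\<phi> n) * Nr p2 (\<lambda>x. \<psi> (Suc n) x - \<psi> n x))"
      unfolding h_def by (intro T_diff_Nr t)
    also have "\<dots> \<le> 2 * (D * (4 * (1 / 4) ^ n) * F' + D * F * (4 * (1 / 4) ^ n))"
      using D F0 by (intro mult_left_mono add_mono mult_mono F F' stepN[OF \<phi> f p(2)] stepN[OF \<psi> g p(3)] Nr_nonneg mult_nonneg_nonneg) auto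
    also have "\<dots> = M * (1 / 4) ^ n" by (simp add: M_def algebra_simps)
    finally show ?thesis .
  qed
  have "\<exists>k. k \<in> borel_measurable \<mu> \<and> (\<forall>n. (\<lambda>x. h n x - k x) \<in> Lp p) \<and> (\<lambda>n. Nr p (\<lambda>x. h n x - k x)) \<longlonglongrightarrow> 0"
    using hL by (intro Lp_complete[OF _ _ hd p(1) M0] Nr_diff p) (auto intro: Lp_measurable)
  then obtain k where k: "\<And>n. (\<lambda>x. h n x - k x) \<in> Lp p" "(\<lambda>n. Nr p (\<lambda>x. h n x - k x)) \<longlonglongrightarrow> 0" by blast
  have kL: "k \<in> Lp p" using Nr_diff(1)[OF hL[of 0] k(1)[of 0] p(1)] by simp
  have "(\<lambda>n. Nr p (\<lambda>x. T (\<phi>' n) (\<psi>' n) x - k x)) \<longlonglongrightarrow> 0" if a: "approx p1 \<phi>' f" "approx p2 \<psi>' g" for \<phi>' \<psi>'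
  proof (rule tendsto_sandwich[where f = "\<lambda>_. 0" and h = "\<lambda>n. 2 * (Nr p (\<lambda>x. T (\<phi>' n) (\<psi>' n) x - h n x) + Nr p (\<lambda>x. h n x - k x))"])
    have "(\<lambda>n. 2 * (Nr p (\<lambda>x. T (\<phi>' n) (\<psi>' n) x - h n x) + Nr p (\<lambda>x. h n x - k x))) \<longlonglongrightarrow> 2 * (0 + 0)"
      unfolding h_def using T_approx_diff[OF a(1) \<phi>(1) f a(2) \<psi>(1) g] k(2) unfolding h_def by (intro tendsto_intros)
    then show "(\<lambda>n. 2 * (Nr p (\<lambda>x. T (\<phi>' n) (\<psi>' n) x - h n x) + Nr p (\<lambda>x. h n x - k x))) \<longlonglongrightarrow> 0" by simp
    have "Nr p (\<lambda>x. T (\<phi>' n) (\<psi>' n) x - k x) \<le> 2 * (Nr p (\<lambda>x. T (\<phi>' n) (\<psi>' n) x - h n x) + Nr p (\<lambda>x. h n x - k x))" for n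
    proof (rule Nr_triangle(2)[OF _ k(1) p(1)])
      show "(\<lambda>x. T (\<phi>' n) (\<psi>' n) x - h n x) \<in> Lp p" by (intro Nr_diff T_Nr hL p approx_test[OF a(1)] approx_test[OF a(2)])
    qed
    then show "\<forall>\<^sub>F n in sequentially. Nr p (\<lambda>x. T (\<phi>' n) (\<psi>' n) x - k x) \<le> 2 * (Nr p (\<lambda>x. T (\<phi>' n) (\<psi>' n) x - h n x) + Nr p (\<lambda>x. h n x - k x))" by simp
  qed (use Nr_nonneg in auto)
  then have "is_ext f g k" unfolding is_ext_def using kL by blast
  then show ?thesis by blast
qed

definition Tb :: "('a \<Rightarrow> complex) \<Rightarrow> ('a \<Rightarrow> complex) \<Rightarrow> 'a \<Rightarrow> complex" where
  "Tb f g = (SOME h. is_ext f g h)"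

lemma Tb:
  assumes "f \<in> Lp p1" "g \<in> Lp p2"
  shows "Tb f g \<in> Lp p"
    and "\<lbrakk>approx p1 \<phi> f; approx p2 \<psi> g\<rbrakk> \<Longrightarrow> (\<lambda>n. Nr p (\<lambda>x. T (\<phi> n) (\<psi> n) x - Tb f g x)) \<longlonglongrightarrow> 0"
proof -
  have e: "is_ext f g (Tb f g)" unfolding Tb_def by (rule someI_ex[OF ext_exists[OF assms]])
  show "Tb f g \<in> Lp p" using e unfolding is_ext_def by blast
  show "(\<lambda>n. Nr p (\<lambda>x. T (\<phi> n) (\<psi> n) x - Tb f g x)) \<longlonglongrightarrow> 0" if "approx p1 \<phi> f" "approx p2 \<psi> g"
    using e that unfolding is_ext_def by blast
qed

lemma Tb_diff_Lp:
  assumes "f \<in> Lp p1" "g \<in> Lp p2" "approx p1 \<phi> f" "approx p2 \<psi> g"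
  shows "(\<lambda>x. T (\<phi> n) (\<psi> n) x - Tb f g x) \<in> Lp p"
  by (intro Nr_diff T_Nr Tb assms p approx_test[OF assms(3)] approx_test[OF assms(4)])

lemma Tb_test:
  assumes "f \<in> test" "g \<in> test"
  shows "AE x in \<mu>. Tb f g x = T f g x"
proof -
  have L: "f \<in> Lp p1" "g \<in> Lp p2" using assms p by (auto intro: test_Lp)
  have "(\<lambda>n::nat. Nr p (\<lambda>x. T f g x - Tb f g x)) \<longlonglongrightarrow> 0" by (rule Tb(2)[OF L approx_const[OF assms(1)] approx_const[OF assms(2)]])
  then have "Nr p (\<lambda>x. T f g x - Tb f g x) = 0" by (simp add: LIMSEQ_const_iff)
  moreover have "(\<lambda>x. T f g x - Tb f g x) \<in> Lp p" by (intro Nr_diff T_Nr Tb L p assms)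
  ultimately have "AE x in \<mu>. T f g x - Tb f g x = 0" using p by (intro Nr_zero_AE) auto
  then show ?thesis by eventually_elim simp
qed

text \<open>Both sides are limits of the same sequence \<open>h\<close> in the norm, and such limits
  agree almost everywhere. Stated for abstract sequences, it covers linearity in either
  argument.\<close>

lemma Tb_lin_aux:
  assumes h: "\<And>n. h n \<in> Lp p" "\<And>n. u n \<in> Lp p" "\<And>n. u' n \<in> Lp p" and k: "k \<in> Lp p" "v \<in> Lp p" "v' \<in> Lp p"
    and eq: "\<And>n. AE x in \<mu>. h n x = a * u n x + b * u' n x"
    and lim: "(\<lambda>n. Nr p (\<lambda>x. h n x - k x)) \<longlonglongrightarrow> 0" "(\<lambda>n. Nr p (\<lambda>x. u n x - v x)) \<longlonglongrightarrow> 0" "(\<lambda>n. Nr p (\<lambda>x. u' n x - v' x)) \<longlonglongrightarrow> 0"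
  shows "AE x in \<mu>. k x = a * v x + b * v' x"
proof (rule Nr_limit_unique[of h])
  have vL: "(\<lambda>x. a * v x + b * v' x) \<in> Lp p" by (intro Lp_lin k p)
  show "(\<lambda>x. h n x - k x) \<in> Lp p" "(\<lambda>x. h n x - (a * v x + b * v' x)) \<in> Lp p" for n
    by (intro Nr_diff h k p vL)+
  show "(\<lambda>n. Nr p (\<lambda>x. h n x - (a * v x + b * v' x))) \<longlonglongrightarrow> 0"
  proof (rule tendsto_sandwich[where f = "\<lambda>_. 0" and h = "\<lambda>n. 2 * (norm a * Nr p (\<lambda>x. u n x - v x) + norm b * Nr p (\<lambda>x. u' n x - v' x))"])
    have "(\<lambda>n. 2 * (norm a * Nr p (\<lambda>x. u n x - v x) + norm b * Nr p (\<lambda>x. u' n x - v' x))) \<longlonglongrightarrow> 2 * (norm a * 0 + norm b * 0)"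
      by (intro tendsto_intros lim)
    then show "(\<lambda>n. 2 * (norm a * Nr p (\<lambda>x. u n x - v x) + norm b * Nr p (\<lambda>x. u' n x - v' x))) \<longlonglongrightarrow> 0" by simp
    have "Nr p (\<lambda>x. h n x - (a * v x + b * v' x)) \<le> 2 * (norm a * Nr p (\<lambda>x. u n x - v x) + norm b * Nr p (\<lambda>x. u' n x - v' x))" for n
    proof -
      have "AE x in \<mu>. h n x - (a * v x + b * v' x) = a * (u n x - v x) + b * (u' n x - v' x)"
        using eq[of n] by eventually_elim (simp add: algebra_simps)
      then have "Nr p (\<lambda>x. h n x - (a * v x + b * v' x)) = Nr p (\<lambda>x. a * (u n x - v x) + b * (u' n x - v' x))" by (rule Nr_cong_AE)
      also have "\<dots> \<le> 2 * (Nr p (\<lambda>x. a * (u n x - v x)) + Nr p (\<lambda>x. b * (u' n x - v' x)))"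
        using p by (intro Nr_add Nr_scale Nr_diff h k) auto
      also have "\<dots> \<le> 2 * (norm a * Nr p (\<lambda>x. u n x - v x) + norm b * Nr p (\<lambda>x. u' n x - v' x))"
        using p by (intro mult_left_mono add_mono Nr_scale(2) Nr_diff h k) auto
      finally show ?thesis .
    qed
    then show "\<forall>\<^sub>F n in sequentially. Nr p (\<lambda>x. h n x - (a * v x + b * v' x)) \<le> 2 * (norm a * Nr p (\<lambda>x. u n x - v x) + norm b * Nr p (\<lambda>x. u' n x - v' x))" by simp
  qed (use Nr_nonneg in auto)
qed (use p lim in auto)

lemma Tb_lin1:
  assumes f: "f \<in> Lp p1" "f' \<in> Lp p1" and g: "g \<in> Lp p2"
  shows "AE x in \<mu>. Tb (\<lambda>x. a * f x + b * f' x) g x = a * Tb f g x + b * Tb f' g x"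
proof -
  obtain \<phi> where \<phi>: "approx p1 \<phi> f" using approx_exists[OF f(1) p(2)] by blast
  obtain \<phi>' where \<phi>': "approx p1 \<phi>' f'" using approx_exists[OF f(2) p(2)] by blast
  obtain \<psi> where \<psi>: "approx p2 \<psi> g" using approx_exists[OF g p(3)] by blast
  have t: "\<phi> n \<in> test" "\<phi>' n \<in> test" "\<psi> n \<in> test" for n using approx_test \<phi> \<phi>' \<psi> by blast+
  have L: "(\<lambda>x. a * f x + b * f' x) \<in> Lp p1" by (intro Lp_lin f p)
  have a: "approx p1 (\<lambda>n x. a * \<phi> n x + b * \<phi>' n x) (\<lambda>x. a * f x + b * f' x)" by (rule approx_add[OF \<phi> \<phi>' f p(2)])
  show ?thesis
  proof (rule Tb_lin_aux)
    show "AE x in \<mu>. T (\<lambda>x. a * \<phi> n x + b * \<phi>' n x) (\<psi> n) x = a * T (\<phi> n) (\<psi> n) x + b * T (\<phi>' n) (\<psi> n) x" for n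
      by (intro T_lin1 t)
    show "(\<lambda>n. Nr p (\<lambda>x. T (\<lambda>x. a * \<phi> n x + b * \<phi>' n x) (\<psi> n) x - Tb (\<lambda>x. a * f x + b * f' x) g x)) \<longlonglongrightarrow> 0" by (rule Tb(2)[OF L g a \<psi>])
    show "(\<lambda>n. Nr p (\<lambda>x. T (\<phi> n) (\<psi> n) x - Tb f g x)) \<longlonglongrightarrow> 0" by (rule Tb(2)[OF f(1) g \<phi> \<psi>])
    show "(\<lambda>n. Nr p (\<lambda>x. T (\<phi>' n) (\<psi> n) x - Tb f' g x)) \<longlonglongrightarrow> 0" by (rule Tb(2)[OF f(2) g \<phi>' \<psi>])
  qed (intro T_Nr t test_lin Tb f g L)+
qed

lemma Tb_lin2:
  assumes f: "f \<in> Lp p1" and g: "g \<in> Lp p2" "g' \<in> Lp p2"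
  shows "AE x in \<mu>. Tb f (\<lambda>x. a * g x + b * g' x) x = a * Tb f g x + b * Tb f g' x"
proof -
  obtain \<phi> where \<phi>: "approx p1 \<phi> f" using approx_exists[OF f(1) p(2)] by blast
  obtain \<psi> where \<psi>: "approx p2 \<psi> g" using approx_exists[OF g(1) p(3)] by blast
  obtain \<psi>' where \<psi>': "approx p2 \<psi>' g'" using approx_exists[OF g(2) p(3)] by blast
  have t: "\<phi> n \<in> test" "\<psi> n \<in> test" "\<psi>' n \<in> test" for n using approx_test \<phi> \<psi> \<psi>' by blast+
  have L: "(\<lambda>x. a * g x + b * g' x) \<in> Lp p2" by (intro Lp_lin g p)
  have a: "approx p2 (\<lambda>n x. a * \<psi> n x + b * \<psi>' n x) (\<lambda>x. a * g x + b * g' x)" by (rule approx_add[OF \<psi> \<psi>' g p(3)])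
  show ?thesis
  proof (rule Tb_lin_aux)
    show "AE x in \<mu>. T (\<phi> n) (\<lambda>x. a * \<psi> n x + b * \<psi>' n x) x = a * T (\<phi> n) (\<psi> n) x + b * T (\<phi> n) (\<psi>' n) x" for n
      by (intro T_lin2 t)
    show "(\<lambda>n. Nr p (\<lambda>x. T (\<phi> n) (\<lambda>x. a * \<psi> n x + b * \<psi>' n x) x - Tb f (\<lambda>x. a * g x + b * g' x) x)) \<longlonglongrightarrow> 0" by (rule Tb(2)[OF f L \<phi> a])
    show "(\<lambda>n. Nr p (\<lambda>x. T (\<phi> n) (\<psi> n) x - Tb f g x)) \<longlonglongrightarrow> 0" by (rule Tb(2)[OF f g(1) \<phi> \<psi>])
    show "(\<lambda>n. Nr p (\<lambda>x. T (\<phi> n) (\<psi>' n) x - Tb f g' x)) \<longlonglongrightarrow> 0" by (rule Tb(2)[OF f g(2) \<phi> \<psi>'])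
  qed (intro T_Nr t test_lin Tb f g L)+
qed

text \<open>The 8 collects three factors 2 of the triangle inequality: one each for the
  approximations of \<open>f\<close> and \<open>g\<close>, and one for the passage from
  \<open>T\<close> to its limit.\<close>

lemma Tb_Nr:
  assumes f: "f \<in> Lp p1" and g: "g \<in> Lp p2"
  shows "Nr p (Tb f g) \<le> 8 * D * Nr p1 f * Nr p2 g"
proof -
  obtain \<phi> where \<phi>: "approx p1 \<phi> f" using approx_exists[OF f(1) p(2)] by blast
  obtain \<psi> where \<psi>: "approx p2 \<psi> g" using approx_exists[OF g(1) p(3)] by blast
  have t: "\<phi> n \<in> test" "\<psi> n \<in> test" for n using approx_test \<phi> \<psi> by blast+
  let ?b = "\<lambda>n. 2 * (Nr p (\<lambda>x. T (\<phi> n) (\<psi> n) x - Tb f g x) +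
      D * (2 * (Nr p1 (\<lambda>x. \<phi> n x - f x) + Nr p1 f)) * (2 * (Nr p2 (\<lambda>x. \<psi> n x - g x) + Nr p2 g)))"
  have "Nr p (Tb f g) \<le> ?b n" for n
  proof -
    have "(\<lambda>x. Tb f g x - T (\<phi> n) (\<psi> n) x) \<in> Lp p" by (intro Nr_diff Tb T_Nr f g t p)
    then have "Nr p (\<lambda>x. (Tb f g x - T (\<phi> n) (\<psi> n) x) + T (\<phi> n) (\<psi> n) x) \<le> 2 * (Nr p (\<lambda>x. Tb f g x - T (\<phi> n) (\<psi> n) x) + Nr p (T (\<phi> n) (\<psi> n)))"
      by (intro Nr_add T_Nr t p)
    also have "Nr p (\<lambda>x. Tb f g x - T (\<phi> n) (\<psi> n) x) = Nr p (\<lambda>x. T (\<phi> n) (\<psi> n) x - Tb f g x)" by (rule Nr_minus_commute)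
    also have "Nr p (T (\<phi> n) (\<psi> n)) \<le> D * Nr p1 (\<phi> n) * Nr p2 (\<psi> n)" by (intro T_Nr t)
    also have "\<dots> \<le> D * (2 * (Nr p1 (\<lambda>x. \<phi> n x - f x) + Nr p1 f)) * (2 * (Nr p2 (\<lambda>x. \<psi> n x - g x) + Nr p2 g))"
      using D Nr_nonneg by (intro mult_mono mult_left_mono approx_Nr_le[OF \<phi> f p(2)] approx_Nr_le[OF \<psi> g p(3)] mult_nonneg_nonneg add_nonneg_nonneg) auto
    finally show ?thesis by simp
  qed
  moreover have "?b \<longlonglongrightarrow> 2 * (0 + D * (2 * (0 + Nr p1 f)) * (2 * (0 + Nr p2 g)))"
    using Tb(2)[OF f g \<phi> \<psi>] \<phi> \<psi> unfolding approx_def by (intro tendsto_intros) auto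
  ultimately have "Nr p (Tb f g) \<le> 2 * (0 + D * (2 * (0 + Nr p1 f)) * (2 * (0 + Nr p2 g)))" by (intro LIMSEQ_le_const) auto
  then show ?thesis by simp
qed

text \<open>The size estimate for \<open>rem\<close> survives the limit: the left side converges
  almost everywhere along a subsequence, and the right side involves finitely many averages, which
  depend continuously on the functions in the norm. It is the trace of the kernel that remains for
  functions that are not test functions.\<close>

lemma Tb_rem:
  assumes f: "f \<in> Lp p1" and g: "g \<in> Lp p2" and nk: "n \<le> k"
  shows "AE y in \<mu>. y \<in> cs z k \<longrightarrow>
    norm (Tb (rs (cs z n) f) (rs (cs z n) g) y - Tb (rs (cs z k) f) (rs (cs z k) g) y) \<le> (\<Sum>i\<in>{n..<k}. C * avg f z i * avg g z i)"
proof -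
  obtain \<phi> where \<phi>: "approx p1 \<phi> f" using approx_exists[OF f(1) p(2)] by blast
  obtain \<psi> where \<psi>: "approx p2 \<psi> g" using approx_exists[OF g(1) p(3)] by blast
  have t: "\<phi> m \<in> test" "\<psi> m \<in> test" for m using approx_test \<phi> \<psi> by blast+
  define h where "h m y = T (rs (cs z n) (\<phi> m)) (rs (cs z n) (\<psi> m)) y - T (rs (cs z k) (\<phi> m)) (rs (cs z k) (\<psi> m)) y" for m y
  define u where "u y = Tb (rs (cs z n) f) (rs (cs z n) g) y - Tb (rs (cs z k) f) (rs (cs z k) g) y" for y
  have L: "rs (cs z j) f \<in> Lp p1" "rs (cs z j) g \<in> Lp p2" for j using p by (intro rs_Lp f g coset_borel; simp)+
  have a: "approx p1 (\<lambda>m. rs (cs z j) (\<phi> m)) (rs (cs z j) f)" "approx p2 (\<lambda>m. rs (cs z j) (\<psi> m)) (rs (cs z j) g)" for j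
    by (rule approx_rs[OF \<phi> f p(2)], rule approx_rs[OF \<psi> g p(3)])
  have d: "(\<lambda>y. T (rs (cs z j) (\<phi> m)) (rs (cs z j) (\<psi> m)) y - Tb (rs (cs z j) f) (rs (cs z j) g) y) \<in> Lp p" for j m
    by (rule Tb_diff_Lp[OF L a])
  have eq: "(\<lambda>y. h m y - u y) = (\<lambda>y. (T (rs (cs z n) (\<phi> m)) (rs (cs z n) (\<psi> m)) y - Tb (rs (cs z n) f) (rs (cs z n) g) y) -
      (T (rs (cs z k) (\<phi> m)) (rs (cs z k) (\<psi> m)) y - Tb (rs (cs z k) f) (rs (cs z k) g) y))" for m
    by (auto simp: h_def u_def)
  have hu: "(\<lambda>y. h m y - u y) \<in> Lp p" for m unfolding eq by (intro Nr_diff d p)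
  have "(\<lambda>m. Nr p (\<lambda>y. h m y - u y)) \<longlonglongrightarrow> 0"
  proof (rule tendsto_sandwich[where f = "\<lambda>_. 0" and h = "\<lambda>m. 2 * (Nr p (\<lambda>y. T (rs (cs z n) (\<phi> m)) (rs (cs z n) (\<psi> m)) y - Tb (rs (cs z n) f) (rs (cs z n) g) y) +
      Nr p (\<lambda>y. T (rs (cs z k) (\<phi> m)) (rs (cs z k) (\<psi> m)) y - Tb (rs (cs z k) f) (rs (cs z k) g) y))"])
    have "(\<lambda>m. 2 * (Nr p (\<lambda>y. T (rs (cs z n) (\<phi> m)) (rs (cs z n) (\<psi> m)) y - Tb (rs (cs z n) f) (rs (cs z n) g) y) +
      Nr p (\<lambda>y. T (rs (cs z k) (\<phi> m)) (rs (cs z k) (\<psi> m)) y - Tb (rs (cs z k) f) (rs (cs z k) g) y))) \<longlonglongrightarrow> 2 * (0 + 0)"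
      by (intro tendsto_intros Tb(2)[OF L a])
    then show "(\<lambda>m. 2 * (Nr p (\<lambda>y. T (rs (cs z n) (\<phi> m)) (rs (cs z n) (\<psi> m)) y - Tb (rs (cs z n) f) (rs (cs z n) g) y) +
      Nr p (\<lambda>y. T (rs (cs z k) (\<phi> m)) (rs (cs z k) (\<psi> m)) y - Tb (rs (cs z k) f) (rs (cs z k) g) y))) \<longlonglongrightarrow> 0" by simp
    show "\<forall>\<^sub>F m in sequentially. Nr p (\<lambda>y. h m y - u y) \<le> 2 * (Nr p (\<lambda>y. T (rs (cs z n) (\<phi> m)) (rs (cs z n) (\<psi> m)) y - Tb (rs (cs z n) f) (rs (cs z n) g) y) +
      Nr p (\<lambda>y. T (rs (cs z k) (\<phi> m)) (rs (cs z k) (\<psi> m)) y - Tb (rs (cs z k) f) (rs (cs z k) g) y))"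
      unfolding eq by (intro always_eventually allI Nr_diff d p)
  qed (use Nr_nonneg in auto)
  from AE_subsequence[OF hu p(1) this] obtain r where r: "\<And>m. m \<le> r m" "AE y in \<mu>. (\<lambda>m. h (r m) y) \<longlonglongrightarrow> u y" by blast
  have rinf: "filterlim r at_top sequentially"
    using r(1) by (auto simp: filterlim_at_top eventually_sequentially intro: order_trans)
  have "AE y in \<mu>. \<forall>m. y \<in> cs z k \<longrightarrow> norm (h m y) \<le> (\<Sum>i\<in>{n..<k}. C * avg (\<phi> m) z i * avg (\<psi> m) z i)"
    unfolding AE_all_countable
  proof
    fix m
    show "AE y in \<mu>. y \<in> cs z k \<longrightarrow> norm (h m y) \<le> (\<Sum>i\<in>{n..<k}. C * avg (\<phi> m) z i * avg (\<psi> m) z i)"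
      using rem_rep(1)[OF t(1)[of m] t(2)[of m] nk, of z]
    proof eventually_elim
      case (elim y)
      then show ?case using rem_size[OF t(1)[of m] t(2)[of m] nk, of y z] by (simp add: h_def)
    qed
  qed
  with r(2) show ?thesis
  proof eventually_elim
    case (elim y)
    show ?case
    proof
      assume y: "y \<in> cs z k"
      have "(\<lambda>m. \<Sum>i\<in>{n..<k}. C * avg (\<phi> m) z i * avg (\<psi> m) z i) \<longlonglongrightarrow> (\<Sum>i\<in>{n..<k}. C * avg f z i * avg g z i)"
        by (intro tendsto_intros approx_avg[OF \<phi> f p(2)] approx_avg[OF \<psi> g p(3)])
      then have lim: "(\<lambda>m. \<Sum>i\<in>{n..<k}. C * avg (\<phi> (r m)) z i * avg (\<psi> (r m)) z i) \<longlonglongrightarrow> (\<Sum>i\<in>{n..<k}. C * avg f z i * avg g z i)"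
        by (rule filterlim_compose[OF _ rinf])
      have "(\<lambda>m. norm (h (r m) y)) \<longlonglongrightarrow> norm (u y)" by (intro tendsto_norm elim)
      from this lim have "norm (u y) \<le> (\<Sum>i\<in>{n..<k}. C * avg f z i * avg g z i)"
        by (rule LIMSEQ_le) (use elim y in blast)
      then show "norm (Tb (rs (cs z n) f) (rs (cs z n) g) y - Tb (rs (cs z k) f) (rs (cs z k) g) y) \<le> (\<Sum>i\<in>{n..<k}. C * avg f z i * avg g z i)"
        by (simp add: u_def)
    qed
  qed
qed

end

section \<open>Extension to Morrey spaces\<close>

context vilenkin_haar begin

lemma morrey_Nr:
  assumes f: "f \<in> morrey \<mu> G p u" and u: "weight G u" and p: "1 < p"
  shows "rs (cs x k) f \<in> Lp p"
    and "Nr p (rs (cs x k) f) \<le> u (cs x k) * enn2real (morrey_norm \<mu> G p u f)"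
proof -
  define \<nu> where "\<nu> = enn2real (morrey_norm \<mu> G p u f)"
  let ?I = "cs x k"
  have fm [measurable]: "f \<in> borel_measurable \<mu>" and fin: "morrey_norm \<mu> G p u f < \<infinity>" using f by (auto simp: morrey_def)
  have \<nu>: "morrey_norm \<mu> G p u f = ennreal \<nu>" "0 \<le> \<nu>" using fin by (auto simp: \<nu>_def)
  have uI: "0 < u ?I" using u by (simp add: weight_def)
  have "1 / ennreal (u ?I) * Lp_norm \<mu> p (rs ?I f) \<le> morrey_norm \<mu> G p u f"
    unfolding morrey_norm_def by (rule SUP_upper) simp
  then have le: "ennreal (1 / u ?I) * Lp_norm \<mu> p (rs ?I f) \<le> ennreal \<nu>"
    unfolding \<nu>(1) using divide_ennreal[of 1 "u ?I"] uI by simp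
  have "Lp_norm \<mu> p (rs ?I f) = ennreal (u ?I) * (ennreal (1 / u ?I) * Lp_norm \<mu> p (rs ?I f))"
    using uI by (simp add: mult.assoc[symmetric] ennreal_mult[symmetric])
  also have "\<dots> \<le> ennreal (u ?I) * ennreal \<nu>" by (intro mult_left_mono le) simp
  also have "\<dots> = ennreal (u ?I * \<nu>)" using uI \<nu>(2) by (simp add: ennreal_mult)
  finally have "Np p (rs ?I f) \<le> ennreal ((u ?I * \<nu>) powr p)"
    using uI \<nu>(2) p by (subst (asm) Lp_norm_le_iff) auto
  moreover have "rs ?I f \<in> borel_measurable \<mu>" by measurable
  ultimately show "rs ?I f \<in> Lp p" "Nr p (rs ?I f) \<le> u ?I * enn2real (morrey_norm \<mu> G p u f)"
    using Nr_le[of "rs ?I f" p "u ?I * \<nu>"] uI \<nu>(2) p unfolding \<nu>_def by auto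
qed

lemma morrey_avg:
  assumes f: "f \<in> morrey \<mu> G p u" and u: "weight G u" and p: "1 < p"
  shows "avg f x k \<le> 2 * enn2real (morrey_norm \<mu> G p u f) * (u (cs x k) / vol k powr (1 / p))"
proof -
  have "avg f x k = avg (rs (cs x k) f) x k" by (rule avg_rs[symmetric]) auto
  also have "\<dots> \<le> 2 * Nr p (rs (cs x k) (rs (cs x k) f)) / vol k powr (1 / p)"
    by (rule locint_Lp(2)[OF morrey_Nr(1)[OF assms] p])
  also have "rs (cs x k) (rs (cs x k) f) = rs (cs x k) f" by (rule rs_rs) simp
  also have "2 * Nr p (rs (cs x k) f) / vol k powr (1 / p) \<le> 2 * (u (cs x k) * enn2real (morrey_norm \<mu> G p u f)) / vol k powr (1 / p)"
    by (intro divide_right_mono mult_left_mono morrey_Nr(2)[OF assms]) auto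
  finally show ?thesis by (simp add: mult_ac)
qed

text \<open>The summability condition with \<open>j \<le> -1\<close> reaches only the levels up to
  \<open>l - 2\<close>, because its terms live at \<open>l + (j - 1)\<close>. The missing level
  \<open>l - 1\<close> is supplied by the doubling condition.\<close>

lemma weight_sum_bound:
  assumes u: "weight G u" and dbl: "weight_doubling G u" and sm: "weight_summability \<mu> G p u" and p: "1 < p"
  shows "\<exists>Cw>0. \<forall>x n l. (\<Sum>i\<in>{n..<l}. u (cs x i) / vol i powr (1 / p)) \<le> Cw * (u (cs x l) / vol l powr (1 / p))"
proof -
  obtain C1 where C1: "0 < C1" "\<And>x l j. u (cs x (l + (j - 1))) \<le> C1 * u (cs x (l + j))"
    using dbl unfolding weight_doubling_def by blast
  define a where "a x l j = measure \<mu> (cs x l) powr (1 / p) / measure \<mu> (cs x (l + (j - 1))) powr (1 / p) * u (cs x (l + (j - 1)))" for x l j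
  obtain C2 where C2: "0 < C2" "\<And>x l. a x l summable_on {..-1} \<and> (\<Sum>\<^sub>\<infinity>j\<in>{..-1}. a x l j) \<le> C2 * u (cs x l)"
    using sm unfolding weight_summability_def Let_def a_def by blast
  have u0: "0 < u (cs x k)" for x k using u by (simp add: weight_def)
  have "(\<Sum>i\<in>{n..<l}. u (cs x i) / vol i powr (1 / p)) \<le> (C2 + C1) * (u (cs x l) / vol l powr (1 / p))" for x n l
  proof -
    let ?b = "\<lambda>i. u (cs x i) / vol i powr (1 / p)"
    have v0: "0 < vol i powr (1 / p)" for i using vol_pos[of i] by simp
    have b0: "0 \<le> ?b i" for i using u0[of x i] v0[of i] by (simp add: less_imp_le)
    have "(\<Sum>i\<in>{n..<l}. ?b i) \<le> (\<Sum>i\<in>insert (l - 1) {n..<l - 1}. ?b i)"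
      by (rule sum_mono2) (use b0 in auto)
    also have "\<dots> = ?b (l - 1) + (\<Sum>i\<in>{n..<l - 1}. ?b i)" by (subst sum.insert) auto
    also have "?b (l - 1) \<le> C1 * ?b l"
    proof -
      have "u (cs x (l - 1)) \<le> C1 * u (cs x l)" using C1(2)[of x l 0] by simp
      moreover have "vol l powr (1 / p) \<le> vol (l - 1) powr (1 / p)"
        using vol_mono[of "l - 1" l] vol_nonneg p by (intro powr_mono2) auto
      ultimately have "?b (l - 1) \<le> C1 * u (cs x l) / vol l powr (1 / p)"
        using u0 v0 C1(1) by (intro frac_le) (auto simp: less_imp_le)
      then show ?thesis by simp
    qed
    also have "(\<Sum>i\<in>{n..<l - 1}. ?b i) \<le> C2 * ?b l"
    proof -
      \<comment> \<open>Level \<open>i\<close> corresponds to the index \<open>j\<close> with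
        \<open>i = l + (j - 1)\<close>.\<close>
      let ?J = "(\<lambda>i. i - l + 1) ` {n..<l - 1}"
      have "(\<Sum>i\<in>{n..<l - 1}. vol l powr (1 / p) * ?b i) = (\<Sum>i\<in>{n..<l - 1}. a x l (i - l + 1))"
        by (rule sum.cong) (auto simp: a_def measure_coset)
      also have "\<dots> = (\<Sum>j\<in>?J. a x l j)" by (subst sum.reindex) (auto simp: inj_on_def)
      also have "\<dots> \<le> (\<Sum>\<^sub>\<infinity>j\<in>{..-1}. a x l j)"
      proof (rule finite_sum_le_infsum)
        show "a x l summable_on {..-1}" using C2(2) by blast
        show "0 \<le> a x l j" for j unfolding a_def using u0[of x "l + (j - 1)"] by (simp add: less_imp_le)
      qed auto
      also have "\<dots> \<le> C2 * u (cs x l)" using C2(2) by blast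
      finally have "vol l powr (1 / p) * (\<Sum>i\<in>{n..<l - 1}. ?b i) \<le> C2 * u (cs x l)" by (simp only: sum_distrib_left)
      then show ?thesis using v0[of l] by (simp add: field_simps)
    qed
    finally show ?thesis by (simp add: algebra_simps add_divide_distrib)
  qed
  then show ?thesis using C1(1) C2(1) by (intro exI[of _ "C2 + C1"]) (auto intro: add_pos_pos)
qed

text \<open>Crude, but sufficient: the weight conditions control the sums for \<open>f\<close> and
  for \<open>g\<close> one at a time.\<close>

lemma sum_mult_le:
  fixes a b :: "int \<Rightarrow> real"
  assumes "finite A" "\<And>i. i \<in> A \<Longrightarrow> 0 \<le> a i" "\<And>i. i \<in> A \<Longrightarrow> 0 \<le> b i"
  shows "(\<Sum>i\<in>A. a i * b i) \<le> (\<Sum>i\<in>A. a i) * (\<Sum>i\<in>A. b i)"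
proof -
  have "(\<Sum>i\<in>A. a i * b i) \<le> (\<Sum>i\<in>A. a i * (\<Sum>i\<in>A. b i))"
    using assms by (intro sum_mono mult_left_mono member_le_sum) auto
  then show ?thesis by (simp add: sum_distrib_right)
qed

end

section \<open>Truncation, limit and the Morrey estimate\<close>

context czo_Lp begin

text \<open>The truncations lie in the Lebesgue spaces, where \<open>Tb\<close> is bounded.
  \<open>lim\<close> is total, so the value is arbitrary where the sequence diverges, which happens
  only on a null set.\<close>

definition T_ext :: "('a \<Rightarrow> complex) \<Rightarrow> ('a \<Rightarrow> complex) \<Rightarrow> 'a \<Rightarrow> complex" where
  "T_ext f g y = lim (\<lambda>m. Tb (rs (cs 0 (- int m)) f) (rs (cs 0 (- int m)) g) y)"

text \<open>On a coset \<open>I\<close> the limit differs from \<open>Tb (rs I f) (rs I g)\<close>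
  by at most a constant \<open>E\<close>, uniformly in the truncation. The norm of this constant
  over \<open>I\<close> is at most \<open>E * vol l powr (1 / p)\<close>, and the relation between
  the exponents cancels all volumes, leaving \<open>u1 I * u2 I\<close>.\<close>

lemma morrey_extension:
  assumes pp: "1 / p = 1 / p1 + 1 / p2"
    and u: "weight G u1" "weight G u2" "weight_doubling G u1" "weight_doubling G u2"
      "weight_summability \<mu> G p1 u1" "weight_summability \<mu> G p2 u2" "\<forall>I\<in>cosets G. u I = u1 I * u2 I"
  shows "\<exists>C>0. \<exists>T'.
           bilinear_op \<mu> (morrey \<mu> G p1 u1) (morrey \<mu> G p2 u2) T' \<and>
           (\<forall>f1 \<in> test_functions G \<inter> morrey \<mu> G p1 u1.
            \<forall>f2 \<in> test_functions G \<inter> morrey \<mu> G p2 u2.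
              AE x in \<mu>. T' f1 f2 x = T f1 f2 x) \<and>
           (\<forall>f1 \<in> morrey \<mu> G p1 u1. \<forall>f2 \<in> morrey \<mu> G p2 u2.
              T' f1 f2 \<in> morrey \<mu> G p u \<and>
              morrey_norm \<mu> G p u (T' f1 f2)
                \<le> ennreal C * morrey_norm \<mu> G p1 u1 f1 * morrey_norm \<mu> G p2 u2 f2)"
proof -
  obtain W1 where W1: "0 < W1" "\<And>x n l. (\<Sum>i\<in>{n..<l}. u1 (cs x i) / vol i powr (1 / p1)) \<le> W1 * (u1 (cs x l) / vol l powr (1 / p1))"
    using weight_sum_bound[OF u(1,3,5) p(2)] by blast
  obtain W2 where W2: "0 < W2" "\<And>x n l. (\<Sum>i\<in>{n..<l}. u2 (cs x i) / vol i powr (1 / p2)) \<le> W2 * (u2 (cs x l) / vol l powr (1 / p2))"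
    using weight_sum_bound[OF u(2,4,6) p(3)] by blast
  have u10: "0 < u1 (cs x k)" and u20: "0 < u2 (cs x k)" for x k using u(1,2) by (auto simp: weight_def)
  let ?X = "morrey \<mu> G p1 u1" and ?Y = "morrey \<mu> G p2 u2"
  let ?\<nu>1 = "\<lambda>f. enn2real (morrey_norm \<mu> G p1 u1 f)" and ?\<nu>2 = "\<lambda>g. enn2real (morrey_norm \<mu> G p2 u2 g)"
  let ?r = "\<lambda>m f. rs (cs 0 (- int m)) f"
  let ?h = "\<lambda>f g m y. Tb (?r m f) (?r m g) y"
  have Lx: "rs (cs x k) f \<in> Lp p1" if "f \<in> ?X" for f x k by (rule morrey_Nr(1)[OF that u(1) p(2)])
  have Ly: "rs (cs x k) g \<in> Lp p2" if "g \<in> ?Y" for g x k by (rule morrey_Nr(1)[OF that u(2) p(3)])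
  \<comment> \<open>Each average of a Morrey function carries a factor 2 from
    \<open>morrey_avg\<close>, hence the 4; the bound does not depend on the lower end
    \<open>n\<close> of the sum.\<close>
  have avg_sum: "(\<Sum>i\<in>{n..<l}. C * avg f x i * avg g x i) \<le>
      4 * C * W1 * W2 * (?\<nu>1 f * ?\<nu>2 g) * (u1 (cs x l) / vol l powr (1 / p1) * (u2 (cs x l) / vol l powr (1 / p2)))"
    if f: "f \<in> ?X" and g: "g \<in> ?Y" for f g x n l
  proof -
    let ?a = "\<lambda>i. u1 (cs x i) / vol i powr (1 / p1)" and ?b = "\<lambda>i. u2 (cs x i) / vol i powr (1 / p2)"
    have a0: "0 \<le> ?a i" and b0: "0 \<le> ?b i" for i using u10[of x i] u20[of x i] by (simp_all add: less_imp_le)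
    have "(\<Sum>i\<in>{n..<l}. C * avg f x i * avg g x i) \<le> (\<Sum>i\<in>{n..<l}. (4 * C * (?\<nu>1 f * ?\<nu>2 g)) * (?a i * ?b i))"
    proof (rule sum_mono)
      fix i
      have "C * (avg f x i * avg g x i) \<le> C * ((2 * ?\<nu>1 f * ?a i) * (2 * ?\<nu>2 g * ?b i))"
        using C_pos a0 b0 by (intro mult_left_mono mult_mono morrey_avg[OF f u(1) p(2)] morrey_avg[OF g u(2) p(3)] avg_nonneg mult_nonneg_nonneg) auto
      then show "C * avg f x i * avg g x i \<le> (4 * C * (?\<nu>1 f * ?\<nu>2 g)) * (?a i * ?b i)" by (simp add: mult_ac)
    qed
    also have "\<dots> = (4 * C * (?\<nu>1 f * ?\<nu>2 g)) * (\<Sum>i\<in>{n..<l}. ?a i * ?b i)" by (simp only: sum_distrib_left)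
    also have "(\<Sum>i\<in>{n..<l}. ?a i * ?b i) \<le> (\<Sum>i\<in>{n..<l}. ?a i) * (\<Sum>i\<in>{n..<l}. ?b i)"
      using a0 b0 by (intro sum_mult_le) auto
    also have "\<dots> \<le> (W1 * ?a l) * (W2 * ?b l)"
      using W1(1) a0 b0 by (intro mult_mono W1 W2 sum_nonneg mult_nonneg_nonneg) auto
    finally have "(\<Sum>i\<in>{n..<l}. C * avg f x i * avg g x i) \<le> (4 * C * (?\<nu>1 f * ?\<nu>2 g)) * ((W1 * ?a l) * (W2 * ?b l))"
      using C_pos by (simp add: mult_left_mono)
    then show ?thesis by (simp only: mult_ac)
  qed
  \<comment> \<open>Enlarging the truncation from \<open>G (- m)\<close> to the next subgroup adds a
    single shell, so on \<open>G (- m)\<close> the increment is at most the one term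
    \<open>\<beta> (- int (Suc m))\<close>. These terms are summable by \<open>avg_sum\<close> at
    \<open>cs 0 0\<close>, and every point lies in \<open>G (- m)\<close> for large
    \<open>m\<close>.\<close>
  have conv: "AE y in \<mu>. (\<lambda>m. ?h f g m y) \<longlonglongrightarrow> T_ext f g y" if f: "f \<in> ?X" and g: "g \<in> ?Y" for f g
  proof -
    define \<beta> where "\<beta> i = C * avg f 0 i * avg g 0 i" for i
    have \<beta>0: "0 \<le> \<beta> i" for i unfolding \<beta>_def using C_pos by (intro mult_nonneg_nonneg avg_nonneg) auto
    have "summable (\<lambda>m. \<beta> (- int (Suc m)))"
    proof (rule summableI_nonneg_bounded)
      fix N :: nat
      have "(\<Sum>m<N. \<beta> (- int (Suc m))) = (\<Sum>i\<in>(\<lambda>m. - int (Suc m)) ` {..<N}. \<beta> i)"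
        by (subst sum.reindex) (auto simp: inj_on_def)
      also have "\<dots> \<le> (\<Sum>i\<in>{- int N..<0}. \<beta> i)"
        by (rule sum_mono2) (use \<beta>0 in auto)
      also have "\<dots> \<le> 4 * C * W1 * W2 * (?\<nu>1 f * ?\<nu>2 g) * (u1 (cs 0 0) / vol 0 powr (1 / p1) * (u2 (cs 0 0) / vol 0 powr (1 / p2)))"
        unfolding \<beta>_def by (rule avg_sum[OF f g])
      finally show "(\<Sum>m<N. \<beta> (- int (Suc m))) \<le> 4 * C * W1 * W2 * (?\<nu>1 f * ?\<nu>2 g) * (u1 (cs 0 0) / vol 0 powr (1 / p1) * (u2 (cs 0 0) / vol 0 powr (1 / p2)))" .
    qed (rule \<beta>0)
    then have sm: "summable (\<lambda>m. \<beta> (- int (Suc m)))" .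
    have "AE y in \<mu>. \<forall>m. y \<in> cs 0 (- int m) \<longrightarrow> norm (?h f g (Suc m) y - ?h f g m y) \<le> \<beta> (- int (Suc m))"
      unfolding AE_all_countable
    proof
      fix m
      have sub: "cs 0 (- int m) \<subseteq> cs 0 (- int (Suc m))" by (rule coset_mono) simp
      have e: "rs (cs 0 (- int (Suc m))) (?r (Suc m) k) = ?r (Suc m) k" "rs (cs 0 (- int m)) (?r (Suc m) k) = ?r m k" for k
        using rs_rs[OF order_refl] rs_rs[OF sub] by auto
      have s: "{- int (Suc m)..<- int m} = {- int (Suc m)}" by auto
      have av: "avg (?r (Suc m) k) 0 (- int (Suc m)) = avg k 0 (- int (Suc m))" for k by (rule avg_rs) auto
      show "AE y in \<mu>. y \<in> cs 0 (- int m) \<longrightarrow> norm (?h f g (Suc m) y - ?h f g m y) \<le> \<beta> (- int (Suc m))"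
        using Tb_rem[OF Lx[OF f, of 0 "- int (Suc m)"] Ly[OF g, of 0 "- int (Suc m)"], of "- int (Suc m)" "- int m" 0]
        unfolding e s \<beta>_def by (simp only: sum.insert sum.empty finite.emptyI empty_iff not_False_eq_True add_0_right av)
    qed
    then show ?thesis
    proof eventually_elim
      case (elim y)
      obtain m0 where m0: "\<And>m. m0 \<le> m \<Longrightarrow> y \<in> cs 0 (- int m)" using eventually_big_coset[of y] unfolding eventually_sequentially by blast
      have "summable (\<lambda>m. ?h f g (Suc m) y - ?h f g m y)"
        by (rule summable_comparison_test'[OF sm, of m0]) (use elim m0 in blast)
      then have "convergent (\<lambda>n. \<Sum>m<n. ?h f g (Suc m) y - ?h f g m y)" by (simp add: summable_iff_convergent)
      then have "convergent (\<lambda>n. ?h f g n y - ?h f g 0 y)" by (simp only: sum_lessThan_telescope[of "\<lambda>m. ?h f g m y"])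
      then have "convergent (\<lambda>n. ?h f g n y)" by (simp add: convergent_diff_const_right_iff)
      then show ?case unfolding T_ext_def by (rule convergent_LIMSEQ_iff[THEN iffD1])
    qed
  qed
  have meas: "T_ext f g \<in> borel_measurable \<mu>" if f: "f \<in> ?X" and g: "g \<in> ?Y" for f g
    unfolding T_ext_def
    by (rule borel_measurable_lim_metric) (intro Lp_measurable[OF Tb(1)] Lx f Ly g)
  have bil': "bilinear_op \<mu> ?X ?Y T_ext"
    unfolding bilinear_op_def
  proof (intro conjI ballI allI)
    fix f f' g a b assume f: "f \<in> ?X" "f' \<in> ?X" and g: "g \<in> ?Y"
    have "AE y in \<mu>. \<forall>m. ?h (\<lambda>x. a * f x + b * f' x) g m y = a * ?h f g m y + b * ?h f' g m y"
      unfolding AE_all_countable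
    proof
      fix m
      have "?r m (\<lambda>x. a * f x + b * f' x) = (\<lambda>x. a * ?r m f x + b * ?r m f' x)" by (auto simp: fun_eq_iff algebra_simps)
      then show "AE y in \<mu>. ?h (\<lambda>x. a * f x + b * f' x) g m y = a * ?h f g m y + b * ?h f' g m y"
        using Tb_lin1[OF Lx[OF f(1)] Lx[OF f(2)] Ly[OF g]] by simp
    qed
    then show "AE x in \<mu>. T_ext (\<lambda>x. a * f x + b * f' x) g x = a * T_ext f g x + b * T_ext f' g x"
      using conv[OF f(1) g] conv[OF f(2) g]
    proof eventually_elim
      case (elim y)
      have "(\<lambda>m. a * ?h f g m y + b * ?h f' g m y) \<longlonglongrightarrow> a * T_ext f g y + b * T_ext f' g y" by (intro tendsto_intros elim)
      then show ?case unfolding T_ext_def[of "\<lambda>x. a * f x + b * f' x"] using elim(1) by (simp add: limI)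
    qed
  next
    fix f g g' a b assume f: "f \<in> ?X" and g: "g \<in> ?Y" "g' \<in> ?Y"
    have "AE y in \<mu>. \<forall>m. ?h f (\<lambda>x. a * g x + b * g' x) m y = a * ?h f g m y + b * ?h f g' m y"
      unfolding AE_all_countable
    proof
      fix m
      have "?r m (\<lambda>x. a * g x + b * g' x) = (\<lambda>x. a * ?r m g x + b * ?r m g' x)" by (auto simp: fun_eq_iff algebra_simps)
      then show "AE y in \<mu>. ?h f (\<lambda>x. a * g x + b * g' x) m y = a * ?h f g m y + b * ?h f g' m y"
        using Tb_lin2[OF Lx[OF f] Ly[OF g(1)] Ly[OF g(2)]] by simp
    qed
    then show "AE x in \<mu>. T_ext f (\<lambda>x. a * g x + b * g' x) x = a * T_ext f g x + b * T_ext f g' x"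
      using conv[OF f g(1)] conv[OF f g(2)]
    proof eventually_elim
      case (elim y)
      have "(\<lambda>m. a * ?h f g m y + b * ?h f g' m y) \<longlonglongrightarrow> a * T_ext f g y + b * T_ext f g' y" by (intro tendsto_intros elim)
      then show ?case unfolding T_ext_def[of f "\<lambda>x. a * g x + b * g' x"] using elim(1) by (simp add: limI)
    qed
  qed (rule meas)
  have ext: "AE x in \<mu>. T_ext f g x = T f g x" if "f \<in> test \<inter> ?X" "g \<in> test \<inter> ?Y" for f g
  proof -
    have f: "f \<in> test" "f \<in> ?X" and g: "g \<in> test" "g \<in> ?Y" using that by auto
    have ev: "eventually (\<lambda>m. ?r m f = f \<and> ?r m g = g) sequentially" by (intro eventually_conj test_rs_big f g)
    show ?thesis
      using Tb_test[OF f(1) g(1)]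
    proof eventually_elim
      case (elim y)
      have "eventually (\<lambda>m. ?h f g m y = T f g y) sequentially"
        using ev by eventually_elim (simp add: elim)
      then have "(\<lambda>m. ?h f g m y) \<longlonglongrightarrow> T f g y" by (rule tendsto_eventually)
      then show ?case unfolding T_ext_def by (rule limI)
    qed
  qed
  \<comment> \<open>\<open>8 * D\<close> bounds the local part through \<open>Tb_Nr\<close>, the
    other summand is the constant of the tails, and the outer 2 comes from the triangle
    inequality.\<close>
  define CT where "CT = 2 * (8 * D + 4 * C * W1 * W2)"
  have CT: "0 < CT" unfolding CT_def using D C_pos W1(1) W2(1) by (intro mult_pos_pos add_pos_pos) auto
  have local: "Np p (rs (cs x l) (T_ext f g)) \<le> ennreal ((CT * (u1 (cs x l) * u2 (cs x l)) * (?\<nu>1 f * ?\<nu>2 g)) powr p)"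
    if f: "f \<in> ?X" and g: "g \<in> ?Y" for f g x l
  proof -
    let ?I = "cs x l"
    let ?TI = "Tb (rs ?I f) (rs ?I g)"
    define E where "E = 4 * C * W1 * W2 * (?\<nu>1 f * ?\<nu>2 g) * (u1 ?I / vol l powr (1 / p1) * (u2 ?I / vol l powr (1 / p2)))"
    have E0: "0 \<le> E" unfolding E_def using C_pos W1(1) W2(1) u10[of x l] u20[of x l] by simp
    have "eventually (\<lambda>m. x \<in> cs 0 (- int m) \<and> nat (- l) \<le> m) sequentially"
      by (intro eventually_conj eventually_big_coset eventually_ge_at_top)
    then obtain m0 where m0: "\<And>m. m0 \<le> m \<Longrightarrow> x \<in> cs 0 (- int m) \<and> nat (- l) \<le> m" unfolding eventually_sequentially by blast
    have "AE y in \<mu>. \<forall>m\<in>{m0..}. y \<in> ?I \<longrightarrow> norm (?h f g m y - ?TI y) \<le> E"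
    proof (subst AE_ball_countable)
      show "\<forall>m\<in>{m0..}. AE y in \<mu>. y \<in> ?I \<longrightarrow> norm (?h f g m y - ?TI y) \<le> E"
      proof
        fix m assume "m \<in> {m0..}"
        then have m: "x \<in> cs 0 (- int m)" "- int m \<le> l" using m0[of m] by auto
        have q: "cs x (- int m) = cs 0 (- int m)" by (rule coset_eq[OF m(1)])
        have sub: "?I \<subseteq> cs 0 (- int m)" unfolding q[symmetric] by (rule coset_mono[OF m(2)])
        have e: "rs (cs x (- int m)) (?r m k) = ?r m k" "rs ?I (?r m k) = rs ?I k" for k
          unfolding q using rs_rs[OF order_refl] rs_rs[OF sub] by auto
        have av: "avg (?r m k) x i = avg k x i" if "i \<in> {- int m..<l}" for k i using that m(1) by (intro avg_rs) auto
        have "(\<Sum>i\<in>{- int m..<l}. C * avg (?r m f) x i * avg (?r m g) x i) = (\<Sum>i\<in>{- int m..<l}. C * avg f x i * avg g x i)"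
          by (rule sum.cong) (simp_all only: av)
        also have "\<dots> \<le> E" unfolding E_def by (rule avg_sum[OF f g])
        finally have le: "(\<Sum>i\<in>{- int m..<l}. C * avg (?r m f) x i * avg (?r m g) x i) \<le> E" .
        show "AE y in \<mu>. y \<in> ?I \<longrightarrow> norm (?h f g m y - ?TI y) \<le> E"
          using Tb_rem[OF Lx[OF f, of 0 "- int m"] Ly[OF g, of 0 "- int m"] m(2), of x] unfolding e
        proof eventually_elim
          case (elim y)
          then show ?case using le order_trans by blast
        qed
      qed
    qed auto
    then have bd: "AE y in \<mu>. y \<in> ?I \<longrightarrow> norm (T_ext f g y - ?TI y) \<le> E"
      using conv[OF f g]
    proof eventually_elim
      case (elim y)
      show ?case
      proof
        assume y: "y \<in> ?I"
        have "(\<lambda>m. norm (?h f g m y - ?TI y)) \<longlonglongrightarrow> norm (T_ext f g y - ?TI y)" by (intro tendsto_intros elim)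
        then show "norm (T_ext f g y - ?TI y) \<le> E"
          by (rule LIMSEQ_le_const2) (use elim y in \<open>auto intro!: exI[of _ m0]\<close>)
      qed
    qed
    have TIL: "?TI \<in> Lp p" by (intro Tb Lx Ly f g)
    have [measurable]: "T_ext f g \<in> borel_measurable \<mu>" "?TI \<in> borel_measurable \<mu>" using meas[OF f g] Lp_measurable[OF TIL] by auto
    have p0: "0 < p" using p(1) by simp
    have A: "rs ?I ?TI \<in> Lp p" "Nr p (rs ?I ?TI) \<le> 8 * D * (u1 ?I * ?\<nu>1 f) * (u2 ?I * ?\<nu>2 g)"
    proof -
      show "rs ?I ?TI \<in> Lp p" by (rule rs_Lp(1)[OF TIL p0 coset_borel])
      have "Nr p (rs ?I ?TI) \<le> Nr p ?TI" by (rule rs_Lp(2)[OF TIL p0 coset_borel])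
      also have "\<dots> \<le> 8 * D * Nr p1 (rs ?I f) * Nr p2 (rs ?I g)" by (intro Tb_Nr Lx Ly f g)
      also have "\<dots> \<le> 8 * D * (u1 ?I * ?\<nu>1 f) * (u2 ?I * ?\<nu>2 g)"
        using D u10[of x l] by (intro mult_mono mult_left_mono morrey_Nr(2)[OF f u(1) p(2)] morrey_Nr(2)[OF g u(2) p(3)] Nr_nonneg mult_nonneg_nonneg) auto
      finally show "Nr p (rs ?I ?TI) \<le> 8 * D * (u1 ?I * ?\<nu>1 f) * (u2 ?I * ?\<nu>2 g)" .
    qed
    define J where "J = (\<lambda>y. indicator ?I y :: complex)"
    have J: "J \<in> Lp p" "Nr p J \<le> vol l powr (1 / p)"
    proof -
      have "Np p J \<le> ennreal ((1 * vol l powr (1 / p)) powr p)"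
        unfolding J_def by (rule Np_le_bounded[where z = x and n = l]) (use p0 in \<open>auto simp: indicator_def\<close>)
      then show "J \<in> Lp p" "Nr p J \<le> vol l powr (1 / p)"
        using Nr_le[of J p "vol l powr (1 / p)"] p0 unfolding J_def by auto
    qed
    have Bd: "rs ?I (\<lambda>y. T_ext f g y - ?TI y) \<in> Lp p" "Nr p (rs ?I (\<lambda>y. T_ext f g y - ?TI y)) \<le> E * Nr p J"
    proof -
      have "AE y in \<mu>. norm (rs ?I (\<lambda>y. T_ext f g y - ?TI y) y) \<le> E * norm (J y)"
        using bd by eventually_elim (auto simp: J_def indicator_def)
      moreover have "rs ?I (\<lambda>y. T_ext f g y - ?TI y) \<in> borel_measurable \<mu>" by measurable
      ultimately show "rs ?I (\<lambda>y. T_ext f g y - ?TI y) \<in> Lp p" "Nr p (rs ?I (\<lambda>y. T_ext f g y - ?TI y)) \<le> E * Nr p J"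
        using Nr_mono[OF J(1), of "rs ?I (\<lambda>y. T_ext f g y - ?TI y)" E] E0 p0 by auto
    qed
    have eq: "rs ?I (T_ext f g) = (\<lambda>y. rs ?I ?TI y + rs ?I (\<lambda>y. T_ext f g y - ?TI y) y)"
      by (auto simp: fun_eq_iff algebra_simps)
    have L: "rs ?I (T_ext f g) \<in> Lp p" unfolding eq by (rule Nr_add(1)[OF A(1) Bd(1) p(1)])
    have EJ: "E * Nr p J \<le> 4 * C * W1 * W2 * (?\<nu>1 f * ?\<nu>2 g) * (u1 ?I * u2 ?I)"
    proof -
      have "E * Nr p J \<le> E * vol l powr (1 / p)" by (intro mult_left_mono J E0)
      also have "vol l powr (1 / p) = vol l powr (1 / p1) * vol l powr (1 / p2)" by (simp add: pp powr_add)
      also have "E * (vol l powr (1 / p1) * vol l powr (1 / p2)) = 4 * C * W1 * W2 * (?\<nu>1 f * ?\<nu>2 g) * (u1 ?I * u2 ?I)"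
        using vol_pos[of l] by (simp add: E_def)
      finally show ?thesis .
    qed
    have "Nr p (rs ?I (T_ext f g)) \<le> 2 * (Nr p (rs ?I ?TI) + Nr p (rs ?I (\<lambda>y. T_ext f g y - ?TI y)))"
      unfolding eq by (rule Nr_add(2)[OF A(1) Bd(1) p(1)])
    also have "\<dots> \<le> 2 * (8 * D * (u1 ?I * ?\<nu>1 f) * (u2 ?I * ?\<nu>2 g) + 4 * C * W1 * W2 * (?\<nu>1 f * ?\<nu>2 g) * (u1 ?I * u2 ?I))"
      by (intro mult_left_mono add_mono A order_trans[OF Bd(2) EJ]) simp
    also have "\<dots> = CT * (u1 ?I * u2 ?I) * (?\<nu>1 f * ?\<nu>2 g)" by (simp add: CT_def algebra_simps)
    finally have "Nr p (rs ?I (T_ext f g)) \<le> CT * (u1 ?I * u2 ?I) * (?\<nu>1 f * ?\<nu>2 g)" .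
    then show ?thesis unfolding Np_Nr[OF L p0] using p0 Nr_nonneg by (intro ennreal_leI powr_mono2) auto
  qed
  have main: "T_ext f g \<in> morrey \<mu> G p u \<and>
      morrey_norm \<mu> G p u (T_ext f g) \<le> ennreal CT * morrey_norm \<mu> G p1 u1 f * morrey_norm \<mu> G p2 u2 g"
    if f: "f \<in> ?X" and g: "g \<in> ?Y" for f g
  proof -
    define a where "a = ?\<nu>1 f"
    define b where "b = ?\<nu>2 g"
    have nf: "morrey_norm \<mu> G p1 u1 f = ennreal a" using f by (auto simp: morrey_def a_def)
    have ng: "morrey_norm \<mu> G p2 u2 g = ennreal b" using g by (auto simp: morrey_def b_def)
    have ab0: "0 \<le> a" "0 \<le> b" by (simp_all add: a_def b_def)
    have R: "ennreal CT * morrey_norm \<mu> G p1 u1 f * morrey_norm \<mu> G p2 u2 g = ennreal (CT * (a * b))"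
      unfolding nf ng using CT ab0 by (simp add: ennreal_mult mult.assoc)
    have le: "morrey_norm \<mu> G p u (T_ext f g) \<le> ennreal (CT * (a * b))"
      unfolding morrey_norm_def
    proof (rule SUP_least)
      fix I assume I: "I \<in> cosets G"
      then obtain x l where xl: "I = cs x l" unfolding cosets_def by blast
      have uI: "u I = u1 I * u2 I" using u(7) I by blast
      have pos: "0 < u I" unfolding uI unfolding xl using u10[of x l] u20[of x l] by simp
      have "Lp_norm \<mu> p (rs I (T_ext f g)) \<le> ennreal (CT * u I * (a * b))"
        using local[OF f g, of x l, folded a_def b_def] p CT pos ab0 unfolding xl[symmetric] uI[symmetric] by (subst Lp_norm_le_iff) auto
      then have "1 / ennreal (u I) * Lp_norm \<mu> p (rs I (T_ext f g)) \<le> ennreal (1 / u I) * ennreal (CT * u I * (a * b))"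
        using divide_ennreal[of 1 "u I"] pos by (simp add: mult_left_mono)
      also have "\<dots> = ennreal (CT * (a * b))" using pos CT ab0 by (simp add: ennreal_mult[symmetric])
      finally show "1 / ennreal (u I) * Lp_norm \<mu> p (\<lambda>x. indicator I x * T_ext f g x) \<le> ennreal (CT * (a * b))" .
    qed
    have "morrey_norm \<mu> G p u (T_ext f g) < \<infinity>" by (rule order_le_less_trans[OF le]) simp
    then show ?thesis using le meas[OF f g] unfolding R by (simp add: morrey_def)
  qed
  have 1: "\<forall>f1 \<in> test \<inter> ?X. \<forall>f2 \<in> test \<inter> ?Y. AE x in \<mu>. T_ext f1 f2 x = T f1 f2 x"
    by (intro ballI ext)
  have 2: "\<forall>f1 \<in> ?X. \<forall>f2 \<in> ?Y. T_ext f1 f2 \<in> morrey \<mu> G p u \<and>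
      morrey_norm \<mu> G p u (T_ext f1 f2) \<le> ennreal CT * morrey_norm \<mu> G p1 u1 f1 * morrey_norm \<mu> G p2 u2 f2"
    by (intro ballI main)
  show ?thesis
    by (rule exI[of _ CT], rule conjI[OF CT], rule exI[of _ T_ext], rule conjI[OF bil' conjI[OF 1 2]])
qed

end

theorem theorem3:
  fixes G :: "int \<Rightarrow> 'a::{topological_ab_group_add, t2_space} set"
    and \<mu> :: "'a measure"
    and T :: "('a \<Rightarrow> complex) \<Rightarrow> ('a \<Rightarrow> complex) \<Rightarrow> ('a \<Rightarrow> complex)"
    and u u1 u2 :: "'a set \<Rightarrow> real"
    and p p1 p2 :: real
  assumes "vilenkin_group G"
    and "haar_measure \<mu>" and "emeasure \<mu> (G 0) = 1"
    and "bilinear_CZ_operator \<mu> G T"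
    and "weight G u1" and "weight G u2"
    and "1 < p" and "1 < p1" and "1 < p2" and "1 / p = 1 / p1 + 1 / p2"
    and "\<forall>n. 2 * vm \<mu> G n \<le> vm \<mu> G (n + 1) \<and>
             vm \<mu> G (n + 1) \<le> real (vilenkin_bound G) * vm \<mu> G n"
    and "weight_doubling G u1" and "weight_doubling G u2"
    and "weight_summability \<mu> G p1 u1" and "weight_summability \<mu> G p2 u2"
    and "\<forall>I\<in>cosets G. u I = u1 I * u2 I"
  shows "\<exists>C>0. \<exists>T'.
           bilinear_op \<mu> (morrey \<mu> G p1 u1) (morrey \<mu> G p2 u2) T' \<and>
           (\<forall>f1 \<in> test_functions G \<inter> morrey \<mu> G p1 u1.
            \<forall>f2 \<in> test_functions G \<inter> morrey \<mu> G p2 u2.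
              AE x in \<mu>. T' f1 f2 x = T f1 f2 x) \<and>
           (\<forall>f1 \<in> morrey \<mu> G p1 u1. \<forall>f2 \<in> morrey \<mu> G p2 u2.
              T' f1 f2 \<in> morrey \<mu> G p u \<and>
              morrey_norm \<mu> G p u (T' f1 f2)
                \<le> ennreal C * morrey_norm \<mu> G p1 u1 f1 * morrey_norm \<mu> G p2 u2 f2)"
proof -
  \<comment> \<open>The growth bound \<open>B\<close> is taken to be the supremum of the quotient
    orders.\<close>
  interpret vilenkin_haar G \<mu> "real (vilenkin_bound G)"
    by (intro vilenkin_haar.intro vilenkin_haar_axioms.intro) (use assms in auto)
  obtain K C \<rho> where "czo G \<mu> (real (vilenkin_bound G)) T K C \<rho>"
    by (rule czo_of_operator[OF assms(4)])
  then interpret czo G \<mu> "real (vilenkin_bound G)" T K C \<rho> .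
  obtain D where "0 < D" "\<forall>f\<in>test. \<forall>g\<in>test. \<forall>a\<ge>0. \<forall>b\<ge>0. Np p1 f \<le> ennreal (a powr p1) \<longrightarrow> Np p2 g \<le> ennreal (b powr p2) \<longrightarrow>
      Np p (T f g) \<le> ennreal ((D * a * b) powr p)"
    using Lp_test_norm[OF assms(7-10)] by blast
  then interpret czo_Lp G \<mu> "real (vilenkin_bound G)" T K C \<rho> p p1 p2 D
    by unfold_locales (use assms(7-9) in auto)
  show ?thesis by (rule morrey_extension[OF assms(10,5,6,12-16)])
qed

end
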